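(* There is an isomorphism of graded algebras $$B\otimes_{\mathbb Q}\mathbb C\;\xrightarrow{\ \sim\ }\;A(\Delta(4,8))$$ which is given by $$\begin{aligned} Z_1&\mapsto\vartheta_{01}(z)\vartheta_{01}(w),\\ Z_2&\mapsto\vartheta_{00}(z)\vartheta_{00}(w),\\ Z_3&\mapsto\vartheta_{10}(z)\vartheta_{10}(w),\\ C&\mapsto\vartheta_{00}(2z)\vartheta_{00}(2w)+\vartheta_{10}(2z)\vartheta_{10}(2w),\\ W_1&\mapsto\vartheta_{10}(2z)\vartheta_{00}(2w)+\vartheta_{00}(2z)\vartheta_{10}(2w),\\ W_2&\mapsto\mathrm i\bigl(\vartheta_{10}(2z)\vartheta_{00}(2w)-\vartheta_{00}(2z)\vartheta_{10}(2w)\bigr),\\ W_3&\mapsto\vartheta_{00}(2z)\vartheta_{00}(2w)-\vartheta_{10}(2z)\vartheta_{10}(2w). \end{aligned}$$ Hence the box variety $\mathcal B=\mathrm{proj}(B\otimes_{\mathbb Q}\mathbb C)$ satisfies $\mathcal B\cong\overline{\mathbb H\times\mathbb H/\Delta(4,8)}$.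
   Context: $B$ is the graded $\mathbb Q$-algebra $B=\mathbb Q[Z_1,Z_2,Z_3,W_1,W_2,W_3,C]$ (generators of degree one) with defining relations $$W_1^2+W_2^2=Z_3^2,\quad W_1^2+W_3^2=Z_2^2,\quad W_2^2+W_3^2=Z_1^2,\quad W_1^2+W_2^2+W_3^2=C^2.$$ $\mathbb H$ is the upper half plane, $\mathbb H^*=\mathbb H\cup\mathbb Q\cup\{\infty\}$, $\Gamma[N]=\ker(\mathrm{SL}(2,\mathbb Z)\to\mathrm{SL}(2,\mathbb Z/N\mathbb Z))$, and $$\Delta(4,8)=\{(M_1,M_2)\in\Gamma[4]\times\Gamma[4]:\ M_1\equiv M_2\bmod 8\},$$ acting on $\mathbb H\times\mathbb H$ componentwise. Square roots are taken with the principal branch of the logarithm ($\sqrt a=\mathrm i\sqrt{|a|}$ for $a<0$). For $(a,b)\in\{(0,0),(1,0),(0,1)\}$, $$\vartheta_{ab}(z)=\sum_{n\in\mathbb Z}e^{\pi\mathrm i\left((n+a/2)^2z+b(n+a/2)\right)}.$$ The theta multiplier system $v_\vartheta$ on $\Gamma_\vartheta=\{\begin{pmatrix}a&b\\c&d\end{pmatrix}\in\mathrm{SL}(2,\mathbb Z):\ ab\equiv cd\equiv0\bmod2\}$ is defined by $\vartheta_{00}(Mz)=v_\vartheta(M)\sqrt{cz+d}\,\vartheta_{00}(z)$. $A(\Delta(4,8))=\bigoplus_{r}A_r$, where $A_r$ is the space of holomorphic functions $f$ on $\mathbb H\times\mathbb H$, regular at all cusps, with $$f(M_1z,M_2w)=\bigl(v_\vartheta(M_1)v_\vartheta(M_2)\bigr)^r\sqrt{c_1z+d_1}^{\,r}\sqrt{c_2w+d_2}^{\,r}f(z,w)\quad\text{for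 all }(M_1,M_2)\in\Delta(4,8),$$ where $(c_i,d_i)$ is the second row of $M_i$. $\overline{\mathbb H\times\mathbb H/\Delta(4,8)}$ denotes the compactification $(\mathbb H^*\times\mathbb H^* )/\Delta(4,8)$, i.e. the projective variety $\mathrm{proj}(A(\Delta(4,8)))$. *)

theory Defs
  imports
    "HOL-Analysis.Analysis"
    "HOL-Algebra.QuotRing"
    "HOL-Algebra.Module"
    "HOL-Library.Poly_Mapping"
begin

section \<open>Algebras and tensor products\<close>

definition type_ring :: "'a::comm_ring_1 ring" where
  "type_ring = \<lparr>carrier = UNIV, mult = (*), one = 1, zero = 0, add = (+)\<rparr>"

text \<open>The ring \<open>R\<close> as an algebra over \<open>'k\<close> via a structural homomorphism \<open>\<eta>\<close>; algebras are
  represented by the library's records of type \<^typ>\<open>('k, 'a) module\<close>.\<close>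

definition algebra_via :: "'a ring \<Rightarrow> ('k \<Rightarrow> 'a) \<Rightarrow> ('k, 'a) module" where
  "algebra_via R \<eta> = ring.extend R (module.fields (\<lambda>k x. \<eta> k \<otimes>\<^bsub>R\<^esub> x))"

text \<open>\<open>S \<otimes>\<^sub>K T\<close> for commutative algebras \<open>S\<close>, \<open>T\<close> over the type \<open>'k\<close>: the monoid ring
  \<open>\<int>[S \<times> T]\<close> modulo the ideal of bilinear relations, regarded as a \<open>T\<close>-algebra.
  Elements of \<open>\<int>[S \<times> T]\<close> are finitely supported functions on pairs.\<close>

definition pair_monoid_ring ::
    "('k, 's) module \<Rightarrow> ('k, 't) module \<Rightarrow> ('s \<times> 't \<Rightarrow>\<^sub>0 int) ring" where
  "pair_monoid_ring S T =
    \<lparr>carrier = {x. Poly_Mapping.keys x \<subseteq> carrier S \<times> carrier T},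
     mult = (\<lambda>x y. frag_extend (\<lambda>(s, t). frag_extend (\<lambda>(s', t').
               frag_of (s \<otimes>\<^bsub>S\<^esub> s', t \<otimes>\<^bsub>T\<^esub> t')) y) x),
     one = frag_of (\<one>\<^bsub>S\<^esub>, \<one>\<^bsub>T\<^esub>), zero = 0, add = (+)\<rparr>"

definition tensor_relations ::
    "('k, 's) module \<Rightarrow> ('k, 't) module \<Rightarrow> ('s \<times> 't \<Rightarrow>\<^sub>0 int) set" where
  "tensor_relations S T =
     {frag_of (s \<oplus>\<^bsub>S\<^esub> s', t) - frag_of (s, t) - frag_of (s', t) | s s' t.
        s \<in> carrier S \<and> s' \<in> carrier S \<and> t \<in> carrier T} \<union>
     {frag_of (s, t \<oplus>\<^bsub>T\<^esub> t') - frag_of (s, t) - frag_of (s, t') | s t t'.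
        s \<in> carrier S \<and> t \<in> carrier T \<and> t' \<in> carrier T} \<union>
     {frag_of (k \<odot>\<^bsub>S\<^esub> s, t) - frag_of (s, k \<odot>\<^bsub>T\<^esub> t) | k s t.
        s \<in> carrier S \<and> t \<in> carrier T}"

definition tensor_ideal ::
    "('k, 's) module \<Rightarrow> ('k, 't) module \<Rightarrow> ('s \<times> 't \<Rightarrow>\<^sub>0 int) set" where
  "tensor_ideal S T = Idl\<^bsub>pair_monoid_ring S T\<^esub> (tensor_relations S T)"

definition pure_tensor ::
    "('k, 's) module \<Rightarrow> ('k, 't) module \<Rightarrow> 's \<Rightarrow> 't \<Rightarrow> ('s \<times> 't \<Rightarrow>\<^sub>0 int) set" where
  "pure_tensor S T s t = tensor_ideal S T +>\<^bsub>pair_monoid_ring S T\<^esub> frag_of (s, t)"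

definition tensor_algebra ::
    "('k, 's) module \<Rightarrow> ('k, 't) module \<Rightarrow> ('t, ('s \<times> 't \<Rightarrow>\<^sub>0 int) set) module" where
  "tensor_algebra S T =
     algebra_via (pair_monoid_ring S T Quot tensor_ideal S T) (pure_tensor S T \<one>\<^bsub>S\<^esub>)"

text \<open>The grading \<open>(S \<otimes> T)\<^sub>r = S\<^sub>r \<otimes> T\<close> (additive span of the pure tensors) induced by a
  grading \<open>G\<close> of \<open>S\<close>.\<close>

definition tensor_grading ::
    "('k, 's) module \<Rightarrow> (nat \<Rightarrow> 's set) \<Rightarrow> ('k, 't) module \<Rightarrow> nat
      \<Rightarrow> ('s \<times> 't \<Rightarrow>\<^sub>0 int) set set" where
  "tensor_grading S G T r =
     (\<lambda>x. tensor_ideal S T +>\<^bsub>pair_monoid_ring S T\<^esub> x) ` {x. Poly_Mapping.keys x \<subseteq> G r \<times> carrier T}"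

definition graded_algebra_iso ::
    "('k, 'a) module \<Rightarrow> (nat \<Rightarrow> 'a set) \<Rightarrow> ('k, 'b) module \<Rightarrow> (nat \<Rightarrow> 'b set)
      \<Rightarrow> ('a \<Rightarrow> 'b) \<Rightarrow> bool" where
  "graded_algebra_iso R G S H \<phi> \<longleftrightarrow>
     \<phi> \<in> ring_iso R S \<and>
     (\<forall>k. \<forall>x\<in>carrier R. \<phi> (k \<odot>\<^bsub>R\<^esub> x) = k \<odot>\<^bsub>S\<^esub> \<phi> x) \<and>
     (\<forall>r. \<phi> ` G r = H r)"

section \<open>The algebra of the box variety\<close>

datatype box_var = Z1 | Z2 | Z3 | W1 | W2 | W3 | C

type_synonym 'k box_poly = "(box_var \<Rightarrow>\<^sub>0 nat) \<Rightarrow>\<^sub>0 'k"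

definition poly_var :: "box_var \<Rightarrow> rat box_poly" where
  "poly_var v = Poly_Mapping.single (Poly_Mapping.single v 1) 1"

definition poly_const :: "rat \<Rightarrow> rat box_poly" where
  "poly_const q = Poly_Mapping.single 0 q"

definition monom_degree :: "(box_var \<Rightarrow>\<^sub>0 nat) \<Rightarrow> nat" where
  "monom_degree m = (\<Sum>v\<in>Poly_Mapping.keys m. Poly_Mapping.lookup m v)"

definition box_relations :: "rat box_poly set" where
  "box_relations =
     {poly_var W1 ^ 2 + poly_var W2 ^ 2 - poly_var Z3 ^ 2,
      poly_var W1 ^ 2 + poly_var W3 ^ 2 - poly_var Z2 ^ 2,
      poly_var W2 ^ 2 + poly_var W3 ^ 2 - poly_var Z1 ^ 2,
      poly_var W1 ^ 2 + poly_var W2 ^ 2 + poly_var W3 ^ 2 - poly_var C ^ 2}"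

definition box_ideal :: "rat box_poly set" where
  "box_ideal = Idl\<^bsub>type_ring\<^esub> box_relations"

definition box_class :: "rat box_poly \<Rightarrow> rat box_poly set" where
  "box_class p = box_ideal +>\<^bsub>type_ring\<^esub> p"

definition box_algebra :: "(rat, rat box_poly set) module" where
  "box_algebra = algebra_via (type_ring Quot box_ideal) (\<lambda>q. box_class (poly_const q))"

definition box_grading :: "nat \<Rightarrow> rat box_poly set set" where
  "box_grading r = box_class ` {p. \<forall>m\<in>Poly_Mapping.keys p. monom_degree m = r}"

definition complex_algebra :: "(rat, complex) module" where
  "complex_algebra = algebra_via type_ring of_rat"

type_synonym box_complex = "(rat box_poly set \<times> complex \<Rightarrow>\<^sub>0 int) set"

definition box_algebra_C :: "(complex, box_complex) module" where
  "box_algebra_C = tensor_algebra box_algebra complex_algebra"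

definition box_grading_C :: "nat \<Rightarrow> box_complex set" where
  "box_grading_C = tensor_grading box_algebra box_grading complex_algebra"

definition box_gen :: "box_var \<Rightarrow> box_complex" where
  "box_gen v = pure_tensor box_algebra complex_algebra (box_class (poly_var v)) 1"

section \<open>Theta functions and modular forms on \<open>\<Delta>(4,8)\<close>\<close>

definition upper_half_plane :: "complex set" where
  "upper_half_plane = {z. Im z > 0}"

definition theta :: "nat \<Rightarrow> nat \<Rightarrow> complex \<Rightarrow> complex" where
  "theta a b z = (\<Sum>\<^sub>\<infinity>n\<in>(UNIV :: int set).
     exp (of_real pi * \<i> * ((of_int n + of_nat a / 2)^2 * z + of_nat b * (of_int n + of_nat a / 2))))"

definition SL2Z :: "(int^2^2) set" where
  "SL2Z = {M. det M = 1}"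

definition principal_congruence_subgroup :: "int \<Rightarrow> (int^2^2) set" where
  "principal_congruence_subgroup N =
     {M \<in> SL2Z. \<forall>i j. M $ i $ j mod N = (mat 1 :: int^2^2) $ i $ j mod N}"

definition Delta48 :: "((int^2^2) \<times> (int^2^2)) set" where
  "Delta48 = {(M\<^sub>1, M\<^sub>2). M\<^sub>1 \<in> principal_congruence_subgroup 4 \<and>
     M\<^sub>2 \<in> principal_congruence_subgroup 4 \<and> (\<forall>i j. M\<^sub>1 $ i $ j mod 8 = M\<^sub>2 $ i $ j mod 8)}"

definition act :: "int^2^2 \<Rightarrow> complex \<Rightarrow> complex" where
  "act M = moebius (of_int (M$1$1)) (of_int (M$1$2)) (of_int (M$2$1)) (of_int (M$2$2))"

text \<open>\<^const>\<open>csqrt\<close> is the principal branch, with \<open>csqrt a = \<i> * sqrt \<bar>a\<bar>\<close> for \<open>a < 0\<close>.\<close>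

definition sqrt_factor :: "int^2^2 \<Rightarrow> complex \<Rightarrow> complex" where
  "sqrt_factor M z = csqrt (of_int (M$2$1) * z + of_int (M$2$2))"

text \<open>Meaningful for \<open>M\<close> in the theta group \<open>ab \<equiv> cd \<equiv> 0 mod 2\<close> only, which contains
  \<open>\<Gamma>[4]\<close>.\<close>

definition theta_mult :: "int^2^2 \<Rightarrow> complex" where
  "theta_mult M = (THE v. \<forall>z\<in>upper_half_plane.
     theta 0 0 (act M z) = v * sqrt_factor M z * theta 0 0 z)"

definition holomorphic2_on :: "(complex \<times> complex \<Rightarrow> complex) \<Rightarrow> (complex \<times> complex) set \<Rightarrow> bool" where
  "holomorphic2_on f U \<longleftrightarrow>
     (\<forall>p\<in>U. \<exists>\<alpha> \<beta>. (f has_derivative (\<lambda>(h, k). \<alpha> * h + \<beta> * k)) (at p))"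

text \<open>Regularity at all cusps in weight \<open>r/2\<close>: every transform by a pair in
  \<open>SL(2,\<int>) \<times> SL(2,\<int>)\<close> is bounded near \<open>(\<infinity>,\<infinity>)\<close>.  The choice of the square root is
  immaterial for boundedness.\<close>

definition regular_at_cusps :: "nat \<Rightarrow> (complex \<times> complex \<Rightarrow> complex) \<Rightarrow> bool" where
  "regular_at_cusps r f \<longleftrightarrow>
     (\<forall>N\<^sub>1\<in>SL2Z. \<forall>N\<^sub>2\<in>SL2Z. \<exists>Y>0. \<exists>K. \<forall>z w. Im z \<ge> Y \<longrightarrow> Im w \<ge> Y \<longrightarrow>
        cmod (f (act N\<^sub>1 z, act N\<^sub>2 w) / (sqrt_factor N\<^sub>1 z ^ r * sqrt_factor N\<^sub>2 w ^ r)) \<le> K)"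

text \<open>Functions on \<open>\<H> \<times> \<H>\<close> are represented by functions on \<open>\<complex> \<times> \<complex>\<close> that vanish outside
  \<open>\<H> \<times> \<H>\<close>, so that equality of representatives is equality on \<open>\<H> \<times> \<H>\<close>.\<close>

definition modular_forms :: "nat \<Rightarrow> (complex \<times> complex \<Rightarrow> complex) set" where
  "modular_forms r = {f.
     (\<forall>p. p \<notin> upper_half_plane \<times> upper_half_plane \<longrightarrow> f p = 0) \<and>
     holomorphic2_on f (upper_half_plane \<times> upper_half_plane) \<and>
     regular_at_cusps r f \<and>
     (\<forall>(M\<^sub>1, M\<^sub>2)\<in>Delta48. \<forall>z\<in>upper_half_plane. \<forall>w\<in>upper_half_plane.
        f (act M\<^sub>1 z, act M\<^sub>2 w) =
          (theta_mult M\<^sub>1 * theta_mult M\<^sub>2) ^ r * sqrt_factor M\<^sub>1 z ^ r * sqrt_factor M\<^sub>2 w ^ r * f (z, w))}"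

type_synonym form_family = "nat \<Rightarrow> complex \<times> complex \<Rightarrow> complex"

text \<open>The element of the direct sum over the weights whose only nonzero component is \<open>f\<close>,
  restricted to \<open>\<H> \<times> \<H>\<close>, in degree \<open>r\<close>.\<close>

definition in_degree :: "nat \<Rightarrow> (complex \<times> complex \<Rightarrow> complex) \<Rightarrow> form_family" where
  "in_degree r f = (\<lambda>k p. if k = r \<and> p \<in> upper_half_plane \<times> upper_half_plane then f p else 0)"

definition form_ring :: "form_family ring" where
  "form_ring =
    \<lparr>carrier = {F. (\<forall>r. F r \<in> modular_forms r) \<and> finite {r. F r \<noteq> (\<lambda>p. 0)}},
     mult = (\<lambda>F G r p. \<Sum>i\<le>r. F i p * G (r - i) p),
     one = in_degree 0 (\<lambda>p. 1),
     zero = (\<lambda>r p. 0),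
     add = (\<lambda>F G r p. F r p + G r p)\<rparr>"

definition form_algebra :: "(complex, form_family) module" where
  "form_algebra = algebra_via form_ring (\<lambda>c. in_degree 0 (\<lambda>p. c))"

definition form_grading :: "nat \<Rightarrow> form_family set" where
  "form_grading r = in_degree r ` modular_forms r"

section \<open>Proj of a graded algebra\<close>

text \<open>\<open>Proj\<close> of a commutative graded algebra \<open>R\<close> with homogeneous components \<open>G r\<close>, as a ringed
  space over the base field: points, Zariski topology and structure sheaf, whose sections are
  functions into the stalks (degree zero homogeneous localizations).\<close>

definition homogeneous_ideal :: "('k, 'a) module \<Rightarrow> (nat \<Rightarrow> 'a set) \<Rightarrow> 'a set \<Rightarrow> bool" where
  "homogeneous_ideal R G I \<longleftrightarrow> ideal I R \<and> I = Idl\<^bsub>R\<^esub> (\<Union>r. I \<inter> G r)"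

definition proj_points :: "('k, 'a) module \<Rightarrow> (nat \<Rightarrow> 'a set) \<Rightarrow> 'a set set" where
  "proj_points R G =
     {P. primeideal P R \<and> homogeneous_ideal R G P \<and> \<not> Idl\<^bsub>R\<^esub> (\<Union>r\<in>{0<..}. G r) \<subseteq> P}"

definition proj_topology :: "('k, 'a) module \<Rightarrow> (nat \<Rightarrow> 'a set) \<Rightarrow> 'a set topology" where
  "proj_topology R G =
     topology_generated_by {{P \<in> proj_points R G. \<not> I \<subseteq> P} | I. homogeneous_ideal R G I}"

text \<open>The fraction \<open>a/s\<close> in the homogeneous localization at \<open>P\<close>, as an equivalence class of
  pairs (numerator, denominator) of equal degree.\<close>

definition hfrac ::
    "('k, 'a) module \<Rightarrow> (nat \<Rightarrow> 'a set) \<Rightarrow> 'a set \<Rightarrow> 'a \<Rightarrow> 'a \<Rightarrow> ('a \<times> 'a) set" where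
  "hfrac R G P a s = {(b, t). \<exists>k. b \<in> G k \<and> t \<in> G k - P \<and>
     (\<exists>j. \<exists>u\<in>G j - P. u \<otimes>\<^bsub>R\<^esub> (t \<otimes>\<^bsub>R\<^esub> a) = u \<otimes>\<^bsub>R\<^esub> (s \<otimes>\<^bsub>R\<^esub> b))}"

definition hfrac_mult ::
    "('k, 'a) module \<Rightarrow> (nat \<Rightarrow> 'a set) \<Rightarrow> 'a set \<Rightarrow> ('a \<times> 'a) set \<Rightarrow> ('a \<times> 'a) set \<Rightarrow> ('a \<times> 'a) set" where
  "hfrac_mult R G P X Y =
     (\<Union>(a, s)\<in>X. \<Union>(b, t)\<in>Y. hfrac R G P (a \<otimes>\<^bsub>R\<^esub> b) (s \<otimes>\<^bsub>R\<^esub> t))"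

definition hfrac_add ::
    "('k, 'a) module \<Rightarrow> (nat \<Rightarrow> 'a set) \<Rightarrow> 'a set \<Rightarrow> ('a \<times> 'a) set \<Rightarrow> ('a \<times> 'a) set \<Rightarrow> ('a \<times> 'a) set" where
  "hfrac_add R G P X Y =
     (\<Union>(a, s)\<in>X. \<Union>(b, t)\<in>Y.
        hfrac R G P ((a \<otimes>\<^bsub>R\<^esub> t) \<oplus>\<^bsub>R\<^esub> (b \<otimes>\<^bsub>R\<^esub> s)) (s \<otimes>\<^bsub>R\<^esub> t))"

type_synonym 'a proj_section = "'a set \<Rightarrow> ('a \<times> 'a) set"

definition proj_sections ::
    "('k, 'a) module \<Rightarrow> (nat \<Rightarrow> 'a set) \<Rightarrow> 'a set set \<Rightarrow> 'a proj_section set" where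
  "proj_sections R G U = {\<sigma> \<in> extensional U.
     \<forall>P\<in>U. \<exists>V. openin (proj_topology R G) V \<and> P \<in> V \<and> V \<subseteq> U \<and>
       (\<exists>r. \<exists>a\<in>G r. \<exists>s\<in>G r. \<forall>Q\<in>V. s \<notin> Q \<and> \<sigma> Q = hfrac R G Q a s)}"

definition proj_sheaf ::
    "('k, 'a) module \<Rightarrow> (nat \<Rightarrow> 'a set) \<Rightarrow> 'a set set \<Rightarrow> ('k, 'a proj_section) module" where
  "proj_sheaf R G U = algebra_via
     \<lparr>carrier = proj_sections R G U,
      mult = (\<lambda>\<sigma> \<tau>. \<lambda>P\<in>U. hfrac_mult R G P (\<sigma> P) (\<tau> P)),
      one = (\<lambda>P\<in>U. hfrac R G P \<one>\<^bsub>R\<^esub> \<one>\<^bsub>R\<^esub>),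
      zero = (\<lambda>P\<in>U. hfrac R G P \<zero>\<^bsub>R\<^esub> \<one>\<^bsub>R\<^esub>),
      add = (\<lambda>\<sigma> \<tau>. \<lambda>P\<in>U. hfrac_add R G P (\<sigma> P) (\<tau> P))\<rparr>
     (\<lambda>k. \<lambda>P\<in>U. hfrac R G P (k \<odot>\<^bsub>R\<^esub> \<one>\<^bsub>R\<^esub>) \<one>\<^bsub>R\<^esub>)"

text \<open>Isomorphism of spaces with a sheaf of algebras whose sections are functions, restriction
  maps being restriction of functions.  Between locally ringed spaces such an isomorphism is
  automatically local on stalks.\<close>

definition ringed_space_iso ::
    "'p topology \<Rightarrow> ('p set \<Rightarrow> ('k, 'p \<Rightarrow> 'u) module) \<Rightarrow>
     'q topology \<Rightarrow> ('q set \<Rightarrow> ('k, 'q \<Rightarrow> 'v) module) \<Rightarrow> bool" where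
  "ringed_space_iso X \<O>\<^sub>X Y \<O>\<^sub>Y \<longleftrightarrow>
     (\<exists>h \<psi>. homeomorphic_map X Y h \<and>
       (\<forall>V. openin Y V \<longrightarrow>
          \<psi> V \<in> ring_iso (\<O>\<^sub>Y V) (\<O>\<^sub>X {x \<in> topspace X. h x \<in> V}) \<and>
          (\<forall>k. \<forall>\<sigma>\<in>carrier (\<O>\<^sub>Y V).
             \<psi> V (k \<odot>\<^bsub>\<O>\<^sub>Y V\<^esub> \<sigma>) = k \<odot>\<^bsub>\<O>\<^sub>X {x \<in> topspace X. h x \<in> V}\<^esub> \<psi> V \<sigma>)) \<and>
       (\<forall>V V'. openin Y V \<longrightarrow> openin Y V' \<longrightarrow> V' \<subseteq> V \<longrightarrow>
          (\<forall>\<sigma>\<in>carrier (\<O>\<^sub>Y V).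
             \<psi> V' (restrict \<sigma> V') = restrict (\<psi> V \<sigma>) {x \<in> topspace X. h x \<in> V'})))"

definition proj_isomorphic ::
    "('k, 'a) module \<Rightarrow> (nat \<Rightarrow> 'a set) \<Rightarrow> ('k, 'b) module \<Rightarrow> (nat \<Rightarrow> 'b set) \<Rightarrow> bool" where
  "proj_isomorphic R G S H \<longleftrightarrow>
     ringed_space_iso (proj_topology R G) (proj_sheaf R G) (proj_topology S H) (proj_sheaf S H)"

end

theory Submission
  imports Defs "HOL-Complex_Analysis.Complex_Analysis" "HOL-Probability.Distributions"
begin

text \<open>Write \<open>X(z) = \<vartheta>\<^sub>0\<^sub>0(2z)\<close>, \<open>Y(z) = \<vartheta>\<^sub>1\<^sub>0(2z)\<close>.  The squares of \<open>\<vartheta>\<^sub>0\<^sub>0\<close>, \<open>\<vartheta>\<^sub>0\<^sub>1\<close>,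
  \<open>\<vartheta>\<^sub>1\<^sub>0\<close> are \<open>X\<^sup>2 + Y\<^sup>2\<close>, \<open>X\<^sup>2 - Y\<^sup>2\<close>, \<open>2XY\<close>; these identities give the relations of \<open>B\<close>, and through the
  arithmetic-geometric mean also the inversion formula for the theta functions.

  Surjectivity: forms of one variable on \<open>\<Gamma>[4]\<close> with the multiplier system of \<open>X\<close> are the homogeneous
  polynomials in \<open>X, Y\<close>, by repeatedly subtracting a multiple of a power of \<open>X\<close> and dividing by \<open>Y\<close>,
  which vanishes at a single cusp.  A form on \<open>\<Delta>(4,8)\<close> splits into eight isotypic components under
  \<open>\<Gamma>[4] / \<Gamma>[8]\<close>; dividing a component by the theta monomial with the same character leaves a
  function which is a form on \<open>\<Gamma>[4]\<close> in each variable, hence by interpolation a bihomogeneous polynomial in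
  \<open>X(z), Y(z)\<close> and \<open>X(w), Y(w)\<close>, that is, a polynomial in \<open>W\<^sub>1, W\<^sub>2, W\<^sub>3, C\<close>.

  Injectivity: \<open>B\<close> is spanned by the monomials with exponents at most \<open>1\<close> in \<open>Z\<^sub>1, Z\<^sub>2, Z\<^sub>3, C\<close>.
  Elements of \<open>\<Gamma>[4]\<close> acting on \<open>z\<close> alone change the signs of the \<open>Z\<^sub>i\<close> independently, which separates
  the powers of the \<open>Z\<^sub>i\<close>; since \<open>Y/X\<close> takes infinitely many values, what remains vanishes on the whole
  quadric \<open>W\<^sub>1\<^sup>2 + W\<^sub>2\<^sup>2 + W\<^sub>3\<^sup>2 = C\<^sup>2\<close>.\<close>

section \<open>Theta series\<close>

text \<open>No Poisson summation is used. At i y, one AGM step moves (theta_00^2, theta_01^2) to 2 i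
  y, and moves (theta_00^2, theta_10^2) to i y / 2 up to a factor 1/2. Both limits can be computed,
  the second from the Gaussian integral, and strict monotonicity of the AGM then forces the moduli
  at y and 1/y to be exchanged. Half-integral weight would ask for a branch of sqrt(c z + d) in
  every computation. Instead the quotient of \<open>thX\<close> (or of theta_00) at M z and at z
  serves as automorphy factor, and growth is measured by an invariant norm. One obstacle to
  surjectivity is the division by a theta monomial, which may vanish at cusps. The loss is at most
  exp(pi y / 4), half a pole in the local parameter exp(pi i z / 2); one-variable forms are defined
  so as to tolerate it. Another is that regularity bounds a form only where both imaginary parts are
  large. Finiteness modulo 8 makes the bound uniform, one variable is frozen high up, and the
  identity theorem removes the restriction.\<close>

lemma summable_on_int_power:
  assumes "0 \<le> r" "r < 1"
  shows "(\<lambda>n::int. r ^ nat \<bar>n\<bar> :: real) summable_on UNIV"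
proof -
  have *: "(\<lambda>n::nat. r ^ n) summable_on UNIV"
    using assms by (intro norm_summable_imp_summable_on) (auto intro!: summable_geometric)
  have 1: "(\<lambda>n::int. r ^ nat \<bar>n\<bar>) summable_on range int"
    using * by (subst summable_on_reindex) (auto simp: o_def)
  have 2: "(\<lambda>n::int. r ^ nat \<bar>n\<bar>) summable_on range (\<lambda>n. - int n)"
    using * by (subst summable_on_reindex) (auto simp: o_def inj_on_def)
  have "UNIV = range int \<union> range (\<lambda>n. - int n)"
    by (auto simp: image_iff) (metis int_cases2)
  with summable_on_union[OF 1 2] show ?thesis by simp
qed

definition theta_term :: "nat \<Rightarrow> nat \<Rightarrow> complex \<Rightarrow> int \<Rightarrow> complex" where
  "theta_term a b z n = exp (of_real pi * \<i> * ((of_int n + of_nat a / 2)^2 * z + of_nat b * (of_int n + of_nat a / 2)))"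

lemma theta_eq_infsum: "theta a b z = (\<Sum>\<^sub>\<infinity>n. theta_term a b z n)"
  by (simp add: theta_def theta_term_def)

lemma norm_theta_term: "norm (theta_term a b z n) = exp (- pi * (of_int n + real a / 2)\<^sup>2 * Im z)"
proof -
  have "(complex_of_int n + of_nat a / 2) = of_real (of_int n + real a / 2)" by simp
  hence "of_real pi * \<i> * ((of_int n + of_nat a / 2)^2 * z + of_nat b * (of_int n + of_nat a / 2)) =
      \<i> * of_real (pi * (of_int n + real a / 2)\<^sup>2) * z + \<i> * of_real (pi * real b * (of_int n + real a / 2))"
    by (simp add: algebra_simps)
  thus ?thesis unfolding theta_term_def by (simp add: norm_exp_eq_Re mult_ac)
qed

text \<open>From t^2 >= |t| - 1 the Gaussian terms are dominated by a constant times a geometric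
  series in |n|; the constant absorbs the shift by \<open>a / 2\<close>.\<close>

lemma theta_bound_summable:
  assumes "c > 0" shows "(\<lambda>n::int. exp (- c * (of_int n + real a / 2)\<^sup>2)) summable_on UNIV"
proof (rule summable_on_comparison_test)
  show "(\<lambda>n::int. exp (c * (1 + real a / 2)) * exp (- c) ^ nat \<bar>n\<bar>) summable_on UNIV"
    using assms by (intro summable_on_cmult_right summable_on_int_power) auto
  fix n :: int
  have "(of_int n + real a / 2)\<^sup>2 \<ge> \<bar>of_int n + real a / 2\<bar> - 1"
  proof -
    have "t\<^sup>2 \<ge> \<bar>t\<bar> - 1" for t :: real
      using zero_le_power2[of "\<bar>t\<bar> - 1/2"] by (simp add: power2_diff) (simp add: power2_eq_square)
    thus ?thesis .
  qed
  moreover have "\<bar>of_int n + real a / 2\<bar> \<ge> \<bar>of_int n\<bar> - real a / 2" by auto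
  ultimately have "(of_int n + real a / 2)\<^sup>2 \<ge> \<bar>of_int n\<bar> - real a / 2 - 1" by linarith
  hence "c * (\<bar>of_int n\<bar> - real a / 2 - 1) \<le> c * (of_int n + real a / 2)\<^sup>2"
    using assms by (intro mult_left_mono) auto
  hence "- c * (of_int n + real a / 2)\<^sup>2 \<le> c * (1 + real a / 2) + real (nat \<bar>n\<bar>) * (- c)"
    by (simp add: algebra_simps)
  thus "exp (- c * (of_int n + real a / 2)\<^sup>2) \<le> exp (c * (1 + real a / 2)) * exp (- c) ^ nat \<bar>n\<bar>"
    by (simp flip: exp_add exp_of_nat_mult)
qed auto

lemma theta_abs_summable:
  assumes "Im z > 0" shows "(\<lambda>n. norm (theta_term a b z n)) summable_on UNIV"
  using theta_bound_summable[of "pi * Im z" a] assms by (simp add: norm_theta_term mult_ac)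

lemma theta_has_sum: "Im z > 0 \<Longrightarrow> (theta_term a b z has_sum theta a b z) UNIV"
  unfolding theta_eq_infsum
  by (rule has_sum_infsum[OF abs_summable_summable[OF theta_abs_summable]])

lemma open_upper_half_plane: "open upper_half_plane"
  unfolding upper_half_plane_def by (rule open_halfspace_Im_gt)

lemma connected_upper_half_plane: "connected upper_half_plane"
  unfolding upper_half_plane_def by (intro convex_connected convex_halfspace_Im_gt)


text \<open>Weierstrass M-test: on the closed disc of radius Im z / 2 about z the imaginary part is
  at least Im z / 2, so the Gaussian at that height majorises every term uniformly.\<close>

lemma theta_holomorphic: "theta a b holomorphic_on upper_half_plane"
proof -
  have "theta a b analytic_on upper_half_plane"
    unfolding analytic_on_def
  proof safe
    fix z assume "z \<in> upper_half_plane"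
    hence z: "Im z > 0" by (simp add: upper_half_plane_def)
    define M where "M n = exp (- (pi * Im z / 2) * (of_int n + real a / 2)\<^sup>2)" for n :: int
    have u: "uniform_limit (cball z (Im z / 2)) (\<lambda>X w. \<Sum>n\<in>X. theta_term a b w n)
        (\<lambda>w. \<Sum>\<^sub>\<infinity>n. theta_term a b w n) (finite_subsets_at_top UNIV)"
    proof (rule Weierstrass_m_test_general)
      show "M summable_on UNIV" unfolding M_def using z by (intro theta_bound_summable) auto
      fix n w assume "w \<in> cball z (Im z / 2)"
      hence "\<bar>Im z - Im w\<bar> \<le> Im z / 2"
        using abs_Im_le_cmod[of "z - w"] by (simp add: dist_norm)
      hence "Im w \<ge> Im z / 2" by linarith
      hence "pi * (of_int n + real a / 2)\<^sup>2 * Im w \<ge> pi * (of_int n + real a / 2)\<^sup>2 * (Im z / 2)"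
        by (intro mult_left_mono) auto
      thus "norm (theta_term a b w n) \<le> M n"
        by (simp add: norm_theta_term M_def mult_ac)
    qed
    have ev: "\<forall>\<^sub>F X in finite_subsets_at_top UNIV. continuous_on (cball z (Im z / 2)) (\<lambda>w. \<Sum>n\<in>X. theta_term a b w n)
        \<and> (\<lambda>w. \<Sum>n\<in>X. theta_term a b w n) holomorphic_on ball z (Im z / 2)"
      by (intro always_eventually allI conjI) (auto simp: theta_term_def intro!: continuous_intros holomorphic_intros)
    obtain "(\<lambda>w. \<Sum>\<^sub>\<infinity>n. theta_term a b w n) holomorphic_on ball z (Im z / 2)"
      by (rule holomorphic_uniform_limit[OF ev u finite_subsets_at_top_neq_bot])
    thus "\<exists>e>0. theta a b holomorphic_on ball z e"
      using z by (intro exI[of _ "Im z / 2"]) (simp add: theta_eq_infsum[abs_def])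
  qed
  thus ?thesis by (rule analytic_imp_holomorphic)
qed

lemma exp_pi_i_int: "exp (of_real pi * \<i> * of_int n) = (-1) powi n"
  using exp_power_int[of "of_real pi * \<i>" n] by (simp add: mult.commute)

lemma neg_one_powi: "(-1) powi (n::int) = (if even n then 1 else -1 :: complex)"
  by (auto simp: power_int_minus_left)

text \<open>Expanding the square turns z + 1 into a factor exp(pi i n^2), which is (-1)^n because
  n^2 and n have the same parity. For \<open>a = 1\<close> the exponent (n + 1/2)^2 = n (n + 1) +
  1/4 leaves only an eighth root of unity.\<close>

lemma theta_term_add_one:
  "theta_term 0 0 (z + 1) n = theta_term 0 1 z n" (is ?A)
  "theta_term 0 1 (z + 1) n = theta_term 0 0 z n" (is ?B)
  "theta_term 1 0 (z + 1) n = exp (of_real pi * \<i> / 4) * theta_term 1 0 z n" (is ?C)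
proof -
  have e: "exp (of_real pi * \<i> * of_int (n\<^sup>2)) = exp (of_real pi * \<i> * of_int n)"
     "exp (of_real pi * \<i> * of_int (n * (n + 1))) = 1" 
     "exp (of_real pi * \<i> * of_int (n\<^sup>2 + n)) = 1" unfolding exp_pi_i_int neg_one_powi by auto
  have "theta_term 0 0 (z + 1) n = theta_term 0 0 z n * exp (of_real pi * \<i> * of_int (n\<^sup>2))"
    by (simp add: theta_term_def algebra_simps flip: exp_add)
  also have "\<dots> = theta_term 0 1 z n" unfolding e by (simp add: theta_term_def algebra_simps flip: exp_add)
  finally show ?A .
  have "theta_term 0 1 (z + 1) n = theta_term 0 0 z n * exp (of_real pi * \<i> * of_int (n\<^sup>2 + n))"
    by (simp add: theta_term_def algebra_simps flip: exp_add)
  thus ?B unfolding e by simp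
  have "theta_term 1 0 (z + 1) n = exp (of_real pi * \<i> / 4) * theta_term 1 0 z n * exp (of_real pi * \<i> * of_int (n * (n + 1)))"
    by (simp add: theta_term_def algebra_simps power2_eq_square add_divide_distrib flip: exp_add)
  thus ?C unfolding e by simp
qed

lemma theta_add_one:
  "theta 0 0 (z + 1) = theta 0 1 z"
  "theta 0 1 (z + 1) = theta 0 0 z"
  "theta 1 0 (z + 1) = exp (of_real pi * \<i> / 4) * theta 1 0 z"
  unfolding theta_eq_infsum theta_term_add_one by (simp_all only: infsum_cmult_right')

lemma int_even_odd_UNIV: "range (\<lambda>n::int. 2 * n) \<union> range (\<lambda>n. 2 * n + 1) = UNIV"
  "range (\<lambda>n::int. 2 * n) \<inter> range (\<lambda>n. 2 * n + 1) = {}"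
proof -
  show "range (\<lambda>n::int. 2 * n) \<union> range (\<lambda>n. 2 * n + 1) = UNIV" 
  proof -
    have "x \<in> range (\<lambda>n::int. 2 * n) \<union> range (\<lambda>n. 2 * n + 1)" for x
      by (cases "even x") (auto elim!: evenE oddE)
    thus ?thesis by blast
  qed
  have "even x" if "x \<in> range (\<lambda>n::int. 2 * n)" for x :: int using that by auto
  moreover have "odd x" if "x \<in> range (\<lambda>n::int. 2 * n + 1)" for x :: int using that by auto
  ultimately show "range (\<lambda>n::int. 2 * n) \<inter> range (\<lambda>n. 2 * n + 1) = {}" by blast
qed

text \<open>Even n = 2 m and odd n = 2 m + 1 have squares 4 m^2 and 4 (m + 1/2)^2; the sign (-1)^n
  in \<open>theta 0 1\<close> distinguishes the two halves.\<close>

lemma theta_split: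
  assumes "Im z > 0"
  shows "theta 0 0 z = theta 0 0 (4 * z) + theta 1 0 (4 * z)"
    and "theta 0 1 z = theta 0 0 (4 * z) - theta 1 0 (4 * z)"
proof -
  have z: "Im (4 * z) > 0" using assms by simp
  have e: "exp (of_real pi * \<i> * of_int (2 * m)) = 1" "exp (of_real pi * \<i> * of_int (2 * m + 1)) = - 1" for m
    unfolding exp_pi_i_int neg_one_powi by auto
  have t: "theta_term 0 0 z (2 * n) = theta_term 0 0 (4 * z) n"
     "theta_term 0 0 z (2 * n + 1) = theta_term 1 0 (4 * z) n" for n
    by (simp_all add: theta_term_def power2_eq_square add_divide_distrib algebra_simps)
  have "theta_term 0 1 z m = theta_term 0 0 z m * exp (of_real pi * \<i> * of_int m)" for m
    by (simp add: theta_term_def algebra_simps flip: exp_add)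
  hence t1: "theta_term 0 1 z (2 * n) = theta_term 0 0 (4 * z) n"
     "theta_term 0 1 z (2 * n + 1) = - theta_term 1 0 (4 * z) n" for n
    by (simp_all add: t e del: of_int_mult of_int_add)
  have r: "(f has_sum A + B) UNIV"
    if "((\<lambda>n. f (2 * n)) has_sum A) UNIV" "((\<lambda>n. f (2 * n + 1)) has_sum B) UNIV" for f :: "int \<Rightarrow> complex" and A B
  proof -
    have "(f has_sum A) (range (\<lambda>n. 2 * n))" "(f has_sum B) (range (\<lambda>n. 2 * n + 1))"
      using that by (auto simp: has_sum_reindex o_def inj_on_def)
    from has_sum_Un_disjoint[OF this] show ?thesis by (simp add: int_even_odd_UNIV)
  qed
  have "(theta_term 0 0 z has_sum (theta 0 0 (4 * z) + theta 1 0 (4 * z))) UNIV"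
    by (rule r) (use theta_has_sum[OF z] in \<open>auto simp: t\<close>)
  with theta_has_sum[OF assms, of 0 0] show "theta 0 0 z = theta 0 0 (4 * z) + theta 1 0 (4 * z)"
    by (rule has_sum_unique)
  have "(theta_term 0 1 z has_sum (theta 0 0 (4 * z) + (- theta 1 0 (4 * z)))) UNIV"
    using theta_has_sum[OF z, of 0 0] theta_has_sum[OF z, of 1 0] by (intro r) (simp_all only: t1 has_sum_uminus minus_minus)
  with theta_has_sum[OF assms, of 0 1] show "theta 0 1 z = theta 0 0 (4 * z) - theta 1 0 (4 * z)"
    using has_sum_unique by force
qed

lemma has_sum_times:
  fixes f :: "'a \<Rightarrow> complex" and g :: "'b \<Rightarrow> complex"
  assumes "(\<lambda>x. norm (f x)) summable_on UNIV" "(\<lambda>x. norm (g x)) summable_on UNIV"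
    and fA: "(f has_sum A) UNIV" and gB: "(g has_sum B) UNIV"
  shows "((\<lambda>(x,y). f x * g y) has_sum (A * B)) UNIV"
proof -
  have 1: "((\<lambda>y. norm (f x * g y)) has_sum (norm (f x) * infsum (\<lambda>y. norm (g y)) UNIV)) UNIV" for x
    unfolding norm_mult by (intro has_sum_cmult_right has_sum_infsum assms)
  have "(\<lambda>p. norm (case p of (x,y) \<Rightarrow> f x * g y)) summable_on (SIGMA x:UNIV. UNIV)"
  proof (rule summable_on_SigmaI[where g = "\<lambda>x. norm (f x) * infsum (\<lambda>y. norm (g y)) UNIV"])
    show "(\<lambda>x. norm (f x) * infsum (\<lambda>y. norm (g y)) UNIV) summable_on UNIV"
      by (intro summable_on_cmult_left assms)
  qed (use 1 in auto)
  hence "(\<lambda>(x,y). f x * g y) summable_on (SIGMA x:UNIV. UNIV)"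
    using abs_summable_summable by blast
  then obtain S where S: "((\<lambda>(x,y). f x * g y) has_sum S) (SIGMA x:UNIV. UNIV)"
    unfolding summable_on_def by blast
  have "((\<lambda>x. f x * B) has_sum S) UNIV"
    by (rule has_sum_SigmaD[OF S]) (auto intro!: has_sum_cmult_right gB)
  moreover have "((\<lambda>x. f x * B) has_sum (A * B)) UNIV" by (intro has_sum_cmult_left fA)
  ultimately have "S = A * B" by (rule has_sum_unique)
  with S show ?thesis by simp
qed

text \<open>Rotation of the lattice: m = j + l, n = j - l gives m^2 + n^2 = 2 (j^2 + l^2) and covers
  the pairs of equal parity. Pairs of opposite parity come from half-integral j and l, hence the
  shift in the second parametrisation and the term with \<open>theta 1 0\<close>.\<close>

lemma theta00_sq:
  assumes "Im z > 0"
  shows "theta 0 0 z ^ 2 = theta 0 0 (2 * z) ^ 2 + theta 1 0 (2 * z) ^ 2"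
proof -
  have z: "Im (2 * z) > 0" using assms by simp
  define F where "F = (\<lambda>(m,n). theta_term 0 0 z m * theta_term 0 0 z n)"
  have pr: "((\<lambda>(m,n). theta_term a 0 w m * theta_term a 0 w n) has_sum (theta a 0 w ^ 2)) UNIV" if "Im w > 0" for a w
    using has_sum_times[OF theta_abs_summable[OF that] theta_abs_summable[OF that] theta_has_sum[OF that] theta_has_sum[OF that]]
    by (simp add: power2_eq_square)
  let ?g = "\<lambda>(j,l). (j + l, j - l)" and ?h = "\<lambda>(j,l). (j + l + 1, j - l :: int)"
  have 1: "F (?g p) = (case p of (m,n) \<Rightarrow> theta_term 0 0 (2 * z) m * theta_term 0 0 (2 * z) n)" for p
    by (cases p) (simp add: F_def theta_term_def power2_eq_square algebra_simps flip: exp_add)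
  have 2: "F (?h p) = (case p of (m,n) \<Rightarrow> theta_term 1 0 (2 * z) m * theta_term 1 0 (2 * z) n)" for p
    by (cases p) (simp add: F_def theta_term_def power2_eq_square algebra_simps flip: exp_add)
  have A: "(F has_sum (theta 0 0 (2 * z) ^ 2)) (range ?g)"
    using pr[OF z, of 0] by (subst has_sum_reindex) (auto simp: inj_on_def o_def 1)
  have B: "(F has_sum (theta 1 0 (2 * z) ^ 2)) (range ?h)"
    using pr[OF z, of 1] by (subst has_sum_reindex) (auto simp: inj_on_def o_def 2)
  have "even (fst p + snd p)" if "p \<in> range ?g" for p :: "int \<times> int" using that by auto
  moreover have "odd (fst p + snd p)" if "p \<in> range ?h" for p :: "int \<times> int" using that by auto
  ultimately have "range ?g \<inter> range ?h = {}" by blast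
  moreover have "range ?g \<union> range ?h = UNIV"
  proof -
    have "(m, n) \<in> range ?g \<union> range ?h" for m n :: int
    proof (cases "even (m + n)")
      case True
      have "(m, n) = ?g ((m + n) div 2, (m - n) div 2)" using True by simp presburger
      thus ?thesis by blast
    next
      case False
      have "(m, n) = ?h ((m + n - 1) div 2, (m - n - 1) div 2)" using False by simp presburger
      thus ?thesis by blast
    qed
    thus ?thesis by auto
  qed
  ultimately have "(F has_sum (theta 0 0 (2 * z) ^ 2 + theta 1 0 (2 * z) ^ 2)) UNIV"
    using has_sum_Un_disjoint[OF A B] by simp
  with pr[OF assms, of 0] show ?thesis unfolding F_def by (rule has_sum_unique)
qed

text \<open>Consequences of \<open>theta00_sq\<close> and \<open>theta_split\<close>. Translating z
  by 1 multiplies \<open>theta 1 0 (2 * z)\<close> twice by an eighth root of unity, so its square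
  changes sign. With A, B the values of \<open>theta 0 0\<close>, \<open>theta 1 0\<close> at the
  fourfold argument, the second identity is (A + B)^2 - (A^2 + B^2) = 2 A B and the third is (A + B)
  (A - B) = A^2 - B^2.\<close>

lemma theta_double:
  assumes "Im z > 0"
  shows "theta 0 1 z ^ 2 = theta 0 0 (2 * z) ^ 2 - theta 1 0 (2 * z) ^ 2"
    and "theta 1 0 z ^ 2 = 2 * theta 0 0 (2 * z) * theta 1 0 (2 * z)"
    and "theta 0 0 z * theta 0 1 z = theta 0 1 (2 * z) ^ 2"
proof -
  have "exp (of_real pi * \<i> / 4) ^ 4 = exp (of_real pi * \<i>)"
    by (subst exp_of_nat_mult[symmetric]) simp
  hence e: "exp (of_real pi * \<i> / 4) ^ 4 = (-1 :: complex)" by simp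
  have c: "(exp (of_real pi * \<i> / 4) * (exp (of_real pi * \<i> / 4) * t)) ^ 2 = - (t ^ 2)" for t :: complex
  proof -
    have "(exp (of_real pi * \<i> / 4) * (exp (of_real pi * \<i> / 4) * t)) ^ 2 = exp (of_real pi * \<i> / 4) ^ 4 * t ^ 2"
      by (simp only: power2_eq_square power4_eq_xxxx mult_ac)
    thus ?thesis unfolding e by simp
  qed
  have "2 * (z + 1) = 2 * z + 1 + 1" by simp
  hence "theta 0 0 (2 * (z + 1)) = theta 0 0 (2 * z)" "theta 1 0 (2 * (z + 1)) ^ 2 = - (theta 1 0 (2 * z) ^ 2)"
    using e by (simp_all only: theta_add_one c)
  thus 1: "theta 0 1 z ^ 2 = theta 0 0 (2 * z) ^ 2 - theta 1 0 (2 * z) ^ 2"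
    using theta00_sq[of "z + 1"] assms by (simp add: theta_add_one)
  have "theta 1 0 (2 * w) ^ 2 = 2 * theta 0 0 (4 * w) * theta 1 0 (4 * w)" if "Im w > 0" for w
    using theta00_sq[of w] theta00_sq[of "2 * w"] theta_split(1)[of w] that by (simp add: power2_eq_square algebra_simps)
  from this[of "z / 2"] assms show 2: "theta 1 0 z ^ 2 = 2 * theta 0 0 (2 * z) * theta 1 0 (2 * z)" by simp
  have "theta 0 1 (2 * z) ^ 2 = theta 0 0 (4 * z) ^ 2 - theta 1 0 (4 * z) ^ 2"
  proof -
    have "2 * (2 * z + 1) = 4 * z + 1 + 1" by simp
    hence "theta 0 0 (2 * (2 * z + 1)) = theta 0 0 (4 * z)" "theta 1 0 (2 * (2 * z + 1)) ^ 2 = - (theta 1 0 (4 * z) ^ 2)"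
      using e by (simp_all only: theta_add_one c)
    thus ?thesis using theta00_sq[of "2 * z + 1"] assms by (simp add: theta_add_one)
  qed
  thus "theta 0 0 z * theta 0 1 z = theta 0 1 (2 * z) ^ 2"
    unfolding theta_split[OF assms] by (simp add: power2_eq_square algebra_simps)
qed

section \<open>Theta values on the imaginary axis and the arithmetic-geometric mean\<close>

definition gsum :: "nat \<Rightarrow> real \<Rightarrow> real" where
  "gsum a y = (\<Sum>\<^sub>\<infinity>n::int. exp (- (pi * y) * (of_int n + real a / 2)\<^sup>2))"

lemma gsum_has_sum:
  assumes "y > 0"
  shows "((\<lambda>n::int. exp (- (pi * y) * (of_int n + real a / 2)\<^sup>2)) has_sum gsum a y) UNIV"
  unfolding gsum_def by (rule has_sum_infsum, rule theta_bound_summable) (use assms in auto)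

lemma theta_imaginary:
  assumes "y > 0"
  shows "theta a 0 (\<i> * of_real y) = of_real (gsum a y)"
proof -
  have t: "theta_term a 0 (\<i> * of_real y) n = of_real (exp (- (pi * y) * (of_int n + real a / 2)\<^sup>2))" for n
    by (simp add: theta_term_def algebra_simps flip: exp_of_real) (simp add: mult.left_commute[of \<i>])?
  have "(theta_term a 0 (\<i> * of_real y) has_sum of_real (gsum a y)) UNIV"
    unfolding t by (rule has_sum_of_real, rule gsum_has_sum[OF assms])
  with theta_has_sum[of "\<i> * of_real y" a 0] assms show ?thesis
    using has_sum_unique by force
qed

lemma gsum_pos:
  assumes "y > 0" shows "gsum a y > 0"
proof -
  have "0 < exp (- (pi * y) * (of_int 0 + real a / 2)\<^sup>2)" by simp
  also have "\<dots> = sum (\<lambda>n. exp (- (pi * y) * (of_int n + real a / 2)\<^sup>2)) {0::int}" by simp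
  also have "\<dots> \<le> gsum a y"
    by (rule finite_sum_le_has_sum[OF gsum_has_sum[OF assms]]) auto
  finally show ?thesis .
qed

text \<open>The value of \<open>theta 0 1\<close> at i y. The even-odd splitting expresses it by
  series with positive terms, so no alternating series has to be handled.\<close>

definition gsum_alt :: "real \<Rightarrow> real" where "gsum_alt y = gsum 0 (4 * y) - gsum 1 (4 * y)"

lemma theta01_imaginary:
  assumes "y > 0" shows "theta 0 1 (\<i> * of_real y) = of_real (gsum_alt y)"
  using theta_split(2)[of "\<i> * of_real y"] theta_imaginary[of "4 * y"] assms
  by (simp add: gsum_alt_def mult_ac)

lemma gsum_double:
  assumes "y > 0"
  shows "gsum 0 y ^ 2 = gsum 0 (2 * y) ^ 2 + gsum 1 (2 * y) ^ 2" (is ?A)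
    and "gsum_alt y ^ 2 = gsum 0 (2 * y) ^ 2 - gsum 1 (2 * y) ^ 2" (is ?B)
    and "gsum 1 y ^ 2 = 2 * gsum 0 (2 * y) * gsum 1 (2 * y)" (is ?C)
    and "gsum 0 y * gsum_alt y = gsum_alt (2 * y) ^ 2" (is ?D)
proof -
  have i: "Im (\<i> * of_real y) > 0" using assms by simp
  have t: "theta 0 0 (\<i> * of_real y) = of_real (gsum 0 y)" "theta 1 0 (\<i> * of_real y) = of_real (gsum 1 y)"
    "theta 0 1 (\<i> * of_real y) = of_real (gsum_alt y)"
    "theta 0 0 (2 * (\<i> * of_real y)) = of_real (gsum 0 (2 * y))" "theta 1 0 (2 * (\<i> * of_real y)) = of_real (gsum 1 (2 * y))"
    "theta 0 1 (2 * (\<i> * of_real y)) = of_real (gsum_alt (2 * y))"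
    using theta_imaginary[of y] theta_imaginary[of "2 * y"] theta01_imaginary[of y] theta01_imaginary[of "2 * y"] assms
    by (simp_all add: mult_ac)
  have "complex_of_real (gsum 0 y ^ 2) = complex_of_real (gsum 0 (2 * y) ^ 2 + gsum 1 (2 * y) ^ 2)"
    using theta00_sq[OF i, unfolded t] by simp
  thus ?A by (simp only: of_real_eq_iff)
  have "complex_of_real (gsum_alt y ^ 2) = complex_of_real (gsum 0 (2 * y) ^ 2 - gsum 1 (2 * y) ^ 2)"
    using theta_double(1)[OF i, unfolded t] by simp
  thus ?B by (simp only: of_real_eq_iff)
  have "complex_of_real (gsum 1 y ^ 2) = complex_of_real (2 * gsum 0 (2 * y) * gsum 1 (2 * y))"
    using theta_double(2)[OF i, unfolded t] by simp
  thus ?C by (simp only: of_real_eq_iff)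
  have "complex_of_real (gsum 0 y * gsum_alt y) = complex_of_real (gsum_alt (2 * y) ^ 2)"
    using theta_double(3)[OF i, unfolded t] by simp
  thus ?D by (simp only: of_real_eq_iff)
qed

lemma has_sum_geometric_nonzero:
  assumes "0 \<le> r" "r < 1"
  shows "((\<lambda>n::int. r ^ nat \<bar>n\<bar> :: real) has_sum (2 * r / (1 - r))) (- {0})"
proof -
  have "((\<lambda>n. r ^ n) has_sum (1 / (1 - r))) UNIV"
    using norm_summable_imp_has_sum[of "\<lambda>n. r ^ n"] geometric_sums[of r] assms by (auto intro: summable_geometric)
  hence "((\<lambda>n. r * r ^ n) has_sum (r * (1 / (1 - r)))) UNIV" by (rule has_sum_cmult_right)
  hence *: "((\<lambda>n. r ^ Suc n) has_sum (r / (1 - r))) UNIV" by simp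
  have 1: "((\<lambda>n::int. r ^ nat \<bar>n\<bar>) has_sum (r / (1 - r))) (range (\<lambda>n. int (Suc n)))"
    using * by (subst has_sum_reindex) (auto simp: o_def inj_on_def nat_add_distrib)
  have 2: "((\<lambda>n::int. r ^ nat \<bar>n\<bar>) has_sum (r / (1 - r))) (range (\<lambda>n. - int (Suc n)))"
    using * by (subst has_sum_reindex) (auto simp: o_def inj_on_def nat_add_distrib)
  have "- {0::int} = range (\<lambda>n. int (Suc n)) \<union> range (\<lambda>n. - int (Suc n))"
  proof -
    have "x \<in> range (\<lambda>n. int (Suc n)) \<union> range (\<lambda>n. - int (Suc n))" if "x \<noteq> 0" for x :: int
    proof (cases "x > 0")
      case True
      hence "x = int (Suc (nat (x - 1)))" by simp
      thus ?thesis by blast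
    next
      case False
      hence "x = - int (Suc (nat (- x - 1)))" using that by simp
      thus ?thesis by blast
    qed
    thus ?thesis by auto
  qed
  moreover have "range (\<lambda>n. int (Suc n)) \<inter> range (\<lambda>n. - int (Suc n)) = {}" by auto
  ultimately show ?thesis using has_sum_Un_disjoint[OF 1 2] by simp
qed

text \<open>\<open>F\<close> has to contain 0 because the majorant is the two-sided geometric series
  over the nonzero integers, with sum 2 r / (1 - r).\<close>

lemma has_sum_int_tail_bound:
  fixes f :: "int \<Rightarrow> complex"
  assumes f: "(f has_sum S) UNIV" and F: "finite F" "0 \<in> F" and r: "0 \<le> r" "r < 1"
    and b: "\<And>n. n \<notin> F \<Longrightarrow> norm (f n) \<le> r ^ nat \<bar>n\<bar>"
  shows "norm (S - sum f F) \<le> 2 * r / (1 - r)"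
proof -
  have "(f has_sum (S - sum f F)) (UNIV - F)"
    by (rule has_sum_Diff[OF f]) (use F in \<open>auto intro: has_sum_finite\<close>)
  moreover have s: "(\<lambda>n::int. r ^ nat \<bar>n\<bar>) summable_on (UNIV - F)"
    using summable_on_int_power[OF r] by (rule summable_on_subset_banach) auto
  have "(\<lambda>n. norm (f n)) summable_on (UNIV - F)"
    by (rule summable_on_comparison_test[OF s]) (use b in auto)
  ultimately have "norm (S - sum f F) \<le> infsum (\<lambda>n. norm (f n)) (UNIV - F)"
    using norm_has_sum_bound[OF has_sum_infsum] by blast
  also have "\<dots> \<le> 2 * r / (1 - r)"
    by (rule has_sum_mono_neutral[OF has_sum_infsum has_sum_geometric_nonzero[OF r]])
       (use \<open>(\<lambda>n. norm (f n)) summable_on (UNIV - F)\<close> F b r in auto)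
  finally show ?thesis .
qed

lemma theta0_near_one:
  assumes "Im z > 0"
  shows "norm (theta 0 b z - 1) \<le> 2 * exp (- (pi * Im z)) / (1 - exp (- (pi * Im z)))"
proof -
  let ?r = "exp (- (pi * Im z))"
  have r: "0 \<le> ?r" "?r < 1" using assms by auto
  have b: "norm (theta_term 0 b z n) \<le> ?r ^ nat \<bar>n\<bar>" for n
  proof -
    have "real_of_int \<bar>n\<bar> \<le> real_of_int (n\<^sup>2)"
      unfolding of_int_le_iff by (metis abs_ge_zero linorder_le_cases mult_le_cancel_right1 not_one_le_zero power2_abs power2_eq_square self_le_power zero_less_numeral int_one_le_iff_zero_less le_less)
    hence "pi * Im z * real (nat \<bar>n\<bar>) \<le> pi * Im z * (of_int n)\<^sup>2"
      using assms by (intro mult_left_mono) auto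
    thus ?thesis by (simp add: norm_theta_term mult_ac flip: exp_of_nat_mult)
  qed
  have "norm (theta 0 b z - sum (theta_term 0 b z) {0}) \<le> 2 * ?r / (1 - ?r)"
    by (rule has_sum_int_tail_bound[OF theta_has_sum]) (use assms r b in auto)
  moreover have "theta_term 0 b z 0 = 1" by (simp add: theta_term_def)
  ultimately show ?thesis by simp
qed

text \<open>The factor exp(-pi i z / 4) cancels the lowest exponent 1/4, which is attained at n = 0
  and n = -1; these two terms make up the 2. For all other n the exponent n (n + 1) is at least
  |n|.\<close>

lemma theta10_near:
  assumes "Im z > 0"
  shows "norm (theta 1 0 z * exp (- (of_real pi * \<i> * z / 4)) - 2) \<le> 2 * exp (- (pi * Im z)) / (1 - exp (- (pi * Im z)))"
proof -
  let ?r = "exp (- (pi * Im z))"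
  let ?f = "\<lambda>n. theta_term 1 0 z n * exp (- (of_real pi * \<i> * z / 4))"
  have r: "0 \<le> ?r" "?r < 1" using assms by auto
  have s: "(?f has_sum (theta 1 0 z * exp (- (of_real pi * \<i> * z / 4)))) UNIV"
    using assms by (intro has_sum_cmult_left theta_has_sum)
  have f: "?f n = exp (of_real pi * \<i> * z * of_int (n * (n + 1)))" for n
    by (simp add: theta_term_def power2_eq_square add_divide_distrib algebra_simps flip: exp_add)
  have b: "norm (?f n) \<le> ?r ^ nat \<bar>n\<bar>" if "n \<notin> {0, -1}" for n
  proof -
    have "\<bar>n\<bar> \<le> n * (n + 1)"
    proof (cases "n > 0")
      case False
      hence "(- n) * 1 \<le> (- n) * (- n - 1)" using that by (intro mult_left_mono) auto
      thus ?thesis using False by (simp add: algebra_simps)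
    qed (simp add: algebra_simps)
    hence "pi * Im z * real_of_int \<bar>n\<bar> \<le> pi * Im z * real_of_int (n * (n + 1))"
      using assms by (intro mult_left_mono) (simp_all only: of_int_le_iff, simp)
    thus ?thesis unfolding f by (simp add: norm_exp_eq_Re mult_ac algebra_simps flip: exp_of_nat_mult)
  qed
  have "norm (theta 1 0 z * exp (- (of_real pi * \<i> * z / 4)) - sum ?f {0, -1}) \<le> 2 * ?r / (1 - ?r)"
    by (rule has_sum_int_tail_bound[OF s]) (use r b in auto)
  moreover have "sum ?f {0, -1} = 2" unfolding f by simp
  ultimately show ?thesis by simp
qed

lemma tendsto_geometric_tail: "((\<lambda>y. 2 * exp (- (pi * y)) / (1 - exp (- (pi * y)))) \<longlongrightarrow> 0) at_top"
  by real_asymp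

lemma filterlim_power2_mult: "(y::real) > 0 \<Longrightarrow> filterlim (\<lambda>n. 2 ^ n * y) at_top sequentially"
  by real_asymp

lemma gsum_dsum_limit:
  assumes "y > 0"
  shows "(\<lambda>n. gsum 0 (2 ^ n * y)) \<longlonglongrightarrow> 1" "(\<lambda>n. gsum_alt (2 ^ n * y)) \<longlonglongrightarrow> 1"
proof -
  have l: "(\<lambda>n. 2 * exp (- (pi * (2 ^ n * y))) / (1 - exp (- (pi * (2 ^ n * y))))) \<longlonglongrightarrow> 0"
    by (rule filterlim_compose[OF tendsto_geometric_tail filterlim_power2_mult[OF assms]])
  have g: "norm (gsum 0 t - 1) \<le> 2 * exp (- (pi * t)) / (1 - exp (- (pi * t)))" 
    and d: "norm (gsum_alt t - 1) \<le> 2 * exp (- (pi * t)) / (1 - exp (- (pi * t)))" if "t > 0" for t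
  proof -
    have "theta 0 0 (\<i> * of_real t) - 1 = of_real (gsum 0 t - 1)" "theta 0 1 (\<i> * of_real t) - 1 = of_real (gsum_alt t - 1)"
      using that by (simp_all only: theta_imaginary theta01_imaginary of_real_diff of_real_1)
    with theta0_near_one[of "\<i> * of_real t" 0] theta0_near_one[of "\<i> * of_real t" 1] that
    show "norm (gsum 0 t - 1) \<le> 2 * exp (- (pi * t)) / (1 - exp (- (pi * t)))" 
      "norm (gsum_alt t - 1) \<le> 2 * exp (- (pi * t)) / (1 - exp (- (pi * t)))"
      by (simp_all only: norm_of_real) simp_all
  qed
  have p: "2 ^ n * y > 0" for n using assms by simp
  show "(\<lambda>n. gsum 0 (2 ^ n * y)) \<longlonglongrightarrow> 1"
    by (rule LIM_zero_cancel, rule Lim_null_comparison[OF _ l], intro always_eventually allI g[OF p])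
  show "(\<lambda>n. gsum_alt (2 ^ n * y)) \<longlonglongrightarrow> 1"
    by (rule LIM_zero_cancel, rule Lim_null_comparison[OF _ l], intro always_eventually allI d[OF p])
qed

text \<open>The product with the positive number \<open>gsum 0 t\<close> is a square, so the value
  is nonnegative. A zero at y would propagate to every 2^n y by the same identity, against the limit
  1.\<close>

lemma gsum_alt_pos:
  assumes "y > 0" shows "gsum_alt y > 0"
proof -
  have nn: "gsum_alt t \<ge> 0" if "t > 0" for t
  proof -
    have "0 \<le> gsum 0 t * gsum_alt t" unfolding gsum_double(4)[OF that] by simp
    thus ?thesis using gsum_pos[OF that, of 0] by (simp add: zero_le_mult_iff)
  qed
  have z: "gsum_alt (2 ^ n * y) = 0" if "gsum_alt y = 0" for n
  proof (induction n)
    case (Suc n)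
    thus ?case using gsum_double(4)[of "2 ^ n * y"] assms by (simp add: mult_ac)
  qed (use that in simp)
  have "gsum_alt y \<noteq> 0"
  proof
    assume "gsum_alt y = 0"
    with gsum_dsum_limit(2)[OF assms] z have "(\<lambda>n. 0::real) \<longlonglongrightarrow> 1" by simp
    thus False by (simp add: LIMSEQ_const_iff)
  qed
  with nn[OF assms] show ?thesis by simp
qed

lemma symmetric_sum_tendsto:
  fixes f :: "int \<Rightarrow> real"
  assumes f: "(f has_sum S) UNIV" and even: "\<And>n. f (- n) = f n"
  shows "(\<lambda>n. 2 * (\<Sum>k\<le>n. f (int k)) - f 0) \<longlonglongrightarrow> S"
proof -
  have "filterlim (\<lambda>n. {- int n..int n}) (finite_subsets_at_top UNIV) sequentially"
    unfolding filterlim_finite_subsets_at_top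
  proof (intro allI impI)
    fix X :: "int set" assume X: "finite X \<and> X \<subseteq> UNIV"
    show "\<forall>\<^sub>F n in sequentially. finite {- int n..int n} \<and> X \<subseteq> {- int n..int n} \<and> {- int n..int n} \<subseteq> UNIV"
    proof (rule eventually_mono[OF eventually_ge_at_top[of "nat (Max (abs ` X))"]], intro conjI subsetI)
      fix n x assume n: "nat (Max (abs ` X)) \<le> n" and x: "x \<in> X"
      have "\<bar>x\<bar> \<le> Max (abs ` X)" using X x by auto
      thus "x \<in> {- int n..int n}" using n by auto
    qed auto
  qed
  hence "(\<lambda>n. sum f {- int n..int n}) \<longlonglongrightarrow> S"
    using f unfolding has_sum_def by (rule filterlim_compose[rotated])
  moreover have "sum f {- int n..int n} = 2 * (\<Sum>k\<le>n. f (int k)) - f 0" for n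
  proof (induction n)
    case (Suc n)
    have "{- int (Suc n)..int (Suc n)} = insert (int (Suc n)) (insert (- int (Suc n)) {- int n..int n})" by auto
    thus ?case using Suc even[of "int (Suc n)"] by (simp add: algebra_simps)
  qed simp
  ultimately show ?thesis by simp
qed

lemma gaussian_integral_tendsto:
  assumes "c > 0"
  shows "(\<lambda>n. integral {0..real n} (\<lambda>x. exp (- (pi * c) * x\<^sup>2))) \<longlonglongrightarrow> 1 / (2 * sqrt c)"
proof -
  define s where "s = sqrt (pi * c)"
  have s: "s > 0" "s\<^sup>2 = pi * c" using assms by (auto simp: s_def)
  define f where "f x = indicator {0..} x *\<^sub>R exp (- (pi * c) * x\<^sup>2)" for x :: real
  have "has_bochner_integral lborel (\<lambda>x. indicator {0..} (0 + s * x) *\<^sub>R exp (- (0 + s * x)\<^sup>2)) ((sqrt pi / 2) /\<^sub>R \<bar>s\<bar>)"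
    using gaussian_moment_0 s(1) by (subst lborel_has_bochner_integral_real_affine_iff[symmetric]) auto
  moreover have "indicator {0..} (0 + s * x) *\<^sub>R exp (- (0 + s * x)\<^sup>2) = f x" for x
    using s by (auto simp: f_def indicator_def zero_le_mult_iff power_mult_distrib)
  moreover have "(sqrt pi / 2) /\<^sub>R \<bar>s\<bar> = 1 / (2 * sqrt c)"
    using s assms by (simp add: s_def real_sqrt_mult field_simps)
  ultimately have f: "has_bochner_integral lborel f (1 / (2 * sqrt c))" by (simp only:)
  have "((\<lambda>y. \<integral>x. indicator {..y} x *\<^sub>R f x \<partial>lborel) \<longlongrightarrow> (\<integral>x. f x \<partial>lborel)) at_top"
    by (rule tendsto_integral_at_top) (use f in \<open>auto simp: has_bochner_integral_iff\<close>)
  hence "(\<lambda>n. \<integral>x. indicator {..real n} x *\<^sub>R f x \<partial>lborel) \<longlonglongrightarrow> (\<integral>x. f x \<partial>lborel)"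
    by (rule filterlim_compose[OF _ filterlim_real_sequentially])
  moreover have "(\<integral>x. f x \<partial>lborel) = 1 / (2 * sqrt c)" using f by (simp add: has_bochner_integral_iff)
  moreover have "(\<integral>x. indicator {..real n} x *\<^sub>R f x \<partial>lborel) = integral {0..real n} (\<lambda>x. exp (- (pi * c) * x\<^sup>2))" for n
  proof -
    have "(\<integral>x. indicator {..real n} x *\<^sub>R f x \<partial>lborel) = (LINT x : {0..real n} | lborel. exp (- (pi * c) * x\<^sup>2))"
      unfolding set_lebesgue_integral_def by (rule Bochner_Integration.integral_cong) (auto simp: f_def indicator_def)
    also have "\<dots> = integral {0..real n} (\<lambda>x. exp (- (pi * c) * x\<^sup>2))"
      by (intro set_borel_integral_eq_integral borel_integrable_atLeastAtMost') (auto intro!: continuous_intros)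
    finally show ?thesis .
  qed
  ultimately show ?thesis by simp
qed

text \<open>Integral test: for the decreasing Gaussian the sum over 0..n exceeds the integral by a
  number between 0 and the central value 1. The full sum is twice the half sum minus the central
  term, so the error lies between -1 and 1. This crude asymptotics for small c is the analytic input
  of the inversion formula.\<close>

lemma gsum_small:
  assumes "c > 0"
  shows "\<bar>gsum 0 c - 1 / sqrt c\<bar> \<le> 1"
proof -
  let ?f = "\<lambda>x. exp (- (pi * c) * x\<^sup>2)"
  interpret antimono_fun_sum_integral_diff ?f
    by unfold_locales (use assms in \<open>auto intro!: continuous_intros mult_left_mono power_mono\<close>)
  have 1: "(\<lambda>n. 2 * (\<Sum>k\<le>n. ?f (real k)) - 1) \<longlonglongrightarrow> gsum 0 c"
    using symmetric_sum_tendsto[OF gsum_has_sum[OF assms, of 0]] by simp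
  have 2: "(\<lambda>n. 2 * integral {0..real n} ?f) \<longlonglongrightarrow> 2 * (1 / (2 * sqrt c))"
    by (intro tendsto_intros gaussian_integral_tendsto assms)
  have "(\<lambda>n. 2 * (\<Sum>k\<le>n. ?f (real k)) - 1 - 2 * integral {0..real n} ?f) \<longlonglongrightarrow> gsum 0 c - 2 * (1 / (2 * sqrt c))"
    by (rule tendsto_diff[OF 1 2])
  hence l: "(\<lambda>n. 2 * sum_integral_diff_series n - 1) \<longlonglongrightarrow> gsum 0 c - 1 / sqrt c"
    by (simp only: sum_integral_diff_series_def) (simp add: algebra_simps)
  have "sum_integral_diff_series n \<le> 1" for n
    using sum_integral_diff_series_antimono[of 0 n] by (simp only: sum_integral_diff_series_def) simp
  hence "gsum 0 c - 1 / sqrt c \<le> 1"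
    by (intro tendsto_upperbound[OF l]) (auto intro!: always_eventually)
  moreover have "gsum 0 c - 1 / sqrt c \<ge> -1"
  proof (intro tendsto_lowerbound[OF l] always_eventually allI)
    show "- 1 \<le> 2 * sum_integral_diff_series n - 1" for n
      using sum_integral_diff_series_nonneg[of n] by linarith
  qed simp
  ultimately show ?thesis by auto
qed

lemma gsum_scaled_limit:
  assumes y: "y > 0"
  shows "(\<lambda>n. gsum 0 (y / 2 ^ n) ^ 2 / 2 ^ n) \<longlonglongrightarrow> 1 / y"
proof -
  let ?c = "\<lambda>n. y / 2 ^ n"
  have c0: "?c \<longlonglongrightarrow> 0" by real_asymp
  hence s: "(\<lambda>n. sqrt (?c n)) \<longlonglongrightarrow> 0" using tendsto_real_sqrt by fastforce
  have "(\<lambda>n. sqrt (?c n) * gsum 0 (?c n)) \<longlonglongrightarrow> 1"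
  proof (rule LIM_zero_cancel, rule Lim_null_comparison[OF _ s], intro always_eventually allI)
    fix n
    have p: "?c n > 0" using y by simp
    have "\<bar>sqrt (?c n) * (gsum 0 (?c n) - 1 / sqrt (?c n))\<bar> \<le> sqrt (?c n) * 1"
      unfolding abs_mult using gsum_small[OF p] p by (intro mult_mono) auto
    moreover have "sqrt (?c n) * (1 / sqrt (?c n)) = 1" using y by simp
    ultimately show "norm (sqrt (?c n) * gsum 0 (?c n) - 1) \<le> sqrt (?c n)"
      by (simp add: right_diff_distrib)
  qed
  hence "(\<lambda>n. (sqrt (?c n) * gsum 0 (?c n)) ^ 2 / y) \<longlonglongrightarrow> 1 ^ 2 / y"
    using y by (intro tendsto_intros) auto
  moreover have "(sqrt (?c n) * gsum 0 (?c n)) ^ 2 / y = gsum 0 (?c n) ^ 2 / 2 ^ n" for n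
    using y by (simp add: power_mult_distrib)
  ultimately show ?thesis by simp
qed

fun agm :: "real \<Rightarrow> real \<Rightarrow> nat \<Rightarrow> real \<times> real" where
  "agm a b 0 = (a, b)"
| "agm a b (Suc n) = agm ((a + b) / 2) (sqrt (a * b)) n"

lemma agm_mono:
  "0 \<le> a \<Longrightarrow> 0 \<le> b \<Longrightarrow> a \<le> a' \<Longrightarrow> b \<le> b' \<Longrightarrow> fst (agm a b n) \<le> fst (agm a' b' n)"
proof (induction n arbitrary: a b a' b')
  case (Suc n)
  show ?case unfolding agm.simps
    using Suc.prems by (intro Suc.IH) (auto intro!: mult_mono divide_right_mono add_mono)
qed auto

lemma agm_scale: "0 \<le> c \<Longrightarrow> fst (agm (c * a) (c * b) n) = c * fst (agm a b n)"
proof (induction n arbitrary: a b)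
  case (Suc n)
  have "sqrt (c * a * (c * b)) = c * sqrt (a * b)"
    using Suc.prems by (simp add: real_sqrt_mult mult_ac)
  moreover have "(c * a + c * b) / 2 = c * ((a + b) / 2)" by (simp add: algebra_simps)
  ultimately show ?case unfolding agm.simps using Suc by (simp only:)
qed simp

text \<open>Monotonicity alone gives a weak inequality. After one step both means have grown at
  least by a common factor r > 1, and homogeneity carries this factor through all later steps into
  the limit.\<close>

lemma agm_limit_strict:
  assumes "0 < b" "b < b'" "0 < a" and l: "(\<lambda>n. fst (agm a b n)) \<longlonglongrightarrow> L" "(\<lambda>n. fst (agm a b' n)) \<longlonglongrightarrow> L'" and "L > 0"
  shows "L < L'"
proof -
  define r where "r = min ((a + b') / (a + b)) (sqrt (b' / b))"
  have r: "r > 1" using assms by (simp add: r_def)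
  have "r * ((a + b) / 2) \<le> (a + b') / 2"
  proof -
    have "r * (a + b) \<le> (a + b') / (a + b) * (a + b)" using assms by (intro mult_right_mono) (auto simp: r_def)
    thus ?thesis using assms by simp
  qed
  moreover have "r * sqrt (a * b) \<le> sqrt (a * b')"
  proof -
    have "r * sqrt (a * b) \<le> sqrt (b' / b) * sqrt (a * b)" using assms by (intro mult_right_mono) (auto simp: r_def)
    also have "\<dots> = sqrt (a * b')" using assms by (simp flip: real_sqrt_mult)
    finally show ?thesis .
  qed
  ultimately have "r * fst (agm a b (Suc n)) \<le> fst (agm a b' (Suc n))" for n
    using agm_mono[of "r * ((a + b) / 2)" "r * sqrt (a * b)" "(a + b') / 2" "sqrt (a * b')" n]
      agm_scale[of r "(a + b) / 2" "sqrt (a * b)" n] r assms by simp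
  hence "r * L \<le> L'"
    using LIMSEQ_Suc[OF l(1)] LIMSEQ_Suc[OF l(2)]
    by (intro LIMSEQ_le[of "\<lambda>n. r * fst (agm a b (Suc n))" _ "\<lambda>n. fst (agm a b' (Suc n))"] tendsto_intros) auto
  moreover have "r * L > 1 * L" using r \<open>L > 0\<close> by (intro mult_strict_right_mono)
  ultimately show ?thesis by simp
qed

text \<open>The arithmetic mean of theta_00^2 and theta_01^2 at i y is theta_00^2 at 2 i y, and
  their geometric mean is theta_01^2 there, so one step doubles y.\<close>

lemma agm_theta:
  assumes "y > 0"
  shows "agm (gsum 0 y ^ 2) (gsum_alt y ^ 2) n = (gsum 0 (2 ^ n * y) ^ 2, gsum_alt (2 ^ n * y) ^ 2)"
  using assms
proof (induction n arbitrary: y)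
  case (Suc n)
  have "(gsum 0 y ^ 2 + gsum_alt y ^ 2) / 2 = gsum 0 (2 * y) ^ 2" using gsum_double(1,2)[OF Suc.prems] by simp
  moreover have "(gsum_alt (2 * y) ^ 2)\<^sup>2 = gsum 0 y ^ 2 * gsum_alt y ^ 2"
    unfolding gsum_double(4)[OF Suc.prems, symmetric] by (rule power_mult_distrib)
  hence "sqrt (gsum 0 y ^ 2 * gsum_alt y ^ 2) = gsum_alt (2 * y) ^ 2"
    by (rule real_sqrt_unique) simp
  ultimately show ?case using Suc.IH[of "2 * y"] Suc.prems by (simp add: mult_ac)
qed simp

text \<open>For the pair with \<open>gsum 1\<close> a step goes the other way: y is halved and both
  means carry a factor 1/2, which homogeneity collects into 1 / 2^n.\<close>

lemma agm_theta':
  assumes "y > 0"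
  shows "fst (agm (gsum 0 y ^ 2) (gsum 1 y ^ 2) n) = gsum 0 (y / 2 ^ n) ^ 2 / 2 ^ n"
  using assms
proof (induction n arbitrary: y)
  case (Suc n)
  have p: "y / 2 > 0" using Suc.prems by simp
  have 1: "(gsum 0 y ^ 2 + gsum 1 y ^ 2) / 2 = (1/2) * gsum 0 (y / 2) ^ 2" using gsum_double(1)[OF p] by simp
  have "sqrt (gsum 0 y ^ 2 * gsum 1 y ^ 2) = gsum 0 y * gsum 1 y"
    using gsum_pos[OF Suc.prems] by (simp add: real_sqrt_mult less_imp_le)
  hence 2: "sqrt (gsum 0 y ^ 2 * gsum 1 y ^ 2) = (1/2) * gsum 1 (y / 2) ^ 2"
    using gsum_double(3)[OF p] by simp
  show ?case unfolding agm.simps 1 2 using Suc.IH[OF p] by (subst agm_scale) auto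
qed simp

text \<open>Put k = theta_10^2 / theta_00^2 and k' = theta_01^2 / theta_00^2, all at i t. The AGM of
  1 and k'(t) is 1 / theta_00^2, that of 1 and k(t) is 1 / (t theta_00^2), and k^2 + k'^2 = 1. If
  k(1/y) > k'(y), then k'(1/y) < k(y) as well, and strict monotonicity makes theta_00^2 at 1/y both
  smaller and larger than y times its value at y; the opposite case is symmetric. Hence k(1/y) =
  k'(y), and comparing the two AGM limits gives the formula.\<close>

lemma gsum_inverse:
  assumes y: "y > 0"
  shows "gsum 0 (1 / y) ^ 2 = y * gsum 0 y ^ 2" and "gsum 1 (1 / y) ^ 2 = y * gsum_alt y ^ 2"
proof -
  have agm1: "(\<lambda>n. fst (agm 1 (gsum_alt t ^ 2 / gsum 0 t ^ 2) n)) \<longlonglongrightarrow> 1 / gsum 0 t ^ 2"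
   and agm2: "(\<lambda>n. fst (agm 1 (gsum 1 t ^ 2 / gsum 0 t ^ 2) n)) \<longlonglongrightarrow> 1 / (t * gsum 0 t ^ 2)" if t: "t > 0" for t
  proof -
    have g: "gsum 0 t ^ 2 > 0" using gsum_pos[OF t, of 0] by simp
    have sc: "fst (agm 1 (v / gsum 0 t ^ 2) n) = fst (agm (gsum 0 t ^ 2) v n) / gsum 0 t ^ 2" for v n
      using agm_scale[of "1 / gsum 0 t ^ 2" "gsum 0 t ^ 2" v n] g by simp
    have "(\<lambda>n. gsum 0 (2 ^ n * t) ^ 2 / gsum 0 t ^ 2) \<longlonglongrightarrow> 1 ^ 2 / gsum 0 t ^ 2"
      using gsum_dsum_limit[OF t] g by (intro tendsto_intros) auto
    thus "(\<lambda>n. fst (agm 1 (gsum_alt t ^ 2 / gsum 0 t ^ 2) n)) \<longlonglongrightarrow> 1 / gsum 0 t ^ 2"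
      unfolding sc agm_theta[OF t] by simp
    have "(\<lambda>n. gsum 0 (t / 2 ^ n) ^ 2 / 2 ^ n / gsum 0 t ^ 2) \<longlonglongrightarrow> 1 / t / gsum 0 t ^ 2"
      by (intro tendsto_intros gsum_scaled_limit[OF t]) (use g in auto)
    thus "(\<lambda>n. fst (agm 1 (gsum 1 t ^ 2 / gsum 0 t ^ 2) n)) \<longlonglongrightarrow> 1 / (t * gsum 0 t ^ 2)"
      unfolding sc agm_theta'[OF t] by simp
  qed
  define k' where "k' t = gsum_alt t ^ 2 / gsum 0 t ^ 2" for t
  define k where "k t = gsum 1 t ^ 2 / gsum 0 t ^ 2" for t
  have kpos: "k t > 0" "k' t > 0" and kk: "k t ^ 2 + k' t ^ 2 = 1" if t: "t > 0" for t
  proof -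
    show "k t > 0" "k' t > 0" unfolding k_def k'_def using gsum_pos[OF t, of 0] gsum_pos[OF t, of 1] gsum_alt_pos[OF t] by simp_all
    have "(gsum 1 t ^ 2)\<^sup>2 + (gsum_alt t ^ 2)\<^sup>2 = (gsum 0 t ^ 2)\<^sup>2"
      unfolding gsum_double(1-3)[OF t] by (simp add: power2_eq_square algebra_simps)
    thus "k t ^ 2 + k' t ^ 2 = 1" unfolding k_def k'_def power_divide using gsum_pos[OF t, of 0]
      by (simp flip: add_divide_distrib)
  qed
  let ?y = "1 / y"
  have y': "?y > 0" using y by simp
  have g: "gsum 0 y ^ 2 > 0" "gsum 0 ?y ^ 2 > 0" using gsum_pos[OF y, of 0] gsum_pos[OF y', of 0] by auto
  note L = agm1[OF y, folded k'_def] agm2[OF y, folded k_def] agm1[OF y', folded k'_def] agm2[OF y', folded k_def]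
  have "\<not> k ?y > k' y"
  proof
    assume less: "k ?y > k' y"
    have "1 / gsum 0 y ^ 2 < 1 / (?y * gsum 0 ?y ^ 2)"
      by (rule agm_limit_strict[OF _ less _ L(1) L(4)]) (use kpos y g in auto)
    moreover have "k' ?y < k y"
    proof (rule power2_less_imp_less)
      have "k' y ^ 2 < k ?y ^ 2" using less kpos(2)[OF y] by (intro power_strict_mono) auto
      thus "k' ?y ^ 2 < k y ^ 2" using kk[OF y] kk[OF y'] by linarith
    qed (use kpos[OF y] in auto)
    hence "1 / gsum 0 ?y ^ 2 < 1 / (y * gsum 0 y ^ 2)"
      by (rule agm_limit_strict[OF _ _ _ L(3) L(2), rotated]) (use kpos(2)[OF y'] g in auto)
    ultimately show False using y g by (simp add: field_simps)
  qed
  moreover have "\<not> k ?y < k' y"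
  proof
    assume less: "k ?y < k' y"
    have "1 / (?y * gsum 0 ?y ^ 2) < 1 / gsum 0 y ^ 2"
      by (rule agm_limit_strict[OF _ less _ L(4) L(1)]) (use kpos(1)[OF y'] y g in auto)
    moreover have "k y < k' ?y"
    proof (rule power2_less_imp_less)
      have "k ?y ^ 2 < k' y ^ 2" using less kpos(1)[OF y'] by (intro power_strict_mono) auto
      thus "k y ^ 2 < k' ?y ^ 2" using kk[OF y] kk[OF y'] by linarith
    qed (use kpos[OF y'] in auto)
    hence "1 / (y * gsum 0 y ^ 2) < 1 / gsum 0 ?y ^ 2"
      by (rule agm_limit_strict[OF _ _ _ L(2) L(3), rotated]) (use kpos(1)[OF y] y g in auto)
    ultimately show False using y g by (simp add: field_simps)
  qed
  ultimately have eq: "k ?y = k' y" by simp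
  hence "1 / gsum 0 y ^ 2 = 1 / (?y * gsum 0 ?y ^ 2)" using L(1,4) LIMSEQ_unique by metis
  thus 1: "gsum 0 ?y ^ 2 = y * gsum 0 y ^ 2" using y g by (simp add: field_simps)
  have "gsum 1 ?y ^ 2 / (y * gsum 0 y ^ 2) = gsum_alt y ^ 2 / gsum 0 y ^ 2"
    using eq unfolding k_def k'_def 1 .
  thus "gsum 1 (1 / y) ^ 2 = y * gsum_alt y ^ 2" using y g by (simp add: field_simps)
qed

lemma theta_inversion_imaginary:
  assumes y: "y > 0"
  shows "gsum 0 (1 / y) = sqrt y * gsum 0 y" "gsum 1 (1 / y) = sqrt y * gsum_alt y" "gsum_alt (1 / y) = sqrt y * gsum 1 y"
proof -
  have *: "a = sqrt t * b" if "a\<^sup>2 = t * b\<^sup>2" "a > 0" "b > 0" "t > 0" for a b t :: real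
    by (rule power2_eq_imp_eq) (use that in \<open>auto simp: power_mult_distrib\<close>)
  have y': "1 / y > 0" using y by simp
  show "gsum 0 (1 / y) = sqrt y * gsum 0 y" "gsum 1 (1 / y) = sqrt y * gsum_alt y"
    using gsum_inverse[OF y] gsum_pos[OF y] gsum_pos[OF y'] gsum_alt_pos[OF y] y by (auto intro!: *)
  have "gsum 1 y ^ 2 = 1 / y * gsum_alt (1 / y) ^ 2" using gsum_inverse(2)[OF y'] by simp
  hence "gsum_alt (1 / y) ^ 2 = y * gsum 1 y ^ 2" using y by (simp add: field_simps)
  thus "gsum_alt (1 / y) = sqrt y * gsum 1 y"
    using gsum_pos[OF y] gsum_alt_pos[OF y'] y by (auto intro!: *)
qed

lemma upper_half_plane_iff [simp]: "z \<in> upper_half_plane \<longleftrightarrow> Im z > 0"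
  by (simp add: upper_half_plane_def)

lemma Im_minus_inverse: "Im (- 1 / z) = Im z / norm z ^ 2"
  by (simp add: Im_divide cmod_power2)

lemma eq_on_imaginary_axis:
  assumes "f holomorphic_on upper_half_plane" "g holomorphic_on upper_half_plane"
    and eq: "\<And>y. y > 0 \<Longrightarrow> f (\<i> * of_real y) = g (\<i> * of_real y)" and z: "Im z > 0"
  shows "f z = g z"
proof -
  have "(\<lambda>z. f z - g z) z = 0"
  proof (rule analytic_continuation[of "\<lambda>z. f z - g z" upper_half_plane "(\<lambda>n. \<i> * (1 + 1 / of_nat (Suc n))) ` UNIV" \<i>])
    show "\<i> islimpt (\<lambda>n. \<i> * (1 + 1 / of_nat (Suc n))) ` UNIV"
    proof -
      have "(\<lambda>n. \<i> * (1 + 1 / of_nat (Suc n))) \<longlonglongrightarrow> \<i> * (1 + 0)"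
        by (intro tendsto_intros LIMSEQ_Suc[OF lim_1_over_n])
      moreover have "\<i> * (1 + 1 / of_nat (Suc n)) \<noteq> \<i>" for n by (simp del: of_nat_Suc)
      ultimately show ?thesis unfolding islimpt_sequential
        by (intro exI[of _ "\<lambda>n. \<i> * (1 + 1 / of_nat (Suc n))"]) auto
    qed
    fix w assume "w \<in> (\<lambda>n. \<i> * (1 + 1 / of_nat (Suc n))) ` UNIV"
    then obtain n where "w = \<i> * (1 + 1 / of_nat (Suc n))" by blast
    hence "w = \<i> * of_real (1 + 1 / real (Suc n))" by simp
    thus "f w - g w = 0" using eq[of "1 + 1 / real (Suc n)"] by (simp del: of_nat_Suc add: add_pos_pos)
  next
    show "(\<lambda>n. \<i> * (1 + 1 / of_nat (Suc n))) ` UNIV \<subseteq> upper_half_plane"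
    proof safe
      fix n
      have "\<i> * (1 + 1 / of_nat (Suc n)) = \<i> * of_real (1 + 1 / real (Suc n))" by simp
      also have "Im \<dots> > 0" by (simp del: of_nat_Suc add: add_pos_pos)
      finally show "\<i> * (1 + 1 / of_nat (Suc n)) \<in> upper_half_plane" by simp
    qed
  qed (use assms z open_upper_half_plane connected_upper_half_plane in \<open>auto intro!: holomorphic_intros\<close>)
  thus ?thesis by simp
qed

text \<open>Both sides are holomorphic because - i z lies in the right half-plane, away from the
  branch cut; on the imaginary axis the root is the positive one of
  \<open>theta_inversion_imaginary\<close>.\<close>

theorem theta_inversion:
  assumes "Im z > 0"
  shows "theta 0 0 (- 1 / z) = csqrt (- \<i> * z) * theta 0 0 z"
    and "theta 1 0 (- 1 / z) = csqrt (- \<i> * z) * theta 0 1 z"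
    and "theta 0 1 (- 1 / z) = csqrt (- \<i> * z) * theta 1 0 z"
proof -
  have inv: "(\<lambda>z. - 1 / z) ` upper_half_plane \<subseteq> upper_half_plane"
  proof safe
    fix z assume "z \<in> upper_half_plane"
    moreover hence "z \<noteq> 0" by auto
    ultimately show "- 1 / z \<in> upper_half_plane" unfolding upper_half_plane_iff Im_minus_inverse by simp
  qed
  have h1: "(\<lambda>z. theta a b (- 1 / z)) holomorphic_on upper_half_plane" for a b
    by (rule holomorphic_on_compose_gen[OF _ theta_holomorphic inv, unfolded o_def]) (auto intro!: holomorphic_intros)
  have h2: "(\<lambda>z. csqrt (- \<i> * z) * theta a b z) holomorphic_on upper_half_plane" for a b
    by (intro holomorphic_intros theta_holomorphic) (auto simp: complex_nonpos_Reals_iff)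
  have c: "csqrt (- \<i> * (\<i> * of_real y)) = of_real (sqrt y)" if "y > 0" for y
    using that by (simp add: csqrt_of_real_nonneg flip: mult.assoc)
  have m: "- 1 / (\<i> * complex_of_real y) = \<i> * of_real (1 / y)" for y
    by (simp add: divide_inverse)
  show "theta 0 0 (- 1 / z) = csqrt (- \<i> * z) * theta 0 0 z"
    by (rule eq_on_imaginary_axis[OF h1 h2 _ assms], unfold c m)
       (simp add: theta_imaginary theta_inversion_imaginary del: of_real_divide)
  show "theta 1 0 (- 1 / z) = csqrt (- \<i> * z) * theta 0 1 z"
    by (rule eq_on_imaginary_axis[OF h1 h2 _ assms], unfold c m)
       (simp add: theta_imaginary theta01_imaginary theta_inversion_imaginary del: of_real_divide flip: One_nat_def)
  show "theta 0 1 (- 1 / z) = csqrt (- \<i> * z) * theta 1 0 z"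
    by (rule eq_on_imaginary_axis[OF h1 h2 _ assms], unfold c m)
       (simp add: theta_imaginary theta01_imaginary theta_inversion_imaginary del: of_real_divide flip: One_nat_def)
qed

section \<open>The modular group\<close>

text \<open>Group elements are carried as four integers rather than as matrices, so that congruences
  and inductions over generators remain plain arithmetic; \<open>mk\<close> and
  \<open>act_mob\<close> translate back.\<close>

definition mob :: "int \<Rightarrow> int \<Rightarrow> int \<Rightarrow> int \<Rightarrow> complex \<Rightarrow> complex" where
  "mob a b c d z = (of_int a * z + of_int b) / (of_int c * z + of_int d)"

lemma mob_denom_nonzero:
  assumes "a * d - b * c = 1" "Im z > 0"
  shows "of_int c * z + of_int d \<noteq> (0 :: complex)"
proof
  assume *: "of_int c * z + of_int d = (0 :: complex)"
  hence "Im (of_int c * z + of_int d) = 0" by simp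
  hence "c = 0" using assms(2) by simp
  with * assms(1) show False by auto
qed

lemma Im_mob:
  assumes "a * d - b * c = 1"
  shows "Im (mob a b c d z) = Im z / norm (of_int c * z + of_int d) ^ 2"
proof -
  have "real_of_int a * real_of_int d - real_of_int b * real_of_int c = 1"
    using assms by (metis of_int_1 of_int_diff of_int_mult)
  moreover have "(real_of_int a * Im z) * (real_of_int c * Re z + real_of_int d) - (real_of_int a * Re z + real_of_int b) * (real_of_int c * Im z)
      = Im z * (real_of_int a * real_of_int d - real_of_int b * real_of_int c)"
    by (simp add: algebra_simps)
  ultimately have "(real_of_int a * Im z) * (real_of_int c * Re z + real_of_int d) - (real_of_int a * Re z + real_of_int b) * (real_of_int c * Im z) = Im z"
    by simp
  thus ?thesis unfolding mob_def Im_divide cmod_power2 by simp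
qed

lemma Im_mob_pos:
  assumes "a * d - b * c = 1" "Im z > 0" shows "Im (mob a b c d z) > 0"
  using mob_denom_nonzero[OF assms] assms by (simp add: Im_mob)

lemma mob_id [simp]: "mob 1 0 0 1 z = z" by (simp add: mob_def)

text \<open>Left multiplication by T^n, by S and by the lower unipotent matrices with entry 4 or -4:
  the steps of the two induction rules below.\<close>

lemma mob_left:
  assumes "a * d - b * c = 1" "Im z > 0"
  shows "mob (a + n * c) (b + n * d) c d z = mob a b c d z + of_int n"
    and "mob (- c) (- d) a b z = - 1 / mob a b c d z"
    and "mob a b (c + 4 * a) (d + 4 * b) z = mob a b c d z / (4 * mob a b c d z + 1)"
    and "mob a b (c - 4 * a) (d - 4 * b) z = mob a b c d z / (1 - 4 * mob a b c d z)"
proof -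
  note nz = mob_denom_nonzero[OF assms]
  show "mob (a + n * c) (b + n * d) c d z = mob a b c d z + of_int n"
    using nz by (simp add: mob_def field_simps)
  show "mob (- c) (- d) a b z = - 1 / mob a b c d z"
    by (simp add: mob_def)
  have *: "(p / q) / (4 * (p / q) + 1) = p / (q + 4 * p)" "(p / q) / (1 - 4 * (p / q)) = p / (q - 4 * p)"
    if "q \<noteq> 0" for p q :: complex
  proof -
    have "4 * (p / q) + 1 = (q + 4 * p) / q" "1 - 4 * (p / q) = (q - 4 * p) / q"
      using that by (simp_all add: field_simps)
    thus "(p / q) / (4 * (p / q) + 1) = p / (q + 4 * p)" "(p / q) / (1 - 4 * (p / q)) = p / (q - 4 * p)"
      using that by simp_all
  qed
  show "mob a b (c + 4 * a) (d + 4 * b) z = mob a b c d z / (4 * mob a b c d z + 1)"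
    unfolding mob_def *(1)[OF nz] by (simp add: algebra_simps)
  show "mob a b (c - 4 * a) (d - 4 * b) z = mob a b c d z / (1 - 4 * mob a b c d z)"
    unfolding mob_def *(2)[OF nz] by (simp add: algebra_simps)
qed

lemma mob_mult:
  assumes "a' * d' - b' * c' = 1" "Im z > 0"
  shows "mob a b c d (mob a' b' c' d' z) = mob (a * a' + b * c') (a * b' + b * d') (c * a' + d * c') (c * b' + d * d') z"
proof -
  note nz = mob_denom_nonzero[OF assms]
  have *: "(p * (u / v) + q) / (r * (u / v) + s) = (p * u + q * v) / (r * u + s * v)" if "v \<noteq> 0" for p q r s u v :: complex
  proof -
    have "p * (u / v) + q = (p * u + q * v) / v" "r * (u / v) + s = (r * u + s * v) / v"
      using that by (simp_all add: field_simps)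
    thus ?thesis using that by simp
  qed
  show ?thesis unfolding mob_def *[OF nz] by (simp add: algebra_simps)
qed

lemma int_translate_induct:
  assumes T: "\<And>a b. P a b \<Longrightarrow> P (a + c) (b + d)" and T': "\<And>a b. P a b \<Longrightarrow> P (a - c) (b - d :: int)"
    and "P a b"
  shows "P (a + n * c) (b + n * d)"
proof (induction n rule: int_induct[of _ 0])
  case (step1 i)
  from T[OF step1(2)] show ?case by (simp add: algebra_simps)
next
  case (step2 i)
  from T'[OF step2(2)] show ?case by (simp add: algebra_simps)
qed (use assms in simp)

text \<open>Euclid's algorithm on the first column: a power of T replaces a by its remainder modulo
  c, and S exchanges the rows up to sign, so |c| drops. At c = 0 the matrix is a translation times 1
  or times -1 = S^2.\<close>

lemma sl2_induct [consumes 1, case_names id T T' S]: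
  assumes det: "a * d - b * c = (1::int)"
    and id: "P 1 0 0 1"
    and T: "\<And>a b c d. a * d - b * c = 1 \<Longrightarrow> P a b c d \<Longrightarrow> P (a + c) (b + d) c d"
    and T': "\<And>a b c d. a * d - b * c = 1 \<Longrightarrow> P a b c d \<Longrightarrow> P (a - c) (b - d) c d"
    and S: "\<And>a b c d. a * d - b * c = 1 \<Longrightarrow> P a b c d \<Longrightarrow> P (- c) (- d) a b"
  shows "P a b c d"
proof -
  define Q where "Q a b c d \<longleftrightarrow> a * d - b * c = 1 \<and> P a b c d" for a b c d
  have "Q (a + c) (b + d) c d" if "Q a b c d" for a b c d
  proof -
    have "(a + c) * d - (b + d) * c = 1" using that by (simp add: Q_def algebra_simps)
    with that T[of a d b c] show ?thesis by (simp add: Q_def)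
  qed
  moreover have "Q (a - c) (b - d) c d" if "Q a b c d" for a b c d
  proof -
    have "(a - c) * d - (b - d) * c = 1" using that by (simp add: Q_def algebra_simps)
    with that T'[of a d b c] show ?thesis by (simp add: Q_def)
  qed
  ultimately have QT: "Q (a + n * c) (b + n * d) c d" if "Q a b c d" for a b c d n
    using that by (rule int_translate_induct[where P = "\<lambda>a b. Q a b c d"])
  have QS: "Q (- c) (- d) a b" if "Q a b c d" for a b c d
    using that S by (auto simp: Q_def mult.commute)
  have Q1: "Q 1 0 0 1" using id by (simp add: Q_def)
  have "Q a b c d" using det
  proof (induction "nat \<bar>c\<bar>" arbitrary: a b c d rule: less_induct)
    case less
    show ?case
    proof (cases "c = 0")
      case True
      hence "a * d = 1" using less by simp
      hence "a = 1 \<and> d = 1 \<or> a = - 1 \<and> d = - 1" by (simp add: zmult_eq_1_iff)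
      thus ?thesis
      proof
        assume "a = 1 \<and> d = 1"
        thus ?thesis using QT[OF Q1, of b] True by simp
      next
        assume "a = - 1 \<and> d = - 1"
        thus ?thesis using QT[OF QS[OF QS[OF Q1]], of "- b"] True by simp
      qed
    next
      case False
      define r q where "r = a mod c" and "q = a div c"
      have a: "a = r + q * c" by (simp add: r_def q_def)
      have "\<bar>r\<bar> < \<bar>c\<bar>" unfolding r_def using False by (rule abs_mod_less)
      have "Q c d (- r) (- (b - q * d))"
        by (rule less(1)) (use \<open>\<bar>r\<bar> < \<bar>c\<bar>\<close> less(2) a in \<open>auto simp: algebra_simps\<close>)
      from QT[OF QS[OF this], of q] a show ?thesis by simp
    qed
  qed
  thus ?thesis by (simp add: Q_def)
qed

lemma exists_small_residue:
  assumes "c \<noteq> (0::int)" shows "\<exists>n. 2 * \<bar>a + n * c\<bar> \<le> \<bar>c\<bar>"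
proof -
  define m where "m = a mod \<bar>c\<bar>"
  define x where "x = - (a div \<bar>c\<bar>) * sgn c"
  have s: "sgn c * c = \<bar>c\<bar>" by (metis abs_sgn mult.commute)
  have "x * c = - (a div \<bar>c\<bar>) * \<bar>c\<bar>" unfolding x_def mult.assoc s ..
  hence x: "a + x * c = m" unfolding m_def by (simp add: minus_div_mult_eq_mod)
  have m: "0 \<le> m" "m < \<bar>c\<bar>" using assms by (auto simp: m_def)
  show ?thesis
  proof (cases "2 * m \<le> \<bar>c\<bar>")
    case True
    thus ?thesis using x m by (intro exI[of _ x]) simp
  next
    case False
    have "a + (x - sgn c) * c = m - \<bar>c\<bar>" using x s by (simp add: left_diff_distrib)
    thus ?thesis using False m by (intro exI[of _ "x - sgn c"]) simp
  qed
qed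

text \<open>Gamma_1(4) is generated by T and the lower unipotent matrix with entry 4. The descent
  alternates two divisions with least absolute remainder: |a'| <= |c| / 2, then |c'| <= 2
  |a'|.\<close>

lemma gamma14_induct [consumes 3, case_names id T T' U U']:
  assumes det: "a * d - b * c = (1::int)" and c: "c mod 4 = 0" and a: "a mod 4 = 1"
    and id: "P 1 0 0 1"
    and T: "\<And>a b c d. a * d - b * c = 1 \<Longrightarrow> c mod 4 = 0 \<Longrightarrow> a mod 4 = 1 \<Longrightarrow> P a b c d \<Longrightarrow> P (a + c) (b + d) c d"
    and T': "\<And>a b c d. a * d - b * c = 1 \<Longrightarrow> c mod 4 = 0 \<Longrightarrow> a mod 4 = 1 \<Longrightarrow> P a b c d \<Longrightarrow> P (a - c) (b - d) c d"
    and U: "\<And>a b c d. a * d - b * c = 1 \<Longrightarrow> c mod 4 = 0 \<Longrightarrow> a mod 4 = 1 \<Longrightarrow> P a b c d \<Longrightarrow> P a b (c + 4 * a) (d + 4 * b)"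
    and U': "\<And>a b c d. a * d - b * c = 1 \<Longrightarrow> c mod 4 = 0 \<Longrightarrow> a mod 4 = 1 \<Longrightarrow> P a b c d \<Longrightarrow> P a b (c - 4 * a) (d - 4 * b)"
  shows "P a b c d"
proof -
  define Q where "Q a b c d \<longleftrightarrow> a * d - b * c = 1 \<and> c mod 4 = 0 \<and> a mod 4 = 1 \<and> P a b c d" for a b c d
  have m: "(a + c) mod 4 = 1" "(a - c) mod 4 = 1" "(c + 4 * a) mod 4 = 0" "(c - 4 * a) mod 4 = 0"
    if "c mod 4 = 0" "a mod 4 = 1" for a c :: int using that by presburger+
  have "Q (a + c) (b + d) c d" if "Q a b c d" for a b c d
  proof -
    have "(a + c) * d - (b + d) * c = 1" using that by (simp add: Q_def algebra_simps)
    with that T[of a d b c] m[of c a] show ?thesis by (simp add: Q_def)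
  qed
  moreover have "Q (a - c) (b - d) c d" if "Q a b c d" for a b c d
  proof -
    have "(a - c) * d - (b - d) * c = 1" using that by (simp add: Q_def algebra_simps)
    with that T'[of a d b c] m[of c a] show ?thesis by (simp add: Q_def)
  qed
  ultimately have QT: "Q (a + n * c) (b + n * d) c d" if "Q a b c d" for a b c d n
    using that by (rule int_translate_induct[where P = "\<lambda>a b. Q a b c d"])
  have "Q a b (c + 4 * a) (d + 4 * b)" if "Q a b c d" for a b c d
  proof -
    have "a * (d + 4 * b) - b * (c + 4 * a) = 1" using that by (simp add: Q_def algebra_simps)
    with that U[of a d b c] m[of c a] show ?thesis by (simp add: Q_def)
  qed
  moreover have "Q a b (c - 4 * a) (d - 4 * b)" if "Q a b c d" for a b c d
  proof -
    have "a * (d - 4 * b) - b * (c - 4 * a) = 1" using that by (simp add: Q_def algebra_simps)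
    with that U'[of a d b c] m[of c a] show ?thesis by (simp add: Q_def)
  qed
  ultimately have QU: "Q a b (c + n * (4 * a)) (d + n * (4 * b))" if "Q a b c d" for a b c d n
    using that by (rule int_translate_induct[where P = "\<lambda>c d. Q a b c d"])
  have Q1: "Q 1 0 0 1" using id by (simp add: Q_def)
  have "Q a b c d" using det c a
  proof (induction "nat \<bar>c\<bar>" arbitrary: a b c d rule: less_induct)
    case less
    show ?case
    proof (cases "c = 0")
      case True
      hence "a * d = 1" using less by simp
      hence "a = 1 \<and> d = 1 \<or> a = - 1 \<and> d = - 1" by (simp add: zmult_eq_1_iff)
      hence "a = 1 \<and> d = 1" using less(4) by auto
      thus ?thesis using QT[OF Q1, of b] True by simp
    next
      case False
      obtain n where n: "2 * \<bar>a + n * c\<bar> \<le> \<bar>c\<bar>" using exists_small_residue[OF False] by blast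
      define a' b' where "a' = a + n * c" and "b' = b + n * d"
      have a'4: "a' mod 4 = 1"
        using less(3,4) unfolding a'_def by (metis mod_add_cong mod_mult_right_eq mult_zero_right mod_0 add_0_right mod_mod_trivial)
      \<comment> \<open>Equality is impossible: a' is odd, so 2 |a'| is 2 modulo 4, while c is
        divisible by 4. Strictness here is what makes |c| decrease.\<close>
      have a'c: "2 * \<bar>a'\<bar> < \<bar>c\<bar>"
      proof -
        have "2 * \<bar>a'\<bar> \<noteq> \<bar>c\<bar>" using a'4 less(3) by presburger
        with n show ?thesis by (simp add: a'_def)
      qed
      have "4 * a' \<noteq> 0" using a'4 by auto
      then obtain m where m: "2 * \<bar>c + m * (4 * a')\<bar> \<le> \<bar>4 * a'\<bar>" using exists_small_residue by blast
      define c' d' where "c' = c + m * (4 * a')" and "d' = d + m * (4 * b')"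
      have "c' mod 4 = 0" using less(3) unfolding c'_def mod_eq_0_iff_dvd by (intro dvd_add) auto
      have "Q a' b' c' d'"
      proof (rule less(1)[OF _ _ \<open>c' mod 4 = 0\<close> a'4])
        have "\<bar>4 * a'\<bar> = 4 * \<bar>a'\<bar>" by simp
        moreover have "2 * x \<le> y \<Longrightarrow> 2 * u < v \<Longrightarrow> y = 4 * u \<Longrightarrow> x < v" for x y u v :: int by linarith
        ultimately have "\<bar>c'\<bar> < \<bar>c\<bar>" using m a'c unfolding c'_def by blast
        thus "nat \<bar>c'\<bar> < nat \<bar>c\<bar>" by simp
        show "a' * d' - b' * c' = 1" using less(2) by (simp add: a'_def b'_def c'_def d'_def algebra_simps)
      qed
      from QT[OF QU[OF this, of "- m"], of "- n"] show ?thesis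
        by (simp add: a'_def b'_def c'_def d'_def)
    qed
  qed
  thus ?thesis by (simp add: Q_def)
qed

text \<open>After a translation |Re w| <= 1/2; if also Im w < 1/2, then |w|^2 <= 1/2 and inversion
  at least doubles the imaginary part. Aiming only at height 1/2 yields this fixed factor 2, hence
  the induction on n with 2^n Im z >= 1/2.\<close>

lemma upper_half_plane_reduction:
  assumes "Im z > 0"
  shows "\<exists>a b c d z'. a * d - b * c = 1 \<and> Im z' \<ge> 1 / 2 \<and> z = mob a b c d z'"
proof -
  obtain n :: nat where "1 / 2 / Im z < 2 ^ n" using real_arch_pow[of 2] by auto
  hence "2 ^ n * Im z \<ge> 1 / 2" using assms by (simp add: field_simps)
  thus ?thesis using assms
  proof (induction n arbitrary: z)
    case 0
    thus ?case by (intro exI[of _ 1] exI[of _ 0] exI[of _ z]) auto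
  next
    case (Suc n)
    show ?case
    proof (cases "Im z \<ge> 1 / 2")
      case True
      thus ?thesis by (intro exI[of _ 1] exI[of _ 0] exI[of _ z]) auto
    next
      case False
      define m where "m = round (Re z)"
      define w where "w = z - of_int m"
      have w: "Im w = Im z" "\<bar>Re w\<bar> \<le> 1 / 2"
        using of_int_round_abs_le[of "Re z"] by (auto simp: w_def m_def abs_minus_commute)
      have w0: "w \<noteq> 0" using w(1) Suc.prems by auto
      have "norm w ^ 2 = \<bar>Re w\<bar>\<^sup>2 + (Im w)\<^sup>2" by (simp add: cmod_power2)
      also have "\<dots> \<le> (1 / 2)\<^sup>2 + (1 / 2)\<^sup>2"
        using w False Suc.prems by (intro add_mono power_mono) auto
      finally have nw: "norm w ^ 2 \<le> 1 / 2" by (simp add: power2_eq_square)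
      have im: "Im (- 1 / w) = Im z / norm w ^ 2" unfolding Im_minus_inverse w ..
      have "Im z / norm w ^ 2 \<ge> Im z / (1 / 2)"
        using nw w w0 Suc.prems by (intro divide_left_mono) auto
      hence "Im (- 1 / w) \<ge> 2 * Im z" using im by simp
      hence "2 ^ n * Im (- 1 / w) \<ge> 2 ^ n * (2 * Im z)" by (intro mult_left_mono) auto
      hence "1 / 2 \<le> 2 ^ n * Im (- 1 / w)" using Suc.prems by simp
      moreover have "Im (- 1 / w) > 0" using im w w0 Suc.prems by simp
      ultimately obtain a b c d z' where M: "a * d - b * c = 1" "Im z' \<ge> 1 / 2" "- 1 / w = mob a b c d z'"
        using Suc.IH by blast
      have z': "Im z' > 0" using M(2) by linarith
      have "z = - 1 / (- 1 / w) + of_int m" using w0 by (simp add: w_def)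
      also have "\<dots> = mob (- c) (- d) a b z' + of_int m" unfolding M(3) mob_left(2)[OF M(1) z'] ..
      also have "\<dots> = mob (- c + m * a) (- d + m * b) a b z'"
        by (rule mob_left(1)[symmetric, OF _ z']) (use M(1) in \<open>simp add: mult.commute\<close>)
      finally have "z = mob (- c + m * a) (- d + m * b) a b z'" .
      moreover have "(- c + m * a) * b - (- d + m * b) * a = 1" using M(1) by (simp add: algebra_simps)
      ultimately show ?thesis using M(2)
        by (intro exI[of _ "- c + m * a"] exI[of _ "- d + m * b"] exI[of _ a] exI[of _ b] exI[of _ z']) blast
    qed
  qed
qed

section \<open>Invariant norms, bounds and non-vanishing of the theta functions\<close>

definition nnorm :: "(complex \<Rightarrow> complex) \<Rightarrow> complex \<Rightarrow> real" where
  "nnorm g z = norm (g z) * Im z powr (1 / 4)"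

definition thetas :: "(complex \<Rightarrow> complex) set" where
  "thetas = {theta 0 0, theta 0 1, theta 1 0}"

definition theta_prod :: "complex \<Rightarrow> complex" where
  "theta_prod z = theta 0 0 z * theta 0 1 z * theta 1 0 z"

lemma norm_csqrt: "norm (csqrt z) = sqrt (norm z)"
  by (metis norm_power norm_ge_zero power2_csqrt real_sqrt_unique)

lemma norm_zeta8: "norm (exp (of_real pi * \<i> / 4)) = 1"
  by (simp add: norm_exp_eq_Re)

lemma nnorm_add_one: "nnorm (theta 0 0) (z + 1) = nnorm (theta 0 1) z"
  "nnorm (theta 0 1) (z + 1) = nnorm (theta 0 0) z"
  "nnorm (theta 1 0) (z + 1) = nnorm (theta 1 0) z"
  unfolding nnorm_def theta_add_one norm_mult norm_zeta8 by simp_all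

lemma nnorm_inversion:
  assumes "Im z > 0"
  shows "nnorm (theta 0 0) (- 1 / z) = nnorm (theta 0 0) z"
    "nnorm (theta 1 0) (- 1 / z) = nnorm (theta 0 1) z"
    "nnorm (theta 0 1) (- 1 / z) = nnorm (theta 1 0) z"
proof -
  have z: "norm z > 0" using assms by auto
  have "Im (- 1 / z) powr (1 / 4) = Im z powr (1 / 4) / (norm z ^ 2) powr (1 / 4)"
    unfolding Im_minus_inverse using assms z by (simp add: powr_divide)
  moreover have "(norm z ^ 2) powr (1 / 4) = sqrt (norm z)"
    using z by (simp add: powr_powr powr_half_sqrt flip: powr_numeral)
  ultimately have *: "sqrt (norm z) * Im (- 1 / z) powr (1 / 4) = Im z powr (1 / 4)"
    using z by simp
  have n: "norm (csqrt (- \<i> * z)) = sqrt (norm z)" by (simp add: norm_csqrt norm_mult)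
  show "nnorm (theta 0 0) (- 1 / z) = nnorm (theta 0 0) z"
    "nnorm (theta 1 0) (- 1 / z) = nnorm (theta 0 1) z"
    "nnorm (theta 0 1) (- 1 / z) = nnorm (theta 1 0) z"
    unfolding nnorm_def theta_inversion[OF assms] norm_mult n *[symmetric] by simp_all
qed

text \<open>The generators permute the three theta functions up to factors which the norm of weight
  1/2 absorbs. So at every cusp each of them is as small or large as one of the three is at
  infinity.\<close>

lemma nnorm_thetas_sl2:
  assumes "a * d - b * c = 1" "f \<in> thetas"
  shows "\<exists>g\<in>thetas. \<forall>z. Im z > 0 \<longrightarrow> nnorm f (mob a b c d z) = nnorm g z"
proof -
  have "\<forall>f\<in>thetas. \<exists>g\<in>thetas. \<forall>z. Im z > 0 \<longrightarrow> nnorm f (mob a b c d z) = nnorm g z"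
    using assms(1)
  proof (induction rule: sl2_induct)
    case (T a b c d)
    have t: "\<forall>f\<in>thetas. \<exists>g\<in>thetas. \<forall>z. Im z > 0 \<longrightarrow> nnorm f (z + 1) = nnorm g z"
      by (auto simp: thetas_def nnorm_add_one simp del: One_nat_def)
    show ?case
    proof
      fix f assume "f \<in> thetas"
      then obtain g where g: "g \<in> thetas" "\<And>z. Im z > 0 \<Longrightarrow> nnorm f (z + 1) = nnorm g z" using t by blast
      then obtain h where h: "h \<in> thetas" "\<And>z. Im z > 0 \<Longrightarrow> nnorm g (mob a b c d z) = nnorm h z" using T by blast
      show "\<exists>g\<in>thetas. \<forall>z. Im z > 0 \<longrightarrow> nnorm f (mob (a + c) (b + d) c d z) = nnorm g z"
        using g h mob_left(1)[OF T(1), of _ 1] Im_mob_pos[OF T(1)] by (intro bexI[of _ h]) auto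
    qed
  next
    case (T' a b c d)
    have t: "\<forall>f\<in>thetas. \<exists>g\<in>thetas. \<forall>z. Im z > 0 \<longrightarrow> nnorm f (z - 1) = nnorm g z"
      using nnorm_add_one[of "z - 1" for z] by (auto simp: thetas_def simp del: One_nat_def)
    show ?case
    proof
      fix f assume "f \<in> thetas"
      then obtain g where g: "g \<in> thetas" "\<And>z. Im z > 0 \<Longrightarrow> nnorm f (z - 1) = nnorm g z" using t by blast
      then obtain h where h: "h \<in> thetas" "\<And>z. Im z > 0 \<Longrightarrow> nnorm g (mob a b c d z) = nnorm h z" using T' by blast
      show "\<exists>g\<in>thetas. \<forall>z. Im z > 0 \<longrightarrow> nnorm f (mob (a - c) (b - d) c d z) = nnorm g z"
        using g h mob_left(1)[OF T'(1), of _ "- 1"] Im_mob_pos[OF T'(1)] by (intro bexI[of _ h]) auto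
    qed
  next
    case (S a b c d)
    have t: "\<forall>f\<in>thetas. \<exists>g\<in>thetas. \<forall>z. Im z > 0 \<longrightarrow> nnorm f (- 1 / z) = nnorm g z"
      unfolding thetas_def using nnorm_inversion by blast
    show ?case
    proof
      fix f assume "f \<in> thetas"
      then obtain g where g: "g \<in> thetas" "\<And>z. Im z > 0 \<Longrightarrow> nnorm f (- 1 / z) = nnorm g z" using t by blast
      then obtain h where h: "h \<in> thetas" "\<And>z. Im z > 0 \<Longrightarrow> nnorm g (mob a b c d z) = nnorm h z" using S by blast
      show "\<exists>g\<in>thetas. \<forall>z. Im z > 0 \<longrightarrow> nnorm f (mob (- c) (- d) a b z) = nnorm g z"
        using g h mob_left(2)[OF S(1)] Im_mob_pos[OF S(1)] by (intro bexI[of _ h]) auto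
    qed
  qed auto
  with assms(2) show ?thesis by blast
qed

text \<open>A permutation of the factors leaves the product alone. It is twice the cube of the
  Dedekind eta function, of weight 3/2, hence the exponent 3/4.\<close>

lemma theta_prod_sl2:
  assumes "a * d - b * c = 1" "Im z > 0"
  shows "norm (theta_prod (mob a b c d z)) * Im (mob a b c d z) powr (3 / 4) = norm (theta_prod z) * Im z powr (3 / 4)"
proof -
  define p where "p z = nnorm (theta 0 0) z * nnorm (theta 0 1) z * nnorm (theta 1 0) z" for z
  have p: "p z = norm (theta_prod z) * Im z powr (3 / 4)" for z
  proof -
    have "Im z powr (3 / 4) = Im z powr (1 / 4) * Im z powr (1 / 4) * Im z powr (1 / 4)"
      by (simp flip: powr_add)
    thus ?thesis by (simp add: p_def nnorm_def theta_prod_def norm_mult mult_ac)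
  qed
  have Tp: "p (w + 1) = p w" for w unfolding p_def nnorm_add_one by (simp add: mult_ac)
  have Sp: "p (- 1 / w) = p w" if "Im w > 0" for w unfolding p_def nnorm_inversion[OF that] by (simp add: mult_ac)
  have "\<forall>z. Im z > 0 \<longrightarrow> p (mob a b c d z) = p z"
    using assms(1)
  proof (induction rule: sl2_induct)
    case (T a b c d)
    show ?case using T Tp mob_left(1)[OF T(1), of _ 1] by auto
  next
    case (T' a b c d)
    show ?case
    proof safe
      fix z assume "Im z > 0"
      thus "p (mob (a - c) (b - d) c d z) = p z"
        using T' Tp[of "mob a b c d z - 1"] mob_left(1)[OF T'(1), of _ "- 1"] by auto
    qed
  next
    case (S a b c d)
    show ?case using S Sp mob_left(2)[OF S(1)] Im_mob_pos[OF S(1)] by auto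
  qed auto
  thus ?thesis using assms(2) by (simp add: p)
qed

text \<open>Quadratic Taylor bounds of exp at 3/2 and 3. They are sharp enough to push the tail 2 r
  / (1 - r) below 1 at height 1/2, where r < 1/3, and to at most 2/7 at height 1, where r <=
  1/8.\<close>

lemma exp_pi_half_bound: "exp (- (pi / 2)) < 1 / 3" "exp (- pi) \<le> 1 / 8"
proof -
  have "3 < exp (3 / 2 :: real)" using exp_lower_Taylor_quadratic[of "3 / 2"] by (simp add: power2_eq_square)
  also have "\<dots> < exp (pi / 2)" using pi_gt3 by simp
  finally show "exp (- (pi / 2)) < 1 / 3" by (simp add: exp_minus field_simps)
  have "8 \<le> exp (3 :: real)" using exp_lower_Taylor_quadratic[of 3] by (simp add: power2_eq_square)
  also have "\<dots> < exp pi" using pi_gt3 by simp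
  finally show "exp (- pi) \<le> 1 / 8" by (simp add: exp_minus field_simps)
qed

lemma tail_bound_mono:
  assumes "exp (- (pi * y)) \<le> r" "r < (1::real)"
  shows "2 * exp (- (pi * y)) / (1 - exp (- (pi * y))) \<le> 2 * r / (1 - r)"
  using assms order_trans[OF exp_ge_zero assms(1)] by (intro frac_le) auto

lemma exp_quarter: "norm (exp (- (of_real pi * \<i> * z / 4))) = exp (pi * Im z / 4)"
  by (simp add: norm_exp_eq_Re)

lemma theta_near:
  assumes "Im z \<ge> 1 / 2"
  shows "norm (theta 0 b z - 1) < 1" "norm (theta 1 0 z * exp (- (of_real pi * \<i> * z / 4)) - 2) < 1"
proof -
  have "pi * Im z \<ge> pi * (1 / 2)" using assms by (intro mult_left_mono) auto
  hence "exp (- (pi * Im z)) \<le> exp (- (pi / 2))" by simp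
  hence "2 * exp (- (pi * Im z)) / (1 - exp (- (pi * Im z))) \<le> 2 * exp (- (pi / 2)) / (1 - exp (- (pi / 2)))"
    using exp_pi_half_bound by (intro tail_bound_mono) auto
  also have "\<dots> < 1" using exp_pi_half_bound(1) by (simp add: field_simps)
  finally have *: "2 * exp (- (pi * Im z)) / (1 - exp (- (pi * Im z))) < 1" .
  show "norm (theta 0 b z - 1) < 1" using theta0_near_one[of z b] assms * by linarith
  show "norm (theta 1 0 z * exp (- (of_real pi * \<i> * z / 4)) - 2) < 1"
    using theta10_near[of z] assms * by linarith
qed

lemma theta_near':
  assumes "Im z \<ge> 1"
  shows "norm (theta 0 b z - 1) \<le> 1 / 2" "norm (theta 1 0 z * exp (- (of_real pi * \<i> * z / 4)) - 2) \<le> 1 / 2"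
proof -
  have "pi * Im z \<ge> pi * 1" using assms by (intro mult_left_mono) auto
  hence "exp (- (pi * Im z)) \<le> exp (- pi)" by simp
  also have "\<dots> \<le> 1 / 8" by (rule exp_pi_half_bound)
  finally have *: "2 * exp (- (pi * Im z)) / (1 - exp (- (pi * Im z))) \<le> 2 * (1 / 8) / (1 - 1 / 8)"
    by (rule tail_bound_mono) auto
  show "norm (theta 0 b z - 1) \<le> 1 / 2" using theta0_near_one[of z b] assms * by auto
  show "norm (theta 1 0 z * exp (- (of_real pi * \<i> * z / 4)) - 2) \<le> 1 / 2"
    using theta10_near[of z] assms * by auto
qed

lemma thetas_bounded:
  assumes "Im z \<ge> 1 / 2" "f \<in> thetas"
  shows "norm (f z) \<le> 3"
proof -
  have "norm (theta 0 b z) \<le> 3" for b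
    using theta_near(1)[OF assms(1), of b] norm_triangle_ineq[of "theta 0 b z - 1" 1] by simp
  moreover have "norm (theta 1 0 z) \<le> 3"
  proof -
    have "norm (theta 1 0 z) * exp (pi * Im z / 4) \<le> 3"
      using theta_near(2)[OF assms(1)] norm_triangle_ineq[of "theta 1 0 z * exp (- (of_real pi * \<i> * z / 4)) - 2" 2]
      by (simp add: norm_mult exp_quarter)
    moreover have "exp (pi * Im z / 4) \<ge> 1" using assms by simp
    hence "norm (theta 1 0 z) * 1 \<le> norm (theta 1 0 z) * exp (pi * Im z / 4)" by (intro mult_left_mono) auto
    ultimately show ?thesis by linarith
  qed
  ultimately show ?thesis using assms(2) by (auto simp: thetas_def)
qed

lemma theta_prod_lower:
  assumes "Im z \<ge> 1"
  shows "norm (theta_prod z) \<ge> exp (- (pi * Im z / 4)) / 4"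
proof -
  have 0: "norm (theta 0 b z) \<ge> 1 / 2" for b
    using theta_near'(1)[OF assms, of b] norm_triangle_ineq[of "1 - theta 0 b z" "theta 0 b z"]
    by (simp add: norm_minus_commute)
  have "norm (theta 1 0 z) * exp (pi * Im z / 4) \<ge> 1"
    using theta_near'(2)[OF assms] norm_triangle_ineq[of "2 - theta 1 0 z * exp (- (of_real pi * \<i> * z / 4))" "theta 1 0 z * exp (- (of_real pi * \<i> * z / 4))"]
    by (simp add: norm_minus_commute norm_mult exp_quarter)
  hence 1: "norm (theta 1 0 z) \<ge> exp (- (pi * Im z / 4))" by (simp add: exp_minus field_simps)
  have "norm (theta_prod z) = norm (theta 0 0 z) * norm (theta 0 1 z) * norm (theta 1 0 z)"
    by (simp add: theta_prod_def norm_mult)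
  also have "\<dots> \<ge> 1 / 2 * (1 / 2) * exp (- (pi * Im z / 4))"
    using 0 1 by (intro mult_mono) auto
  finally show ?thesis by simp
qed

text \<open>The invariant norm reduces the claim to Im z >= 1/2, where the leading terms 1, 1 and 2
  dominate the tails. Absence of zeros is what later permits dividing by theta monomials.\<close>

lemma theta_prod_nonzero:
  assumes "Im z > 0" shows "theta_prod z \<noteq> 0"
proof -
  obtain a b c d z' where M: "a * d - b * c = 1" "Im z' \<ge> 1 / 2" "z = mob a b c d z'"
    using upper_half_plane_reduction[OF assms] by blast
  have "theta 0 b z' \<noteq> 0" for b using theta_near(1)[OF M(2), of b] by auto
  moreover have "theta 1 0 z' \<noteq> 0" using theta_near(2)[OF M(2)] by auto
  ultimately have "theta_prod z' \<noteq> 0" by (auto simp: theta_prod_def)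
  hence "norm (theta_prod z') * Im z' powr (3 / 4) \<noteq> 0" using M(2) by auto
  thus ?thesis using theta_prod_sl2[OF M(1), of z'] M by auto
qed

lemma theta_nonzero:
  assumes "Im z > 0" shows "theta 0 0 z \<noteq> 0" "theta 0 1 z \<noteq> 0" "theta 1 0 z \<noteq> 0"
  using theta_prod_nonzero[OF assms] by (auto simp: theta_prod_def)

section \<open>The functions of doubled argument and the transformation formulas on
  Gamma_1(4)\<close>

definition thX :: "complex \<Rightarrow> complex" where "thX z = theta 0 0 (2 * z)"
definition thY :: "complex \<Rightarrow> complex" where "thY z = theta 1 0 (2 * z)"

lemma theta_squares:
  assumes "Im z > 0"
  shows "theta 0 0 z ^ 2 = thX z ^ 2 + thY z ^ 2" "theta 0 1 z ^ 2 = thX z ^ 2 - thY z ^ 2"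
    "theta 1 0 z ^ 2 = 2 * thX z * thY z"
  unfolding thX_def thY_def using theta00_sq[OF assms] theta_double[OF assms] by auto

lemma theta_half:
  assumes "Im z > 0"
  shows "theta 0 0 (z / 2) = thX z + thY z" "theta 0 1 (z / 2) = thX z - thY z"
  unfolding thX_def thY_def using theta_split[of "z / 2"] assms by auto

lemma thX_nonzero: "Im z > 0 \<Longrightarrow> thX z \<noteq> 0"
  unfolding thX_def by (rule theta_nonzero) simp

lemma thY_nonzero: "Im z > 0 \<Longrightarrow> thY z \<noteq> 0"
  unfolding thY_def by (rule theta_nonzero) simp

lemma thX_holomorphic: "thX holomorphic_on upper_half_plane"
  unfolding thX_def by (rule holomorphic_on_compose_gen[OF _ theta_holomorphic, unfolded o_def]) (auto intro!: holomorphic_intros)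

lemma thY_holomorphic: "thY holomorphic_on upper_half_plane"
  unfolding thY_def by (rule holomorphic_on_compose_gen[OF _ theta_holomorphic, unfolded o_def]) (auto intro!: holomorphic_intros)

lemma zeta8_powers: "exp (of_real pi * \<i> / 4) ^ 2 = \<i>" "exp (of_real pi * \<i> / 4) ^ 4 = (-1 :: complex)"
proof -
  have "exp (of_real pi * \<i> / 4) ^ 2 = cis (pi / 2)"
    by (subst exp_of_nat_mult[symmetric]) (simp add: cis_conv_exp mult.commute)
  thus *: "exp (of_real pi * \<i> / 4) ^ 2 = \<i>" by simp
  have "exp (of_real pi * \<i> / 4) ^ 4 = (exp (of_real pi * \<i> / 4) ^ 2 :: complex) ^ 2" by (simp flip: power_mult)
  thus "exp (of_real pi * \<i> / 4) ^ 4 = (-1 :: complex)" unfolding * by simp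
qed

lemma thX_add_one: "thX (z + 1) = thX z"
proof -
  have "2 * (z + 1) = 2 * z + 1 + 1" by simp
  thus ?thesis unfolding thX_def by (simp only: theta_add_one)
qed

lemma thY_add_one: "thY (z + 1) = \<i> * thY z"
proof -
  have "2 * (z + 1) = 2 * z + 1 + 1" by simp
  thus ?thesis unfolding thY_def using zeta8_powers(1) 
    by (simp only: theta_add_one) (simp add: power2_eq_square flip: mult.assoc)
qed

lemma thX_inversion:
  assumes "Im z > 0"
  shows "thX (- 1 / z) = csqrt (- \<i> * z / 2) * (thX z + thY z)" "thY (- 1 / z) = csqrt (- \<i> * z / 2) * (thX z - thY z)"
proof -
  \<comment> \<open>Doubling before an inversion is halving after it, so the inversion formula ends
    at z / 2, which \<open>theta_half\<close> expresses through \<open>thX\<close> and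
    \<open>thY\<close> at z.\<close>
  have *: "2 * (- 1 / z) = - 1 / (z / 2)" by simp
  show "thX (- 1 / z) = csqrt (- \<i> * z / 2) * (thX z + thY z)" "thY (- 1 / z) = csqrt (- \<i> * z / 2) * (thX z - thY z)"
    unfolding thX_def[of "- 1 / z"] thY_def[of "- 1 / z"] *
    using theta_inversion[of "z / 2"] theta_half[OF assms] assms by simp_all
qed

lemma csqrt_half: "of_real (sqrt 2) * csqrt (z / 2) = csqrt z"
proof -
  have "csqrt z = of_real (sqrt 2) * csqrt (z / 2)"
  proof (rule csqrt_unique)
    have "(of_real (sqrt 2) :: complex)\<^sup>2 = 2" by (simp flip: of_real_power)
    thus "(of_real (sqrt 2) * csqrt (z / 2))\<^sup>2 = z" by (simp add: power_mult_distrib)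
    show "0 < Re (of_real (sqrt 2) * csqrt (z / 2)) \<or> Re (of_real (sqrt 2) * csqrt (z / 2)) = 0 \<and> 0 \<le> Im (of_real (sqrt 2) * csqrt (z / 2))"
      using csqrt_principal[of "z / 2"] by (auto simp del: csqrt.simps)
  qed
  thus ?thesis by simp
qed

lemma add_four: "theta 0 0 (z + 4) = theta 0 0 z" "theta 0 1 (z + 4) = theta 0 1 z" "theta 1 0 (z + 4) = - theta 1 0 z"
  "thX (z + 4) = thX z" "thY (z + 4) = thY z"
proof -
  have e: "z + 4 = z + 1 + 1 + 1 + 1" by simp
  have "exp (of_real pi * \<i> / 4) ^ 4 * theta 1 0 z = - theta 1 0 z" unfolding zeta8_powers by simp
  thus "theta 1 0 (z + 4) = - theta 1 0 z" unfolding e by (simp only: theta_add_one power4_eq_xxxx mult.assoc)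
  show "theta 0 0 (z + 4) = theta 0 0 z" "theta 0 1 (z + 4) = theta 0 1 z" "thX (z + 4) = thX z"
    unfolding e by (simp_all only: theta_add_one thX_add_one)
  show "thY (z + 4) = thY z" unfolding e by (simp only: thY_add_one) simp
qed

text \<open>The map is a conjugate of a translation by -4: two inversions, through w = -1/z - 4 and
  -1/w. The product J of the two root factors is described by its square only, so no branch is
  tracked. The same J serves \<open>thX\<close>, \<open>thY\<close> and the theta functions because
  csqrt(-i w) csqrt(-i z) is twice the product of the roots of the halved arguments. The minus sign
  stems from \<open>theta 1 0 (w + 4) = - theta 1 0 w\<close>.\<close>

lemma theta_lower_unipotent:
  assumes z: "Im z > 0"
  shows "\<exists>J. J ^ 2 = 4 * z + 1 \<and> thX (z / (4 * z + 1)) = J * thX z \<and> thY (z / (4 * z + 1)) = J * thY z \<and>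
    theta 0 0 (z / (4 * z + 1)) = J * theta 0 0 z \<and> theta 1 0 (z / (4 * z + 1)) = J * theta 1 0 z \<and>
    theta 0 1 (z / (4 * z + 1)) = - J * theta 0 1 z"
proof -
  define w where "w = - 1 / z - 4"
  have z0: "z \<noteq> 0" and n0: "4 * z + 1 \<noteq> 0" using z by (auto simp: complex_eq_iff)
  have w4: "w + 4 = - 1 / z" by (simp add: w_def)
  have w: "Im w > 0" unfolding w_def using Im_minus_inverse[of z] z z0 by simp
  have "w = - ((4 * z + 1) / z)" using z0 by (simp add: w_def field_simps)
  hence u: "z / (4 * z + 1) = - 1 / w" by simp
  define s where "s = csqrt (- \<i> * w / 2) * csqrt (- \<i> * z / 2)"
  have s: "csqrt (- \<i> * w) * csqrt (- \<i> * z) = 2 * s"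
  proof -
    have "(of_real (sqrt 2) :: complex) * of_real (sqrt 2) = 2" by (simp flip: of_real_mult)
    thus ?thesis unfolding s_def csqrt_half[symmetric, of "- \<i> * w"] csqrt_half[symmetric, of "- \<i> * z"] by simp
  qed
  have sw: "thX w = csqrt (- \<i> * z / 2) * (thX z + thY z)" "thY w = csqrt (- \<i> * z / 2) * (thX z - thY z)"
    using thX_inversion[OF z] add_four(4,5)[of w] unfolding w4 by simp_all
  have tw: "theta 0 0 w = csqrt (- \<i> * z) * theta 0 0 z" "theta 0 1 w = csqrt (- \<i> * z) * theta 1 0 z"
    "theta 1 0 w = - csqrt (- \<i> * z) * theta 0 1 z"
    using theta_inversion[OF z] add_four(1-3)[of w] unfolding w4 by simp_all
  have "(2 * s)\<^sup>2 = 4 * ((- \<i> * w / 2) * (- \<i> * z / 2))" by (simp add: s_def power_mult_distrib)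
  also have "\<dots> = - (w * z)" by (simp add: algebra_simps)
  also have "\<dots> = 4 * z + 1" using z0 by (simp add: w_def field_simps)
  finally have "(2 * s)\<^sup>2 = 4 * z + 1" .
  moreover have "thX (z / (4 * z + 1)) = 2 * s * thX z" "thY (z / (4 * z + 1)) = 2 * s * thY z"
    unfolding u thX_inversion[OF w] sw s_def by (simp_all add: algebra_simps)
  moreover have "theta 0 0 (z / (4 * z + 1)) = 2 * s * theta 0 0 z" "theta 1 0 (z / (4 * z + 1)) = 2 * s * theta 1 0 z"
    "theta 0 1 (z / (4 * z + 1)) = - (2 * s) * theta 0 1 z"
    unfolding u theta_inversion[OF w] tw s[symmetric] by (simp_all add: mult_ac)
  ultimately show ?thesis by blast
qed

lemma powi_periodic:
  fixes w :: complex
  assumes "w ^ n = 1" "n > 0" "k mod int n = l mod int n"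
  shows "w powi k = w powi l"
proof -
  have w: "w \<noteq> 0" using assms by (auto simp: power_0_left)
  obtain q where "k = l + int n * q" using assms(3) by (metis mod_eqE mult.commute add.commute mod_eq_dvd_iff dvd_def diff_add_cancel)
  moreover have "w powi (int n * q) = 1" by (simp add: power_int_mult assms)
  ultimately show ?thesis using w by (simp add: power_int_add)
qed

abbreviation sg :: "int \<Rightarrow> complex" where "sg n \<equiv> (if even n then 1 else - 1)"

lemma gamma14_mod:
  assumes "a * d - b * c = (1::int)" "c mod 4 = 0" "a mod 4 = 1"
  shows "d mod 4 = 1" "odd a" "odd d"
proof -
  define m n where "m = a div 4" and "n = c div 4"
  have ac: "a = 4 * m + 1" "c = 4 * n" using assms by (auto simp: m_def n_def) presburger
  have "d = 1 + 4 * (b * n - m * d)" using assms(1) unfolding ac by (simp add: algebra_simps)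
  hence "d mod 4 = (1 + 4 * (b * n - m * d)) mod 4" by (rule arg_cong)
  thus "d mod 4 = 1" by (simp only: mod_mult_self2) simp
  thus "odd d" by presburger
  show "odd a" using assms(3) by presburger
qed

text \<open>One J serves all five functions, namely the root of c z + d that belongs to
  \<open>thX\<close>; odd b exchanges \<open>theta 0 0\<close> and \<open>theta 0 1\<close>. The
  exponent b d + d - 1 is compatible with the generators because d^2 is 1 modulo 8 (step T) and b^2
  + b is even (step U).\<close>

lemma theta_gamma14:
  assumes "a * d - b * c = (1::int)" "c mod 4 = 0" "a mod 4 = 1" "Im z > 0"
  shows "\<exists>J. J ^ 2 = of_int c * z + of_int d \<and> thX (mob a b c d z) = J * thX z \<and>
    thY (mob a b c d z) = J * \<i> powi b * thY z \<and>
    theta 1 0 (mob a b c d z) = J * exp (of_real pi * \<i> / 4) powi (b * d + d - 1) * theta 1 0 z \<and>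
    theta 0 0 (mob a b c d z) = J * sg ((d - 1) div 4 + b * (c div 4)) * (if even b then theta 0 0 z else theta 0 1 z) \<and>
    theta 0 1 (mob a b c d z) = J * sg ((d - 1) div 4 + b * (c div 4) + c div 4) * (if even b then theta 0 1 z else theta 0 0 z)"
    (is "\<exists>J. ?P J a b c d z")
proof -
  let ?z8 = "exp (of_real pi * \<i> / 4) :: complex"
  have z8: "?z8 ^ 8 = 1" using zeta8_powers(2) by (metis power_mult mult_2_right numeral_Bit0 power2_minus power_one power2_eq_square power_add)
  have i4: "\<i> ^ 4 = (1::complex)" by simp
  have step_T: "\<exists>J. ?P J (a + c) (b + d) c d z"
    if M: "a * d - b * c = 1" "c mod 4 = 0" "a mod 4 = 1" and z: "Im z > 0" and IH: "\<exists>J. ?P J a b c d z" for a b c d z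
  proof -
    obtain J where J: "?P J a b c d z" using IH by blast
    note dm = gamma14_mod[OF M]
    have e: "mob (a + c) (b + d) c d z = mob a b c d z + 1" using mob_left(1)[OF M(1) z, of 1] by simp
    have "\<i> powi (b + d) = \<i> powi b * \<i>"
      using powi_periodic[OF i4, of d 1] dm by (simp add: power_int_add)
    moreover have "?z8 powi ((b + d) * d + d - 1) = ?z8 powi (b * d + d - 1) * ?z8"
    proof -
      have "(d * d) mod 8 = 1"
      proof -
        obtain k where k: "d = 4 * k + 1" using dm(1) by (metis mult_div_mod_eq)
        have "d * d = 1 + 8 * (2 * k * k + k)" unfolding k by (simp add: algebra_simps)
        thus ?thesis by (simp only: mod_mult_self2) simp
      qed
      hence "?z8 powi (d * d) = ?z8 powi 1" using powi_periodic[OF z8, of "d * d" 1] by simp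
      moreover have "(b + d) * d + d - 1 = (b * d + d - 1) + d * d" by (simp add: algebra_simps)
      ultimately show ?thesis by (simp only: power_int_add exp_not_eq_zero simp_thms power_int_1_right)
    qed
    moreover have "even ((d - 1) div 4 + (b + d) * (c div 4)) = even ((d - 1) div 4 + b * (c div 4) + c div 4)"
      "even (b + d) = odd b" using dm by (auto simp: distrib_right)
    ultimately have "?P J (a + c) (b + d) c d z"
      using J unfolding e thX_add_one thY_add_one theta_add_one by (auto simp: distrib_right dm simp del: One_nat_def)
    thus ?thesis by blast
  qed
  have step_U: "\<exists>J. ?P J a b (c + 4 * a) (d + 4 * b) z"
    if M: "a * d - b * c = 1" "c mod 4 = 0" "a mod 4 = 1" and z: "Im z > 0" and IH: "\<exists>J. ?P J a b c d z" for a b c d z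
  proof -
    obtain J where J: "?P J a b c d z" using IH by blast
    note dm = gamma14_mod[OF M]
    let ?w = "mob a b c d z"
    have w: "Im ?w > 0" using Im_mob_pos[OF M(1) z] .
    obtain L where L: "L ^ 2 = 4 * ?w + 1" "thX (?w / (4 * ?w + 1)) = L * thX ?w" "thY (?w / (4 * ?w + 1)) = L * thY ?w"
      "theta 0 0 (?w / (4 * ?w + 1)) = L * theta 0 0 ?w" "theta 1 0 (?w / (4 * ?w + 1)) = L * theta 1 0 ?w"
      "theta 0 1 (?w / (4 * ?w + 1)) = - L * theta 0 1 ?w" using theta_lower_unipotent[OF w] by blast
    note e = mob_left(3)[OF M(1) z]
    have nz: "of_int c * z + of_int d \<noteq> 0" by (rule mob_denom_nonzero[OF M(1) z])
    have "(L * J) ^ 2 = (4 * ?w + 1) * (of_int c * z + of_int d)" using L J by (simp add: power_mult_distrib)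
    also have "\<dots> = of_int (c + 4 * a) * z + of_int (d + 4 * b)"
    proof -
      have h: "(4 * (p / q) + 1) * q = 4 * p + q" if "q \<noteq> 0" for p q :: complex using that by (simp add: field_simps)
      show ?thesis unfolding mob_def h[OF nz] by (simp add: algebra_simps)
    qed
    finally have "(L * J) ^ 2 = of_int (c + 4 * a) * z + of_int (d + 4 * b)" .
    moreover have "?z8 powi (b * (d + 4 * b) + (d + 4 * b) - 1) = ?z8 powi (b * d + d - 1)"
    proof (rule powi_periodic[OF z8])
      have "even (b * b + b)" by simp
      then obtain k where "b * b + b = 2 * k" by blast
      hence "b * (d + 4 * b) + (d + 4 * b) - 1 = (b * d + d - 1) + 8 * k" by (simp add: algebra_simps)
      thus "(b * (d + 4 * b) + (d + 4 * b) - 1) mod int 8 = (b * d + d - 1) mod int 8" by (metis mod_mult_self2 of_nat_numeral)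
    qed simp
    moreover have "(d + 4 * b - 1) div 4 = (d - 1) div 4 + b" "(c + 4 * a) div 4 = c div 4 + a" by presburger+
    ultimately have "?P (L * J) a b (c + 4 * a) (d + 4 * b) z"
      using J L(2-6) dm unfolding e by (simp add: algebra_simps del: One_nat_def)
    thus ?thesis by blast
  qed
  have step_T4: "\<exists>J. ?P J (a - c) (b - d) c d z"
    if M: "a * d - b * c = 1" "c mod 4 = 0" "a mod 4 = 1" and z: "Im z > 0" and IH: "\<exists>J. ?P J a b c d z" for a b c d z
  proof -
    obtain J where J: "?P J a b c d z" using IH by blast
    note dm = gamma14_mod[OF M]
    \<comment> \<open>The old point is the translate of the new one, so the translation formulas are
      read backwards.\<close>
    have "mob (a - c) (b - d) c d z = mob a b c d z + of_int (- 1)" using mob_left(1)[OF M(1) z, of "- 1"] by simp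
    hence e: "mob a b c d z = mob (a - c) (b - d) c d z + 1" by simp
    have "\<i> powi b = \<i> powi (b - d) * \<i>"
      using powi_periodic[OF i4, of d 1] dm power_int_add[of \<i> "b - d" d] by simp
    moreover have "?z8 powi (b * d + d - 1) = ?z8 powi ((b - d) * d + d - 1) * ?z8"
    proof -
      have "(d * d) mod 8 = 1"
      proof -
        obtain k where k: "d = 4 * k + 1" using dm(1) by (metis mult_div_mod_eq)
        have "d * d = 1 + 8 * (2 * k * k + k)" unfolding k by (simp add: algebra_simps)
        thus ?thesis by (simp only: mod_mult_self2) simp
      qed
      hence "?z8 powi (d * d) = ?z8 powi 1" using powi_periodic[OF z8, of "d * d" 1] by simp
      moreover have "b * d + d - 1 = ((b - d) * d + d - 1) + d * d" by (simp add: algebra_simps)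
      ultimately show ?thesis by (simp only: power_int_add exp_not_eq_zero simp_thms power_int_1_right)
    qed
    moreover have "even ((d - 1) div 4 + (b - d) * (c div 4)) = even ((d - 1) div 4 + b * (c div 4) + c div 4)"
      "even ((d - 1) div 4 + (b - d) * (c div 4) + c div 4) = even ((d - 1) div 4 + b * (c div 4))"
      "even (b - d) = odd b" using dm by (auto simp: left_diff_distrib)
    ultimately have "?P J (a - c) (b - d) c d z"
      using J unfolding e thX_add_one thY_add_one theta_add_one by (auto simp: dm simp del: One_nat_def)
    thus ?thesis by blast
  qed
  have step_U4: "\<exists>J. ?P J a b (c - 4 * a) (d - 4 * b) z"
    if M: "a * d - b * c = 1" "c mod 4 = 0" "a mod 4 = 1" and z: "Im z > 0" and IH: "\<exists>J. ?P J a b c d z" for a b c d z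
  proof -
    obtain J where J: "?P J a b c d z" using IH by blast
    note dm = gamma14_mod[OF M]
    have M': "a * (d - 4 * b) - b * (c - 4 * a) = 1" using M(1) by (simp add: algebra_simps)
    let ?w = "mob a b (c - 4 * a) (d - 4 * b) z"
    have w: "Im ?w > 0" using Im_mob_pos[OF M' z] .
    \<comment> \<open>The unipotent formula is applied at the new point \<open>?w\<close>, whose
      image is the old one; the new factor is therefore \<open>J / L\<close>.\<close>
    obtain L where L: "L ^ 2 = 4 * ?w + 1" "thX (?w / (4 * ?w + 1)) = L * thX ?w" "thY (?w / (4 * ?w + 1)) = L * thY ?w"
      "theta 0 0 (?w / (4 * ?w + 1)) = L * theta 0 0 ?w" "theta 1 0 (?w / (4 * ?w + 1)) = L * theta 1 0 ?w"
      "theta 0 1 (?w / (4 * ?w + 1)) = - L * theta 0 1 ?w" using theta_lower_unipotent[OF w] by blast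
    have e: "?w / (4 * ?w + 1) = mob a b c d z" using mob_left(3)[OF M' z] by simp
    have nz: "of_int (c - 4 * a) * z + of_int (d - 4 * b) \<noteq> 0" by (rule mob_denom_nonzero[OF M' z])
    have nz2: "of_int c * z + of_int d \<noteq> 0" by (rule mob_denom_nonzero[OF M(1) z])
    have L2: "L ^ 2 * (of_int (c - 4 * a) * z + of_int (d - 4 * b)) = of_int c * z + of_int d"
    proof -
      have h: "(4 * (p / q) + 1) * q = 4 * p + q" if "q \<noteq> 0" for p q :: complex using that by (simp add: field_simps)
      show ?thesis unfolding L(1) mob_def h[OF nz] by (simp add: algebra_simps)
    qed
    hence L0: "L \<noteq> 0" using nz2 by auto
    have "(J / L) ^ 2 = of_int (c - 4 * a) * z + of_int (d - 4 * b)"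
      using J L0 L2 by (simp add: power_divide field_simps)
    moreover have "?z8 powi (b * (d - 4 * b) + (d - 4 * b) - 1) = ?z8 powi (b * d + d - 1)"
    proof (rule powi_periodic[OF z8])
      have "even (b * b + b)" by simp
      then obtain k where "b * b + b = 2 * k" by blast
      hence "b * (d - 4 * b) + (d - 4 * b) - 1 = (b * d + d - 1) + 8 * (- k)" by (simp add: algebra_simps)
      thus "(b * (d - 4 * b) + (d - 4 * b) - 1) mod int 8 = (b * d + d - 1) mod int 8" by (metis mod_mult_self2 of_nat_numeral)
    qed simp
    moreover have dv: "(d - 4 * b - 1) div 4 = (d - 1) div 4 - b" "(c - 4 * a) div 4 = c div 4 - a" by presburger+
    have "even ((d - 1) div 4 - b + b * (c div 4 - a)) = even ((d - 1) div 4 + b * (c div 4))"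
      "even ((d - 1) div 4 - b + b * (c div 4 - a) + (c div 4 - a)) = odd ((d - 1) div 4 + b * (c div 4) + c div 4)"
      using dm by (simp_all add: right_diff_distrib) blast+
    hence "sg ((d - 4 * b - 1) div 4 + b * ((c - 4 * a) div 4)) = sg ((d - 1) div 4 + b * (c div 4))"
      "sg ((d - 4 * b - 1) div 4 + b * ((c - 4 * a) div 4) + (c - 4 * a) div 4) = - sg ((d - 1) div 4 + b * (c div 4) + c div 4)"
      unfolding dv by simp_all
    moreover have "thX ?w = J / L * thX z" "thY ?w = J / L * \<i> powi b * thY z"
      "theta 1 0 ?w = J / L * ?z8 powi (b * d + d - 1) * theta 1 0 z"
      "theta 0 0 ?w = J / L * sg ((d - 1) div 4 + b * (c div 4)) * (if even b then theta 0 0 z else theta 0 1 z)"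
      "theta 0 1 ?w = J / L * - sg ((d - 1) div 4 + b * (c div 4) + c div 4) * (if even b then theta 0 1 z else theta 0 0 z)"
    proof -
      have dv: "u = J / L * s * t" if "L * u = J * s * t" for u s t
        using that L0 by (simp add: field_simps)
      have "L * thX ?w = J * 1 * thX z" using J L(2) unfolding e by simp
      from dv[OF this] show "thX ?w = J / L * thX z" by simp
      have "L * thY ?w = J * \<i> powi b * thY z" using J L(3) unfolding e by simp
      from dv[OF this] show "thY ?w = J / L * \<i> powi b * thY z" .
      have "L * theta 1 0 ?w = J * ?z8 powi (b * d + d - 1) * theta 1 0 z" using J L(5) unfolding e by simp
      from dv[OF this] show "theta 1 0 ?w = J / L * ?z8 powi (b * d + d - 1) * theta 1 0 z" .
      have "L * theta 0 0 ?w = J * sg ((d - 1) div 4 + b * (c div 4)) * (if even b then theta 0 0 z else theta 0 1 z)"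
        using J L(4) unfolding e by metis
      from dv[OF this] show "theta 0 0 ?w = J / L * sg ((d - 1) div 4 + b * (c div 4)) * (if even b then theta 0 0 z else theta 0 1 z)" .
      have "- (L * theta 0 1 ?w) = J * sg ((d - 1) div 4 + b * (c div 4) + c div 4) * (if even b then theta 0 1 z else theta 0 0 z)"
        using J L(6) unfolding e by (metis mult_minus_left)
      hence "L * theta 0 1 ?w = J * (- sg ((d - 1) div 4 + b * (c div 4) + c div 4)) * (if even b then theta 0 1 z else theta 0 0 z)"
        by (metis minus_minus mult_minus_left mult_minus_right)
      from dv[OF this] show "theta 0 1 ?w = J / L * - sg ((d - 1) div 4 + b * (c div 4) + c div 4) * (if even b then theta 0 1 z else theta 0 0 z)" .
    qed
    ultimately have "?P (J / L) a b (c - 4 * a) (d - 4 * b) z"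
      by presburger
    thus ?thesis by blast
  qed
  have "\<forall>z. Im z > 0 \<longrightarrow> (\<exists>J. ?P J a b c d z)"
    using assms(1-3)
  proof (induction rule: gamma14_induct)
    case id
    show ?case
    proof safe
      fix z assume "Im z > 0"
      have "?P 1 1 0 0 1 z" by (simp del: One_nat_def)
      thus "\<exists>J. ?P J 1 0 0 1 z" by blast
    qed
  next
    case (T a b c d)
    show ?case using step_T[OF T(1-3)] T(4) by blast
  next
    case (T' a b c d)
    show ?case using step_T4[OF T'(1-3)] T'(4) by blast
  next
    case (U a b c d)
    show ?case using step_U[OF U(1-3)] U(4) by blast
  next
    case (U' a b c d)
    show ?case using step_U4[OF U'(1-3)] U'(4) by blast
  qed
  thus ?thesis using assms(4) by blast
qed

section \<open>Modular forms of one variable\<close>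

definition gamma4 :: "int \<Rightarrow> int \<Rightarrow> int \<Rightarrow> int \<Rightarrow> bool" where
  "gamma4 a b c d \<longleftrightarrow> a * d - b * c = 1 \<and> a mod 4 = 1 \<and> b mod 4 = 0 \<and> c mod 4 = 0 \<and> d mod 4 = 1"

text \<open>A square root of c z + d normalised by \<open>thX\<close> instead of by a branch. As a
  quotient of values of a function without zeros it obeys the cocycle rule automatically.\<close>

definition jfac :: "int \<Rightarrow> int \<Rightarrow> int \<Rightarrow> int \<Rightarrow> complex \<Rightarrow> complex" where
  "jfac a b c d z = thX (mob a b c d z) / thX z"

text \<open>Divisibility of b by 4 trivialises i^b, makes the exponent of the eighth root of unity a
  multiple of 4 and excludes the exchange of \<open>theta 0 0\<close> and \<open>theta 0 1\<close>.
  What remains are three sign characters, trivial on Gamma[8], on which the later decomposition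
  rests.\<close>

lemma theta_gamma4:
  assumes "gamma4 a b c d" and z: "Im z > 0"
  shows "jfac a b c d z ^ 2 = of_int c * z + of_int d"
    and "thX (mob a b c d z) = jfac a b c d z * thX z"
    and "thY (mob a b c d z) = jfac a b c d z * thY z"
    and "theta 1 0 (mob a b c d z) = jfac a b c d z * sg (b div 4 + (d - 1) div 4) * theta 1 0 z"
    and "theta 0 0 (mob a b c d z) = jfac a b c d z * sg ((d - 1) div 4) * theta 0 0 z"
    and "theta 0 1 (mob a b c d z) = jfac a b c d z * sg ((d - 1) div 4 + c div 4) * theta 0 1 z"
proof -
  let ?z8 = "exp (of_real pi * \<i> / 4) :: complex"
  have M: "a * d - b * c = 1" "c mod 4 = 0" "a mod 4 = 1" and b4: "b mod 4 = 0" and d4: "d mod 4 = 1"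
    using assms by (auto simp: gamma4_def)
  obtain J where J: "J ^ 2 = of_int c * z + of_int d" "thX (mob a b c d z) = J * thX z"
    "thY (mob a b c d z) = J * \<i> powi b * thY z"
    "theta 1 0 (mob a b c d z) = J * ?z8 powi (b * d + d - 1) * theta 1 0 z"
    "theta 0 0 (mob a b c d z) = J * sg ((d - 1) div 4 + b * (c div 4)) * (if even b then theta 0 0 z else theta 0 1 z)"
    "theta 0 1 (mob a b c d z) = J * sg ((d - 1) div 4 + b * (c div 4) + c div 4) * (if even b then theta 0 1 z else theta 0 0 z)"
    using theta_gamma14[OF M z] by blast
  have j: "jfac a b c d z = J" using J(2) thX_nonzero[OF z] by (simp add: jfac_def)
  have b: "even b" "odd d" using b4 d4 by presburger+
  have "\<i> powi b = \<i> powi 0" by (rule powi_periodic[of _ 4]) (use b4 in auto)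
  hence i: "\<i> powi b = 1" by simp
  have e: "b * d + d - 1 = 4 * ((b div 4) * d + (d - 1) div 4)"
  proof -
    have "b = 4 * (b div 4)" "d - 1 = 4 * ((d - 1) div 4)" using b4 d4 by presburger+
    thus ?thesis by (metis add_diff_eq distrib_left mult.assoc)
  qed
  have "?z8 powi (b * d + d - 1) = (?z8 powi 4) powi ((b div 4) * d + (d - 1) div 4)" unfolding e by (rule power_int_mult)
  also have "?z8 powi 4 = -1" using zeta8_powers(2) by simp
  also have "(-1) powi ((b div 4) * d + (d - 1) div 4) = sg (b div 4 + (d - 1) div 4)"
    unfolding neg_one_powi using b by simp
  finally have z8: "?z8 powi (b * d + d - 1) = sg (b div 4 + (d - 1) div 4)" .
  show "jfac a b c d z ^ 2 = of_int c * z + of_int d" "thX (mob a b c d z) = jfac a b c d z * thX z"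
    "thY (mob a b c d z) = jfac a b c d z * thY z" unfolding j using J(1-3) i by simp_all
  show "theta 1 0 (mob a b c d z) = jfac a b c d z * sg (b div 4 + (d - 1) div 4) * theta 1 0 z"
    unfolding j J(4) z8 ..
  show "theta 0 0 (mob a b c d z) = jfac a b c d z * sg ((d - 1) div 4) * theta 0 0 z"
    unfolding j J(5) using b by simp
  show "theta 0 1 (mob a b c d z) = jfac a b c d z * sg ((d - 1) div 4 + c div 4) * theta 0 1 z"
    unfolding j J(6) using b by simp
qed

lemma jfac_nonzero: "gamma4 a b c d \<Longrightarrow> Im z > 0 \<Longrightarrow> jfac a b c d z \<noteq> 0"
  using thX_nonzero Im_mob_pos by (simp add: jfac_def gamma4_def)

text \<open>\<open>k\<close> is twice the weight. It is an integer, not a natural number, because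
  division by theta monomials may lead to negative weight.\<close>

definition wnorm :: "int \<Rightarrow> (complex \<Rightarrow> complex) \<Rightarrow> complex \<Rightarrow> real" where
  "wnorm k h z = norm (h z) * Im z powr (of_int k / 4)"

lemma wnorm_nonneg [simp]: "wnorm k h z \<ge> 0" by (simp add: wnorm_def)

lemma nnorm_wnorm: "nnorm h z = wnorm 1 h z" by (simp add: nnorm_def wnorm_def)

lemma wnorm_mult: "Im z > 0 \<Longrightarrow> wnorm (k + l) (\<lambda>z. f z * g z) z = wnorm k f z * wnorm l g z"
  by (simp add: wnorm_def norm_mult add_divide_distrib powr_add mult_ac)

lemma wnorm_power: "Im z > 0 \<Longrightarrow> wnorm (int n * k) (\<lambda>z. f z ^ n) z = wnorm k f z ^ n"
proof (induction n)
  case (Suc n)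
  have "int (Suc n) * k = k + int n * k" by (simp add: algebra_simps)
  thus ?case using Suc wnorm_mult[of z k "int n * k" f "\<lambda>z. f z ^ n"] by simp
qed (simp add: wnorm_def)

lemma wnorm_mob:
  assumes "a * d - b * c = 1" "Im z > 0" and J: "J ^ 2 = of_int c * z + of_int d" "norm (h (mob a b c d z)) = norm J powi k * norm (h z)"
  shows "wnorm k h (mob a b c d z) = wnorm k h z"
proof -
  have nz: "of_int c * z + of_int d \<noteq> 0" by (rule mob_denom_nonzero[OF assms(1,2)])
  hence J0: "J \<noteq> 0" using J(1) by auto
  define n where "n = norm J"
  have n: "n > 0" "norm (of_int c * z + of_int d) = n ^ 2" using J0 J(1) by (auto simp: n_def simp flip: norm_power)
  have "Im (mob a b c d z) powr (of_int k / 4) = Im z powr (of_int k / 4) / (n ^ 4) powr (of_int k / 4)"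
    unfolding Im_mob[OF assms(1)] n using assms(2) n by (simp add: powr_divide flip: power_mult)
  also have "(n ^ 4) powr (of_int k / 4) = n powi k"
  proof -
    have "(n ^ 4) powr (of_int k / 4) = n powr (4 * (of_int k / 4))"
      using n(1) by (simp add: powr_powr flip: powr_numeral)
    thus ?thesis using n(1) by (simp add: powr_real_of_int')
  qed
  finally show ?thesis using n(1) unfolding wnorm_def J(2)
    by (simp add: n_def)
qed

text \<open>Weaker than regularity: the factor exp(pi Im z / 4) pays for a division by theta
  monomials. In the local parameter q = exp(pi i z / 2) it is |q|^(-1/2), too slow for a
  pole.\<close>

definition cusp_growth :: "int \<Rightarrow> (complex \<Rightarrow> complex) \<Rightarrow> bool" where
  "cusp_growth k h \<longleftrightarrow> (\<forall>a b c d. a * d - b * c = 1 \<longrightarrow> (\<exists>K Y. Y > 0 \<and> (\<forall>z. Im z \<ge> Y \<longrightarrow>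
     wnorm k h (mob a b c d z) \<le> K * (Im z powr (of_int k / 4) * exp (pi * Im z / 4)))))"

definition forms1 :: "int \<Rightarrow> (complex \<Rightarrow> complex) set" where
  "forms1 k = {h. h holomorphic_on upper_half_plane \<and>
     (\<forall>a b c d z. gamma4 a b c d \<longrightarrow> Im z > 0 \<longrightarrow> h (mob a b c d z) = jfac a b c d z powi k * h z) \<and>
     cusp_growth k h}"

lemma finite_image_factor:
  assumes "finite (r ` S)" "\<And>s t. s \<in> S \<Longrightarrow> t \<in> S \<Longrightarrow> r s = r t \<Longrightarrow> g s = g t"
  shows "finite (g ` S)"
proof -
  have "g ` S \<subseteq> (\<lambda>x. g (SOME s. s \<in> S \<and> r s = x)) ` (r ` S)"
  proof
    fix y assume "y \<in> g ` S"
    then obtain s where s: "s \<in> S" "y = g s" by blast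
    define t where "t = (SOME t. t \<in> S \<and> r t = r s)"
    have "t \<in> S \<and> r t = r s" unfolding t_def by (rule someI[of _ s]) (use s in auto)
    hence "y = g t" using assms(2)[of s t] s by auto
    thus "y \<in> (\<lambda>x. g (SOME s. s \<in> S \<and> r s = x)) ` (r ` S)"
      using s(1) unfolding t_def by blast
  qed
  thus ?thesis using assms(1) finite_surj by blast
qed

text \<open>p, q, r, s are the entries of the first matrix times the inverse of the second.\<close>

lemma sl2_congruent:
  assumes "a * d - b * c = (1::int)" "a' * d' - b' * c' = 1"
    and m: "a mod m = a' mod m" "b mod m = b' mod m" "c mod m = c' mod m" "d mod m = d' mod m"
  obtains p q r s where "p * s - q * r = 1" "p mod m = 1 mod m" "q mod m = 0" "r mod m = 0" "s mod m = 1 mod m"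
    "\<And>z. Im z > 0 \<Longrightarrow> mob a b c d z = mob p q r s (mob a' b' c' d' z)"
proof -
  obtain k1 where k1: "a = a' + m * k1" using m(1) by (metis mod_eqE)
  obtain k2 where k2: "b = b' + m * k2" using m(2) by (metis mod_eqE)
  obtain k3 where k3: "c = c' + m * k3" using m(3) by (metis mod_eqE)
  obtain k4 where k4: "d = d' + m * k4" using m(4) by (metis mod_eqE)
  define p q r s where "p = a * d' - b * c'" and "q = b * a' - a * b'" and "r = c * d' - d * c'" and "s = d * a' - c * b'"
  have p: "p = 1 + m * (k1 * d' - k2 * c')" using assms(2) unfolding p_def k1 k2 by (simp add: algebra_simps)
  have s: "s = 1 + m * (k4 * a' - k3 * b')" using assms(2) unfolding s_def k3 k4 by (simp add: algebra_simps)
  have q: "q = m * (k2 * a' - k1 * b')" unfolding q_def k1 k2 by (simp add: algebra_simps)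
  have r: "r = m * (k3 * d' - k4 * c')" unfolding r_def k3 k4 by (simp add: algebra_simps)
  have "p * s - q * r = (a * d - b * c) * (a' * d' - b' * c')" unfolding p_def q_def r_def s_def by (simp add: algebra_simps)
  hence det: "p * s - q * r = 1" using assms(1,2) by simp
  have e: "p * a' + q * c' = a * (a' * d' - b' * c')" "p * b' + q * d' = b * (a' * d' - b' * c')"
    "r * a' + s * c' = c * (a' * d' - b' * c')" "r * b' + s * d' = d * (a' * d' - b' * c')"
    unfolding p_def q_def r_def s_def by (simp_all add: algebra_simps)
  show ?thesis
  proof (rule that[OF det])
    show "p mod m = 1 mod m" "s mod m = 1 mod m" "q mod m = 0" "r mod m = 0" unfolding p q r s by simp_all
    show "mob a b c d z = mob p q r s (mob a' b' c' d' z)" if "Im z > 0" for z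
      using mob_mult[OF assms(2) that, of p q r s] e assms(2) by simp
  qed
qed

lemma exp_half_upper_half_plane:
  assumes "0 < norm q" "norm q < (1::real)"
  shows "exp (of_real pi * \<i> * (2 / (of_real pi * \<i>) * Ln q) / 2) = q" "Im (2 / (of_real pi * \<i>) * Ln q) > 0"
    "norm q = exp (- pi * Im (2 / (of_real pi * \<i>) * Ln q) / 2)"
proof -
  have q: "q \<noteq> 0" using assms by auto
  have e: "2 / (of_real pi * \<i>) * Ln q = - \<i> * of_real (2 / pi) * Ln q" by (simp add: field_simps)
  have "of_real pi * \<i> * (2 / (of_real pi * \<i>) * Ln q) / 2 = Ln q" by (simp add: field_simps)
  thus 1: "exp (of_real pi * \<i> * (2 / (of_real pi * \<i>) * Ln q) / 2) = q" using q by simp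
  have im: "Im (2 / (of_real pi * \<i>) * Ln q) = - (2 / pi) * ln (norm q)"
    unfolding e using q by (simp add: Re_Ln)
  have "ln (norm q) < 0" using assms by simp
  thus "Im (2 / (of_real pi * \<i>) * Ln q) > 0" unfolding im by (intro mult_neg_neg) auto
  have "- pi * (- (2 / pi) * ln (norm q)) / 2 = ln (norm q)" by simp
  thus "norm q = exp (- pi * Im (2 / (of_real pi * \<i>) * Ln q) / 2)" unfolding im using q by simp
qed

lemma norm_exp_half: "norm (exp (of_real pi * \<i> * z / 2)) = exp (- pi * Im z / 2)"
  by (simp add: norm_exp_eq_Re)

text \<open>A removable singularity at \<open>q = 0\<close>: the permitted growth is that of \<open>\<bar>q\<bar>\<close> to the power
  \<open>- 1 / 2\<close>, where \<open>q = exp (\<pi> \<i> z / 2)\<close>.\<close>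

lemma cusp_expansion:
  assumes hol: "g holomorphic_on upper_half_plane" and per: "\<And>z. Im z > 0 \<Longrightarrow> g (z + 4) = g z"
    and gr: "\<And>z. Im z \<ge> Y \<Longrightarrow> norm (g z) \<le> K * exp (pi * Im z / 4)"
  obtains G where "G holomorphic_on ball 0 1" "\<And>z. Im z > 0 \<Longrightarrow> g z = G (exp (of_real pi * \<i> * z / 2))"
proof -
  have per_nat: "g (z + 4 * of_nat n) = g z" if "Im z > 0" for z n
  proof (induction n)
    case (Suc n)
    thus ?case using per[of "z + 4 * of_nat n"] that by (simp add: algebra_simps)
  qed simp
  have per_int: "g (z + 4 * of_int n) = g z" if "Im z > 0" for z n
  proof (cases "n \<ge> 0")
    case True
    thus ?thesis using per_nat[OF that, of "nat n"] by simp
  next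
    case False
    have "g ((z + 4 * of_int n) + 4 * of_nat (nat (- n))) = g (z + 4 * of_int n)"
      by (rule per_nat) (use that in simp)
    thus ?thesis using False by simp
  qed
  define L where "L q = 2 / (of_real pi * \<i>) * q" for q :: complex
  define G0 where "G0 q = g (L (Ln q))" for q
  have G0: "g z = G0 (exp (of_real pi * \<i> * z / 2))" if z: "Im z > 0" for z
  proof -
    let ?q = "exp (of_real pi * \<i> * z / 2)"
    have "exp (Ln ?q) = exp (of_real pi * \<i> * z / 2)" by simp
    then obtain n where n: "Ln ?q = of_real pi * \<i> * z / 2 + of_real (of_int (2 * n) * pi) * \<i>"
      unfolding exp_eq by blast
    have "L (Ln ?q) = z + 4 * of_int n" unfolding L_def n by (simp add: field_simps)
    thus ?thesis unfolding G0_def using per_int[OF z] by simp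
  qed
  have hol0: "G0 holomorphic_on ball 0 1 - {0}"
  proof -
    have "\<exists>e>0. G0 holomorphic_on ball q e" if q: "q \<in> ball 0 1 - {0}" for q
    proof -
      define e where "e = min (norm q) (1 - norm q)"
      have e: "e > 0" using q by (auto simp: e_def)
      \<comment> \<open>A branch of the logarithm near q that avoids the cut of \<open>Ln\<close>,
        since w / q stays in the right half-plane. By periodicity \<open>G0\<close> does not see the
        choice of branch.\<close>
      define Lq where "Lq w = Ln q + Ln (w / q)" for w
      have re: "Re (w / q) > 0" if w: "w \<in> ball q e" for w
      proof -
        have "norm (w / q - 1) = norm (w - q) / norm q" using q by (simp add: field_simps flip: norm_divide)
        also have "\<dots> < 1" using w q by (simp add: e_def dist_norm norm_minus_commute)
        finally have "\<bar>Re (w / q - 1)\<bar> < 1" using abs_Re_le_cmod[of "w / q - 1"] by linarith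
        thus ?thesis by (simp only: minus_complex.sel one_complex.sel)
      qed
      have inb: "norm w < 1" "w \<noteq> 0" if w: "w \<in> ball q e" for w
        using re[OF w] w norm_triangle_ineq[of q "w - q"] by (auto simp: e_def dist_norm norm_minus_commute)
      have ex: "exp (Lq w) = w" if w: "w \<in> ball q e" for w
        using inb[OF w] q by (simp add: Lq_def exp_add)
      have Lpos: "Im (L (Lq w)) > 0" if w: "w \<in> ball q e" for w
      proof -
        have "norm (exp (Lq w)) < 1" using ex[OF w] inb[OF w] by simp
        hence "Re (Lq w) < 0" by (simp add: norm_exp_eq_Re)
        moreover have "L (Lq w) = - \<i> * of_real (2 / pi) * Lq w" unfolding L_def by (simp add: field_simps)
        ultimately show ?thesis by (simp add: divide_neg_pos)
      qed
      have "(\<lambda>w. g (L (Lq w))) holomorphic_on ball q e"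
      proof (rule holomorphic_on_compose_gen[OF _ hol, unfolded o_def])
        show "(\<lambda>w. L (Lq w)) holomorphic_on ball q e"
          unfolding L_def Lq_def using q re by (intro holomorphic_intros) (force simp: complex_nonpos_Reals_iff)+
        show "(\<lambda>w. L (Lq w)) ` ball q e \<subseteq> upper_half_plane" using Lpos by auto
      qed
      moreover have "G0 w = g (L (Lq w))" if w: "w \<in> ball q e" for w
      proof -
        have "exp (of_real pi * \<i> * L (Lq w) / 2) = w" using ex[OF w] by (simp add: L_def)
        thus ?thesis using G0[OF Lpos[OF w]] by simp
      qed
      ultimately show ?thesis using e by (metis holomorphic_cong)
    qed
    hence "G0 analytic_on ball 0 1 - {0}" by (simp add: analytic_on_def)
    thus ?thesis by (rule analytic_imp_holomorphic)
  qed
  have bound: "norm (q * G0 q) \<le> K * sqrt (norm q)" if q: "0 < norm q" "norm q < 1" "norm q \<le> exp (- pi * Y / 2)" for q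
  proof -
    let ?z = "L (Ln q)"
    note z = exp_half_upper_half_plane[OF q(1,2), folded L_def]
    have "exp (- pi * Im ?z / 2) \<le> exp (- pi * Y / 2)" using z(3) q(3) by simp
    hence "Im ?z \<ge> Y" by simp
    from gr[OF this] have "norm (G0 q) \<le> K * exp (pi * Im ?z / 4)" by (simp add: G0_def)
    moreover have "exp (pi * Im ?z / 4) = 1 / sqrt (norm q)"
    proof -
      have "sqrt (norm q) = exp (- pi * Im ?z / 4)"
        by (rule real_sqrt_unique) (use z(3) in \<open>simp_all flip: exp_of_nat_mult exp_double\<close>)
      thus ?thesis using q(1) by (simp add: exp_minus field_simps)
    qed
    ultimately have "norm q * norm (G0 q) \<le> norm q * (K * (1 / sqrt (norm q)))" by (intro mult_left_mono) auto
    also have "\<dots> = K * (norm q / sqrt (norm q))" by simp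
    also have "norm q / sqrt (norm q) = sqrt (norm q)" by (rule real_div_sqrt) simp
    finally show ?thesis by (simp add: norm_mult)
  qed
  have lim: "((\<lambda>q. (q - 0) * G0 q) \<longlongrightarrow> 0) (at 0)"
  proof (rule Lim_null_comparison)
    have s: "((\<lambda>q::complex. sqrt (norm q)) \<longlongrightarrow> sqrt (norm (0::complex))) (at 0)" by (intro tendsto_intros)
    have "((\<lambda>q::complex. K * sqrt (norm q)) \<longlongrightarrow> K * sqrt (norm (0::complex))) (at 0)" by (intro tendsto_intros s)
    thus "((\<lambda>q::complex. K * sqrt (norm q)) \<longlongrightarrow> 0) (at 0)" by simp
    show "\<forall>\<^sub>F q in at 0. norm ((q - 0) * G0 q) \<le> K * sqrt (norm q)"
      unfolding eventually_at
      by (rule exI[of _ "min (1/2) (exp (- pi * Y / 2))"]) (auto intro!: bound[simplified])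
  qed
  have "\<exists>G. G holomorphic_on ball 0 1 \<and> (\<forall>q\<in>ball 0 1 - {0}. G q = G0 q)"
    using holomorphic_on_extend_lim[of G0 "ball 0 1" 0] hol0 lim by simp
  then obtain G where G: "G holomorphic_on ball 0 1" "\<And>q. q \<in> ball 0 1 - {0} \<Longrightarrow> G q = G0 q" by blast
  show ?thesis
  proof (rule that[OF G(1)])
    fix z assume z: "Im z > 0"
    have "exp (of_real pi * \<i> * z / 2) \<in> ball 0 1 - {0}" using z by (simp add: norm_exp_half)
    thus "g z = G (exp (of_real pi * \<i> * z / 2))" using G(2) G0[OF z] by simp
  qed
qed

section \<open>Size of \<open>thX\<close> and \<open>thY\<close> at the cusps\<close>

lemma thXY_near:
  assumes "Im z \<ge> 1"
  shows "1 / 2 \<le> norm (thX z)" "norm (thX z) \<le> 3" "exp (- (pi * Im z / 2)) \<le> norm (thY z)"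
    "norm (thY z) \<le> 3 * exp (- (pi * Im z / 2))"
proof -
  have z: "Im (2 * z) \<ge> 1" using assms by simp
  show "1 / 2 \<le> norm (thX z)" "norm (thX z) \<le> 3"
    using theta_near'(1)[OF z, of 0] norm_triangle_ineq[of "1 - thX z" "thX z"] norm_triangle_ineq[of "thX z - 1" 1]
    by (simp_all add: thX_def norm_minus_commute)
  have "norm (thY z * exp (- (of_real pi * \<i> * (2 * z) / 4)) - 2) \<le> 1 / 2" unfolding thY_def by (rule theta_near'(2)[OF z])
  moreover have "norm (thY z * exp (- (of_real pi * \<i> * (2 * z) / 4))) = norm (thY z) * exp (pi * Im z / 2)"
    unfolding norm_mult exp_quarter by simp
  ultimately have "1 \<le> norm (thY z) * exp (pi * Im z / 2)" "norm (thY z) * exp (pi * Im z / 2) \<le> 3"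
    using norm_triangle_ineq[of "2 - thY z * exp (- (of_real pi * \<i> * (2 * z) / 4))" "thY z * exp (- (of_real pi * \<i> * (2 * z) / 4))"]
      norm_triangle_ineq[of "thY z * exp (- (of_real pi * \<i> * (2 * z) / 4)) - 2" 2]
    by (simp_all only: norm_minus_commute) simp_all
  thus "exp (- (pi * Im z / 2)) \<le> norm (thY z)" "norm (thY z) \<le> 3 * exp (- (pi * Im z / 2))"
    by (simp_all add: exp_minus field_simps)
qed

lemma theta_wnorm_bounded:
  assumes "a * d - b * c = 1" "f \<in> thetas" "Im z \<ge> 1 / 2"
  shows "wnorm 1 f (mob a b c d z) \<le> 3 * Im z powr (1 / 4)"
proof -
  obtain g where g: "g \<in> thetas" "\<And>z. Im z > 0 \<Longrightarrow> nnorm f (mob a b c d z) = nnorm g z"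
    using nnorm_thetas_sl2[OF assms(1,2)] by blast
  have "wnorm 1 f (mob a b c d z) = nnorm g z" using g(2)[of z] assms(3) by (simp flip: nnorm_wnorm)
  also have "\<dots> \<le> 3 * Im z powr (1 / 4)" unfolding nnorm_def
    by (intro mult_right_mono thetas_bounded[OF assms(3) g(1)]) auto
  finally show ?thesis .
qed

text \<open>SL(2,Z) does not permute \<open>thX\<close> and \<open>thY\<close>, but 2 X^2 and 2 Y^2
  are the sum and the difference of theta_00^2 and theta_01^2, so the bound of the theta functions
  is inherited.\<close>

lemma thXY_wnorm_bounded:
  assumes "a * d - b * c = 1" "f \<in> {thX, thY}" "Im z \<ge> 1 / 2"
  shows "wnorm 1 f (mob a b c d z) \<le> 3 * Im z powr (1 / 4)"
proof (rule power2_le_imp_le)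
  let ?w = "mob a b c d z"
  have w: "Im ?w > 0" using Im_mob_pos[OF assms(1), of z] assms(3) by simp
  have "2 * norm (f ?w) ^ 2 \<le> norm (theta 0 0 ?w) ^ 2 + norm (theta 0 1 ?w) ^ 2"
  proof -
    have "norm (2 * thX ?w ^ 2) = norm (theta 0 0 ?w ^ 2 + theta 0 1 ?w ^ 2)"
      "norm (2 * thY ?w ^ 2) = norm (theta 0 0 ?w ^ 2 - theta 0 1 ?w ^ 2)"
      unfolding theta_squares[OF w] by simp_all
    hence "norm (2 * f ?w ^ 2) \<le> norm (theta 0 0 ?w ^ 2) + norm (theta 0 1 ?w ^ 2)"
      using norm_triangle_ineq[of "theta 0 0 ?w ^ 2" "theta 0 1 ?w ^ 2"] norm_triangle_ineq4[of "theta 0 0 ?w ^ 2" "theta 0 1 ?w ^ 2"] assms(2)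
      by (auto simp del: One_nat_def)
    thus ?thesis by (simp add: norm_mult norm_power)
  qed
  hence "2 * norm (f ?w) ^ 2 * (Im ?w powr (1/4)) ^ 2 \<le> (norm (theta 0 0 ?w) ^ 2 + norm (theta 0 1 ?w) ^ 2) * (Im ?w powr (1/4)) ^ 2"
    by (intro mult_right_mono) auto
  hence "2 * wnorm 1 f ?w ^ 2 \<le> wnorm 1 (theta 0 0) ?w ^ 2 + wnorm 1 (theta 0 1) ?w ^ 2"
    by (simp add: wnorm_def power_mult_distrib distrib_right)
  moreover have "wnorm 1 (theta 0 0) ?w ^ 2 \<le> (3 * Im z powr (1/4)) ^ 2" "wnorm 1 (theta 0 1) ?w ^ 2 \<le> (3 * Im z powr (1/4)) ^ 2"
    using theta_wnorm_bounded[OF assms(1) _ assms(3)] by (intro power_mono; simp add: thetas_def)+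
  ultimately show "wnorm 1 f ?w ^ 2 \<le> (3 * Im z powr (1/4)) ^ 2" by linarith
qed simp


lemma mob_neg: "mob (- a) (- b) (- c) (- d) z = mob a b c d z"
proof -
  have "mob (- a) (- b) (- c) (- d) z = (- (of_int a * z + of_int b)) / (- (of_int c * z + of_int d))"
    unfolding mob_def by simp
  also have "\<dots> = mob a b c d z" unfolding mob_def by (simp only: minus_divide_divide)
  finally show ?thesis .
qed

text \<open>Up to a sign, which acts trivially, a matrix of Gamma_0(4) has a = 1 modulo 4. Splitting
  off the translation by b replaces the upper right entry by b - a b, which is divisible by
  4.\<close>

lemma gamma0_4_decompose:
  assumes "a * d - b * c = (1::int)" "c mod 4 = 0"
  obtains a' b' c' d' n where "gamma4 a' b' c' d'" "\<And>z. Im z > 0 \<Longrightarrow> mob a b c d z = mob a' b' c' d' (z + of_int n)"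
proof -
  have *: "gamma4 a (b - a * b) c (d - c * b) \<and> (\<forall>z. Im z > 0 \<longrightarrow> mob a b c d z = mob a (b - a * b) c (d - c * b) (z + of_int b))"
    if M: "a * d - b * c = (1::int)" "c mod 4 = 0" "a mod 4 = 1" for a b c d
  proof
    have d: "d mod 4 = 1" by (rule gamma14_mod[OF M])
    obtain n where n: "c = 4 * n" using M(2) by blast
    obtain m where m: "a = 4 * m + 1" using M(3) by (metis mult_div_mod_eq)
    have "b - a * b = 4 * (- (m * b))" unfolding m by (simp add: algebra_simps)
    hence "(b - a * b) mod 4 = 0" by simp
    moreover have "(d - c * b) mod 4 = 1"
    proof -
      have "d - c * b = d + 4 * (- (n * b))" unfolding n by simp
      thus ?thesis using d by (metis mod_mult_self2)
    qed
    ultimately show "gamma4 a (b - a * b) c (d - c * b)" using M by (simp add: gamma4_def algebra_simps)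
    show "\<forall>z. Im z > 0 \<longrightarrow> mob a b c d z = mob a (b - a * b) c (d - c * b) (z + of_int b)"
      by (simp add: mob_def algebra_simps)
  qed
  have "odd a"
  proof
    assume "even a"
    moreover have "even c" using assms(2) by presburger
    ultimately have "even (a * d - b * c)" by simp
    thus False using assms(1) by simp
  qed
  hence "a mod 4 = 1 \<or> (- a) mod 4 = 1" by presburger
  thus ?thesis
  proof
    assume "a mod 4 = 1"
    from *[OF assms this] that show ?thesis by blast
  next
    assume a: "(- a) mod 4 = 1"
    have "(- a) * (- d) - (- b) * (- c) = 1" "(- c) mod 4 = 0" using assms by (auto, presburger?)
    from *[OF this a] that show ?thesis unfolding mob_neg by blast
  qed
qed

lemma gamma4_theta_wnorm:
  assumes "gamma4 a b c d" "Im z > 0" "f \<in> {thX, thY}"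
  shows "wnorm 1 f (mob a b c d z) = wnorm 1 f z"
  by (rule wnorm_mob[OF _ assms(2) theta_gamma4(1)[OF assms(1,2)]])
     (use assms(3) theta_gamma4(2,3)[OF assms(1,2)] assms(1) in \<open>auto simp: norm_mult gamma4_def\<close>)

lemma thY_wnorm_inversion:
  assumes "Im w > 0"
  shows "wnorm 1 thY (- 1 / w) = wnorm 1 (\<lambda>w. thX w - thY w) w / sqrt 2"
    and "wnorm 1 (\<lambda>w. thX w - thY w) (- 1 / w) = sqrt 2 * wnorm 1 thY w"
    and "wnorm 1 (\<lambda>w. thX w + thY w) (- 1 / w) = sqrt 2 * wnorm 1 thX w"
proof -
  have w: "norm w > 0" using assms by auto
  have "Im (- 1 / w) powr (1 / 4) = Im w powr (1 / 4) / (norm w ^ 2) powr (1 / 4)"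
    unfolding Im_minus_inverse using assms w by (simp add: powr_divide)
  moreover have "(norm w ^ 2) powr (1 / 4) = sqrt (norm w)"
    using w by (simp add: powr_powr powr_half_sqrt flip: powr_numeral)
  ultimately have i: "Im (- 1 / w) powr (1 / 4) = Im w powr (1 / 4) / sqrt (norm w)" by simp
  have s: "norm (csqrt (- \<i> * w / 2)) = sqrt (norm w) / sqrt 2"
    by (simp add: norm_csqrt norm_mult norm_divide real_sqrt_divide)
  have sw: "sqrt (norm w) > 0" using w by simp
  show "wnorm 1 thY (- 1 / w) = wnorm 1 (\<lambda>w. thX w - thY w) w / sqrt 2"
    unfolding wnorm_def thX_inversion[OF assms] norm_mult s using i sw by simp
  have "thX (- 1 / w) - thY (- 1 / w) = csqrt (- \<i> * w / 2) * (2 * thY w)"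
    "thX (- 1 / w) + thY (- 1 / w) = csqrt (- \<i> * w / 2) * (2 * thX w)"
    unfolding thX_inversion[OF assms] by (simp_all add: algebra_simps)
  hence n: "norm (thX (- 1 / w) - thY (- 1 / w)) = sqrt (norm w) / sqrt 2 * (2 * norm (thY w))"
    "norm (thX (- 1 / w) + thY (- 1 / w)) = sqrt (norm w) / sqrt 2 * (2 * norm (thX w))"
    by (simp_all only: norm_mult s) simp_all
  have h: "s / sqrt 2 * (2 * n) * (t / s) = sqrt 2 * (n * t)" if "s > 0" for s n t :: real
  proof -
    have "s / sqrt 2 * (2 * n) * (t / s) = 2 / sqrt 2 * (n * t)" using that by simp
    also have "2 / sqrt 2 = sqrt 2" by (rule real_div_sqrt) simp
    finally show ?thesis .
  qed
  show "wnorm 1 (\<lambda>w. thX w - thY w) (- 1 / w) = sqrt 2 * wnorm 1 thY w"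
    "wnorm 1 (\<lambda>w. thX w + thY w) (- 1 / w) = sqrt 2 * wnorm 1 thX w"
    unfolding wnorm_def n of_int_1 i by (rule h[OF sw])+
qed

lemma wnorm_cong: "norm (f z) = norm (g w) \<Longrightarrow> Im z = Im w \<Longrightarrow> wnorm k f z = wnorm k g w"
  by (simp add: wnorm_def)

text \<open>\<open>\<vartheta>\<^sub>1\<^sub>0(2z)\<close> vanishes only at the cusps equivalent to \<open>\<infinity>\<close> under \<open>\<Gamma>\<^sub>0(4)\<close>.\<close>

lemma thY_lower_bound:
  assumes det: "a * d - b * c = (1::int)" and c: "c mod 4 \<noteq> 0" and z: "Im z \<ge> 2"
  shows "wnorm 1 thY (mob a b c d z) \<ge> Im z powr (1 / 4) / 4"
proof -
  have inv: "wnorm 1 f (mob a b c d z) = wnorm 1 f (z + of_int n)"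
    if "gamma4 a' b' c' d'" "\<And>z. Im z > 0 \<Longrightarrow> mob a b c d z = mob a' b' c' d' (z + of_int n)" "Im z > 0" "f \<in> {thX, thY}"
    for a b c d a' b' c' d' n z f
    using gamma4_theta_wnorm[OF that(1) _ that(4), of "z + of_int n"] that by simp
  have tr: "norm (thY (z + of_int n)) = norm (thY z)" for z n
  proof (induction n rule: int_induct[of _ 0])
    case (step1 i)
    thus ?case using thY_add_one[of "z + of_int i"] by (simp add: norm_mult add.assoc)
  next
    case (step2 i)
    thus ?case using thY_add_one[of "z + of_int i - 1"] by (simp add: norm_mult add_diff_eq)
  qed simp
  have g0: "wnorm 1 thY (mob a b c d z) = wnorm 1 thY z" if M: "a * d - b * c = (1::int)" "c mod 4 = 0" "Im z > 0" for a b c d z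
  proof -
    obtain a' b' c' d' n where "gamma4 a' b' c' d'" "\<And>z. Im z > 0 \<Longrightarrow> mob a b c d z = mob a' b' c' d' (z + of_int n)"
      using gamma0_4_decompose[OF M(1,2)] by blast
    from inv[OF this M(3), of thY] show ?thesis by (simp add: wnorm_def tr)
  qed
  have s2: "sqrt 2 \<le> 2" by (rule real_le_lsqrt) auto
  show ?thesis
  proof (cases "odd c")
    case True
    \<comment> \<open>The cusp is equivalent to 0. Translating by c d turns d into d - c^2 d,
      divisible by 4 since c is odd; after exchanging columns by S this is the lower left entry up
      to sign, so a matrix in Gamma_0(4) remains.\<close>
    define n where "n = c * d"
    define w where "w = z + of_int n"
    have w: "Im w = Im z" "Im w > 0" using z by (auto simp: w_def)
    define b1 d1 where "b1 = b - n * a" and "d1 = d - n * c"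
    have d1: "d1 mod 4 = 0"
    proof -
      obtain k where k: "c = 2 * k + 1" using True by (rule oddE)
      have "d1 = 4 * (- (d * (k * k + k)))" unfolding d1_def n_def k by (simp add: algebra_simps)
      thus ?thesis by simp
    qed
    have d1': "(- d1) mod 4 = 0" using d1 by presburger
    have det1: "(- b1) * c - a * (- d1) = 1" using det by (simp add: b1_def d1_def algebra_simps)
    have inv_w: "Im (- 1 / w) > 0" using w Im_minus_inverse[of w] by (auto simp: complex_eq_iff)
    have "mob a b c d z = mob (- b1) a (- d1) c (- 1 / w)"
    proof -
      have w0: "w \<noteq> 0" using w by auto
      have "mob (- b1) a (- d1) c (- 1 / w) = (of_int b1 / w + of_int a) / (of_int d1 / w + of_int c)"
        by (simp add: mob_def)
      also have "\<dots> = (of_int b1 + of_int a * w) / (of_int d1 + of_int c * w)"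
        using w0 by (simp add: add_divide_eq_iff divide_add_eq_iff)
      also have "\<dots> = mob a b c d z" by (simp add: mob_def b1_def d1_def w_def algebra_simps)
      finally show ?thesis ..
    qed
    hence "wnorm 1 thY (mob a b c d z) = wnorm 1 thY (- 1 / w)"
      using g0[OF det1 _ inv_w] d1' by simp
    also have "\<dots> = wnorm 1 (\<lambda>w. thX w - thY w) w / sqrt 2" by (rule thY_wnorm_inversion[OF w(2)])
    also have "\<dots> = norm (theta 0 1 (w / 2)) * Im z powr (1/4) / sqrt 2"
      using theta_half(2)[OF w(2)] w by (simp add: wnorm_def)
    finally have e: "wnorm 1 thY (mob a b c d z) = norm (theta 0 1 (w / 2)) * Im z powr (1/4) / sqrt 2" .
    have "Im (w / 2) \<ge> 1" using w z by simp
    hence "norm (theta 0 1 (w / 2)) \<ge> 1 / 2"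
      using theta_near'(1)[of "w / 2" 1] norm_triangle_ineq[of "1 - theta 0 1 (w / 2)" "theta 0 1 (w / 2)"]
      by (simp add: norm_minus_commute)
    hence "norm (theta 0 1 (w / 2)) * Im z powr (1/4) / sqrt 2 \<ge> (1 / 2) * Im z powr (1/4) / 2"
      using s2 by (intro frac_le mult_right_mono) auto
    thus ?thesis unfolding e by simp
  next
    case False
    have d: "odd d"
    proof
      assume "even d"
      hence "even (a * d - b * c)" using False by simp
      thus False using det by simp
    qed
    have c2: "(c - 2 * d) mod 4 = 0" using False c d by presburger
    \<comment> \<open>Here c is 2 modulo 4 and the cusp is equivalent to 1/2. Splitting off the
      lower unipotent matrix with entry 2 leaves c - 2 d, divisible by 4. Since w + 2 = -1/z, the
      value of X - Y at w becomes X + Y at -1/z and finally X at z, which is bounded below.\<close>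
    define w where "w = - 1 / z - 2"
    have z0: "Im z > 0" "z \<noteq> 0" using z by auto
    have iz: "Im (- 1 / z) > 0" using z0 Im_minus_inverse[of z] by simp
    hence w: "Im w > 0" by (simp add: w_def)
    have w0: "w \<noteq> 0" using w by auto
    have lz: "- 1 / w = z / (2 * z + 1)"
    proof -
      have "w = - ((2 * z + 1) / z)" using z0 by (simp add: w_def field_simps)
      thus ?thesis by simp
    qed
    have l0: "2 * z + 1 \<noteq> 0" using z by (auto simp: complex_eq_iff)
    have i1: "Im (- 1 / w) > 0" using w w0 Im_minus_inverse[of w] by simp
    have "mob a b c d z = mob (a - 2 * b) b (c - 2 * d) d (- 1 / w)"
    proof -
      have "mob (a - 2 * b) b (c - 2 * d) d (z / (2 * z + 1)) =
          (of_int (a - 2 * b) * z + of_int b * (2 * z + 1)) / (of_int (c - 2 * d) * z + of_int d * (2 * z + 1))"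
        unfolding mob_def using l0 by (simp add: add_divide_eq_iff divide_add_eq_iff del: of_int_diff)
      also have "\<dots> = mob a b c d z" by (simp add: mob_def algebra_simps)
      finally show ?thesis unfolding lz ..
    qed
    moreover have "(a - 2 * b) * d - b * (c - 2 * d) = 1" using det by (simp add: algebra_simps)
    ultimately have "wnorm 1 thY (mob a b c d z) = wnorm 1 thY (- 1 / w)"
      using g0[OF _ c2 i1] by simp
    also have "\<dots> = wnorm 1 (\<lambda>w. thX w - thY w) w / sqrt 2" by (rule thY_wnorm_inversion[OF w])
    also have "wnorm 1 (\<lambda>w. thX w - thY w) w = wnorm 1 (\<lambda>w. thX w + thY w) (- 1 / z)"
    proof (rule wnorm_cong)
      have e: "- 1 / z = w + 1 + 1" by (simp add: w_def)
      have "thX (- 1 / z) + thY (- 1 / z) = thX w - thY w" unfolding e thX_add_one thY_add_one by simp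
      thus "norm (thX w - thY w) = norm (thX (- 1 / z) + thY (- 1 / z))" by simp
      show "Im w = Im (- 1 / z)" by (simp add: w_def)
    qed
    also have "\<dots> = sqrt 2 * wnorm 1 thX z" by (rule thY_wnorm_inversion[OF z0(1)])
    finally have e: "wnorm 1 thY (mob a b c d z) = norm (thX z) * Im z powr (1/4)" by (simp add: wnorm_def)
    have "norm (thX z) * Im z powr (1/4) \<ge> (1 / 4) * Im z powr (1/4)"
      using thXY_near(1)[of z] z by (intro mult_right_mono) auto
    thus ?thesis unfolding e by simp
  qed
qed


text \<open>p, q, r, s is the conjugate M T^4 M^(-1), again in the normal subgroup Gamma[4]. So the
  transform of an invariant function under any M has period 4.\<close>

lemma mob_add_four:
  assumes "a * d - b * c = (1::int)"
  obtains p q r s where "gamma4 p q r s" "\<And>z. Im z > 0 \<Longrightarrow> mob a b c d (z + 4) = mob p q r s (mob a b c d z)"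
proof (rule that)
  let ?p = "1 - 4 * (a * c)" and ?q = "4 * (a * a)" and ?r = "- 4 * (c * c)" and ?s = "1 + 4 * (a * c)"
  have "?p = 1 + 4 * (- (a * c))" by simp
  hence "?p mod 4 = 1" "?s mod 4 = 1" by (simp_all only: mod_mult_self2) simp_all
  moreover have "?q mod 4 = 0" "?r mod 4 = 0" by simp_all
  moreover have "?p * ?s - ?q * ?r = 1" by (simp add: algebra_simps)
  ultimately show "gamma4 ?p ?q ?r ?s" by (simp only: gamma4_def)
  have "?p * b + ?q * d = b + 4 * a * (a * d - b * c)" "?r * b + ?s * d = d + 4 * c * (a * d - b * c)"
    by (simp_all add: algebra_simps)
  hence e: "?p * a + ?q * c = a" "?p * b + ?q * d = b + 4 * a" "?r * a + ?s * c = c" "?r * b + ?s * d = d + 4 * c"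
    using assms by (simp_all add: algebra_simps)
  show "mob a b c d (z + 4) = mob ?p ?q ?r ?s (mob a b c d z)" if "Im z > 0" for z
    unfolding mob_mult[OF assms that] e by (simp add: mob_def algebra_simps)
qed

text \<open>Maximum principle on the compactified curve. The form has finitely many transforms under
  SL(2,Z), each a holomorphic function of q = exp(pi i z / 2) in the unit disc, and every point is
  equivalent to one of height at least 1/2, that is with |q| <= exp(-pi/4). Hence the largest
  absolute value is attained by one transform at an interior point, and this transform is
  constant.\<close>

lemma forms1_zero_constant:
  assumes h: "h \<in> forms1 0"
  obtains k where "\<And>z. Im z > 0 \<Longrightarrow> h z = k"
proof -
  have hol: "h holomorphic_on upper_half_plane" and gr: "cusp_growth 0 h"
    and inv: "\<And>a b c d z. gamma4 a b c d \<Longrightarrow> Im z > 0 \<Longrightarrow> h (mob a b c d z) = h z"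
    using h by (auto simp: forms1_def)
  define S where "S = {(a, b, c, d). a * d - b * c = (1::int)}"
  define H where "H = (\<lambda>(a, b, c, d) z. if Im z > 0 then h (mob a b c d z) else 0)"
  define Q where "Q z = exp (of_real pi * \<i> * z / 2)" for z
  have fin: "finite (H ` S)"
  proof (rule finite_image_factor[where r = "\<lambda>(a, b, c, d). (a mod 4, b mod 4, c mod 4, d mod (4::int))"])
    have "(\<lambda>(a, b, c, d). (a mod 4, b mod 4, c mod 4, d mod (4::int))) ` S \<subseteq> {0..<4} \<times> {0..<4} \<times> {0..<4} \<times> {0..<4}"
      by auto
    thus "finite ((\<lambda>(a, b, c, d). (a mod 4, b mod 4, c mod 4, d mod (4::int))) ` S)"
      by (rule finite_subset) auto
    fix s t assume st: "s \<in> S" "t \<in> S" "(\<lambda>(a, b, c, d). (a mod 4, b mod 4, c mod 4, d mod (4::int))) s = (\<lambda>(a, b, c, d). (a mod 4, b mod 4, c mod 4, d mod (4::int))) t"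
    obtain a b c d a' b' c' d' where e: "s = (a, b, c, d)" "t = (a', b', c', d')" by (cases s; cases t)
    have d: "a * d - b * c = 1" "a' * d' - b' * c' = 1"
      and m: "a mod 4 = a' mod 4" "b mod 4 = b' mod 4" "c mod 4 = c' mod 4" "d mod 4 = d' mod 4"
      using st unfolding e S_def by simp_all
    obtain p q r u where M: "p * u - q * r = 1" "p mod 4 = 1 mod 4" "q mod 4 = 0" "r mod 4 = 0" "u mod 4 = 1 mod 4"
      "\<And>z. Im z > 0 \<Longrightarrow> mob a b c d z = mob p q r u (mob a' b' c' d' z)"
      by (rule sl2_congruent[OF d m]) (rule that; assumption)
    have "gamma4 p q r u" using M by (simp add: gamma4_def)
    moreover have "Im (mob a' b' c' d' z) > 0" if "Im z > 0" for z
      by (rule Im_mob_pos[OF d(2) that])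
    ultimately show "H s = H t" using inv M(6) by (simp add: H_def e fun_eq_iff)
  qed
  have "\<exists>G. G holomorphic_on ball 0 1 \<and> (\<forall>z. Im z > 0 \<longrightarrow> F z = G (Q z))" if F: "F \<in> H ` S" for F
  proof -
    obtain a b c d where M: "a * d - b * c = 1" "F = H (a, b, c, d)" using F unfolding S_def by blast
    have F_eq: "F z = h (mob a b c d z)" if "Im z > 0" for z using M that by (simp add: H_def)
    obtain p q r s where P: "gamma4 p q r s" "\<And>z. Im z > 0 \<Longrightarrow> mob a b c d (z + 4) = mob p q r s (mob a b c d z)"
      using mob_add_four[OF M(1)] by blast
    obtain K Y where K: "Y > 0" "\<And>z. Im z \<ge> Y \<Longrightarrow> wnorm 0 h (mob a b c d z) \<le> K * (Im z powr (0 / 4) * exp (pi * Im z / 4))"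
      using gr M(1) unfolding cusp_growth_def by (metis of_int_0)
    have holF: "(\<lambda>z. h (mob a b c d z)) holomorphic_on upper_half_plane"
    proof (rule holomorphic_on_compose_gen[OF _ hol, unfolded o_def])
      show "mob a b c d holomorphic_on upper_half_plane"
        unfolding mob_def using mob_denom_nonzero[OF M(1)] by (intro holomorphic_intros) auto
    qed (use Im_mob_pos[OF M(1)] in auto)
    obtain G where "G holomorphic_on ball 0 1" "\<And>z. Im z > 0 \<Longrightarrow> h (mob a b c d z) = G (exp (of_real pi * \<i> * z / 2))"
    proof (rule cusp_expansion[OF holF, of Y K])
      show "h (mob a b c d (z + 4)) = h (mob a b c d z)" if "Im z > 0" for z
        unfolding P(2)[OF that] using inv[OF P(1)] Im_mob_pos[OF M(1) that] by simp
      show "norm (h (mob a b c d z)) \<le> K * exp (pi * Im z / 4)" if "Im z \<ge> Y" for z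
        using K(2)[OF that] K(1) that Im_mob_pos[OF M(1), of z] by (simp add: wnorm_def)
    qed (rule that)
    thus ?thesis using F_eq unfolding Q_def by (intro exI[of _ G]) auto
  qed
  then obtain G where G: "\<And>F. F \<in> H ` S \<Longrightarrow> G F holomorphic_on ball 0 1"
    "\<And>F z. F \<in> H ` S \<Longrightarrow> Im z > 0 \<Longrightarrow> F z = G F (Q z)" by metis
  define r where "r = exp (- (pi / 4))"
  have r: "0 < r" "r < 1" by (auto simp: r_def)
  have "\<exists>q\<in>cball 0 r. \<forall>p\<in>cball 0 r. norm (G F p) \<le> norm (G F q)" if "F \<in> H ` S" for F
  proof (rule continuous_attains_sup)
    have "continuous_on (cball 0 r) (G F)"
      using holomorphic_on_imp_continuous_on[OF G(1)[OF that]] by (rule continuous_on_subset) (use r in auto)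
    thus "continuous_on (cball 0 r) (\<lambda>q. norm (G F q))" by (intro continuous_intros)
  qed (use r in auto)
  then obtain q where q: "\<And>F. F \<in> H ` S \<Longrightarrow> q F \<in> cball 0 r"
    "\<And>F p. F \<in> H ` S \<Longrightarrow> p \<in> cball 0 r \<Longrightarrow> norm (G F p) \<le> norm (G F (q F))" by metis
  define m where "m F = norm (G F (q F))" for F
  have "(1, 0, 0, 1) \<in> S" by (simp add: S_def)
  hence ne: "H ` S \<noteq> {}" by blast
  obtain F where F: "F \<in> H ` S" "\<And>F'. F' \<in> H ` S \<Longrightarrow> m F' \<le> m F"
  proof -
    have "Max (m ` H ` S) \<in> m ` H ` S" using fin ne by (intro Max_in) auto
    then obtain F where "Max (m ` H ` S) = m F" "F \<in> H ` S" by (rule imageE)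
    moreover have "m F' \<le> Max (m ` H ` S)" if "F' \<in> H ` S" for F' using fin that by (intro Max_ge) auto
    ultimately show ?thesis using that by metis
  qed
  have hm: "norm (h w) \<le> m F" if w: "Im w > 0" for w
  proof -
    obtain a b c d z where z: "a * d - b * c = 1" "Im z \<ge> 1 / 2" "w = mob a b c d z"
      using upper_half_plane_reduction[OF w] by blast
    let ?F = "H (a, b, c, d)"
    have F': "?F \<in> H ` S" using z(1) unfolding S_def by blast
    have "h w = ?F z" using z by (simp add: H_def)
    also have "\<dots> = G ?F (Q z)" using G(2)[OF F', of z] z by simp
    finally have "norm (h w) = norm (G ?F (Q z))" by simp
    also have "\<dots> \<le> m ?F" unfolding m_def
      by (rule q(2)[OF F']) (use z in \<open>simp add: Q_def norm_exp_half r_def\<close>)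
    also have "\<dots> \<le> m F" by (rule F(2)[OF F'])
    finally show ?thesis .
  qed
  obtain a b c d where M: "a * d - b * c = 1" "F = H (a, b, c, d)" using F(1) unfolding S_def by blast
  have "G F constant_on ball 0 1"
  proof (rule maximum_modulus_principle[OF G(1)[OF F(1)], of "ball 0 1" "q F"])
    show "q F \<in> ball 0 1" using q(1)[OF F(1)] r by auto
    fix p :: complex assume p: "p \<in> ball 0 1"
    show "norm (G F p) \<le> norm (G F (q F))"
    proof (cases "p = 0")
      case True
      thus ?thesis using q(2)[OF F(1), of 0] r by simp
    next
      case False
      let ?z = "2 / (of_real pi * \<i>) * Ln p"
      have "0 < norm p" "norm p < 1" using False p by auto
      note z = exp_half_upper_half_plane[OF this]
      have "G F p = F ?z" using G(2)[OF F(1) z(2)] z(1) by (simp add: Q_def)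
      also have "\<dots> = h (mob a b c d ?z)" unfolding M(2) H_def using z(2) by simp
      finally show ?thesis using hm[OF Im_mob_pos[OF M(1) z(2)]] by (simp add: m_def)
    qed
  qed auto
  then obtain k where k: "\<And>p. p \<in> ball 0 1 \<Longrightarrow> G F p = k" unfolding constant_on_def by blast
  show ?thesis
  proof (rule that)
    fix w assume w: "Im w > 0"
    have M': "d * a - (- b) * (- c) = 1" using M(1) by (simp add: mult.commute)
    let ?z = "mob d (- b) (- c) a w"
    have z: "Im ?z > 0" by (rule Im_mob_pos[OF M' w])
    have "a * d + b * - c = 1" "a * - b + b * a = 0" "c * d + d * - c = 0" "c * - b + d * a = 1"
      using M(1) by (simp_all add: algebra_simps)
    hence "mob a b c d ?z = w" unfolding mob_mult[OF M' w] by simp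
    hence "h w = F ?z" using z M(2) by (simp add: H_def)
    also have "\<dots> = k" using G(2)[OF F(1) z] k[of "Q ?z"] z by (simp add: Q_def norm_exp_half)
    finally show "h w = k" .
  qed
qed

lemma cusp_growth_mult_power:
  assumes "cusp_growth k h" "f \<in> {thX, thY}"
  shows "cusp_growth (k + int m) (\<lambda>z. h z * f z ^ m)"
  unfolding cusp_growth_def
proof (intro allI impI)
  fix a b c d :: int assume det: "a * d - b * c = 1"
  obtain K Y where K: "Y > 0" "\<And>z. Im z \<ge> Y \<Longrightarrow> wnorm k h (mob a b c d z) \<le> K * (Im z powr (of_int k / 4) * exp (pi * Im z / 4))"
    using assms(1) det unfolding cusp_growth_def by blast
  show "\<exists>K Y. 0 < Y \<and> (\<forall>z. Y \<le> Im z \<longrightarrow> wnorm (k + int m) (\<lambda>z. h z * f z ^ m) (mob a b c d z)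
           \<le> K * (Im z powr (of_int (k + int m) / 4) * exp (pi * Im z / 4)))"
  proof (rule exI[of _ "K * 3 ^ m"], rule exI[of _ "max Y 1"], intro conjI allI impI)
    fix z assume z: "max Y 1 \<le> Im z"
    let ?w = "mob a b c d z"
    have w: "Im ?w > 0" using Im_mob_pos[OF det, of z] z by simp
    have p: "(Im z powr (1/4)) ^ m = Im z powr (of_int (int m) / 4)"
      using z by (simp add: powr_powr flip: powr_realpow)
    have "wnorm (k + int m) (\<lambda>z. h z * f z ^ m) ?w = wnorm k h ?w * wnorm 1 f ?w ^ m"
      using wnorm_mult[OF w, of k "int m" h "\<lambda>z. f z ^ m"] wnorm_power[OF w, of m 1 f] by simp
    also have "\<dots> \<le> (K * (Im z powr (of_int k / 4) * exp (pi * Im z / 4))) * (3 * Im z powr (1/4)) ^ m"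
      using K(2)[of z] z thXY_wnorm_bounded[OF det assms(2), of z] order_trans[OF wnorm_nonneg K(2)[of z]]
      by (intro mult_mono power_mono) auto
    also have "(K * (Im z powr (of_int k / 4) * exp (pi * Im z / 4))) * (3 * Im z powr (1/4)) ^ m =
        K * 3 ^ m * (Im z powr (of_int (k + int m) / 4) * exp (pi * Im z / 4))"
      by (simp add: power_mult_distrib add_divide_distrib powr_add mult_ac p)
    finally show "wnorm (k + int m) (\<lambda>z. h z * f z ^ m) ?w \<le> K * 3 ^ m * (Im z powr (of_int (k + int m) / 4) * exp (pi * Im z / 4))" .
  qed simp
qed

lemma thXY_gamma4:
  assumes "gamma4 a b c d" "Im z > 0" "f \<in> {thX, thY}"
  shows "f (mob a b c d z) = jfac a b c d z * f z"
  using theta_gamma4(2,3)[OF assms(1,2)] assms(3) by auto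

lemma thXY_holomorphic: "f \<in> {thX, thY} \<Longrightarrow> f holomorphic_on upper_half_plane"
  using thX_holomorphic thY_holomorphic by auto

lemma forms1_mult_power:
  assumes "h \<in> forms1 k" "f \<in> {thX, thY}"
  shows "(\<lambda>z. h z * f z ^ m) \<in> forms1 (k + int m)"
proof -
  have "h (mob a b c d z) * f (mob a b c d z) ^ m = jfac a b c d z powi (k + int m) * (h z * f z ^ m)"
    if "gamma4 a b c d" "Im z > 0" for a b c d z
    using assms(1) that jfac_nonzero[OF that] unfolding thXY_gamma4[OF that assms(2)]
    by (simp add: forms1_def power_int_add power_mult_distrib)
  thus ?thesis using assms cusp_growth_mult_power[of k h f m] thXY_holomorphic[of f]
    unfolding forms1_def by (auto intro!: holomorphic_intros)
qed

lemma thY_thX_tendsto: "((\<lambda>y. thY (\<i> * of_real y) / thX (\<i> * of_real y)) \<longlongrightarrow> 0) at_top"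
proof (rule Lim_null_comparison)
  show "\<forall>\<^sub>F y in at_top. norm (thY (\<i> * of_real y) / thX (\<i> * of_real y)) \<le> 6 * exp (- (pi * y / 2))"
  proof (rule eventually_mono[OF eventually_ge_at_top[of 1]])
    fix y :: real assume "1 \<le> y"
    hence y: "Im (\<i> * of_real y) \<ge> 1" by simp
    have "norm (thY (\<i> * of_real y)) / norm (thX (\<i> * of_real y)) \<le> 3 * exp (- (pi * y / 2)) / (1 / 2)"
      using thXY_near[OF y] by (intro frac_le) auto
    thus "norm (thY (\<i> * of_real y) / thX (\<i> * of_real y)) \<le> 6 * exp (- (pi * y / 2))" by (simp add: norm_divide)
  qed
  show "((\<lambda>y. 6 * exp (- (pi * y / 2))) \<longlongrightarrow> 0) at_top" by real_asymp
qed

text \<open>h X^m and h Y^m have weight 0 and are constants u, v with u (Y/X)^m = v. Letting Y/X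
  tend to 0 at infinity gives v = 0.\<close>

lemma forms1_negative:
  assumes "h \<in> forms1 k" "k < 0" "Im z > 0"
  shows "h z = 0"
proof -
  define m where "m = nat (- k)"
  have m: "k + int m = 0" "m > 0" using assms(2) by (auto simp: m_def)
  obtain u where u: "\<And>z. Im z > 0 \<Longrightarrow> h z * thX z ^ m = u"
    using forms1_zero_constant[of "\<lambda>z. h z * thX z ^ m"] forms1_mult_power[OF assms(1), of thX m] m by auto
  obtain v where v: "\<And>z. Im z > 0 \<Longrightarrow> h z * thY z ^ m = v"
    using forms1_zero_constant[of "\<lambda>z. h z * thY z ^ m"] forms1_mult_power[OF assms(1), of thY m] m by auto
  have e: "u * (thY z / thX z) ^ m = v" if "Im z > 0" for z
    using u[OF that] v[OF that] thX_nonzero[OF that] by (auto simp: power_divide field_simps)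
  have "((\<lambda>y. u * (thY (\<i> * of_real y) / thX (\<i> * of_real y)) ^ m) \<longlongrightarrow> u * 0 ^ m) at_top"
    by (intro tendsto_intros thY_thX_tendsto)
  moreover have "\<forall>\<^sub>F y in at_top. u * (thY (\<i> * of_real y) / thX (\<i> * of_real y)) ^ m = v"
    by (rule eventually_mono[OF eventually_gt_at_top[of 0]]) (rule e, simp)
  ultimately have "((\<lambda>y::real. v) \<longlongrightarrow> u * 0 ^ m) at_top" by (simp only: tendsto_cong)
  hence "v = 0" using m(2) by (simp add: power_0_left tendsto_const_iff)
  thus ?thesis using v[OF assms(3)] thY_nonzero[OF assms(3)] by simp
qed

lemma holomorphic_difference_bound:
  assumes "G holomorphic_on ball 0 1"
  obtains B where "B \<ge> 0" "\<And>q. norm q \<le> 1 / 2 \<Longrightarrow> norm (G q - G 0) \<le> B * norm q"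
proof -
  define D where "D q = (if q = 0 then deriv G 0 else (G q - G 0) / (q - 0))" for q
  have "D holomorphic_on ball 0 1" unfolding D_def by (rule pole_lemma[OF assms]) auto
  hence "continuous_on (cball 0 (1/2)) D"
    by (rule continuous_on_subset[OF holomorphic_on_imp_continuous_on]) auto
  hence "bounded (D ` cball 0 (1/2))" by (intro compact_imp_bounded compact_continuous_image) auto
  then obtain B where B: "B > 0" "\<And>q. q \<in> cball 0 (1/2) \<Longrightarrow> norm (D q) \<le> B" unfolding bounded_pos by auto
  show ?thesis
  proof (rule that[of B])
    fix q :: complex assume q: "norm q \<le> 1 / 2"
    have "G q - G 0 = D q * q" by (simp add: D_def)
    thus "norm (G q - G 0) \<le> B * norm q" using B(2)[of q] q by (simp add: norm_mult mult_right_mono)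
  qed (use B in simp)
qed

text \<open>c is the value of h / X^(k+1) at infinity. The difference then vanishes there to first
  order in q = exp(pi i z / 2), just as \<open>thY\<close> does, so the quotient stays bounded.
  Matrices in Gamma_0(4) reduce to this case; for all others \<open>thY_lower_bound\<close> controls
  the division.\<close>

lemma forms1_step:
  assumes h: "h \<in> forms1 (int (Suc k))"
  obtains c where "(\<lambda>z. (h z - c * thX z ^ Suc k) / thY z) \<in> forms1 (int k)"
proof -
  have hol: "h holomorphic_on upper_half_plane" and gr: "cusp_growth (int (Suc k)) h"
    and inv: "\<And>a b c d z. gamma4 a b c d \<Longrightarrow> Im z > 0 \<Longrightarrow> h (mob a b c d z) = jfac a b c d z ^ Suc k * h z"
    using h by (auto simp: forms1_def simp del: power_Suc of_nat_Suc)
  obtain p q r s where P: "gamma4 p q r s" "\<And>z. Im z > 0 \<Longrightarrow> mob 1 0 0 1 (z + 4) = mob p q r s (mob 1 0 0 1 z)"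
    by (rule mob_add_four[of 1 1 0 0]) auto
  obtain K Y where K: "Y > 0" "\<And>z. Im z \<ge> Y \<Longrightarrow> wnorm (int (Suc k)) h (mob 1 0 0 1 z) \<le> K * (Im z powr (of_int (int (Suc k)) / 4) * exp (pi * Im z / 4))"
    using gr[unfolded cusp_growth_def, rule_format, of 1 1 0 0] by auto
  obtain G where G: "G holomorphic_on ball 0 1" "\<And>z. Im z > 0 \<Longrightarrow> h z / thX z ^ Suc k = G (exp (of_real pi * \<i> * z / 2))"
  proof (rule cusp_expansion[of "\<lambda>z. h z / thX z ^ Suc k" "max Y 1" "K * 2 ^ Suc k"])
    show "(\<lambda>z. h z / thX z ^ Suc k) holomorphic_on upper_half_plane"
      using thX_nonzero by (intro holomorphic_intros hol thX_holomorphic) auto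
    show "h (z + 4) / thX (z + 4) ^ Suc k = h z / thX z ^ Suc k" if z: "Im z > 0" for z
    proof -
      have "h (z + 4) = jfac p q r s z ^ Suc k * h z" "thX (z + 4) = jfac p q r s z * thX z"
        using P(2)[OF z] inv[OF P(1) z] theta_gamma4(2)[OF P(1) z] by (simp_all only: mob_id)
      thus ?thesis using jfac_nonzero[OF P(1) z] by (simp add: power_mult_distrib)
    qed
    fix z assume z: "max Y 1 \<le> Im z"
    have "norm (h z) * Im z powr (of_int (int (Suc k)) / 4) \<le> (K * exp (pi * Im z / 4)) * Im z powr (of_int (int (Suc k)) / 4)"
      using K(2)[of z] z by (simp add: wnorm_def mult_ac)
    hence 1: "norm (h z) \<le> K * exp (pi * Im z / 4)" using z by (subst (asm) mult_le_cancel_right) auto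
    have "norm (h z / thX z ^ Suc k) = norm (h z) / norm (thX z) ^ Suc k" by (simp add: norm_divide norm_mult norm_power)
    also have "\<dots> \<le> (K * exp (pi * Im z / 4)) / (1 / 2) ^ Suc k"
      using 1 thXY_near(1)[of z] z by (intro frac_le power_mono order_trans[OF norm_ge_zero 1]) auto
    also have "\<dots> = K * 2 ^ Suc k * exp (pi * Im z / 4)" by (simp add: power_one_over)
    finally show "norm (h z / thX z ^ Suc k) \<le> K * 2 ^ Suc k * exp (pi * Im z / 4)" .
  qed (rule that)
  define c0 where "c0 = G 0"
  obtain B where B: "B \<ge> 0" "\<And>q. norm q \<le> 1 / 2 \<Longrightarrow> norm (G q - G 0) \<le> B * norm q"
    using holomorphic_difference_bound[OF G(1)] by blast
  define f where "f z = (h z - c0 * thX z ^ Suc k) / thY z" for z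
  have f_bound: "norm (f z) \<le> 3 ^ Suc k * B" if z: "Im z \<ge> 1" for z
  proof -
    let ?q = "exp (of_real pi * \<i> * z / 2)"
    have z0: "Im z > 0" using z by simp
    have q: "norm ?q = exp (- (pi * Im z / 2))" by (simp add: norm_exp_half)
    have "pi * Im z / 2 \<ge> pi / 2" using z by (simp add: mult_le_cancel_left1)
    hence "norm ?q \<le> exp (- (pi / 2))" unfolding q by simp
    hence "norm ?q \<le> 1 / 2" using exp_pi_half_bound(1) by linarith
    hence 1: "norm (G ?q - G 0) \<le> B * norm ?q" by (rule B(2))
    have "h z - c0 * thX z ^ Suc k = thX z ^ Suc k * (G ?q - G 0)"
      using G(2)[OF z0] thX_nonzero[OF z0] by (simp add: c0_def field_simps)
    hence "norm (h z - c0 * thX z ^ Suc k) = norm (thX z) ^ Suc k * norm (G ?q - G 0)"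
      by (simp add: norm_mult norm_power)
    also have "\<dots> \<le> 3 ^ Suc k * (B * norm ?q)" using 1 thXY_near(2)[OF z] by (intro mult_mono power_mono) auto
    finally have 2: "norm (h z - c0 * thX z ^ Suc k) \<le> 3 ^ Suc k * B * norm ?q" by simp
    have "norm (f z) = norm (h z - c0 * thX z ^ Suc k) / norm (thY z)" by (simp add: f_def norm_divide)
    also have "\<dots> \<le> (3 ^ Suc k * B * norm ?q) / norm ?q"
      using 2 thXY_near(3)[OF z] B(1) unfolding q by (intro frac_le) auto
    also have "\<dots> = 3 ^ Suc k * B" by simp
    finally show ?thesis .
  qed
  have f_inv: "f (mob a b c d z) = jfac a b c d z ^ k * f z" if M: "gamma4 a b c d" "Im z > 0" for a b c d z
  proof -
    have "h (mob a b c d z) - c0 * thX (mob a b c d z) ^ Suc k = jfac a b c d z ^ Suc k * (h z - c0 * thX z ^ Suc k)"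
      unfolding inv[OF M] theta_gamma4(2)[OF M] by (simp add: power_mult_distrib algebra_simps)
    thus ?thesis unfolding f_def theta_gamma4(3)[OF M] using jfac_nonzero[OF M] by simp
  qed
  have f_eq: "f z * thY z = h z - c0 * thX z ^ Suc k" if "Im z > 0" for z
    using thY_nonzero[OF that] by (simp add: f_def)
  have "cusp_growth (int k) f"
    unfolding cusp_growth_def
  proof (intro allI impI)
    fix a b c d :: int assume det: "a * d - b * c = 1"
    show "\<exists>K Y. 0 < Y \<and> (\<forall>z. Y \<le> Im z \<longrightarrow> wnorm (int k) f (mob a b c d z) \<le> K * (Im z powr (of_int (int k) / 4) * exp (pi * Im z / 4)))"
    proof (cases "c mod 4 = 0")
      case True
      obtain a' b' c' d' n where M: "gamma4 a' b' c' d'" "\<And>z. Im z > 0 \<Longrightarrow> mob a b c d z = mob a' b' c' d' (z + of_int n)"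
        using gamma0_4_decompose[OF det True] by blast
      show ?thesis
      proof (rule exI[of _ "3 ^ Suc k * B"], rule exI[of _ 1], intro conjI allI impI)
        fix z assume z: "1 \<le> Im z"
        let ?w = "z + of_int n"
        have w: "Im ?w = Im z" "Im ?w > 0" using z by auto
        have "wnorm (int k) f (mob a b c d z) = wnorm (int k) f ?w"
          unfolding M(2)[of z, simplified] using z M(2)[of z]
          by (simp add: wnorm_mob[OF _ w(2) theta_gamma4(1)[OF M(1) w(2)]] f_inv[OF M(1) w(2)] norm_mult norm_power gamma4_def[of a' b' c' d', THEN iffD1, OF M(1)])
        also have "\<dots> = norm (f ?w) * Im z powr (of_int (int k) / 4)" unfolding wnorm_def w(1) ..
        also have "\<dots> \<le> (3 ^ Suc k * B) * (Im z powr (of_int (int k) / 4) * exp (pi * Im z / 4))"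
        proof (intro mult_mono f_bound)
          have "exp (pi * Im z / 4) \<ge> 1" using z by simp
          thus "Im z powr (of_int (int k) / 4) \<le> Im z powr (of_int (int k) / 4) * exp (pi * Im z / 4)"
            by (metis mult.right_neutral mult_left_mono powr_ge_zero)
        qed (use w z B in auto)
        finally show "wnorm (int k) f (mob a b c d z) \<le> (3 ^ Suc k * B) * (Im z powr (of_int (int k) / 4) * exp (pi * Im z / 4))" .
      qed simp
    next
      case False
      obtain K Y where K: "Y > 0" "\<And>z. Im z \<ge> Y \<Longrightarrow> wnorm (int (Suc k)) h (mob a b c d z) \<le> K * (Im z powr (of_int (int (Suc k)) / 4) * exp (pi * Im z / 4))"
        using gr det unfolding cusp_growth_def by blast
      show ?thesis
      proof (rule exI[of _ "4 * (K + norm c0 * 3 ^ Suc k)"], rule exI[of _ "max Y 2"], intro conjI allI impI)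
        fix z assume z: "max Y 2 \<le> Im z"
        let ?w = "mob a b c d z"
        define e where "e = exp (pi * Im z / 4)"
        define i where "i = Im z powr (1/4)"
        define t where "t = Im z powr (of_int (int k) / 4)"
        have w: "Im ?w > 0" using Im_mob_pos[OF det, of z] z by simp
        have e: "e \<ge> 1" using z by (simp add: e_def)
        have i: "i > 0" and t: "t > 0" using z by (simp_all add: i_def t_def)
        have ti: "Im z powr (of_int (int (Suc k)) / 4) = t * i"
          unfolding t_def i_def by (simp add: add_divide_distrib powr_add mult.commute)
        have ik: "i ^ Suc k = t * i"
        proof -
          have "i ^ Suc k = (Im z powr (1/4)) powr (real (Suc k))" using z unfolding i_def by (subst powr_realpow) auto
          also have "\<dots> = Im z powr (of_int (int (Suc k)) / 4)" by (simp add: powr_powr)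
          finally show ?thesis unfolding ti .
        qed
        have K2: "wnorm (int (Suc k)) h ?w \<le> K * (t * i * e)"
          using K(2)[of z] z unfolding ti e_def by simp
        have X2: "wnorm 1 thX ?w \<le> 3 * i"
          unfolding i_def by (rule thXY_wnorm_bounded[OF det]) (use z in auto)
        have "wnorm (int k) f ?w * (i / 4) \<le> wnorm (int k) f ?w * wnorm 1 thY ?w"
          using thY_lower_bound[OF det False, of z] z by (intro mult_left_mono) (auto simp: i_def)
        also have "\<dots> = wnorm (int k + 1) (\<lambda>z. f z * thY z) ?w" by (rule wnorm_mult[OF w, symmetric])
        also have "\<dots> = norm (h ?w - c0 * thX ?w ^ Suc k) * Im ?w powr (of_int (int (Suc k)) / 4)"
          unfolding wnorm_def f_eq[OF w] by (simp add: add.commute)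
        also have "\<dots> \<le> (norm (h ?w) + norm c0 * norm (thX ?w ^ Suc k)) * Im ?w powr (of_int (int (Suc k)) / 4)"
          using norm_triangle_ineq4[of "h ?w" "c0 * thX ?w ^ Suc k"] by (intro mult_right_mono) (auto simp: norm_mult)
        also have "\<dots> = wnorm (int (Suc k)) h ?w + norm c0 * wnorm 1 thX ?w ^ Suc k"
          unfolding wnorm_power[OF w, of "Suc k" 1 thX, symmetric] by (simp add: wnorm_def distrib_right)
        also have "\<dots> \<le> K * (t * i * e) + norm c0 * (3 * i) ^ Suc k"
          by (rule add_mono[OF K2 mult_left_mono[OF power_mono[OF X2]]]) auto
        also have "norm c0 * (3 * i) ^ Suc k = norm c0 * 3 ^ Suc k * (t * i * 1)"
          unfolding power_mult_distrib ik by simp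
        also have "\<dots> \<le> norm c0 * 3 ^ Suc k * (t * i * e)"
          using e i t by (intro mult_left_mono) auto
        finally have "wnorm (int k) f ?w * (i / 4) \<le> (4 * (K + norm c0 * 3 ^ Suc k) * (t * e)) * (i / 4)"
          by (simp add: algebra_simps)
        hence "wnorm (int k) f ?w \<le> 4 * (K + norm c0 * 3 ^ Suc k) * (t * e)"
          using i by (subst (asm) mult_le_cancel_right) auto
        thus "wnorm (int k) f ?w \<le> 4 * (K + norm c0 * 3 ^ Suc k) * (Im z powr (of_int (int k) / 4) * exp (pi * Im z / 4))"
          by (simp add: t_def e_def)
      qed simp
    qed
  qed
  moreover have "f holomorphic_on upper_half_plane" unfolding f_def
    using thY_nonzero by (intro holomorphic_intros hol thX_holomorphic thY_holomorphic) auto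
  ultimately have "f \<in> forms1 (int k)" using f_inv by (simp add: forms1_def)
  thus ?thesis using that[of c0] unfolding f_def[abs_def] by blast
qed

theorem forms1_polynomial:
  assumes "h \<in> forms1 (int k)"
  shows "\<exists>c. \<forall>z. Im z > 0 \<longrightarrow> h z = (\<Sum>j\<le>k. c j * thX z ^ (k - j) * thY z ^ j)"
  using assms
proof (induction k arbitrary: h)
  case 0
  then obtain u where "\<And>z. Im z > 0 \<Longrightarrow> h z = u" using forms1_zero_constant[of h] by auto
  thus ?case by (intro exI[of _ "\<lambda>_. u"]) simp
next
  case (Suc k)
  obtain c0 where c0: "(\<lambda>z. (h z - c0 * thX z ^ Suc k) / thY z) \<in> forms1 (int k)" using forms1_step[OF Suc.prems] by blast
  obtain c where c: "\<And>z. Im z > 0 \<Longrightarrow> (h z - c0 * thX z ^ Suc k) / thY z = (\<Sum>j\<le>k. c j * thX z ^ (k - j) * thY z ^ j)"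
    using Suc.IH[OF c0] by blast
  show ?case
  proof (intro exI[of _ "case_nat c0 c"] allI impI)
    fix z assume z: "Im z > 0"
    have "h z = c0 * thX z ^ Suc k + thY z * (\<Sum>j\<le>k. c j * thX z ^ (k - j) * thY z ^ j)"
      unfolding c[OF z, symmetric] using thY_nonzero[OF z] by simp
    also have "\<dots> = (\<Sum>j\<le>Suc k. case_nat c0 c j * thX z ^ (Suc k - j) * thY z ^ j)"
      unfolding sum.atMost_Suc_shift by (simp add: sum_distrib_left mult_ac)
    finally show "h z = (\<Sum>j\<le>Suc k. case_nat c0 c j * thX z ^ (Suc k - j) * thY z ^ j)" .
  qed
qed

section \<open>Modular forms of two variables\<close>

definition mk :: "int \<Rightarrow> int \<Rightarrow> int \<Rightarrow> int \<Rightarrow> int^2^2" where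
  "mk a b c d = vector [vector [a, b], vector [c, d]]"

lemma mk_nth [simp]: "mk a b c d $ 1 $ 1 = a" "mk a b c d $ 1 $ 2 = b" "mk a b c d $ 2 $ 1 = c" "mk a b c d $ 2 $ 2 = d"
  by (simp_all add: mk_def)

lemma mk_eta: "mk (M $ 1 $ 1) (M $ 1 $ 2) (M $ 2 $ 1) (M $ 2 $ 2) = M"
  by (simp add: vec_eq_iff forall_2)

lemma act_mob: "act (mk a b c d) = mob a b c d"
  by (simp add: act_def mob_def moebius_def fun_eq_iff)

lemma mk_SL2Z: "mk a b c d \<in> SL2Z \<longleftrightarrow> a * d - b * c = 1"
  by (simp add: SL2Z_def det_2)

lemma mk_gamma4: "mk a b c d \<in> principal_congruence_subgroup 4 \<longleftrightarrow> gamma4 a b c d"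
  by (auto simp: principal_congruence_subgroup_def mk_SL2Z gamma4_def forall_2 mat_def)

definition delta48 :: "int \<times> int \<times> int \<times> int \<Rightarrow> int \<times> int \<times> int \<times> int \<Rightarrow> bool" where
  "delta48 = (\<lambda>(a, b, c, d) (a', b', c', d'). gamma4 a b c d \<and> gamma4 a' b' c' d' \<and>
     a mod 8 = a' mod 8 \<and> b mod 8 = b' mod 8 \<and> c mod 8 = c' mod 8 \<and> d mod 8 = d' mod 8)"

lemma mk_Delta48: "(mk a b c d, mk a' b' c' d') \<in> Delta48 \<longleftrightarrow> delta48 (a, b, c, d) (a', b', c', d')"
  by (auto simp: Delta48_def delta48_def mk_gamma4 forall_2)

lemma norm_sqrt_factor: "norm (sqrt_factor (mk a b c d) z) = sqrt (norm (of_int c * z + of_int d))"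
  by (simp add: sqrt_factor_def norm_csqrt)

text \<open>The quotient of the two sides without the multiplier has square 1, hence is constant on
  the connected half-plane; this constant is what the definite description picks. The principal root
  is holomorphic because c z + d avoids the negative axis: for c = 0 the congruence forces d =
  1.\<close>

lemma theta_mult_gamma4:
  assumes M: "gamma4 a b c d"
  shows "Im z > 0 \<Longrightarrow> theta 0 0 (mob a b c d z) = theta_mult (mk a b c d) * sqrt_factor (mk a b c d) z * theta 0 0 z"
proof -
  let ?s = "\<lambda>z. csqrt (of_int c * z + of_int d)"
  define q where "q z = theta 0 0 (mob a b c d z) / (?s z * theta 0 0 z)" for z
  have det: "a * d - b * c = 1" using M by (simp add: gamma4_def)
  have nz: "of_int c * z + of_int d \<noteq> 0" if "Im z > 0" for z by (rule mob_denom_nonzero[OF det that])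
  have npos: "of_int c * z + of_int d \<notin> \<real>\<^sub>\<le>\<^sub>0" if z: "Im z > 0" for z
  proof (cases "c = 0")
    case True
    hence "a * d = 1" using det by simp
    hence "d = 1" using M by (auto simp: zmult_eq_1_iff gamma4_def)
    thus ?thesis using True by (simp add: complex_nonpos_Reals_iff)
  next
    case False
    thus ?thesis using z by (simp add: complex_nonpos_Reals_iff)
  qed
  have q2: "q z ^ 2 = 1" if z: "Im z > 0" for z
  proof -
    have "theta 0 0 (mob a b c d z) ^ 2 = (of_int c * z + of_int d) * theta 0 0 z ^ 2"
      unfolding theta_gamma4(5)[OF M z] using theta_gamma4(1)[OF M z] by (auto simp: power_mult_distrib)
    thus ?thesis using nz[OF z] theta_nonzero(1)[OF z] by (simp add: q_def power_divide power_mult_distrib)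
  qed
  have "q constant_on upper_half_plane"
  proof (rule continuous_finite_range_constant[OF connected_upper_half_plane])
    have "(\<lambda>z. theta 0 0 (mob a b c d z)) holomorphic_on upper_half_plane"
    proof (rule holomorphic_on_compose_gen[OF _ theta_holomorphic, unfolded o_def])
      show "mob a b c d holomorphic_on upper_half_plane"
        unfolding mob_def using nz by (intro holomorphic_intros) auto
    qed (use Im_mob_pos[OF det] in auto)
    hence "q holomorphic_on upper_half_plane" unfolding q_def
      using npos nz theta_nonzero(1) by (intro holomorphic_intros theta_holomorphic) auto
    thus "continuous_on upper_half_plane q" by (rule holomorphic_on_imp_continuous_on)
    have "q ` upper_half_plane \<subseteq> {1, -1}"
    proof (rule image_subsetI)
      fix z assume "z \<in> upper_half_plane"
      thus "q z \<in> {1, -1}" using q2[of z] by (simp add: power2_eq_1_iff)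
    qed
    thus "finite (q ` upper_half_plane)" by (rule finite_subset) simp
  qed
  then obtain v where v: "\<And>z. Im z > 0 \<Longrightarrow> q z = v" unfolding constant_on_def by auto
  have qv: "theta 0 0 (mob a b c d z) = v * ?s z * theta 0 0 z" if z: "Im z > 0" for z
    using v[OF z] nz[OF z] theta_nonzero(1)[OF z] by (auto simp: q_def field_simps)
  have "theta_mult (mk a b c d) = v"
    unfolding theta_mult_def
  proof (rule the_equality)
    show "\<forall>z\<in>upper_half_plane. theta 0 0 (act (mk a b c d) z) = v * sqrt_factor (mk a b c d) z * theta 0 0 z"
      using qv by (simp add: act_mob sqrt_factor_def)
    fix v' assume "\<forall>z\<in>upper_half_plane. theta 0 0 (act (mk a b c d) z) = v' * sqrt_factor (mk a b c d) z * theta 0 0 z"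
    hence "v' * ?s \<i> * theta 0 0 \<i> = v * ?s \<i> * theta 0 0 \<i>" using qv[of \<i>] by (simp add: act_mob sqrt_factor_def)
    thus "v' = v" using nz[of \<i>] theta_nonzero(1)[of \<i>] by simp
  qed
  thus "theta 0 0 (mob a b c d z) = theta_mult (mk a b c d) * sqrt_factor (mk a b c d) z * theta 0 0 z" if "Im z > 0"
    using qv[OF that] by (simp add: sqrt_factor_def)
qed

text \<open>The factor v_theta(M) sqrt(c z + d), expressed without a branch. It differs from
  \<open>jfac\<close> by the sign (-1)^((d - 1)/4).\<close>

definition tfac :: "int \<Rightarrow> int \<Rightarrow> int \<Rightarrow> int \<Rightarrow> complex \<Rightarrow> complex" where
  "tfac a b c d z = theta 0 0 (mob a b c d z) / theta 0 0 z"

lemma tfac_eq: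
  assumes "gamma4 a b c d" "Im z > 0"
  shows "tfac a b c d z = theta_mult (mk a b c d) * sqrt_factor (mk a b c d) z"
    "tfac a b c d z = jfac a b c d z * sg ((d - 1) div 4)"
  using theta_mult_gamma4[OF assms] theta_gamma4(5)[OF assms] theta_nonzero(1)[OF assms(2)]
  unfolding tfac_def by simp_all

definition wnorm2 :: "nat \<Rightarrow> (complex \<times> complex \<Rightarrow> complex) \<Rightarrow> complex \<Rightarrow> complex \<Rightarrow> real" where
  "wnorm2 r f z w = norm (f (z, w)) * (Im z powr (real r / 4) * Im w powr (real r / 4))"

text \<open>Since |c z + d|^2 Im(M z) = Im z, the modulus of the root factors can be traded for
  powers of imaginary parts. In this form boundedness at the cusps is a statement about an invariant
  norm.\<close>

lemma regular_term:
  assumes N1: "a * d - b * c = 1" and N2: "a' * d' - b' * c' = 1" and z: "Im z > 0" and w: "Im w > 0"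
  shows "cmod (f (act (mk a b c d) z, act (mk a' b' c' d') w) / (sqrt_factor (mk a b c d) z ^ r * sqrt_factor (mk a' b' c' d') w ^ r)) \<le> K \<longleftrightarrow>
    wnorm2 r f (mob a b c d z) (mob a' b' c' d' w) \<le> K * (Im z powr (real r / 4) * Im w powr (real r / 4))"
proof -
  have s: "norm (sqrt_factor (mk a b c d) z ^ r) * Im (mob a b c d z) powr (real r / 4) = Im z powr (real r / 4)"
    "sqrt_factor (mk a b c d) z \<noteq> 0"
    if M: "a * d - b * c = 1" and z: "Im z > 0" for a b c d z
  proof -
    define n where "n = norm (of_int c * z + of_int d)"
    have n: "n > 0" using mob_denom_nonzero[OF M z] by (simp add: n_def)
    have "Im (mob a b c d z) powr (real r / 4) = Im z powr (real r / 4) / (n ^ 2) powr (real r / 4)"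
      unfolding Im_mob[OF M] n_def[symmetric] using z n by (simp add: powr_divide)
    also have "(n ^ 2) powr (real r / 4) = sqrt n ^ r"
    proof -
      have "(n ^ 2) powr (real r / 4) = (n powr (1 / 2)) powr real r"
        using n by (simp add: powr_powr flip: powr_numeral)
      thus ?thesis using n by (simp add: powr_half_sqrt powr_realpow)
    qed
    finally show "norm (sqrt_factor (mk a b c d) z ^ r) * Im (mob a b c d z) powr (real r / 4) = Im z powr (real r / 4)"
      using n by (simp add: norm_power norm_sqrt_factor n_def)
    show "sqrt_factor (mk a b c d) z \<noteq> 0" using n norm_sqrt_factor[of a b c d z] by (auto simp: n_def)
  qed
  let ?A = "norm (sqrt_factor (mk a b c d) z ^ r)" and ?B = "norm (sqrt_factor (mk a' b' c' d') w ^ r)"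
  let ?p = "Im (mob a b c d z) powr (real r / 4)" and ?q = "Im (mob a' b' c' d' w) powr (real r / 4)"
  have pos: "?A > 0" "?B > 0" "?p > 0" "?q > 0"
    using s(2)[OF N1 z] s(2)[OF N2 w] Im_mob_pos[OF N1 z] Im_mob_pos[OF N2 w] by simp_all
  have "wnorm2 r f (mob a b c d z) (mob a' b' c' d' w) \<le> K * (Im z powr (real r / 4) * Im w powr (real r / 4)) \<longleftrightarrow>
    norm (f (mob a b c d z, mob a' b' c' d' w)) * (?p * ?q) \<le> (K * (?A * ?B)) * (?p * ?q)"
    unfolding wnorm2_def s(1)[OF N1 z, symmetric] s(1)[OF N2 w, symmetric] by (simp add: mult_ac)
  also have "\<dots> \<longleftrightarrow> norm (f (mob a b c d z, mob a' b' c' d' w)) \<le> K * (?A * ?B)"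
    by (rule mult_le_cancel_right_pos) (use pos in simp)
  also have "\<dots> \<longleftrightarrow> norm (f (mob a b c d z, mob a' b' c' d' w)) / (?A * ?B) \<le> K"
    using pos by (subst pos_divide_le_eq) auto
  finally show ?thesis by (simp add: act_mob norm_divide norm_mult)
qed

lemma regular_at_cusps_iff:
  "regular_at_cusps r f \<longleftrightarrow> (\<forall>a b c d a' b' c' d'. a * d - b * c = 1 \<longrightarrow> a' * d' - b' * c' = 1 \<longrightarrow>
     (\<exists>Y>0. \<exists>K. \<forall>z w. Im z \<ge> Y \<longrightarrow> Im w \<ge> Y \<longrightarrow>
        wnorm2 r f (mob a b c d z) (mob a' b' c' d' w) \<le> K * (Im z powr (real r / 4) * Im w powr (real r / 4))))"
    (is "_ \<longleftrightarrow> ?R")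
proof
  assume reg: "regular_at_cusps r f"
  show ?R
  proof (intro allI impI)
    fix a b c d a' b' c' d' :: int assume N: "a * d - b * c = 1" "a' * d' - b' * c' = 1"
    obtain Y K where Y: "Y > 0" "\<And>z w. Im z \<ge> Y \<Longrightarrow> Im w \<ge> Y \<Longrightarrow>
      cmod (f (act (mk a b c d) z, act (mk a' b' c' d') w) / (sqrt_factor (mk a b c d) z ^ r * sqrt_factor (mk a' b' c' d') w ^ r)) \<le> K"
      using reg N unfolding regular_at_cusps_def mk_SL2Z[symmetric] by blast
    have "wnorm2 r f (mob a b c d z) (mob a' b' c' d' w) \<le> K * (Im z powr (real r / 4) * Im w powr (real r / 4))"
      if "Im z \<ge> Y" "Im w \<ge> Y" for z w
      using Y(2)[OF that] regular_term[OF N, of z w f r K] that Y(1) by simp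
    thus "\<exists>Y>0. \<exists>K. \<forall>z w. Im z \<ge> Y \<longrightarrow> Im w \<ge> Y \<longrightarrow>
        wnorm2 r f (mob a b c d z) (mob a' b' c' d' w) \<le> K * (Im z powr (real r / 4) * Im w powr (real r / 4))"
      using Y(1) by blast
  qed
next
  assume R: ?R
  show "regular_at_cusps r f"
    unfolding regular_at_cusps_def
  proof (intro ballI)
    fix N1 N2 assume "N1 \<in> SL2Z" "N2 \<in> SL2Z"
    moreover obtain a b c d a' b' c' d' where e: "N1 = mk a b c d" "N2 = mk a' b' c' d'" using mk_eta by metis
    ultimately have N: "a * d - b * c = 1" "a' * d' - b' * c' = 1" by (simp_all add: mk_SL2Z)
    obtain Y K where Y: "Y > 0" "\<And>z w. Im z \<ge> Y \<Longrightarrow> Im w \<ge> Y \<Longrightarrow>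
        wnorm2 r f (mob a b c d z) (mob a' b' c' d' w) \<le> K * (Im z powr (real r / 4) * Im w powr (real r / 4))"
      using R N by blast
    have "cmod (f (act N1 z, act N2 w) / (sqrt_factor N1 z ^ r * sqrt_factor N2 w ^ r)) \<le> K"
      if "Im z \<ge> Y" "Im w \<ge> Y" for z w
      using Y(2)[OF that] regular_term[OF N, of z w f r K] that Y(1) unfolding e by simp
    thus "\<exists>Y>0. \<exists>K. \<forall>z w. Y \<le> Im z \<longrightarrow> Y \<le> Im w \<longrightarrow>
        cmod (f (act N1 z, act N2 w) / (sqrt_factor N1 z ^ r * sqrt_factor N2 w ^ r)) \<le> K" using Y(1) by blast
  qed
qed

lemma modular_forms_iff:
  "f \<in> modular_forms r \<longleftrightarrow>
     (\<forall>p. p \<notin> upper_half_plane \<times> upper_half_plane \<longrightarrow> f p = 0) \<and>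
     holomorphic2_on f (upper_half_plane \<times> upper_half_plane) \<and> regular_at_cusps r f \<and>
     (\<forall>a b c d a' b' c' d' z w. delta48 (a, b, c, d) (a', b', c', d') \<longrightarrow> Im z > 0 \<longrightarrow> Im w > 0 \<longrightarrow>
       f (mob a b c d z, mob a' b' c' d' w) = tfac a b c d z ^ r * tfac a' b' c' d' w ^ r * f (z, w))"
proof -
  have "(\<forall>(M\<^sub>1, M\<^sub>2)\<in>Delta48. \<forall>z\<in>upper_half_plane. \<forall>w\<in>upper_half_plane.
        f (act M\<^sub>1 z, act M\<^sub>2 w) =
          (theta_mult M\<^sub>1 * theta_mult M\<^sub>2) ^ r * sqrt_factor M\<^sub>1 z ^ r * sqrt_factor M\<^sub>2 w ^ r * f (z, w)) \<longleftrightarrow>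
     (\<forall>a b c d a' b' c' d' z w. delta48 (a, b, c, d) (a', b', c', d') \<longrightarrow> Im z > 0 \<longrightarrow> Im w > 0 \<longrightarrow>
       f (mob a b c d z, mob a' b' c' d' w) = tfac a b c d z ^ r * tfac a' b' c' d' w ^ r * f (z, w))"
    (is "?L \<longleftrightarrow> ?R")
  proof -
    have t: "tfac a b c d z ^ r * tfac a' b' c' d' w ^ r =
       (theta_mult (mk a b c d) * theta_mult (mk a' b' c' d')) ^ r * sqrt_factor (mk a b c d) z ^ r * sqrt_factor (mk a' b' c' d') w ^ r"
      if "delta48 (a, b, c, d) (a', b', c', d')" "Im z > 0" "Im w > 0" for a b c d a' b' c' d' z w
      using that tfac_eq(1)[of a b c d z] tfac_eq(1)[of a' b' c' d' w]
      by (simp add: delta48_def power_mult_distrib mult_ac)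
    show ?thesis
    proof
      assume L: ?L
      show ?R
      proof (intro allI impI)
        fix a b c d a' b' c' d' z w assume A: "delta48 (a, b, c, d) (a', b', c', d')" "Im z > 0" "Im w > 0"
        show "f (mob a b c d z, mob a' b' c' d' w) = tfac a b c d z ^ r * tfac a' b' c' d' w ^ r * f (z, w)"
          unfolding t[OF A] using bspec[OF L A(1)[folded mk_Delta48]] A(2,3) by (simp add: act_mob)
      qed
    next
      assume R: ?R
      show ?L
      proof safe
        fix M1 M2 z w assume A: "(M1, M2) \<in> Delta48" and zw: "z \<in> upper_half_plane" "w \<in> upper_half_plane"
        obtain a b c d a' b' c' d' where e: "M1 = mk a b c d" "M2 = mk a' b' c' d'" using mk_eta by metis
        have D: "delta48 (a, b, c, d) (a', b', c', d')" using A unfolding e mk_Delta48 .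
        have zw': "Im z > 0" "Im w > 0" using zw by auto
        show "f (act M1 z, act M2 w) = (theta_mult M1 * theta_mult M2) ^ r * sqrt_factor M1 z ^ r * sqrt_factor M2 w ^ r * f (z, w)"
          using R[rule_format, OF D zw'] unfolding e act_mob t[OF D zw'] .
      qed
    qed
  qed
  thus ?thesis unfolding modular_forms_def by simp
qed

lemma norm_tfac: "gamma4 a b c d \<Longrightarrow> Im z > 0 \<Longrightarrow> norm (tfac a b c d z) = norm (jfac a b c d z)"
  by (simp add: tfac_eq(2) norm_mult)

lemma wnorm2_delta48:
  assumes D: "delta48 (a, b, c, d) (a', b', c', d')" and zw: "Im z > 0" "Im w > 0"
    and f: "f (mob a b c d z, mob a' b' c' d' w) = tfac a b c d z ^ r * tfac a' b' c' d' w ^ r * f (z, w)"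
  shows "wnorm2 r f (mob a b c d z) (mob a' b' c' d' w) = wnorm2 r f z w"
proof -
  have M: "gamma4 a b c d" "gamma4 a' b' c' d'" using D by (auto simp: delta48_def)
  have i: "norm (jfac a b c d z) ^ r * Im (mob a b c d z) powr (real r / 4) = Im z powr (real r / 4)"
    if M: "gamma4 a b c d" and z: "Im z > 0" for a b c d z
  proof -
    have "wnorm (int r) (\<lambda>v. thX v ^ r) (mob a b c d z) = wnorm (int r) (\<lambda>v. thX v ^ r) z"
      by (rule wnorm_mob[OF _ z theta_gamma4(1)[OF M z]])
         (use M theta_gamma4(2)[OF M z] in \<open>auto simp: gamma4_def norm_mult norm_power power_mult_distrib\<close>)
    thus ?thesis using theta_gamma4(2)[OF M z] thX_nonzero[OF z] 
      by (simp add: wnorm_def norm_mult norm_power power_mult_distrib)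
  qed
  show ?thesis unfolding wnorm2_def f i[OF M(1) zw(1), symmetric] i[OF M(2) zw(2), symmetric]
    by (simp add: norm_mult norm_power norm_tfac[OF M(1) zw(1)] norm_tfac[OF M(2) zw(2)])
qed

lemma sl2_mod_one_gamma4:
  assumes "p * s - q * r = 1" "p mod 8 = 1 mod 8" "q mod 8 = 0" "r mod 8 = 0" "s mod 8 = 1 mod (8::int)"
  shows "gamma4 p q r s"
proof -
  have "x mod 4 = x mod 8 mod 4" for x :: int by (simp add: mod_mod_cancel)
  from this[of p] this[of q] this[of r] this[of s]
  have "p mod 4 = 1" "s mod 4 = 1" "q mod 4 = 0" "r mod 4 = 0" unfolding assms(2-5) by simp_all
  thus ?thesis using assms(1) by (simp add: gamma4_def)
qed

text \<open>Regularity supplies constants for each pair of matrices separately. The invariant norm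
  depends only on residues modulo 8, as Gamma[8] x Gamma[8] lies in Delta(4,8), so finitely many
  constants suffice. The common Y allows one variable to be fixed while the other approaches all
  cusps.\<close>

lemma modular_forms_uniform:
  assumes "f \<in> modular_forms r"
  obtains Y K where "Y \<ge> 1" "\<And>a b c d a' b' c' d' z w. a * d - b * c = 1 \<Longrightarrow> a' * d' - b' * c' = 1 \<Longrightarrow> Im z \<ge> Y \<Longrightarrow> Im w \<ge> Y \<Longrightarrow>
        wnorm2 r f (mob a b c d z) (mob a' b' c' d' w) \<le> K * (Im z powr (real r / 4) * Im w powr (real r / 4))"
proof -
  have reg: "\<And>a b c d a' b' c' d'. a * d - b * c = 1 \<Longrightarrow> a' * d' - b' * c' = 1 \<Longrightarrow>
     (\<exists>Y>0. \<exists>K. \<forall>z w. Im z \<ge> Y \<longrightarrow> Im w \<ge> Y \<longrightarrow>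
        wnorm2 r f (mob a b c d z) (mob a' b' c' d' w) \<le> K * (Im z powr (real r / 4) * Im w powr (real r / 4)))"
   and inv: "\<And>a b c d a' b' c' d' z w. delta48 (a, b, c, d) (a', b', c', d') \<Longrightarrow> Im z > 0 \<Longrightarrow> Im w > 0 \<Longrightarrow>
       f (mob a b c d z, mob a' b' c' d' w) = tfac a b c d z ^ r * tfac a' b' c' d' w ^ r * f (z, w)"
    using assms unfolding modular_forms_iff regular_at_cusps_iff by blast+
  define S where "S = {((a, b, c, d), (a', b', c', d')). a * d - b * c = (1::int) \<and> a' * d' - b' * c' = (1::int)}"
  define H where "H = (\<lambda>((a, b, c, d), (a', b', c', d')) z w. if Im z > 0 \<and> Im w > 0 then wnorm2 r f (mob a b c d z) (mob a' b' c' d' w) else 0)"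
  define res where "res = (\<lambda>((a, b, c, d), (a', b', c', d')). ((a mod (8::int), b mod (8::int), c mod (8::int), d mod (8::int)), (a' mod (8::int), b' mod (8::int), c' mod (8::int), d' mod (8::int))))"
  have fin: "finite (H ` S)"
  proof (rule finite_image_factor[where r = res])
    have "res ` S \<subseteq> ({0..<8} \<times> {0..<8} \<times> {0..<8} \<times> {0..<8}) \<times> ({0..<8} \<times> {0..<8} \<times> {0..<8} \<times> {0..<8})"
      by (auto simp: res_def)
    thus "finite (res ` S)" by (rule finite_subset) auto
    fix s t assume st: "s \<in> S" "t \<in> S" "res s = res t"
    obtain a b c d a' b' c' d' where s: "s = ((a, b, c, d), (a', b', c', d'))" by (metis prod.exhaust)
    obtain e f1 g h e' f1' g' h' where t: "t = ((e, f1, g, h), (e', f1', g', h'))" by (metis prod.exhaust)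
    have dt: "a * d - b * c = 1" "e * h - f1 * g = 1" "a' * d' - b' * c' = 1" "e' * h' - f1' * g' = 1"
      using st(1,2) by (simp_all add: S_def s t)
    have m: "a mod 8 = e mod 8" "b mod 8 = f1 mod 8" "c mod 8 = g mod 8" "d mod 8 = h mod 8"
      "a' mod 8 = e' mod 8" "b' mod 8 = f1' mod 8" "c' mod 8 = g' mod 8" "d' mod 8 = h' mod 8"
      using st(3) by (simp_all add: res_def s t)
    obtain p1 q1 r1 s1 where P1: "p1 * s1 - q1 * r1 = 1" "p1 mod 8 = 1 mod 8" "q1 mod 8 = 0" "r1 mod 8 = 0" "s1 mod 8 = 1 mod 8"
      "\<And>z. Im z > 0 \<Longrightarrow> mob a b c d z = mob p1 q1 r1 s1 (mob e f1 g h z)"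
      by (rule sl2_congruent[OF dt(1,2) m(1-4)]) (rule that; assumption)
    obtain p2 q2 r2 s2 where P2: "p2 * s2 - q2 * r2 = 1" "p2 mod 8 = 1 mod 8" "q2 mod 8 = 0" "r2 mod 8 = 0" "s2 mod 8 = 1 mod 8"
      "\<And>z. Im z > 0 \<Longrightarrow> mob a' b' c' d' z = mob p2 q2 r2 s2 (mob e' f1' g' h' z)"
      by (rule sl2_congruent[OF dt(3,4) m(5-8)]) (rule that; assumption)
    have D: "delta48 (p1, q1, r1, s1) (p2, q2, r2, s2)"
      by (simp only: delta48_def prod.case P1(2-5) P2(2-5) sl2_mod_one_gamma4[OF P1(1-5)] sl2_mod_one_gamma4[OF P2(1-5)] simp_thms)
    have "wnorm2 r f (mob a b c d z) (mob a' b' c' d' w) = wnorm2 r f (mob e f1 g h z) (mob e' f1' g' h' w)"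
      if "Im z > 0" "Im w > 0" for z w
      unfolding P1(6)[OF that(1)] P2(6)[OF that(2)]
      by (intro wnorm2_delta48[OF D] inv[OF D] Im_mob_pos[OF dt(2)] Im_mob_pos[OF dt(4)] that)
    thus "H s = H t" by (simp add: H_def s t fun_eq_iff)
  qed
  have "\<exists>Y K. \<forall>z w. Im z \<ge> max Y 1 \<longrightarrow> Im w \<ge> max Y 1 \<longrightarrow> F z w \<le> K * (Im z powr (real r / 4) * Im w powr (real r / 4))"
    if F: "F \<in> H ` S" for F
  proof -
    obtain a b c d a' b' c' d' where M: "a * d - b * c = 1" "a' * d' - b' * c' = 1" "F = H ((a, b, c, d), (a', b', c', d'))"
      using F unfolding S_def by blast
    obtain Y K where "\<And>z w. Im z \<ge> Y \<Longrightarrow> Im w \<ge> Y \<Longrightarrow>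
        wnorm2 r f (mob a b c d z) (mob a' b' c' d' w) \<le> K * (Im z powr (real r / 4) * Im w powr (real r / 4))"
      using reg[OF M(1,2)] by blast
    thus ?thesis by (intro exI[of _ Y] exI[of _ K]) (auto simp: M(3) H_def)
  qed
  then obtain Y K where YK: "\<And>F z w. F \<in> H ` S \<Longrightarrow> Im z \<ge> max (Y F) 1 \<Longrightarrow> Im w \<ge> max (Y F) 1 \<Longrightarrow>
      F z w \<le> K F * (Im z powr (real r / 4) * Im w powr (real r / 4))" by metis
  define Y0 where "Y0 = Max (insert 1 (Y ` H ` S))"
  define K0 where "K0 = Max (insert 1 (K ` H ` S))"
  have Y0: "Y0 \<ge> 1" "\<And>F. F \<in> H ` S \<Longrightarrow> Y0 \<ge> Y F" and K0: "\<And>F. F \<in> H ` S \<Longrightarrow> K0 \<ge> K F"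
    unfolding Y0_def K0_def using fin by (auto intro!: Max_ge)
  show ?thesis
  proof (rule that[OF Y0(1)])
    fix a b c d a' b' c' d' :: int and z w assume M: "a * d - b * c = 1" "a' * d' - b' * c' = 1" and zw: "Im z \<ge> Y0" "Im w \<ge> Y0"
    let ?F = "H ((a, b, c, d), (a', b', c', d'))"
    have F: "?F \<in> H ` S" using M unfolding S_def by blast
    have "wnorm2 r f (mob a b c d z) (mob a' b' c' d' w) = ?F z w" using zw Y0(1) by (simp add: H_def)
    also have "\<dots> \<le> K ?F * (Im z powr (real r / 4) * Im w powr (real r / 4))"
      by (rule YK[OF F]) (use zw Y0 Y0(2)[OF F] in auto)
    also have "\<dots> \<le> K0 * (Im z powr (real r / 4) * Im w powr (real r / 4))" using K0[OF F] by (intro mult_right_mono) auto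
    finally show "wnorm2 r f (mob a b c d z) (mob a' b' c' d' w) \<le> K0 * (Im z powr (real r / 4) * Im w powr (real r / 4))" .
  qed
qed

section \<open>The quotient of Gamma[4] by Gamma[8] and its characters\<close>

definition cls :: "int \<times> int \<times> int \<times> int \<Rightarrow> bool \<times> bool \<times> bool" where
  "cls = (\<lambda>(a, b, c, d). (odd (b div 4), odd (c div 4), odd ((d - 1) div 4)))"

definition cls_add :: "bool \<times> bool \<times> bool \<Rightarrow> bool \<times> bool \<times> bool \<Rightarrow> bool \<times> bool \<times> bool" where
  "cls_add = (\<lambda>(x, y, t) (x', y', t'). (x \<noteq> x', y \<noteq> y', t \<noteq> t'))"

definition chi :: "bool \<times> bool \<times> bool \<Rightarrow> bool \<times> bool \<times> bool \<Rightarrow> complex" where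
  "chi = (\<lambda>(x, y, t) (x', y', t'). (if x \<and> x' then -1 else 1) * (if y \<and> y' then -1 else 1) * (if t \<and> t' then -1 else 1))"

text \<open>Products of T^4 = (1, 4, 0, 1), its transpose (1, 0, 4, 1) and (5, 8, 8, 13), one for
  each class. The last matrix has (d - 1)/4 odd while b/4 and c/4 are even.\<close>

definition rep :: "bool \<times> bool \<times> bool \<Rightarrow> int \<times> int \<times> int \<times> int" where
  "rep = (\<lambda>(x, y, t). if x then if y then if t then (37, 60, 156, 253) else (1, 4, 4, 17)
     else if t then (5, 28, 8, 45) else (1, 4, 0, 1)
     else if y then if t then (37, 8, 60, 13) else (1, 0, 4, 1)
     else if t then (5, 8, 8, 13) else (1, 0, 0, 1))"

lemma chi_cls_add: "chi u (cls_add v m) = chi u v * chi u m"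
  by (cases u; cases v; cases m) (auto simp: chi_def cls_add_def)

lemma norm_chi [simp]: "norm (chi u v) = 1"
  by (cases u; cases v) (auto simp: chi_def norm_mult)

lemma cls_add_self: "cls_add (cls_add v m) m = v"
  by (cases v; cases m) (auto simp: cls_add_def)

lemma UNIV_bool3: "(UNIV :: (bool \<times> bool \<times> bool) set) =
  {(False, False, False), (False, False, True), (False, True, False), (False, True, True),
   (True, False, False), (True, False, True), (True, True, False), (True, True, True)}"
proof -
  have "p \<in> {(False, False, False), (False, False, True), (False, True, False), (False, True, True),
   (True, False, False), (True, False, True), (True, True, False), (True, True, True)}" for p
    by (cases p) auto
  thus ?thesis by (rule UNIV_eq_I)
qed

lemma sum_chi: "(\<Sum>u\<in>UNIV. chi u v) = (if v = (False, False, False) then 8 else 0)"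
proof (cases v)
  case (fields x y t)
  show ?thesis unfolding UNIV_bool3 fields by (cases x; cases y; cases t) (simp_all add: chi_def)
qed

definition gamma4t :: "int \<times> int \<times> int \<times> int \<Rightarrow> bool" where
  "gamma4t = (\<lambda>(a, b, c, d). gamma4 a b c d)"

lemma rep_gamma4: "gamma4t (rep v)" "cls (rep v) = v"
  by (cases v, auto simp: rep_def gamma4t_def gamma4_def cls_def split: if_splits)+

text \<open>The determinant forces k + n to be divisible by 4, so k and n have the same parity; this
  is why three bits in \<open>cls\<close> suffice.\<close>

lemma gamma4_param:
  assumes "gamma4 a b c d"
  obtains k l m n where "a = 4 * k + 1" "b = 4 * l" "c = 4 * m" "d = 4 * n + 1"
    "k + n = 4 * (l * m - k * n)" "cls (a, b, c, d) = (odd l, odd m, odd n)"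
proof -
  define k l m n where "k = a div 4" and "l = b div 4" and "m = c div 4" and "n = d div 4"
  have e: "a = 4 * k + 1" "b = 4 * l" "c = 4 * m" "d = 4 * n + 1"
  proof -
    have m: "a mod 4 = 1" "b mod 4 = 0" "c mod 4 = 0" "d mod 4 = 1" using assms by (auto simp only: gamma4_def)
    show "a = 4 * k + 1" "d = 4 * n + 1" unfolding k_def n_def using m(1,4) by (metis mult_div_mod_eq)+
    show "b = 4 * l" "c = 4 * m" unfolding l_def m_def using m(2,3) by (metis mult_div_mod_eq add_0_right)+
  qed
  have "(4 * k + 1) * (4 * n + 1) - (4 * l) * (4 * m) = 1" using assms unfolding e by (simp add: gamma4_def)
  hence "k + n = 4 * (l * m - k * n)" by (simp add: algebra_simps)
  with e show ?thesis using that by (simp add: cls_def)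
qed

text \<open>Second-order terms of the product carry a factor 16, so k, l, m, n add up modulo 4. In
  particular \<open>cls\<close> is a homomorphism to a group of exponent 2.\<close>

lemma gamma4_mult:
  assumes "gamma4 a b c d" "gamma4 a' b' c' d'"
  shows "gamma4 (a * a' + b * c') (a * b' + b * d') (c * a' + d * c') (c * b' + d * d')"
    and "cls (a * a' + b * c', a * b' + b * d', c * a' + d * c', c * b' + d * d') = cls_add (cls (a, b, c, d)) (cls (a', b', c', d'))"
proof -
  obtain k l m n where e: "a = 4 * k + 1" "b = 4 * l" "c = 4 * m" "d = 4 * n + 1" "cls (a, b, c, d) = (odd l, odd m, odd n)"
    using gamma4_param[OF assms(1)] by metis
  obtain k' l' m' n' where e': "a' = 4 * k' + 1" "b' = 4 * l'" "c' = 4 * m'" "d' = 4 * n' + 1" "cls (a', b', c', d') = (odd l', odd m', odd n')"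
    using gamma4_param[OF assms(2)] by metis
  have p: "a * a' + b * c' = 4 * (k + k' + 4 * (k * k' + l * m')) + 1" "a * b' + b * d' = 4 * (l + l' + 4 * (k * l' + l * n'))"
    "c * a' + d * c' = 4 * (m + m' + 4 * (m * k' + n * m'))" "c * b' + d * d' = 4 * (n + n' + 4 * (m * l' + n * n')) + 1"
    unfolding e(1-4) e'(1-4) by (simp_all add: algebra_simps)
  have "(a * a' + b * c') * (c * b' + d * d') - (a * b' + b * d') * (c * a' + d * c') = (a * d - b * c) * (a' * d' - b' * c')"
    by (simp add: algebra_simps)
  hence "(a * a' + b * c') * (c * b' + d * d') - (a * b' + b * d') * (c * a' + d * c') = 1"
    using assms by (simp add: gamma4_def)
  moreover have "(4 * x + 1) mod 4 = (1::int)" "(4 * x) mod 4 = (0::int)" for x by presburger+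
  ultimately show "gamma4 (a * a' + b * c') (a * b' + b * d') (c * a' + d * c') (c * b' + d * d')"
    unfolding gamma4_def by (simp only: p simp_thms)
  have h: "cls (4 * x + 1, 4 * y, 4 * t, 4 * s + 1) = (odd y, odd t, odd s)" for x y t s by (simp add: cls_def)
  show "cls (a * a' + b * c', a * b' + b * d', c * a' + d * c', c * b' + d * d') = cls_add (cls (a, b, c, d)) (cls (a', b', c', d'))"
    unfolding p h e(5) e'(5) cls_add_def by auto
qed

lemma gamma4_inverse:
  assumes "gamma4 a b c d"
  shows "gamma4 d (- b) (- c) a" "cls (d, - b, - c, a) = cls (a, b, c, d)"
proof -
  obtain k l m n where e: "a = 4 * k + 1" "b = 4 * l" "c = 4 * m" "d = 4 * n + 1"
    "k + n = 4 * (l * m - k * n)" "cls (a, b, c, d) = (odd l, odd m, odd n)"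
    using gamma4_param[OF assms] by metis
  have mods: "(4 * x + 1) mod 4 = (1::int)" "(- (4 * x)) mod 4 = (0::int)" for x by presburger+
  have "d * a - (- b) * (- c) = 1" using assms by (simp add: gamma4_def mult.commute)
  thus "gamma4 d (- b) (- c) a" unfolding gamma4_def using mods by (simp only: e(1-4) simp_thms)
  have "even (k + n)" unfolding e(5) by simp
  hence "odd k = odd n" by auto
  moreover have "cls (d, - b, - c, a) = (odd (- l), odd (- m), odd k)"
  proof -
    have h: "- b = 4 * (- l)" "- c = 4 * (- m)" unfolding e by simp_all
    have "(4 * y) div 4 = y" "(4 * y + 1 - 1) div 4 = y" for y :: int by simp_all
    thus ?thesis unfolding h e(1) cls_def prod.case by (simp only:)
  qed
  ultimately show "cls (d, - b, - c, a) = cls (a, b, c, d)" unfolding e(6) by simp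
qed

text \<open>In other words, the kernel of \<open>cls\<close> is Gamma[8].\<close>

lemma cls_congruent:
  assumes "gamma4 a b c d" "gamma4 a' b' c' d'" "cls (a, b, c, d) = cls (a', b', c', d')"
  shows "a mod 8 = a' mod 8 \<and> b mod 8 = b' mod 8 \<and> c mod 8 = c' mod 8 \<and> d mod 8 = d' mod 8"
proof -
  obtain k l m n where e: "a = 4 * k + 1" "b = 4 * l" "c = 4 * m" "d = 4 * n + 1"
    "k + n = 4 * (l * m - k * n)" "cls (a, b, c, d) = (odd l, odd m, odd n)"
    using gamma4_param[OF assms(1)] by metis
  obtain k' l' m' n' where e': "a' = 4 * k' + 1" "b' = 4 * l'" "c' = 4 * m'" "d' = 4 * n' + 1"
    "k' + n' = 4 * (l' * m' - k' * n')" "cls (a', b', c', d') = (odd l', odd m', odd n')"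
    using gamma4_param[OF assms(2)] by metis
  have "even (k + n)" "even (k' + n')" unfolding e(5) e'(5) by simp_all
  hence par: "even k = even k'" "even l = even l'" "even m = even m'" "even n = even n'"
    using assms(3) unfolding e(6) e'(6) by auto
  have *: "(4 * x + 1) mod 8 = (4 * y + 1) mod 8" "(4 * x) mod 8 = (4 * y) mod 8" if "even x = even y" for x y :: int
  proof -
    have "even (x - y)" using that by simp
    then obtain j where "x - y = 2 * j" by (rule evenE)
    hence "x = y + 2 * j" by simp
    hence "4 * x = 4 * y + 8 * j" "4 * x + 1 = 4 * y + 1 + 8 * j" by simp_all
    thus "(4 * x + 1) mod 8 = (4 * y + 1) mod 8" "(4 * x) mod 8 = (4 * y) mod 8" by (simp_all only: mod_mult_self2)
  qed
  show ?thesis unfolding e(1-4) e'(1-4)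
    by (intro conjI *(1)[OF par(1)] *(2)[OF par(2)] *(2)[OF par(3)] *(1)[OF par(4)])
qed

lemma delta48_same: "gamma4 a b c d \<Longrightarrow> delta48 (a, b, c, d) (a, b, c, d)"
  by (simp add: delta48_def)

lemma gamma4_id: "gamma4 1 0 0 1" by (simp add: gamma4_def)

lemma tfac_theta: "Im z > 0 \<Longrightarrow> theta 0 0 (mob a b c d z) = tfac a b c d z * theta 0 0 z"
  using theta_nonzero(1) by (simp add: tfac_def)

lemma tfac_nonzero: "gamma4 a b c d \<Longrightarrow> Im z > 0 \<Longrightarrow> tfac a b c d z \<noteq> 0"
  using theta_nonzero(1) Im_mob_pos by (simp add: tfac_def gamma4_def)

lemma holomorphic2_slice:
  assumes "holomorphic2_on f (upper_half_plane \<times> upper_half_plane)"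
  shows "Im w > 0 \<Longrightarrow> (\<lambda>z. f (z, w)) holomorphic_on upper_half_plane"
    and "Im z > 0 \<Longrightarrow> (\<lambda>w. f (z, w)) holomorphic_on upper_half_plane"
proof -
  have d: "\<exists>\<alpha> \<beta>. (f has_derivative (\<lambda>(h, k). \<alpha> * h + \<beta> * k)) (at (z, w))" if "Im z > 0" "Im w > 0" for z w
    using assms that unfolding holomorphic2_on_def by auto
  show "(\<lambda>z. f (z, w)) holomorphic_on upper_half_plane" if w: "Im w > 0"
    unfolding holomorphic_on_open[OF open_upper_half_plane]
  proof
    fix z assume "z \<in> upper_half_plane"
    hence z: "Im z > 0" by simp
    obtain \<alpha> \<beta> where fd: "(f has_derivative (\<lambda>(h, k). \<alpha> * h + \<beta> * k)) (at (z, w))" using d[OF z w] by blast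
    have "((\<lambda>z. f (z, w)) has_derivative (\<lambda>h. (\<lambda>(h, k). \<alpha> * h + \<beta> * k) (h, 0))) (at z)"
      by (rule has_derivative_compose[where f = "\<lambda>z. (z, w)" and f' = "\<lambda>h. (h, 0)" and x = z and s = UNIV, OF _ fd])
         (auto intro!: derivative_eq_intros)
    thus "\<exists>f'. ((\<lambda>z. f (z, w)) has_field_derivative f') (at z)" by (auto simp: has_field_derivative_def)
  qed
  show "(\<lambda>w. f (z, w)) holomorphic_on upper_half_plane" if z: "Im z > 0"
    unfolding holomorphic_on_open[OF open_upper_half_plane]
  proof
    fix w assume "w \<in> upper_half_plane"
    hence w: "Im w > 0" by simp
    obtain \<alpha> \<beta> where fd: "(f has_derivative (\<lambda>(h, k). \<alpha> * h + \<beta> * k)) (at (z, w))" using d[OF z w] by blast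
    have "((\<lambda>w. f (z, w)) has_derivative (\<lambda>h. (\<lambda>(h, k). \<alpha> * h + \<beta> * k) (0, h))) (at w)"
      by (rule has_derivative_compose[where f = "\<lambda>w. (z, w)" and f' = "\<lambda>h. (0, h)" and x = w and s = UNIV, OF _ fd])
         (auto intro!: derivative_eq_intros)
    thus "\<exists>f'. ((\<lambda>w. f (z, w)) has_field_derivative f') (at w)" by (auto simp: has_field_derivative_def)
  qed
qed

lemma mob_holomorphic:
  assumes "a * d - b * c = 1" shows "mob a b c d holomorphic_on upper_half_plane"
  unfolding mob_def using mob_denom_nonzero[OF assms] by (intro holomorphic_intros) auto

text \<open>The isotypic components of a form under \<open>\<Gamma>[4] / \<Gamma>[8]\<close>, acting on the first variable.\<close>

definition quot_form :: "nat \<Rightarrow> (complex \<times> complex \<Rightarrow> complex) \<Rightarrow> complex \<Rightarrow> complex \<Rightarrow> complex" where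
  "quot_form r f z w = f (z, w) / (theta 0 0 z * theta 0 0 w) ^ r"

definition twist :: "nat \<Rightarrow> (complex \<times> complex \<Rightarrow> complex) \<Rightarrow> bool \<times> bool \<times> bool \<Rightarrow> complex \<Rightarrow> complex \<Rightarrow> complex" where
  "twist r f v z w = (case rep v of (a, b, c, d) \<Rightarrow> quot_form r f (mob a b c d z) w)"

definition component :: "nat \<Rightarrow> (complex \<times> complex \<Rightarrow> complex) \<Rightarrow> bool \<times> bool \<times> bool \<Rightarrow> complex \<Rightarrow> complex \<Rightarrow> complex" where
  "component r f u z w = (\<Sum>v\<in>UNIV. chi u v * twist r f v z w) / 8 * (theta 0 0 z * theta 0 0 w) ^ r"

context
  fixes f :: "complex \<times> complex \<Rightarrow> complex" and r :: nat
  assumes f: "f \<in> modular_forms r"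
begin

lemma f_hol: "holomorphic2_on f (upper_half_plane \<times> upper_half_plane)"
  using f by (simp add: modular_forms_iff)

lemma quot_form_invariant:
  assumes "delta48 (a, b, c, d) (a', b', c', d')" "Im z > 0" "Im w > 0"
  shows "quot_form r f (mob a b c d z) (mob a' b' c' d' w) = quot_form r f z w"
proof -
  have M: "gamma4 a b c d" "gamma4 a' b' c' d'" using assms(1) by (auto simp: delta48_def)
  have "f (mob a b c d z, mob a' b' c' d' w) = tfac a b c d z ^ r * tfac a' b' c' d' w ^ r * f (z, w)"
    using f assms unfolding modular_forms_iff by blast
  thus ?thesis unfolding quot_form_def tfac_theta[OF assms(2)] tfac_theta[OF assms(3)]
    using tfac_nonzero[OF M(1) assms(2)] tfac_nonzero[OF M(2) assms(3)] by (simp add: power_mult_distrib mult_ac)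
qed

text \<open>Delta(4,8) contains Gamma[8] x 1, and dividing by the theta power has removed the
  automorphy factor, so only the class of the matrix matters and it may be exchanged for the
  representative.\<close>

lemma quot_form_twist:
  assumes M: "gamma4 a b c d" and zw: "Im z > 0" "Im w > 0"
  shows "quot_form r f (mob a b c d z) w = twist r f (cls (a, b, c, d)) z w"
proof -
  obtain a' b' c' d' where e: "rep (cls (a, b, c, d)) = (a', b', c', d')" by (metis prod.exhaust)
  have M': "gamma4 a' b' c' d'" and cl: "cls (a', b', c', d') = cls (a, b, c, d)"
    using rep_gamma4[of "cls (a, b, c, d)"] unfolding e by (auto simp: gamma4t_def)
  have det: "a * d - b * c = 1" "a' * d' - b' * c' = 1" using M M' by (auto simp: gamma4_def)
  note m = cls_congruent[OF M M' cl[symmetric], THEN conjunct1]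
    cls_congruent[OF M M' cl[symmetric], THEN conjunct2, THEN conjunct1]
    cls_congruent[OF M M' cl[symmetric], THEN conjunct2, THEN conjunct2, THEN conjunct1]
    cls_congruent[OF M M' cl[symmetric], THEN conjunct2, THEN conjunct2, THEN conjunct2]
  obtain p q r1 s where P: "p * s - q * r1 = 1" "p mod 8 = 1 mod 8" "q mod 8 = 0" "r1 mod 8 = 0" "s mod 8 = 1 mod 8"
      "\<And>z. Im z > 0 \<Longrightarrow> mob a b c d z = mob p q r1 s (mob a' b' c' d' z)"
    by (rule sl2_congruent[OF det m]) (rule that; assumption)
  have "delta48 (p, q, r1, s) (1, 0, 0, 1)"
    by (simp only: delta48_def prod.case P(2-5) sl2_mod_one_gamma4[OF P(1-5)] gamma4_id simp_thms) simp
  from quot_form_invariant[OF this Im_mob_pos[OF det(2) zw(1)] zw(2)]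
  show ?thesis unfolding P(6)[OF zw(1)] twist_def e by simp
qed

lemma twist_first:
  assumes M: "gamma4 a b c d" and zw: "Im z > 0" "Im w > 0"
  shows "twist r f v (mob a b c d z) w = twist r f (cls_add v (cls (a, b, c, d))) z w"
proof -
  obtain a' b' c' d' where e: "rep v = (a', b', c', d')" by (metis prod.exhaust)
  have M': "gamma4 a' b' c' d'" and cl: "cls (a', b', c', d') = v" using rep_gamma4[of v] unfolding e by (auto simp: gamma4t_def)
  have det: "a * d - b * c = 1" using M by (simp add: gamma4_def)
  show ?thesis unfolding twist_def[of r f v] e prod.case mob_mult[OF det zw(1)]
    using quot_form_twist[OF gamma4_mult(1)[OF M' M] zw] gamma4_mult(2)[OF M' M] cl by simp
qed

text \<open>Delta(4,8) contains the diagonal Gamma[4]. Moving M past the representative conjugates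
  it, which does not change its class because the quotient group is abelian; p', q', s', t' are the
  entries of that conjugate.\<close>

lemma twist_both:
  assumes M: "gamma4 a b c d" and zw: "Im z > 0" "Im w > 0"
  shows "twist r f v (mob a b c d z) (mob a b c d w) = twist r f v z w"
proof -
  obtain a' b' c' d' where e: "rep v = (a', b', c', d')" by (metis prod.exhaust)
  have M': "gamma4 a' b' c' d'" and cl: "cls (a', b', c', d') = v" using rep_gamma4[of v] unfolding e by (auto simp: gamma4t_def)
  have det: "a * d - b * c = 1" "a' * d' - b' * c' = 1" using M M' by (auto simp: gamma4_def)
  note M1 = gamma4_inverse[OF M]
  define p q s t where "p = a' * a + b' * c" and "q = a' * b + b' * d" and "s = c' * a + d' * c" and "t = c' * b + d' * d"
  have P: "gamma4 p q s t" "cls (p, q, s, t) = cls_add v (cls (a, b, c, d))"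
    unfolding p_def q_def s_def t_def using gamma4_mult[OF M' M] cl by simp_all
  define p' q' s' t' where "p' = d * p + (- b) * s" and "q' = d * q + (- b) * t" and "s' = (- c) * p + a * s" and "t' = (- c) * q + a * t"
  have P': "gamma4 p' q' s' t'" "cls (p', q', s', t') = cls_add (cls (a, b, c, d)) (cls (p, q, s, t))"
    unfolding p'_def q'_def s'_def t'_def using gamma4_mult[OF M1(1) P(1)] M1(2) by simp_all
  have v: "cls (p', q', s', t') = v" unfolding P'(2) P(2) by (cases v; cases "cls (a, b, c, d)") (auto simp: cls_add_def)
  have dP': "p' * t' - q' * s' = 1" using P' by (simp add: gamma4_def)
  have "a * p' + b * s' = (a * d - b * c) * p" "a * q' + b * t' = (a * d - b * c) * q"
    "c * p' + d * s' = (a * d - b * c) * s" "c * q' + d * t' = (a * d - b * c) * t"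
    unfolding p'_def q'_def s'_def t'_def by (simp_all add: algebra_simps)
  hence pr: "a * p' + b * s' = p" "a * q' + b * t' = q" "c * p' + d * s' = s" "c * q' + d * t' = t" using det(1) by simp_all
  have "mob a' b' c' d' (mob a b c d z) = mob p q s t z"
    unfolding mob_mult[OF det(1) zw(1)] p_def q_def s_def t_def ..
  also have "\<dots> = mob a b c d (mob p' q' s' t' z)" unfolding mob_mult[OF dP' zw(1)] pr ..
  finally have "twist r f v (mob a b c d z) (mob a b c d w) = quot_form r f (mob a b c d (mob p' q' s' t' z)) (mob a b c d w)"
    by (simp add: twist_def e)
  also have "\<dots> = quot_form r f (mob p' q' s' t' z) w"
    by (rule quot_form_invariant[OF delta48_same[OF M] Im_mob_pos[OF dP' zw(1)] zw(2)])
  also have "\<dots> = twist r f v z w" using quot_form_twist[OF P'(1) zw] v by simp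
  finally show ?thesis .
qed

text \<open>Adding the class of M permutes the summands of the character sum, and multiplicativity
  of \<open>chi\<close> pulls out the factor.\<close>

lemma component_first:
  assumes M: "gamma4 a b c d" and zw: "Im z > 0" "Im w > 0"
  shows "component r f u (mob a b c d z) w = chi u (cls (a, b, c, d)) * tfac a b c d z ^ r * component r f u z w"
proof -
  let ?m = "cls (a, b, c, d)"
  have "(\<Sum>v\<in>UNIV. chi u v * twist r f v (mob a b c d z) w) = (\<Sum>v\<in>UNIV. chi u v * twist r f (cls_add v ?m) z w)"
    by (simp add: twist_first[OF M zw])
  also have "\<dots> = (\<Sum>v\<in>UNIV. chi u (cls_add v ?m) * twist r f v z w)"
    by (rule sum.reindex_bij_witness[of _ "\<lambda>v. cls_add v ?m" "\<lambda>v. cls_add v ?m"]) (auto simp: cls_add_self)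
  also have "\<dots> = chi u ?m * (\<Sum>v\<in>UNIV. chi u v * twist r f v z w)"
    by (simp add: chi_cls_add sum_distrib_left mult_ac)
  finally show ?thesis unfolding component_def tfac_theta[OF zw(1)] by (simp add: power_mult_distrib mult_ac)
qed

text \<open>By \<open>twist_both\<close>, M on the second variable can be traded for M^(-1) on the
  first. Both have the same class, so the same character appears as in
  \<open>component_first\<close>.\<close>

lemma component_second:
  assumes M: "gamma4 a b c d" and zw: "Im z > 0" "Im w > 0"
  shows "component r f u z (mob a b c d w) = chi u (cls (a, b, c, d)) * tfac a b c d w ^ r * component r f u z w"
proof -
  have det: "a * d - b * c = 1" using M by (simp add: gamma4_def)
  note M1 = gamma4_inverse[OF M]
  have det1: "d * a - (- b) * (- c) = 1" using M1(1) by (simp add: gamma4_def)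
  let ?z = "mob d (- b) (- c) a z"
  have z: "Im ?z > 0" by (rule Im_mob_pos[OF det1 zw(1)])
  have "a * d + b * - c = 1" "a * - b + b * a = 0" "c * d + d * - c = 0" "c * - b + d * a = 1"
    using det by (simp_all add: algebra_simps)
  hence bk: "mob a b c d ?z = z" unfolding mob_mult[OF det1 zw(1)] by simp
  have "(\<Sum>v\<in>UNIV. chi u v * twist r f v z (mob a b c d w)) = (\<Sum>v\<in>UNIV. chi u v * twist r f v ?z w)"
    using twist_both[OF M z zw(2)] unfolding bk by simp
  also have "\<dots> = (\<Sum>v\<in>UNIV. chi u v * twist r f (cls_add v (cls (a, b, c, d))) z w)"
    using twist_first[OF M1(1) zw] M1(2) by simp
  also have "\<dots> = (\<Sum>v\<in>UNIV. chi u (cls_add v (cls (a, b, c, d))) * twist r f v z w)"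
    by (rule sum.reindex_bij_witness[of _ "\<lambda>v. cls_add v (cls (a, b, c, d))" "\<lambda>v. cls_add v (cls (a, b, c, d))"]) (auto simp: cls_add_self)
  also have "\<dots> = chi u (cls (a, b, c, d)) * (\<Sum>v\<in>UNIV. chi u v * twist r f v z w)"
    by (simp add: chi_cls_add sum_distrib_left mult_ac)
  finally show ?thesis unfolding component_def tfac_theta[OF zw(2)] by (simp add: power_mult_distrib mult_ac)
qed

lemma sum_component:
  assumes "Im z > 0" "Im w > 0"
  shows "(\<Sum>u\<in>UNIV. component r f u z w) = f (z, w)"
proof -
  have t: "twist r f (False, False, False) z w = quot_form r f z w" by (simp add: twist_def rep_def)
  have "(\<Sum>u\<in>UNIV. \<Sum>v\<in>UNIV. chi u v * twist r f v z w) = (\<Sum>v\<in>UNIV. (\<Sum>u\<in>UNIV. chi u v) * twist r f v z w)"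
    unfolding sum_distrib_right by (rule sum.swap)
  also have "\<dots> = (\<Sum>v\<in>UNIV. if v = (False, False, False) then 8 * twist r f v z w else 0)"
    unfolding sum_chi by (intro sum.cong) auto
  also have "\<dots> = 8 * quot_form r f z w" by (simp add: t)
  finally have "(\<Sum>u\<in>UNIV. component r f u z w) = quot_form r f z w * (theta 0 0 z * theta 0 0 w) ^ r"
    unfolding component_def by (simp flip: sum_distrib_right sum_divide_distrib)
  thus ?thesis using theta_nonzero(1)[OF assms(1)] theta_nonzero(1)[OF assms(2)] by (simp add: quot_form_def)
qed

lemma twist_holomorphic:
  shows "Im w > 0 \<Longrightarrow> (\<lambda>z. twist r f v z w) holomorphic_on upper_half_plane"
    and "Im z > 0 \<Longrightarrow> (\<lambda>w. twist r f v z w) holomorphic_on upper_half_plane"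
proof -
  obtain a b c d where e: "rep v = (a, b, c, d)" by (metis prod.exhaust)
  have det: "a * d - b * c = 1" using rep_gamma4(1)[of v] unfolding e by (simp add: gamma4t_def gamma4_def)
  have m: "mob a b c d ` upper_half_plane \<subseteq> upper_half_plane" using Im_mob_pos[OF det] by auto
  show "(\<lambda>z. twist r f v z w) holomorphic_on upper_half_plane" if w: "Im w > 0"
  proof -
    have "(\<lambda>z. quot_form r f z w) holomorphic_on upper_half_plane" unfolding quot_form_def
      using theta_nonzero(1) w by (intro holomorphic_intros holomorphic2_slice[OF f_hol] theta_holomorphic) auto
    from holomorphic_on_compose_gen[OF mob_holomorphic[OF det] this m]
    show ?thesis by (simp add: twist_def e o_def)
  qed
  show "(\<lambda>w. twist r f v z w) holomorphic_on upper_half_plane" if z: "Im z > 0"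
    unfolding twist_def e prod.case quot_form_def
    using theta_nonzero(1) z Im_mob_pos[OF det z] by (intro holomorphic_intros holomorphic2_slice[OF f_hol] theta_holomorphic) auto
qed

lemma component_holomorphic:
  shows "Im w > 0 \<Longrightarrow> (\<lambda>z. component r f u z w) holomorphic_on upper_half_plane"
    and "Im z > 0 \<Longrightarrow> (\<lambda>w. component r f u z w) holomorphic_on upper_half_plane"
  unfolding component_def by (intro holomorphic_intros twist_holomorphic theta_holomorphic; simp)+

text \<open>The invariant norm of theta_00 is unchanged under Gamma[4], so the norm of a twist is
  the norm of f at the moved point. A component is an average of eight twists weighted by numbers of
  modulus 1.\<close>

lemma component_growth:
  obtains Y K where "Y \<ge> 1" "\<And>u a b c d a' b' c' d' z w. a * d - b * c = 1 \<Longrightarrow> a' * d' - b' * c' = 1 \<Longrightarrow> Im z \<ge> Y \<Longrightarrow> Im w \<ge> Y \<Longrightarrow>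
      wnorm2 r (\<lambda>(z, w). component r f u z w) (mob a b c d z) (mob a' b' c' d' w) \<le> K * (Im z powr (real r / 4) * Im w powr (real r / 4))"
proof -
  obtain Y K where Y: "Y \<ge> 1" and YK: "\<And>a b c d a' b' c' d' z w. a * d - b * c = 1 \<Longrightarrow> a' * d' - b' * c' = 1 \<Longrightarrow> Im z \<ge> Y \<Longrightarrow> Im w \<ge> Y \<Longrightarrow>
        wnorm2 r f (mob a b c d z) (mob a' b' c' d' w) \<le> K * (Im z powr (real r / 4) * Im w powr (real r / 4))"
    using modular_forms_uniform[OF f] by metis
  have tw: "norm (twist r f v z w * (theta 0 0 z * theta 0 0 w) ^ r) * (Im z powr (real r / 4) * Im w powr (real r / 4))
      = wnorm2 r f (mob a b c d z) w"
    if e: "rep v = (a, b, c, d)" and zw: "Im z > 0" "Im w > 0" for v a b c d z w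
  proof -
    have M: "gamma4 a b c d" using rep_gamma4(1)[of v] unfolding e by (simp add: gamma4t_def)
    have nz: "theta 0 0 (mob a b c d z) \<noteq> 0" "theta 0 0 w \<noteq> 0"
      using M Im_mob_pos[of a d b c z] theta_nonzero(1) zw by (auto simp: gamma4_def)
    have "wnorm 1 (theta 0 0) (mob a b c d z) = wnorm 1 (theta 0 0) z"
      by (rule wnorm_mob[OF _ zw(1) theta_gamma4(1)[OF M zw(1)]])
         (use M theta_gamma4(5)[OF M zw(1)] in \<open>auto simp: gamma4_def norm_mult\<close>)
    hence "wnorm 1 (theta 0 0) z ^ r = wnorm 1 (theta 0 0) (mob a b c d z) ^ r" by simp
    moreover have "(Im x powr (1 / 4)) ^ r = Im x powr (real r / 4)" if "Im x > 0" for x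
      using that by (simp add: powr_powr flip: powr_realpow)
    ultimately have th: "norm (theta 0 0 z) ^ r * Im z powr (real r / 4) = norm (theta 0 0 (mob a b c d z)) ^ r * Im (mob a b c d z) powr (real r / 4)"
      using zw(1) M Im_mob_pos[of a d b c z] by (simp add: wnorm_def power_mult_distrib gamma4_def)
    have "norm (twist r f v z w * (theta 0 0 z * theta 0 0 w) ^ r) * (Im z powr (real r / 4) * Im w powr (real r / 4)) =
      norm (f (mob a b c d z, w)) / (norm (theta 0 0 (mob a b c d z)) ^ r * norm (theta 0 0 w) ^ r) *
      (norm (theta 0 0 z) ^ r * Im z powr (real r / 4)) * (norm (theta 0 0 w) ^ r * Im w powr (real r / 4))"
      by (simp add: twist_def e quot_form_def norm_mult norm_divide norm_power power_mult_distrib mult_ac)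
    also have "\<dots> = wnorm2 r f (mob a b c d z) w" unfolding th wnorm2_def using nz by simp
    finally show ?thesis .
  qed
  show ?thesis
  proof (rule that[OF Y])
    fix u and a b c d a' b' c' d' :: int and z w
    assume N: "a * d - b * c = 1" "a' * d' - b' * c' = 1" and zw: "Im z \<ge> Y" "Im w \<ge> Y"
    let ?z = "mob a b c d z" and ?w = "mob a' b' c' d' w"
    have zw0: "Im z > 0" "Im w > 0" using zw Y by auto
    have zw': "Im ?z > 0" "Im ?w > 0" using Im_mob_pos[OF N(1) zw0(1)] Im_mob_pos[OF N(2) zw0(2)] by auto
    let ?p = "Im ?z powr (real r / 4) * Im ?w powr (real r / 4)"
    have b: "norm (twist r f v ?z ?w * (theta 0 0 ?z * theta 0 0 ?w) ^ r) * ?p \<le> K * (Im z powr (real r / 4) * Im w powr (real r / 4))" for v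
    proof -
      obtain p q s t where e: "rep v = (p, q, s, t)" by (metis prod.exhaust)
      have det: "p * t - q * s = 1" using rep_gamma4(1)[of v] unfolding e by (simp add: gamma4t_def gamma4_def)
      have "(p * a + q * c) * (s * b + t * d) - (p * b + q * d) * (s * a + t * c) = (p * t - q * s) * (a * d - b * c)"
        by (simp add: algebra_simps)
      hence "(p * a + q * c) * (s * b + t * d) - (p * b + q * d) * (s * a + t * c) = 1" using det N(1) by simp
      from YK[OF this N(2) zw] show ?thesis unfolding tw[OF e zw'] mob_mult[OF N(1) zw0(1)] .
    qed
    have "component r f u ?z ?w = (\<Sum>v\<in>UNIV. chi u v * (twist r f v ?z ?w * (theta 0 0 ?z * theta 0 0 ?w) ^ r)) / 8"
      unfolding component_def by (simp only: sum_distrib_right times_divide_eq_left mult.assoc)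
    moreover have "norm ((\<Sum>v\<in>UNIV. chi u v * A v) / 8) \<le> (\<Sum>v\<in>UNIV. norm (A v)) / 8" for A
      using norm_sum[of "\<lambda>v. chi u v * A v" UNIV] by (simp add: norm_divide norm_mult)
    ultimately have "norm (component r f u ?z ?w) \<le> (\<Sum>v\<in>UNIV. norm (twist r f v ?z ?w * (theta 0 0 ?z * theta 0 0 ?w) ^ r)) / 8"
      by (simp only:)
    hence "norm (component r f u ?z ?w) * ?p \<le> (\<Sum>v\<in>UNIV. norm (twist r f v ?z ?w * (theta 0 0 ?z * theta 0 0 ?w) ^ r)) / 8 * ?p"
      by (intro mult_right_mono) auto
    also have "\<dots> = (\<Sum>v\<in>UNIV. norm (twist r f v ?z ?w * (theta 0 0 ?z * theta 0 0 ?w) ^ r) * ?p) / 8"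
      by (simp add: sum_distrib_right)
    also have "\<dots> \<le> (\<Sum>v\<in>(UNIV :: (bool \<times> bool \<times> bool) set). K * (Im z powr (real r / 4) * Im w powr (real r / 4))) / 8"
      by (intro divide_right_mono sum_mono b) auto
    also have "\<dots> = K * (Im z powr (real r / 4) * Im w powr (real r / 4))" by (simp add: card_UNIV_bool card_cartesian_product flip: UNIV_Times_UNIV)
    finally show "wnorm2 r (\<lambda>(z, w). component r f u z w) ?z ?w \<le> K * (Im z powr (real r / 4) * Im w powr (real r / 4))"
      by (simp add: wnorm2_def)
  qed
qed

end

section \<open>Theta monomials and division by them\<close>

definition thS :: "nat \<times> nat \<times> nat \<Rightarrow> complex \<Rightarrow> complex" where
  "thS = (\<lambda>(i, j, k) z. theta 0 0 z ^ i * theta 0 1 z ^ j * theta 1 0 z ^ k)"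

definition tsize :: "nat \<times> nat \<times> nat \<Rightarrow> nat" where "tsize = (\<lambda>(i, j, k). i + j + k)"

text \<open>The exponents of \<open>\<vartheta>\<^sub>0\<^sub>0, \<vartheta>\<^sub>0\<^sub>1, \<vartheta>\<^sub>1\<^sub>0\<close> in the theta monomial whose character on
  \<open>\<Gamma>[4]\<close> is that of the component indexed by \<open>u\<close> in weight \<open>r / 2\<close>.\<close>

definition texp :: "nat \<Rightarrow> bool \<times> bool \<times> bool \<Rightarrow> nat \<times> nat \<times> nat" where
  "texp r = (\<lambda>(x, y, t). (of_bool ((x \<noteq> y) \<noteq> (t \<noteq> odd r)), of_bool y, of_bool x))"

lemma thS_nonzero: "Im z > 0 \<Longrightarrow> thS e z \<noteq> 0"
  using theta_nonzero by (cases e) (simp add: thS_def)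

lemma thS_holomorphic: "thS e holomorphic_on upper_half_plane"
  by (cases e) (auto simp: thS_def intro!: holomorphic_intros theta_holomorphic)

text \<open>In \<open>theta_gamma4\<close> the parity of b/4 concerns theta_10 only and that of c/4
  concerns theta_01 only, which determines these two exponents. The exponent of theta_00 then
  adjusts the parity of (d - 1)/4, to which all three functions and \<open>tfac ^ r\<close>
  contribute; this is the origin of the formula in \<open>texp\<close>.\<close>

lemma thS_gamma4:
  assumes M: "gamma4 a b c d" and z: "Im z > 0"
  shows "chi u (cls (a, b, c, d)) * tfac a b c d z ^ r * thS (texp r u) z =
     jfac a b c d z powi (int r - int (tsize (texp r u))) * thS (texp r u) (mob a b c d z)"
proof -
  obtain x y t where u: "u = (x, y, t)" by (metis prod.exhaust)
  define J where "J = jfac a b c d z"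
  have J: "J \<noteq> 0" unfolding J_def by (rule jfac_nonzero[OF M z])
  define i j k where "i = (of_bool ((x \<noteq> y) \<noteq> (t \<noteq> odd r)) :: nat)" and "j = (of_bool y :: nat)" and "k = (of_bool x :: nat)"
  have e: "texp r u = (i, j, k)" by (simp add: texp_def u i_def j_def k_def)
  let ?l = "b div 4" and ?m = "c div 4" and ?n = "(d - 1) div 4"
  have s: "chi u (cls (a, b, c, d)) * sg ?n ^ r = sg ?n ^ i * sg (?n + ?m) ^ j * sg (?l + ?n) ^ k"
    unfolding u cls_def prod.case chi_def i_def j_def k_def
    by (cases x; cases y; cases t; cases "even r"; cases "even ?l"; cases "even ?m"; cases "even ?n") simp_all
  have "thS (i, j, k) (mob a b c d z) = J ^ (i + j + k) * (sg ?n ^ i * sg (?n + ?m) ^ j * sg (?l + ?n) ^ k) * thS (i, j, k) z"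
    unfolding thS_def prod.case theta_gamma4(4-6)[OF M z] J_def[symmetric] power_mult_distrib by (simp add: power_add mult_ac)
  also have "\<dots> = J ^ (i + j + k) * (chi u (cls (a, b, c, d)) * sg ?n ^ r) * thS (i, j, k) z" unfolding s ..
  finally have th: "thS (i, j, k) (mob a b c d z) = J ^ (i + j + k) * (chi u (cls (a, b, c, d)) * sg ?n ^ r) * thS (i, j, k) z" .
  have "J powi (int r - int n) * J ^ n = J ^ r" for n using J by (simp add: power_int_diff)
  from this[of "i + j + k"] have "J powi (int r - int (i + j + k)) * J ^ (i + j + k) = J ^ r" .
  hence "J powi (int r - int (i + j + k)) * thS (i, j, k) (mob a b c d z) = J ^ r * (chi u (cls (a, b, c, d)) * sg ?n ^ r) * thS (i, j, k) z"
    unfolding th by (simp only: mult.assoc[symmetric])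
  thus ?thesis unfolding e tsize_def prod.case tfac_eq(2)[OF M z] J_def[symmetric] by (simp only: power_mult_distrib mult_ac)
qed

text \<open>The product of all three theta functions has an invariant norm, bounded below by
  \<open>theta_prod_lower\<close>. Dividing out the missing factors, each of norm at most 3 Im
  z^(1/4), leaves the bound; 108 = 4 * 27 combines the 4 there with three factors 3.\<close>

lemma thS_lower_bound:
  assumes det: "a * d - b * c = 1" and z: "Im z \<ge> 1" and e: "e = (i, j, k)" "i \<le> 1" "j \<le> 1" "k \<le> 1"
  shows "wnorm (int (tsize e)) (thS e) (mob a b c d z) \<ge> Im z powr (real (tsize e) / 4) * exp (- (pi * Im z / 4)) / 108"
proof -
  let ?w = "mob a b c d z"
  have z0: "Im z > 0" using z by simp
  have w: "Im ?w > 0" by (rule Im_mob_pos[OF det z0])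
  define A B C where "A = wnorm 1 (theta 0 0) ?w" and "B = wnorm 1 (theta 0 1) ?w" and "C = wnorm 1 (theta 1 0) ?w"
  define I where "I = Im z powr (1 / 4)"
  have I: "I > 0" using z by (simp add: I_def)
  have ub: "0 \<le> A" "A \<le> 3 * I" "0 \<le> B" "B \<le> 3 * I" "0 \<le> C" "C \<le> 3 * I"
    unfolding A_def B_def C_def I_def using theta_wnorm_bounded[OF det] z by (auto simp: thetas_def)
  have I4: "I ^ n = Im z powr (real n / 4)" for n
    using z by (simp add: I_def powr_powr flip: powr_realpow)
  have W4: "(Im ?w powr (1 / 4)) ^ n = Im ?w powr (real n / 4)" for n
    using w by (simp add: powr_powr flip: powr_realpow)
  have "A * B * C = norm (theta_prod ?w) * Im ?w powr (3 / 4)"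
    using W4[of 3] by (simp add: A_def B_def C_def wnorm_def theta_prod_def norm_mult power3_eq_cube mult_ac)
  also have "\<dots> = norm (theta_prod z) * Im z powr (3 / 4)" by (rule theta_prod_sl2[OF det z0])
  also have "\<dots> \<ge> (exp (- (pi * Im z / 4)) / 4) * Im z powr (3 / 4)"
    using theta_prod_lower[OF z] by (intro mult_right_mono) auto
  finally have ABC: "A * B * C \<ge> exp (- (pi * Im z / 4)) / 4 * I ^ 3" using I4[of 3] by simp
  have wn: "wnorm (int (tsize e)) (thS e) ?w = A ^ i * B ^ j * C ^ k"
    using W4[of "i + j + k"] unfolding e thS_def tsize_def A_def B_def C_def wnorm_def prod.case
    by (simp add: norm_mult norm_power power_mult_distrib power_add mult_ac)
  have ex: "(1 - i) + (1 - j) + (1 - k) = 3 - tsize e" using e by (simp add: tsize_def)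
  have sp: "x ^ n * x ^ (1 - n) = x" if "n \<le> 1" for x :: real and n :: nat using that by (cases n) auto
  have "A * B * C = (A ^ i * B ^ j * C ^ k) * (A ^ (1 - i) * B ^ (1 - j) * C ^ (1 - k))"
    using sp[OF e(2), of A] sp[OF e(3), of B] sp[OF e(4), of C] by (simp add: mult_ac)
  also have "\<dots> \<le> (A ^ i * B ^ j * C ^ k) * ((3 * I) ^ (1 - i) * (3 * I) ^ (1 - j) * (3 * I) ^ (1 - k))"
    using ub I by (intro mult_left_mono mult_mono power_mono) auto
  also have "(3 * I) ^ (1 - i) * (3 * I) ^ (1 - j) * (3 * I) ^ (1 - k) = 3 ^ (3 - tsize e) * I ^ (3 - tsize e)"
    unfolding ex[symmetric] power_add power_mult_distrib by (simp only: mult_ac)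
  also have "(A ^ i * B ^ j * C ^ k) * (3 ^ (3 - tsize e) * I ^ (3 - tsize e)) \<le> (A ^ i * B ^ j * C ^ k) * (27 * I ^ (3 - tsize e))"
    using ub I power_increasing[of "3 - tsize e" 3 "3::real"] by (intro mult_left_mono mult_right_mono) auto
  finally have "exp (- (pi * Im z / 4)) / 4 * I ^ 3 \<le> (A ^ i * B ^ j * C ^ k) * (27 * I ^ (3 - tsize e))" using ABC by linarith
  moreover have "I ^ 3 = I ^ tsize e * I ^ (3 - tsize e)" using e by (simp add: tsize_def flip: power_add)
  ultimately have "(I ^ tsize e * exp (- (pi * Im z / 4)) / 108) * (27 * I ^ (3 - tsize e)) \<le> (A ^ i * B ^ j * C ^ k) * (27 * I ^ (3 - tsize e))"
    by (simp add: mult_ac)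
  hence "I ^ tsize e * exp (- (pi * Im z / 4)) / 108 \<le> A ^ i * B ^ j * C ^ k"
    using I by (subst (asm) mult_le_cancel_right_pos) auto
  thus ?thesis unfolding wn I4 .
qed

lemma texp_cases: "\<exists>i j k. texp r u = (i, j, k) \<and> i \<le> 1 \<and> j \<le> 1 \<and> k \<le> 1"
  by (cases u) (auto simp: texp_def)

text \<open>The monomial has no zeros in the half-plane, and at the cusps it loses at most exp(-pi
  Im z / 4), precisely what \<open>cusp_growth\<close> grants. Its character cancels that of g, so
  the plain factor \<open>jfac\<close> remains.\<close>

lemma forms1_divide:
  assumes hol: "g holomorphic_on upper_half_plane"
    and inv: "\<And>a b c d z. gamma4 a b c d \<Longrightarrow> Im z > 0 \<Longrightarrow> g (mob a b c d z) = chi u (cls (a, b, c, d)) * tfac a b c d z ^ r * g z"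
    and gr: "\<And>a b c d z. a * d - b * c = 1 \<Longrightarrow> Im z \<ge> Y \<Longrightarrow> wnorm (int r) g (mob a b c d z) \<le> K * Im z powr (real r / 4)"
  shows "(\<lambda>z. g z / thS (texp r u) z) \<in> forms1 (int r - int (tsize (texp r u)))"
proof -
  let ?e = "texp r u" and ?k = "int r - int (tsize (texp r u))"
  have 1: "g (mob a b c d z) / thS ?e (mob a b c d z) = jfac a b c d z powi ?k * (g z / thS ?e z)"
    if M: "gamma4 a b c d" "Im z > 0" for a b c d z
  proof -
    have w: "Im (mob a b c d z) > 0" using M Im_mob_pos by (simp add: gamma4_def)
    have "g (mob a b c d z) * thS ?e z = chi u (cls (a, b, c, d)) * tfac a b c d z ^ r * thS ?e z * g z"
      unfolding inv[OF M] by (simp only: mult_ac)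
    also have "\<dots> = jfac a b c d z powi ?k * g z * thS ?e (mob a b c d z)" unfolding thS_gamma4[OF M] by (simp only: mult_ac)
    finally show ?thesis using thS_nonzero[OF w] thS_nonzero[OF M(2)] by (simp add: field_simps)
  qed
  obtain i j k where e: "?e = (i, j, k)" "i \<le> 1" "j \<le> 1" "k \<le> 1" using texp_cases by blast
  have "cusp_growth ?k (\<lambda>z. g z / thS ?e z)"
    unfolding cusp_growth_def
  proof (intro allI impI)
    fix a b c d :: int assume det: "a * d - b * c = 1"
    show "\<exists>K Y. 0 < Y \<and> (\<forall>z. Y \<le> Im z \<longrightarrow> wnorm ?k (\<lambda>z. g z / thS ?e z) (mob a b c d z) \<le> K * (Im z powr (of_int ?k / 4) * exp (pi * Im z / 4)))"
    proof (rule exI[of _ "108 * K"], rule exI[of _ "max Y 1"], intro conjI allI impI)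
      fix z assume z: "max Y 1 \<le> Im z"
      let ?w = "mob a b c d z"
      define E where "E = exp (pi * Im z / 4)"
      define P where "P = Im z powr (real (tsize ?e) / 4)"
      define Q where "Q = Im z powr (of_int ?k / 4)"
      have pos: "E > 0" "P > 0" "Q > 0" using z by (auto simp: E_def P_def Q_def)
      have w: "Im ?w > 0" using Im_mob_pos[OF det, of z] z by simp
      have Em: "exp (- (pi * Im z / 4)) = 1 / E" by (simp add: E_def exp_minus field_simps)
      have PQ: "Im z powr (real r / 4) = Q * P"
        unfolding P_def Q_def by (simp add: diff_divide_distrib flip: powr_add)
      have lb: "P / (108 * E) \<le> wnorm (int (tsize ?e)) (thS ?e) ?w"
        using thS_lower_bound[OF det _ e, of z] z unfolding Em P_def by simp
      have "wnorm ?k (\<lambda>z. g z / thS ?e z) ?w * (P / (108 * E)) \<le> wnorm ?k (\<lambda>z. g z / thS ?e z) ?w * wnorm (int (tsize ?e)) (thS ?e) ?w"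
        using lb by (intro mult_left_mono) auto
      also have "\<dots> = wnorm (?k + int (tsize ?e)) (\<lambda>z. g z / thS ?e z * thS ?e z) ?w" by (rule wnorm_mult[OF w, symmetric])
      also have "\<dots> = wnorm (int r) g ?w" using thS_nonzero[OF w, of ?e] by (simp add: wnorm_def)
      also have "\<dots> \<le> K * (Q * P)" using gr[OF det, of z] z unfolding PQ by simp
      also have "\<dots> = (108 * K * (Q * E)) * (P / (108 * E))" using pos by simp
      finally show "wnorm ?k (\<lambda>z. g z / thS ?e z) ?w \<le> 108 * K * (Im z powr (of_int ?k / 4) * exp (pi * Im z / 4))"
        unfolding Q_def[symmetric] E_def[symmetric] using pos by (subst (asm) mult_le_cancel_right_pos) auto
    qed simp
  qed
  moreover have "(\<lambda>z. g z / thS ?e z) holomorphic_on upper_half_plane"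
    by (intro holomorphic_on_divide hol thS_holomorphic) (simp add: thS_nonzero)
  ultimately show ?thesis using 1 unfolding forms1_def by blast
qed

text \<open>Lagrange interpolation. The point is the order of quantifiers: the coefficients
  \<open>a i j\<close> depend on the nodes only, so they stay fixed when \<open>c\<close> varies
  with a parameter.\<close>

lemma polynomial_interpolation:
  fixes t :: "nat \<Rightarrow> complex"
  assumes inj: "inj_on t {..k}"
  shows "\<exists>a. \<forall>c j. j \<le> k \<longrightarrow> c j = (\<Sum>i\<le>k. a i j * (\<Sum>l\<le>k. c l * t i ^ l))"
proof -
  define L where "L i = (\<Prod>m\<in>{..k} - {i}. Polynomial.smult (1 / (t i - t m)) [:- t m, 1:])" for i
  have deg: "degree (L i) \<le> k" if "i \<le> k" for i
  proof -
    have "degree (L i) \<le> (\<Sum>m\<in>{..k} - {i}. degree (Polynomial.smult (1 / (t i - t m)) [:- t m, 1:]))" unfolding L_def by (rule degree_prod_sum_le[unfolded o_def]) simp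
    also have "\<dots> \<le> (\<Sum>m\<in>{..k} - {i}. 1)" by (intro sum_mono) simp
    also have "\<dots> = k" using that by simp
    finally show ?thesis .
  qed
  have delta: "poly (L i) (t n) = (if i = n then 1 else 0)" if "i \<le> k" "n \<le> k" for i n
  proof (cases "i = n")
    case True
    have "poly (Polynomial.smult (1 / (t n - t m)) [:- t m, 1:]) (t n) = 1" if "m \<in> {..k} - {n}" for m
    proof -
      have "t n - t m \<noteq> 0" using inj \<open>n \<le> k\<close> that by (auto dest: inj_onD)
      thus ?thesis by (simp add: diff_divide_distrib[symmetric])
    qed
    thus ?thesis unfolding L_def poly_prod True by (simp del: poly_smult)
  next
    case False
    hence "(\<Prod>m\<in>{..k} - {i}. poly (Polynomial.smult (1 / (t i - t m)) [:- t m, 1:]) (t n)) = 0"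
      using that by (intro prod_zero) (auto intro!: bexI[of _ n])
    thus ?thesis using False by (simp add: L_def poly_prod)
  qed
  show ?thesis
  proof (rule exI[of _ "\<lambda>i j. coeff (L i) j"], intro allI impI)
    fix c :: "nat \<Rightarrow> complex" and j assume j: "j \<le> k"
    define P where "P = (\<Sum>l\<le>k. monom (c l) l)"
    have Pt: "poly P x = (\<Sum>l\<le>k. c l * x ^ l)" for x by (simp add: P_def poly_sum poly_monom)
    have "P = (\<Sum>i\<le>k. Polynomial.smult (poly P (t i)) (L i))"
    proof (rule poly_eqI_degree[of "t ` {..k}"])
      have card: "card (t ` {..k}) = Suc k" by (simp add: card_image[OF inj])
      show "card (t ` {..k}) > degree P" unfolding card P_def less_Suc_eq_le
        by (rule degree_sum_le) (auto intro: order_trans[OF degree_monom_le])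
      show "card (t ` {..k}) > degree (\<Sum>i\<le>k. Polynomial.smult (poly P (t i)) (L i))" unfolding card less_Suc_eq_le
      proof (rule degree_sum_le)
        fix i assume "i \<in> {..k}"
        hence "degree (L i) \<le> k" using deg by simp
        thus "degree (Polynomial.smult (poly P (t i)) (L i)) \<le> k" using degree_smult_le order_trans by blast
      qed simp
      fix x assume "x \<in> t ` {..k}"
      then obtain n where n: "n \<le> k" "x = t n" by auto
      have "poly (\<Sum>i\<le>k. Polynomial.smult (poly P (t i)) (L i)) x = (\<Sum>i\<le>k. if i = n then poly P (t i) else 0)"
        unfolding poly_sum n(2) by (intro sum.cong) (use delta n in auto)
      also have "\<dots> = poly P x" using n by simp
      finally show "poly P x = poly (\<Sum>i\<le>k. Polynomial.smult (poly P (t i)) (L i)) x" by simp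
    qed
    hence "coeff P j = coeff (\<Sum>i\<le>k. Polynomial.smult (poly P (t i)) (L i)) j"
      by (rule arg_cong[where f = "\<lambda>p. coeff p j"])
    also have "\<dots> = (\<Sum>i\<le>k. poly P (t i) * coeff (L i) j)" by (simp add: Polynomial.coeff_sum)
    finally have "coeff P j = (\<Sum>i\<le>k. poly P (t i) * coeff (L i) j)" .
    moreover have "coeff P j = c j"
    proof -
      have "coeff P j = (\<Sum>l\<le>k. if l = j then c l else 0)" unfolding P_def coeff_sum by (intro sum.cong) auto
      thus ?thesis using j by simp
    qed
    ultimately show "c j = (\<Sum>i\<le>k. coeff (L i) j * (\<Sum>l\<le>k. c l * t i ^ l))" unfolding Pt by (simp add: mult.commute)
  qed
qed

text \<open>Along the imaginary axis the quotient tends to 0 without ever being 0.\<close>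

lemma thY_thX_infinite: "infinite ((\<lambda>z. thY z / thX z) ` {z. Im z \<ge> Y})"
proof
  assume fin: "finite ((\<lambda>z. thY z / thX z) ` {z. Im z \<ge> Y})"
  let ?V = "(\<lambda>z. thY z / thX z) ` {z. Im z \<ge> max Y 1}"
  have fin: "finite ?V" by (rule finite_subset[OF _ fin]) auto
  have "\<i> * of_real (max Y 1) \<in> {z. Im z \<ge> max Y 1}" by simp
  hence ne: "?V \<noteq> {}" by blast
  have pos: "Min (norm ` ?V) > 0"
    using fin ne thX_nonzero thY_nonzero by (subst Min_gr_iff) auto
  have "\<forall>\<^sub>F y in at_top. norm (thY (\<i> * of_real y) / thX (\<i> * of_real y)) < Min (norm ` ?V)"
    using order_tendstoD(2)[OF tendsto_norm_zero[OF thY_thX_tendsto] pos] .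
  moreover have "\<forall>\<^sub>F y in at_top. y \<ge> max Y 1" by (rule eventually_ge_at_top)
  ultimately obtain y where y: "norm (thY (\<i> * of_real y) / thX (\<i> * of_real y)) < Min (norm ` ?V)" "y \<ge> max Y 1"
    using eventually_happens'[OF trivial_limit_at_top_linorder eventually_conj] by blast
  have "\<i> * of_real y \<in> {z. Im z \<ge> max Y 1}" using y(2) by simp
  hence "norm (thY (\<i> * of_real y) / thX (\<i> * of_real y)) \<in> norm ` ?V" by blast
  hence "Min (norm ` ?V) \<le> norm (thY (\<i> * of_real y) / thX (\<i> * of_real y))" using fin by (intro Min_le) auto
  thus False using y(1) by simp
qed

definition XY :: "nat \<Rightarrow> nat \<Rightarrow> complex \<Rightarrow> complex" where
  "XY k j z = thX z ^ (k - j) * thY z ^ j"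

text \<open>For fixed w, division by the monomial gives a form in z, thus a polynomial in X(z), Y(z)
  with coefficients depending on w. Interpolation at k + 1 points with distinct Y/X writes each
  coefficient as a fixed combination of the functions w -> F(zeta_i, w), and these are theta
  monomials times forms in w. If the monomial has higher weight than the form, the quotient has
  negative weight and vanishes.\<close>

lemma component_expansion:
  assumes f: "f \<in> modular_forms r"
  shows "\<exists>d. \<forall>z w. Im z > 0 \<longrightarrow> Im w > 0 \<longrightarrow> component r f u z w =
     (if tsize (texp r u) \<le> r then thS (texp r u) z * thS (texp r u) w *
        (\<Sum>i\<le>r - tsize (texp r u). \<Sum>j\<le>r - tsize (texp r u). d i j * (XY (r - tsize (texp r u)) i z * XY (r - tsize (texp r u)) j w)) else 0)"
proof -
  let ?F = "component r f u" and ?e = "texp r u"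
  let ?T = "thS ?e"
  define k where "k = r - tsize ?e"
  obtain Y K where Y: "Y \<ge> 1" and gr: "\<And>u a b c d a' b' c' d' z w. a * d - b * c = 1 \<Longrightarrow> a' * d' - b' * c' = 1 \<Longrightarrow> Im z \<ge> Y \<Longrightarrow> Im w \<ge> Y \<Longrightarrow>
      wnorm2 r (\<lambda>(z, w). component r f u z w) (mob a b c d z) (mob a' b' c' d' w) \<le> K * (Im z powr (real r / 4) * Im w powr (real r / 4))"
    using component_growth[OF f] by metis
  have id: "1 * 1 - 0 * 0 = (1::int)" by simp
  have g1: "wnorm (int r) (\<lambda>z. ?F z w) (mob a b c d z) \<le> K * Im z powr (real r / 4)"
    if "a * d - b * c = 1" "Im z \<ge> Y" "Im w \<ge> Y" for a b c d z w
  proof -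
    have "wnorm (int r) (\<lambda>z. ?F z w) (mob a b c d z) * Im w powr (real r / 4) \<le> (K * Im z powr (real r / 4)) * Im w powr (real r / 4)"
      using gr[OF that(1) id that(2,3), of u] by (simp add: wnorm2_def wnorm_def mult_ac)
    thus ?thesis using that Y by (subst (asm) mult_le_cancel_right_pos) auto
  qed
  have g2: "wnorm (int r) (\<lambda>w. ?F z w) (mob a b c d w) \<le> K * Im w powr (real r / 4)"
    if "a * d - b * c = 1" "Im z \<ge> Y" "Im w \<ge> Y" for a b c d z w
  proof -
    have "wnorm (int r) (\<lambda>w. ?F z w) (mob a b c d w) * Im z powr (real r / 4) \<le> (K * Im w powr (real r / 4)) * Im z powr (real r / 4)"
      using gr[OF id that(1) that(2,3), of u] by (simp add: wnorm2_def wnorm_def mult_ac)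
    thus ?thesis using that Y by (subst (asm) mult_le_cancel_right_pos) auto
  qed
  have F1: "(\<lambda>z. ?F z w / ?T z) \<in> forms1 (int r - int (tsize ?e))" if "Im w \<ge> Y" for w
    by (rule forms1_divide[OF component_holomorphic(1)[OF f] component_first[OF f] g1]) (use that Y in auto)
  have F2: "(\<lambda>w. ?F z w / ?T w) \<in> forms1 (int r - int (tsize ?e))" if "Im z \<ge> Y" for z
    by (rule forms1_divide[OF component_holomorphic(2)[OF f] component_second[OF f] g2]) (use that Y in auto)
  \<comment> \<open>Forms in z are available only for Im w >= Y; the identity theorem in w lifts
    this restriction.\<close>
  have ext: "?F z w = G z w" if hol: "\<And>z. Im z > 0 \<Longrightarrow> (\<lambda>w. G z w) holomorphic_on upper_half_plane"
    and eq: "\<And>z w. Im z > 0 \<Longrightarrow> Im w \<ge> Y \<Longrightarrow> ?F z w = G z w" and zw: "Im z > 0" "Im w > 0" for G z w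
  proof (rule analytic_continuation_open[of "{w. Im w > Y}" upper_half_plane "\<lambda>w. ?F z w" "\<lambda>w. G z w"])
    show "open {w. Im w > Y}" by (rule open_halfspace_Im_gt)
    have "\<i> * of_real (Y + 1) \<in> {w. Im w > Y}" by simp
    thus "{w. Im w > Y} \<noteq> {}" by blast
  qed (use hol[OF zw(1)] eq zw Y component_holomorphic(2)[OF f zw(1)] open_upper_half_plane connected_upper_half_plane in auto)
  show ?thesis
  proof (cases "tsize ?e \<le> r")
    case False
    have "?F z w = 0" if "Im z > 0" "Im w > 0" for z w
    proof (rule ext[where G = "\<lambda>z w. 0", OF _ _ that])
      fix z w assume z: "Im z > 0" and w: "Im w \<ge> Y"
      have "?F z w / ?T z = 0" by (rule forms1_negative[OF F1[OF w] _ z]) (use False in simp)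
      thus "?F z w = 0" using thS_nonzero[OF z, of ?e] by simp
    qed auto
    thus ?thesis using False by simp
  next
    case True
    hence k: "int r - int (tsize ?e) = int k" by (simp add: k_def)
    obtain \<zeta> where \<zeta>: "inj (\<lambda>n. thY (\<zeta> n) / thX (\<zeta> n))" "\<And>n::nat. Im (\<zeta> n) \<ge> Y"
    proof -
      obtain g :: "nat \<Rightarrow> complex" where g: "inj g" "range g \<subseteq> (\<lambda>z. thY z / thX z) ` {z. Im z \<ge> Y}"
        using infinite_countable_subset[OF thY_thX_infinite[of Y]] by blast
      have "\<forall>n. \<exists>z. Im z \<ge> Y \<and> g n = thY z / thX z" using g(2) by blast
      then obtain \<zeta> where "\<And>n. Im (\<zeta> n) \<ge> Y \<and> g n = thY (\<zeta> n) / thX (\<zeta> n)" by metis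
      thus ?thesis using that[of \<zeta>] g(1) by (simp add: inj_def)
    qed
    define t where "t n = thY (\<zeta> n) / thX (\<zeta> n)" for n
    have "inj_on t {..k}" using \<zeta>(1) by (auto simp: t_def inj_def inj_on_def)
    then obtain a where a: "\<And>c j. j \<le> k \<Longrightarrow> c j = (\<Sum>i\<le>k. a i j * (\<Sum>l\<le>k. c l * t i ^ l))"
      using polynomial_interpolation by metis
    have \<zeta>0: "Im (\<zeta> i) > 0" for i using \<zeta>(2)[of i] Y by linarith
    \<comment> \<open>Turns F(zeta_i, w) into the value at the node t_i = Y/X of the dehomogenised
      polynomial in z, up to the monomial in w.\<close>
    define b where "b i = 1 / (?T (\<zeta> i) * thX (\<zeta> i) ^ k)" for i
    have "\<exists>d. \<forall>w. Im w > 0 \<longrightarrow> ?F (\<zeta> i) w / ?T w = (\<Sum>j\<le>k. d j * thX w ^ (k - j) * thY w ^ j)" for i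
      by (rule forms1_polynomial) (use F2[OF \<zeta>(2)[of i]] k in simp)
    then obtain d where d: "\<And>i w. Im w > 0 \<Longrightarrow> ?F (\<zeta> i) w / ?T w = (\<Sum>j\<le>k. d i j * thX w ^ (k - j) * thY w ^ j)" by metis
    define D where "D j l = (\<Sum>i\<le>k. a i j * b i * d i l)" for j l
    define G where "G z w = ?T z * ?T w * (\<Sum>i\<le>k. \<Sum>j\<le>k. D i j * (XY k i z * XY k j w))" for z w
    have eq: "?F z w = G z w" if zw: "Im z > 0" "Im w \<ge> Y" for z w
    proof -
      have w: "Im w > 0" using zw Y by simp
      obtain c where c: "\<And>z. Im z > 0 \<Longrightarrow> ?F z w / ?T z = (\<Sum>j\<le>k. c j * thX z ^ (k - j) * thY z ^ j)"
        using forms1_polynomial[OF F1[OF zw(2), unfolded k]] by blast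
      have "c j = ?T w * (\<Sum>l\<le>k. D j l * XY k l w)" if j: "j \<le> k" for j
      proof -
        have "(\<Sum>l\<le>k. c l * t i ^ l) = b i * ?T w * (\<Sum>l\<le>k. d i l * XY k l w)" for i
        proof -
          have X: "thX (\<zeta> i) \<noteq> 0" by (rule thX_nonzero[OF \<zeta>0])
          have "(\<Sum>l\<le>k. c l * t i ^ l) = (\<Sum>l\<le>k. c l * thX (\<zeta> i) ^ (k - l) * thY (\<zeta> i) ^ l) / thX (\<zeta> i) ^ k"
            unfolding sum_divide_distrib using X by (intro sum.cong) (auto simp: t_def power_divide power_diff field_simps)
          also have "\<dots> = ?F (\<zeta> i) w * b i" unfolding c[OF \<zeta>0, symmetric] by (simp add: b_def)
          also have "?F (\<zeta> i) w = ?T w * (\<Sum>l\<le>k. d i l * XY k l w)"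
            using d[OF w, of i] thS_nonzero[OF w, of ?e] by (simp add: XY_def field_simps mult.assoc)
          finally show ?thesis by (simp only: mult_ac)
        qed
        hence "c j = (\<Sum>i\<le>k. a i j * (b i * ?T w * (\<Sum>l\<le>k. d i l * XY k l w)))" using a[OF j, of c] by simp
        also have "\<dots> = ?T w * (\<Sum>i\<le>k. \<Sum>l\<le>k. a i j * b i * d i l * XY k l w)"
          by (simp add: sum_distrib_left mult_ac)
        also have "\<dots> = ?T w * (\<Sum>l\<le>k. D j l * XY k l w)"
          unfolding D_def sum_distrib_right by (subst sum.swap) simp
        finally show ?thesis .
      qed
      hence "?F z w / ?T z = (\<Sum>j\<le>k. (?T w * (\<Sum>l\<le>k. D j l * XY k l w)) * XY k j z)"
        unfolding c[OF zw(1)] XY_def[of k _ z] by (intro sum.cong) (auto simp: mult.assoc)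
      also have "\<dots> = ?T w * (\<Sum>i\<le>k. \<Sum>j\<le>k. D i j * (XY k i z * XY k j w))"
        by (simp add: sum_distrib_left sum_distrib_right mult_ac)
      finally show ?thesis using thS_nonzero[OF zw(1), of ?e] by (simp add: G_def field_simps)
    qed
    have "?F z w = G z w" if "Im z > 0" "Im w > 0" for z w
    proof (rule ext[OF _ eq that])
      show "(\<lambda>w. G z w) holomorphic_on upper_half_plane" for z
        unfolding G_def XY_def by (intro holomorphic_intros thS_holomorphic thX_holomorphic thY_holomorphic)
    qed
    thus ?thesis using True unfolding G_def k_def by auto
  qed
qed

theorem modular_forms_expansion:
  assumes f: "f \<in> modular_forms r"
  shows "\<exists>d. \<forall>z w. Im z > 0 \<longrightarrow> Im w > 0 \<longrightarrow> f (z, w) =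
    (\<Sum>u\<in>UNIV. if tsize (texp r u) \<le> r then thS (texp r u) z * thS (texp r u) w *
        (\<Sum>i\<le>r - tsize (texp r u). \<Sum>j\<le>r - tsize (texp r u). d u i j * (XY (r - tsize (texp r u)) i z * XY (r - tsize (texp r u)) j w)) else 0)"
proof -
  let ?P = "\<lambda>u d. \<forall>z w. Im z > 0 \<longrightarrow> Im w > 0 \<longrightarrow> component r f u z w =
     (if tsize (texp r u) \<le> r then thS (texp r u) z * thS (texp r u) w *
        (\<Sum>i\<le>r - tsize (texp r u). \<Sum>j\<le>r - tsize (texp r u). d i j * (XY (r - tsize (texp r u)) i z * XY (r - tsize (texp r u)) j w)) else 0)"
  have "\<forall>u. \<exists>d. ?P u d" by (rule allI, rule component_expansion[OF f])
  hence "\<exists>d. \<forall>u. ?P u (d u)" by (rule choice)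
  then obtain d where d: "\<forall>u. ?P u (d u)" by (rule exE)
  show ?thesis
  proof (rule exI[of _ d], intro allI impI)
    fix z w assume zw: "Im z > 0" "Im w > 0"
    show "f (z, w) = (\<Sum>u\<in>UNIV. if tsize (texp r u) \<le> r then thS (texp r u) z * thS (texp r u) w *
        (\<Sum>i\<le>r - tsize (texp r u). \<Sum>j\<le>r - tsize (texp r u). d u i j * (XY (r - tsize (texp r u)) i z * XY (r - tsize (texp r u)) j w)) else 0)"
      unfolding sum_component[OF f zw, symmetric] by (rule sum.cong[OF refl], rule d[rule_format, OF zw])
  qed
qed

section \<open>Isomorphic graded algebras have isomorphic \<open>Proj\<close>\<close>

lemma algebra_via_simps:
  "carrier (algebra_via R \<eta>) = carrier R" "mult (algebra_via R \<eta>) = mult R" "one (algebra_via R \<eta>) = one R"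
  "zero (algebra_via R \<eta>) = zero R" "add (algebra_via R \<eta>) = add R" "smult (algebra_via R \<eta>) k x = \<eta> k \<otimes>\<^bsub>R\<^esub> x"
  by (simp_all add: algebra_via_def ring.defs module.defs)

locale graded_pair =
  R: cring R + S: cring S
  for R :: "('k, 'a) module" and S :: "('k, 'b) module" +
  fixes G :: "nat \<Rightarrow> 'a set" and H :: "nat \<Rightarrow> 'b set" and \<phi> :: "'a \<Rightarrow> 'b" and \<psi> :: "'b \<Rightarrow> 'a"
  assumes phi_hom: "\<phi> \<in> ring_hom R S" and psi_hom: "\<psi> \<in> ring_hom S R"
    and psi_phi: "\<And>x. x \<in> carrier R \<Longrightarrow> \<psi> (\<phi> x) = x" and phi_psi: "\<And>y. y \<in> carrier S \<Longrightarrow> \<phi> (\<psi> y) = y"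
    and phi_G: "\<And>r. \<phi> ` G r = H r" and psi_H: "\<And>r. \<psi> ` H r = G r"
    and G_carrier: "\<And>r. G r \<subseteq> carrier R" and H_carrier: "\<And>r. H r \<subseteq> carrier S"
    and smult_R: "\<And>k. k \<odot>\<^bsub>R\<^esub> \<one>\<^bsub>R\<^esub> \<in> carrier R" and phi_smult: "\<And>k. \<phi> (k \<odot>\<^bsub>R\<^esub> \<one>\<^bsub>R\<^esub>) = k \<odot>\<^bsub>S\<^esub> \<one>\<^bsub>S\<^esub>"
begin

text \<open>The locale contains the inverse among its parameters and is symmetric, so each fact
  about phi is also one about psi. This is how all converse inclusions below are obtained.\<close>

lemma swap: "graded_pair S R H G \<psi> \<phi>"
proof (unfold_locales, goal_cases)
  case (9 k)
  show ?case using ring_hom_closed[OF phi_hom smult_R[of k]] phi_smult[of k] by simp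
next
  case (10 k)
  show ?case using psi_phi[OF smult_R[of k]] phi_smult[of k] by simp
qed (use phi_hom psi_hom psi_phi phi_psi phi_G psi_H G_carrier H_carrier in auto)

lemma phi_closed: "x \<in> carrier R \<Longrightarrow> \<phi> x \<in> carrier S"
  by (rule ring_hom_closed[OF phi_hom])

lemma psi_closed: "y \<in> carrier S \<Longrightarrow> \<psi> y \<in> carrier R"
  by (rule ring_hom_closed[OF psi_hom])

lemma image_iff_psi: "P \<subseteq> carrier R \<Longrightarrow> y \<in> \<phi> ` P \<longleftrightarrow> y \<in> carrier S \<and> \<psi> y \<in> P"
  using phi_closed psi_phi phi_psi by (auto simp: image_iff subset_iff) metis

lemma phi_mem_image: "P \<subseteq> carrier R \<Longrightarrow> x \<in> carrier R \<Longrightarrow> \<phi> x \<in> \<phi> ` P \<longleftrightarrow> x \<in> P"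
  using image_iff_psi phi_closed psi_phi by auto

lemma phi_mem_H: "x \<in> carrier R \<Longrightarrow> \<phi> x \<in> H r \<longleftrightarrow> x \<in> G r"
  using phi_mem_image[OF G_carrier] phi_G by metis

lemma psi_phi_image: "P \<subseteq> carrier R \<Longrightarrow> \<psi> ` \<phi> ` P = P"
  using psi_phi by (auto simp: image_image subset_iff)

lemma hom_ring: "ring_hom_ring R S \<phi>" "ring_hom_ring S R \<psi>"
  using phi_hom psi_hom R.ring_axioms S.ring_axioms by (auto intro: ring_hom_ringI2)

lemma ideal_image:
  assumes "ideal I R" shows "ideal (\<phi> ` I) S"
proof -
  have "I \<subseteq> carrier R" using assms by (simp add: additive_subgroup.a_subset ideal.axioms(1))
  hence "\<phi> ` I = {s \<in> carrier S. \<psi> s \<in> I}" using image_iff_psi by blast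
  thus ?thesis using ring_hom_ring.ideal_vimage[OF hom_ring(2) assms] by simp
qed

lemma ideal_subset: "ideal I R \<Longrightarrow> I \<subseteq> carrier R"
  by (simp add: additive_subgroup.a_subset ideal.axioms(1))

lemma primeideal_image:
  assumes "primeideal I R" shows "primeideal (\<phi> ` I) S"
proof -
  have "I \<subseteq> carrier R" using assms by (intro ideal_subset) (simp add: primeideal.axioms(1))
  hence "\<phi> ` I = {s \<in> carrier S. \<psi> s \<in> I}" using image_iff_psi by blast
  thus ?thesis using ring_hom_ring.primeideal_vimage[OF hom_ring(2) S.is_cring assms] by simp
qed

lemma Idl_image_subset:
  assumes "A \<subseteq> carrier R" shows "Idl\<^bsub>S\<^esub> (\<phi> ` A) \<subseteq> \<phi> ` (Idl\<^bsub>R\<^esub> A)"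
  using R.genideal_self[OF assms] by (intro S.genideal_minimal ideal_image R.genideal_ideal assms image_mono)

lemma Idl_subset: "A \<subseteq> carrier R \<Longrightarrow> Idl\<^bsub>R\<^esub> A \<subseteq> carrier R"
  by (rule ideal_subset[OF R.genideal_ideal])

lemma Idl_image:
  assumes "A \<subseteq> carrier R" shows "\<phi> ` (Idl\<^bsub>R\<^esub> A) = Idl\<^bsub>S\<^esub> (\<phi> ` A)"
proof
  interpret T: graded_pair S R H G \<psi> \<phi> by (rule swap)
  have A: "\<phi> ` A \<subseteq> carrier S" using assms phi_closed by auto
  have "Idl\<^bsub>R\<^esub> A \<subseteq> \<psi> ` (Idl\<^bsub>S\<^esub> (\<phi> ` A))" using T.Idl_image_subset[OF A] psi_phi_image[OF assms] by simp
  hence "\<phi> ` (Idl\<^bsub>R\<^esub> A) \<subseteq> \<phi> ` \<psi> ` (Idl\<^bsub>S\<^esub> (\<phi> ` A))" by (rule image_mono)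
  thus "\<phi> ` (Idl\<^bsub>R\<^esub> A) \<subseteq> Idl\<^bsub>S\<^esub> (\<phi> ` A)" using T.psi_phi_image[OF T.Idl_subset[OF A]] by simp
qed (rule Idl_image_subset[OF assms])

lemma image_Int_G:
  assumes "I \<subseteq> carrier R" shows "\<phi> ` (I \<inter> G r) = \<phi> ` I \<inter> H r"
proof -
  have "I \<inter> G r \<subseteq> carrier R" using assms by auto
  thus ?thesis unfolding phi_G[symmetric] set_eq_iff Int_iff image_iff_psi[OF assms] image_iff_psi[OF G_carrier[of r]]
    using \<open>I \<inter> G r \<subseteq> carrier R\<close> by (simp add: image_iff_psi) blast
qed

lemma homogeneous_image:
  assumes "homogeneous_ideal R G I" shows "homogeneous_ideal S H (\<phi> ` I)"
proof -
  have I: "ideal I R" "I = Idl\<^bsub>R\<^esub> (\<Union>r. I \<inter> G r)" using assms by (auto simp: homogeneous_ideal_def)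
  have s: "I \<subseteq> carrier R" by (rule ideal_subset[OF I(1)])
  have "\<phi> ` I = \<phi> ` (Idl\<^bsub>R\<^esub> (\<Union>r. I \<inter> G r))" using I(2) by simp
  also have "\<dots> = Idl\<^bsub>S\<^esub> (\<phi> ` (\<Union>r. I \<inter> G r))" by (rule Idl_image) (use s in auto)
  also have "\<phi> ` (\<Union>r. I \<inter> G r) = (\<Union>r. \<phi> ` I \<inter> H r)" unfolding image_UN image_Int_G[OF s] ..
  finally show ?thesis using ideal_image[OF I(1)] by (simp add: homogeneous_ideal_def)
qed

lemma image_subset_iff: "A \<subseteq> carrier R \<Longrightarrow> B \<subseteq> carrier R \<Longrightarrow> \<phi> ` A \<subseteq> \<phi> ` B \<longleftrightarrow> A \<subseteq> B"
  using psi_phi_image by (metis image_mono)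

lemma points_subset: "P \<in> proj_points R G \<Longrightarrow> P \<subseteq> carrier R"
  unfolding proj_points_def using ideal_subset primeideal.axioms(1) by blast

lemma irrelevant_subset: "(\<Union>r\<in>{0<..}. G r) \<subseteq> carrier R"
  using G_carrier by auto

lemma points_image:
  assumes "P \<in> proj_points R G" shows "\<phi> ` P \<in> proj_points S H"
proof -
  have "\<phi> ` (Idl\<^bsub>R\<^esub> (\<Union>r\<in>{0<..}. G r)) = Idl\<^bsub>S\<^esub> (\<Union>r\<in>{0<..}. H r)"
    unfolding Idl_image[OF irrelevant_subset] image_UN phi_G ..
  thus ?thesis using assms primeideal_image homogeneous_image
      image_subset_iff[OF Idl_subset[OF irrelevant_subset] points_subset[OF assms]]
    by (auto simp: proj_points_def)
qed

lemma topspace_subset: "P \<in> topspace (proj_topology R G) \<Longrightarrow> P \<in> proj_points R G"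
  by (auto simp: proj_topology_def topology_generated_by_topspace)

text \<open>The open set attached to a homogeneous ideal I pulls back to the open set attached to
  the image of I under the inverse isomorphism.\<close>

lemma continuous_image: "continuous_map (proj_topology R G) (proj_topology S H) (\<lambda>P. \<phi> ` P)"
  unfolding proj_topology_def[of S H]
proof (rule continuous_on_generated_topo)
  interpret T: graded_pair S R H G \<psi> \<phi> by (rule swap)
  fix U assume "U \<in> {{P \<in> proj_points S H. \<not> I \<subseteq> P} |I. homogeneous_ideal S H I}"
  then obtain I where I: "homogeneous_ideal S H I" "U = {P \<in> proj_points S H. \<not> I \<subseteq> P}" by blast
  have sI: "I \<subseteq> carrier S" using I(1) T.ideal_subset by (auto simp: homogeneous_ideal_def)
  have hI: "homogeneous_ideal R G (\<psi> ` I)" by (rule T.homogeneous_image[OF I(1)])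
  have e: "\<phi> ` P \<in> U \<longleftrightarrow> \<not> \<psi> ` I \<subseteq> P" if P: "P \<in> proj_points R G" for P
  proof -
    have "\<not> I \<subseteq> \<phi> ` P \<longleftrightarrow> \<not> \<psi> ` I \<subseteq> P"
      using T.image_subset_iff[OF sI, of "\<phi> ` P"] psi_phi_image[OF points_subset[OF P]] points_subset[OF P] phi_closed by auto
    thus ?thesis using points_image[OF P] by (simp add: I(2))
  qed
  have "(\<lambda>P. \<phi> ` P) -` U \<inter> topspace (proj_topology R G) = {P \<in> proj_points R G. \<not> \<psi> ` I \<subseteq> P} \<inter> topspace (proj_topology R G)"
    using e topspace_subset by auto
  moreover have "openin (proj_topology R G) {P \<in> proj_points R G. \<not> \<psi> ` I \<subseteq> P}"
    unfolding proj_topology_def by (rule topology_generated_by_Basis) (use hI in blast)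
  ultimately show "openin (proj_topology R G) ((\<lambda>P. \<phi> ` P) -` U \<inter> topspace (proj_topology R G))" by auto
next
  interpret T: graded_pair S R H G \<psi> \<phi> by (rule swap)
  show "(\<lambda>P. \<phi> ` P) ` topspace (proj_topology R G) \<subseteq> \<Union> {{P \<in> proj_points S H. \<not> I \<subseteq> P} |I. homogeneous_ideal S H I}"
  proof
    fix Q assume "Q \<in> (\<lambda>P. \<phi> ` P) ` topspace (proj_topology R G)"
    then obtain P where P: "P \<in> topspace (proj_topology R G)" "Q = \<phi> ` P" by blast
    then obtain I where I: "homogeneous_ideal R G I" "P \<in> proj_points R G" "\<not> I \<subseteq> P"
      unfolding proj_topology_def topology_generated_by_topspace by blast
    have "I \<subseteq> carrier R" using I(1) ideal_subset by (auto simp: homogeneous_ideal_def)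
    hence "\<not> \<phi> ` I \<subseteq> \<phi> ` P" using image_subset_iff points_subset[OF I(2)] I(3) by blast
    thus "Q \<in> \<Union> {{P \<in> proj_points S H. \<not> I \<subseteq> P} |I. homogeneous_ideal S H I}"
      using homogeneous_image[OF I(1)] points_image[OF I(2)] P(2) by blast
  qed
qed

lemma homeomorphic_image: "homeomorphic_map (proj_topology R G) (proj_topology S H) (\<lambda>P. \<phi> ` P)"
proof -
  interpret T: graded_pair S R H G \<psi> \<phi> by (rule swap)
  have "homeomorphic_maps (proj_topology R G) (proj_topology S H) (\<lambda>P. \<phi> ` P) (\<lambda>Q. \<psi> ` Q)"
    unfolding homeomorphic_maps_def
    by (intro conjI ballI continuous_image T.continuous_image psi_phi_image T.psi_phi_image
      points_subset topspace_subset T.points_subset T.topspace_subset)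
  from exI[of "homeomorphic_maps (proj_topology R G) (proj_topology S H) (\<lambda>P. \<phi> ` P)", OF this]
  show ?thesis unfolding homeomorphic_map_maps .
qed

text \<open>Stalk elements are sets of pairs, so a fraction is transported as a preimage under phi x
  phi. The restriction to the carrier is necessary because phi is arbitrary outside it.\<close>

definition pull :: "('b \<times> 'b) set \<Rightarrow> ('a \<times> 'a) set" where
  "pull Z = {(a, s). a \<in> carrier R \<and> s \<in> carrier R \<and> (\<phi> a, \<phi> s) \<in> Z}"

lemma hfrac_subset: "hfrac R G P a s \<subseteq> carrier R \<times> carrier R"
  using G_carrier by (auto simp: hfrac_def)

lemma pull_hfrac:
  assumes P: "P \<subseteq> carrier R" and as: "a \<in> carrier R" "s \<in> carrier R"
  shows "pull (hfrac S H (\<phi> ` P) (\<phi> a) (\<phi> s)) = hfrac R G P a s"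
proof -
  have HP: "\<phi> ` (G j - P) = H j - \<phi> ` P" for j
  proof -
    have "G j - P \<subseteq> carrier R" using G_carrier[of j] by auto
    thus ?thesis unfolding phi_G[symmetric] set_eq_iff Diff_iff image_iff_psi[OF P] image_iff_psi[OF G_carrier[of j]]
      by (simp add: image_iff_psi) blast
  qed
  have "(\<phi> b, \<phi> t) \<in> hfrac S H (\<phi> ` P) (\<phi> a) (\<phi> s) \<longleftrightarrow> (b, t) \<in> hfrac R G P a s"
    if bt: "b \<in> carrier R" "t \<in> carrier R" for b t
  proof -
    have eq: "\<phi> u \<otimes>\<^bsub>S\<^esub> (\<phi> t \<otimes>\<^bsub>S\<^esub> \<phi> a) = \<phi> u \<otimes>\<^bsub>S\<^esub> (\<phi> s \<otimes>\<^bsub>S\<^esub> \<phi> b) \<longleftrightarrow> u \<otimes>\<^bsub>R\<^esub> (t \<otimes>\<^bsub>R\<^esub> a) = u \<otimes>\<^bsub>R\<^esub> (s \<otimes>\<^bsub>R\<^esub> b)"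
      if u: "u \<in> carrier R" for u
    proof -
      have "\<phi> u \<otimes>\<^bsub>S\<^esub> (\<phi> t \<otimes>\<^bsub>S\<^esub> \<phi> a) = \<phi> (u \<otimes>\<^bsub>R\<^esub> (t \<otimes>\<^bsub>R\<^esub> a))" "\<phi> u \<otimes>\<^bsub>S\<^esub> (\<phi> s \<otimes>\<^bsub>S\<^esub> \<phi> b) = \<phi> (u \<otimes>\<^bsub>R\<^esub> (s \<otimes>\<^bsub>R\<^esub> b))"
        using u bt as by (simp_all add: ring_hom_mult[OF phi_hom])
      thus ?thesis using psi_phi u bt as R.m_closed by metis
    qed
    have "(\<exists>u\<in>H j - \<phi> ` P. u \<otimes>\<^bsub>S\<^esub> (\<phi> t \<otimes>\<^bsub>S\<^esub> \<phi> a) = u \<otimes>\<^bsub>S\<^esub> (\<phi> s \<otimes>\<^bsub>S\<^esub> \<phi> b)) \<longleftrightarrow>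
      (\<exists>u\<in>G j - P. u \<otimes>\<^bsub>R\<^esub> (t \<otimes>\<^bsub>R\<^esub> a) = u \<otimes>\<^bsub>R\<^esub> (s \<otimes>\<^bsub>R\<^esub> b))" for j
      unfolding HP[symmetric] using eq G_carrier[of j] by (auto; blast)
    moreover have "\<phi> t \<in> \<phi> ` P \<longleftrightarrow> t \<in> P" by (rule phi_mem_image[OF P bt(2)])
    ultimately show ?thesis unfolding hfrac_def using phi_mem_H bt by simp
  qed
  thus ?thesis unfolding pull_def using hfrac_subset[of P a s] by auto
qed

text \<open>Bijectivity on the carriers makes X the image of \<open>pull X\<close>, so the unions
  that define the operations on both sides run over corresponding representatives.\<close>

lemma pull_hfrac_mult:
  assumes P: "P \<subseteq> carrier R" and XY: "X \<subseteq> carrier S \<times> carrier S" "Y \<subseteq> carrier S \<times> carrier S"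
  shows "pull (hfrac_mult S H (\<phi> ` P) X Y) = hfrac_mult R G P (pull X) (pull Y)"
    and "pull (hfrac_add S H (\<phi> ` P) X Y) = hfrac_add R G P (pull X) (pull Y)"
proof -
  have X: "X = map_prod \<phi> \<phi> ` pull X" if "X \<subseteq> carrier S \<times> carrier S" for X
  proof -
    have "(a, s) \<in> map_prod \<phi> \<phi> ` pull X" if "(a, s) \<in> X" for a s
    proof -
      have c: "a \<in> carrier S" "s \<in> carrier S" using that \<open>X \<subseteq> carrier S \<times> carrier S\<close> by auto
      hence "(\<psi> a, \<psi> s) \<in> pull X" using that psi_closed phi_psi by (simp add: pull_def)
      moreover have "(a, s) = map_prod \<phi> \<phi> (\<psi> a, \<psi> s)" using c phi_psi by simp
      ultimately show ?thesis by blast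
    qed
    thus ?thesis by (auto simp: pull_def)
  qed
  have pU: "pull (\<Union>x\<in>A. F x) = (\<Union>x\<in>A. pull (F x))" for A and F :: "'z \<Rightarrow> _" by (auto simp: pull_def)
  have c: "fst p \<in> carrier R" "snd p \<in> carrier R" if "p \<in> pull Z" for p Z using that by (auto simp: pull_def)
  have "pull (hfrac_mult S H (\<phi> ` P) (map_prod \<phi> \<phi> ` pull X) (map_prod \<phi> \<phi> ` pull Y)) =
    (\<Union>x\<in>pull X. \<Union>y\<in>pull Y. pull (hfrac S H (\<phi> ` P) (\<phi> (fst x) \<otimes>\<^bsub>S\<^esub> \<phi> (fst y)) (\<phi> (snd x) \<otimes>\<^bsub>S\<^esub> \<phi> (snd y))))"
    unfolding hfrac_mult_def by (simp add: pU case_prod_unfold)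
  also have "\<dots> = (\<Union>x\<in>pull X. \<Union>y\<in>pull Y. hfrac R G P (fst x \<otimes>\<^bsub>R\<^esub> fst y) (snd x \<otimes>\<^bsub>R\<^esub> snd y))"
    by (intro SUP_cong refl) (simp add: c pull_hfrac[OF P] flip: ring_hom_mult[OF phi_hom])
  finally show "pull (hfrac_mult S H (\<phi> ` P) X Y) = hfrac_mult R G P (pull X) (pull Y)"
    unfolding hfrac_mult_def[of R] case_prod_unfold using X[OF XY(1)] X[OF XY(2)] by simp
  have "pull (hfrac_add S H (\<phi> ` P) (map_prod \<phi> \<phi> ` pull X) (map_prod \<phi> \<phi> ` pull Y)) =
    (\<Union>x\<in>pull X. \<Union>y\<in>pull Y. pull (hfrac S H (\<phi> ` P) ((\<phi> (fst x) \<otimes>\<^bsub>S\<^esub> \<phi> (snd y)) \<oplus>\<^bsub>S\<^esub> (\<phi> (fst y) \<otimes>\<^bsub>S\<^esub> \<phi> (snd x))) (\<phi> (snd x) \<otimes>\<^bsub>S\<^esub> \<phi> (snd y))))"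
    unfolding hfrac_add_def by (simp add: pU case_prod_unfold)
  also have "\<dots> = (\<Union>x\<in>pull X. \<Union>y\<in>pull Y. hfrac R G P ((fst x \<otimes>\<^bsub>R\<^esub> snd y) \<oplus>\<^bsub>R\<^esub> (fst y \<otimes>\<^bsub>R\<^esub> snd x)) (snd x \<otimes>\<^bsub>R\<^esub> snd y))"
    by (intro SUP_cong refl) (simp add: c pull_hfrac[OF P] flip: ring_hom_mult[OF phi_hom] ring_hom_add[OF phi_hom])
  finally show "pull (hfrac_add S H (\<phi> ` P) X Y) = hfrac_add R G P (pull X) (pull Y)"
    unfolding hfrac_add_def[of R] case_prod_unfold using X[OF XY(1)] X[OF XY(2)] by simp
qed

lemma section_subset:
  assumes "\<sigma> \<in> proj_sections R G U" "P \<in> U" shows "\<sigma> P \<subseteq> carrier R \<times> carrier R"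
proof -
  obtain V r a s where "P \<in> V" "\<forall>Q\<in>V. s \<notin> Q \<and> \<sigma> Q = hfrac R G Q a s"
    using assms unfolding proj_sections_def by blast
  thus ?thesis using hfrac_subset by blast
qed

definition pre :: "'b set set \<Rightarrow> 'a set set" where
  "pre V = {P \<in> topspace (proj_topology R G). \<phi> ` P \<in> V}"

definition pull_section :: "'b set set \<Rightarrow> 'b proj_section \<Rightarrow> 'a proj_section" where
  "pull_section V \<sigma> = (\<lambda>P\<in>pre V. pull (\<sigma> (\<phi> ` P)))"

lemma pre_open: "openin (proj_topology S H) V \<Longrightarrow> openin (proj_topology R G) (pre V)"
  using continuous_image by (simp add: continuous_map_def pre_def)

lemma pre_subset: "P \<in> pre V \<Longrightarrow> P \<subseteq> carrier R"
  using points_subset topspace_subset by (auto simp: pre_def)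

lemma pull_section_closed:
  assumes V: "openin (proj_topology S H) V" and \<sigma>: "\<sigma> \<in> proj_sections S H V"
  shows "pull_section V \<sigma> \<in> proj_sections R G (pre V)"
  unfolding proj_sections_def
proof (safe)
  interpret T: graded_pair S R H G \<psi> \<phi> by (rule swap)
  show "pull_section V \<sigma> \<in> extensional (pre V)" by (simp add: pull_section_def)
  fix P assume P: "P \<in> pre V"
  hence "\<phi> ` P \<in> V" by (simp add: pre_def)
  then obtain W r a s where W: "openin (proj_topology S H) W" "\<phi> ` P \<in> W" "W \<subseteq> V" "a \<in> H r" "s \<in> H r"
    "\<forall>Q\<in>W. s \<notin> Q \<and> \<sigma> Q = hfrac S H Q a s" using \<sigma> unfolding proj_sections_def by blast
  have as: "a \<in> carrier S" "s \<in> carrier S" using W(4,5) H_carrier by auto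
  have sub: "pre W \<subseteq> pre V" using W(3) by (auto simp: pre_def)
  show "\<exists>W. openin (proj_topology R G) W \<and> P \<in> W \<and> W \<subseteq> pre V \<and>
       (\<exists>r. \<exists>a\<in>G r. \<exists>s\<in>G r. \<forall>Q\<in>W. s \<notin> Q \<and> pull_section V \<sigma> Q = hfrac R G Q a s)"
  proof (rule exI[of _ "pre W"], intro conjI)
    show "openin (proj_topology R G) (pre W)" by (rule pre_open[OF W(1)])
    show "P \<in> pre W" using P W(2) by (simp add: pre_def)
    have G: "\<psi> a \<in> G r" "\<psi> s \<in> G r" using W(4,5) psi_H by auto
    have "\<psi> s \<notin> Q \<and> pull_section V \<sigma> Q = hfrac R G Q (\<psi> a) (\<psi> s)" if Q: "Q \<in> pre W" for Q
    proof
      have Q': "\<phi> ` Q \<in> W" using Q by (simp add: pre_def)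
      show "\<psi> s \<notin> Q" using W(6) Q' as phi_psi by (metis imageI)
      have "pull_section V \<sigma> Q = pull (\<sigma> (\<phi> ` Q))" using Q sub by (auto simp: pull_section_def)
      also have "\<dots> = pull (hfrac S H (\<phi> ` Q) (\<phi> (\<psi> a)) (\<phi> (\<psi> s)))" using W(6) Q' as phi_psi by simp
      also have "\<dots> = hfrac R G Q (\<psi> a) (\<psi> s)" by (rule pull_hfrac[OF pre_subset[OF Q] psi_closed psi_closed]) (use as in auto)
      finally show "pull_section V \<sigma> Q = hfrac R G Q (\<psi> a) (\<psi> s)" .
    qed
    thus "\<exists>r. \<exists>a\<in>G r. \<exists>s\<in>G r. \<forall>Q\<in>pre W. s \<notin> Q \<and> pull_section V \<sigma> Q = hfrac R G Q a s"
      using G by blast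
  qed (rule sub)
qed

end

context graded_pair
begin

interpretation T: graded_pair S R H G \<psi> \<phi> by (rule swap)

lemma pull_pull: "Z \<subseteq> carrier R \<times> carrier R \<Longrightarrow> pull (T.pull Z) = Z"
  using psi_phi phi_closed unfolding pull_def T.pull_def by auto

lemma pre_pre:
  assumes "V \<subseteq> topspace (proj_topology R G)" shows "pre (T.pre V) = V"
proof -
  have "\<psi> ` \<phi> ` P = P" "\<phi> ` P \<in> topspace (proj_topology S H)" if "P \<in> topspace (proj_topology R G)" for P
    using psi_phi_image[OF points_subset[OF topspace_subset[OF that]]] continuous_image that
    by (auto simp: continuous_map_def)
  thus ?thesis using assms by (auto simp: pre_def T.pre_def)
qed

lemma pull_section_pull_section:
  assumes V: "openin (proj_topology R G) V" and \<sigma>: "\<sigma> \<in> proj_sections R G V"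
  shows "pull_section (T.pre V) (T.pull_section V \<sigma>) = \<sigma>"
proof
  fix P
  have V': "V \<subseteq> topspace (proj_topology R G)" using V by (rule openin_subset)
  have e: "pre (T.pre V) = V" by (rule pre_pre[OF V'])
  show "pull_section (T.pre V) (T.pull_section V \<sigma>) P = \<sigma> P"
  proof (cases "P \<in> V")
    case True
    have i: "\<psi> ` \<phi> ` P = P" using True V' psi_phi_image points_subset topspace_subset by blast
    have "\<phi> ` P \<in> T.pre V" using True e unfolding pre_def by blast
    thus ?thesis using True e i pull_pull[OF section_subset[OF \<sigma> True]]
      by (simp add: pull_section_def T.pull_section_def)
  next
    case False
    thus ?thesis using \<sigma> e by (simp add: pull_section_def proj_sections_def extensional_def)
  qed
qed

lemma sheaf_simps:
  "carrier (proj_sheaf R G U) = proj_sections R G U"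
  "\<sigma> \<otimes>\<^bsub>proj_sheaf R G U\<^esub> \<tau> = (\<lambda>P\<in>U. hfrac_mult R G P (\<sigma> P) (\<tau> P))"
  "\<sigma> \<oplus>\<^bsub>proj_sheaf R G U\<^esub> \<tau> = (\<lambda>P\<in>U. hfrac_add R G P (\<sigma> P) (\<tau> P))"
  "\<one>\<^bsub>proj_sheaf R G U\<^esub> = (\<lambda>P\<in>U. hfrac R G P \<one>\<^bsub>R\<^esub> \<one>\<^bsub>R\<^esub>)"
  "k \<odot>\<^bsub>proj_sheaf R G U\<^esub> \<sigma> = (\<lambda>P\<in>U. hfrac_mult R G P (hfrac R G P (k \<odot>\<^bsub>R\<^esub> \<one>\<^bsub>R\<^esub>) \<one>\<^bsub>R\<^esub>) (\<sigma> P))"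
  unfolding proj_sheaf_def algebra_via_simps by (simp_all cong: restrict_cong)

end

context graded_pair
begin

interpretation T: graded_pair S R H G \<psi> \<phi> by (rule swap)

theorem proj_iso: "proj_isomorphic R G S H"
  unfolding proj_isomorphic_def ringed_space_iso_def
proof (rule exI[of _ "\<lambda>P. \<phi> ` P"], rule exI[of _ pull_section], intro conjI allI impI ballI)
  show "homeomorphic_map (proj_topology R G) (proj_topology S H) (\<lambda>P. \<phi> ` P)" by (rule homeomorphic_image)
next
  fix V assume V: "openin (proj_topology S H) V"
  note pre = pre_def[symmetric]
  have c: "\<phi> ` P \<in> V" "P \<subseteq> carrier R" if "P \<in> pre V" for P using that pre_subset by (auto simp: pre_def)
  have one: "\<phi> \<one>\<^bsub>R\<^esub> = \<one>\<^bsub>S\<^esub>" by (rule ring_hom_one[OF phi_hom])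
  have ph1: "pull (hfrac S H (\<phi> ` P) \<one>\<^bsub>S\<^esub> \<one>\<^bsub>S\<^esub>) = hfrac R G P \<one>\<^bsub>R\<^esub> \<one>\<^bsub>R\<^esub>" if "P \<subseteq> carrier R" for P
    using pull_hfrac[OF that R.one_closed R.one_closed] one by simp
  have phk: "pull (hfrac S H (\<phi> ` P) (k \<odot>\<^bsub>S\<^esub> \<one>\<^bsub>S\<^esub>) \<one>\<^bsub>S\<^esub>) = hfrac R G P (k \<odot>\<^bsub>R\<^esub> \<one>\<^bsub>R\<^esub>) \<one>\<^bsub>R\<^esub>" if "P \<subseteq> carrier R" for P k
    using pull_hfrac[OF that smult_R R.one_closed, of k] one phi_smult by simp
  show "pull_section V \<in> ring_iso (proj_sheaf S H V) (proj_sheaf R G {x \<in> topspace (proj_topology R G). \<phi> ` x \<in> V})"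
    unfolding pre ring_iso_def
  proof (safe intro!: ring_hom_memI)
    fix \<sigma> assume "\<sigma> \<in> carrier (proj_sheaf S H V)"
    thus "pull_section V \<sigma> \<in> carrier (proj_sheaf R G (pre V))"
      using pull_section_closed[OF V] by (simp add: sheaf_simps T.sheaf_simps)
  next
    fix \<sigma> \<tau> assume st: "\<sigma> \<in> carrier (proj_sheaf S H V)" "\<tau> \<in> carrier (proj_sheaf S H V)"
    hence s: "\<sigma> Q \<subseteq> carrier S \<times> carrier S" "\<tau> Q \<subseteq> carrier S \<times> carrier S" if "Q \<in> V" for Q
      using T.section_subset that by (simp_all add: T.sheaf_simps)
    show "pull_section V (\<sigma> \<otimes>\<^bsub>proj_sheaf S H V\<^esub> \<tau>) = pull_section V \<sigma> \<otimes>\<^bsub>proj_sheaf R G (pre V)\<^esub> pull_section V \<tau>"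
      unfolding sheaf_simps T.sheaf_simps pull_section_def
      by (rule restrict_ext) (simp add: c pull_hfrac_mult(1)[OF c(2) s(1) s(2)])
    show "pull_section V (\<sigma> \<oplus>\<^bsub>proj_sheaf S H V\<^esub> \<tau>) = pull_section V \<sigma> \<oplus>\<^bsub>proj_sheaf R G (pre V)\<^esub> pull_section V \<tau>"
      unfolding sheaf_simps T.sheaf_simps pull_section_def
      by (rule restrict_ext) (simp add: c pull_hfrac_mult(2)[OF c(2) s(1) s(2)])
  next
    show "pull_section V \<one>\<^bsub>proj_sheaf S H V\<^esub> = \<one>\<^bsub>proj_sheaf R G (pre V)\<^esub>"
      unfolding sheaf_simps T.sheaf_simps pull_section_def
      by (rule restrict_ext) (simp add: c ph1)
  next
    have V': "V \<subseteq> topspace (proj_topology S H)" using V by (rule openin_subset)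
    have p: "T.pre (pre V) = V" by (rule T.pre_pre[OF V'])
    show "bij_betw (pull_section V) (carrier (proj_sheaf S H V)) (carrier (proj_sheaf R G (pre V)))"
      unfolding sheaf_simps T.sheaf_simps
    proof (rule bij_betw_byWitness[where f' = "T.pull_section (pre V)"])
      show "\<forall>\<sigma>\<in>proj_sections S H V. T.pull_section (pre V) (pull_section V \<sigma>) = \<sigma>"
        using T.pull_section_pull_section[OF V] by blast
      show "\<forall>\<sigma>\<in>proj_sections R G (pre V). pull_section V (T.pull_section (pre V) \<sigma>) = \<sigma>"
        using pull_section_pull_section[OF pre_open[OF V]] p by simp
      show "pull_section V ` proj_sections S H V \<subseteq> proj_sections R G (pre V)" using pull_section_closed[OF V] by blast
      show "T.pull_section (pre V) ` proj_sections R G (pre V) \<subseteq> proj_sections S H V"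
        using T.pull_section_closed[OF pre_open[OF V]] p by auto
    qed
  qed
  fix k \<sigma> assume "\<sigma> \<in> carrier (proj_sheaf S H V)"
  hence s: "\<sigma> Q \<subseteq> carrier S \<times> carrier S" if "Q \<in> V" for Q
    using T.section_subset that by (simp add: T.sheaf_simps)
  show "pull_section V (k \<odot>\<^bsub>proj_sheaf S H V\<^esub> \<sigma>) = k \<odot>\<^bsub>proj_sheaf R G {x \<in> topspace (proj_topology R G). \<phi> ` x \<in> V}\<^esub> pull_section V \<sigma>"
    unfolding pre sheaf_simps T.sheaf_simps pull_section_def
    by (rule restrict_ext) (simp add: c pull_hfrac_mult(1)[OF c(2) T.hfrac_subset s] phk)
next
  fix V V' \<sigma> assume "openin (proj_topology S H) V" "openin (proj_topology S H) V'" and sub: "V' \<subseteq> V"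
  show "pull_section V' (restrict \<sigma> V') = restrict (pull_section V \<sigma>) {x \<in> topspace (proj_topology R G). \<phi> ` x \<in> V'}"
    using sub by (auto simp: pull_section_def pre_def fun_eq_iff restrict_def)
qed

end

theorem graded_iso_proj_isomorphic:
  fixes R :: "('k, 'a) module" and S :: "('k, 'b) module"
  assumes "cring R" "cring S" and iso: "graded_algebra_iso R G S H \<phi>"
    and G: "\<And>r. G r \<subseteq> carrier R" and k: "\<And>k. k \<odot>\<^bsub>R\<^esub> \<one>\<^bsub>R\<^esub> \<in> carrier R"
  shows "proj_isomorphic R G S H"
proof -
  interpret R: cring R by fact
  interpret S: cring S by fact
  have hom: "\<phi> \<in> ring_hom R S" and bij: "bij_betw \<phi> (carrier R) (carrier S)"
    and sm: "\<And>k x. x \<in> carrier R \<Longrightarrow> \<phi> (k \<odot>\<^bsub>R\<^esub> x) = k \<odot>\<^bsub>S\<^esub> \<phi> x" and im: "\<And>r. \<phi> ` G r = H r"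
    using iso by (auto simp: graded_algebra_iso_def ring_iso_def)
  define \<psi> where "\<psi> = inv_into (carrier R) \<phi>"
  have pp: "\<psi> (\<phi> x) = x" if "x \<in> carrier R" for x
    using bij that by (simp add: \<psi>_def bij_betw_def)
  have pp': "\<phi> (\<psi> y) = y" "\<psi> y \<in> carrier R" if "y \<in> carrier S" for y
    using bij that by (auto simp: \<psi>_def bij_betw_def f_inv_into_f inv_into_into)
  have "\<psi> \<in> ring_hom S R"
    using ring_iso_set_sym[OF R.ring_axioms, of \<phi> S] hom bij by (simp add: \<psi>_def ring_iso_def)
  moreover have "\<psi> ` H r = G r" for r unfolding im[symmetric] using G[of r] pp by (auto simp: image_image subset_iff)
  moreover have "H r \<subseteq> carrier S" for r unfolding im[symmetric] using G[of r] ring_hom_closed[OF hom] by auto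
  moreover have "\<phi> (k \<odot>\<^bsub>R\<^esub> \<one>\<^bsub>R\<^esub>) = k \<odot>\<^bsub>S\<^esub> \<one>\<^bsub>S\<^esub>" for k using sm[OF R.one_closed] ring_hom_one[OF hom] by simp
  ultimately interpret graded_pair R S G H \<phi> \<psi>
    using hom pp pp' im G k by unfold_locales auto
  show ?thesis by (rule proj_iso)
qed

section \<open>The algebra \<open>B \<otimes> \<complex>\<close>\<close>

lemma algebra_via_cring:
  assumes "cring R" shows "cring (algebra_via R \<eta>)"
proof -
  interpret cring R by fact
  show ?thesis
    by (intro cringI abelian_groupI comm_monoidI)
      (auto simp: algebra_via_simps a_assoc m_assoc l_distr intro: a_comm m_comm l_neg r_neg bexI[of _ "\<ominus>\<^bsub>R\<^esub> _"] exI)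
qed

lemma type_ring_simps [simp]:
  "carrier type_ring = UNIV" "mult type_ring = (*)" "one type_ring = 1" "zero type_ring = 0" "add type_ring = (+)"
  by (simp_all add: type_ring_def)

lemma type_ring_cring: "cring (type_ring :: 'a::comm_ring_1 ring)"
  by (intro cringI abelian_groupI comm_monoidI) (auto simp: algebra_simps intro: exI[of _ "- _"])

lemma type_ring_hom:
  assumes "cring R" "\<And>x y. x \<in> carrier R \<Longrightarrow> y \<in> carrier R \<Longrightarrow> h (x \<otimes>\<^bsub>R\<^esub> y) = h x * h y"
    "\<And>x y. x \<in> carrier R \<Longrightarrow> y \<in> carrier R \<Longrightarrow> h (x \<oplus>\<^bsub>R\<^esub> y) = h x + h y" "h \<one>\<^bsub>R\<^esub> = 1"
  shows "ring_hom_ring R (type_ring :: 'a::comm_ring_1 ring) h"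
  by (intro ring_hom_ringI cring.axioms(1)[OF assms(1)] cring.axioms(1)[OF type_ring_cring]) (simp_all add: assms)

lemma genideal_vanish:
  assumes "ring_hom_ring R (type_ring :: 'a::comm_ring_1 ring) h" "A \<subseteq> carrier R" "\<And>a. a \<in> A \<Longrightarrow> h a = 0"
    "x \<in> Idl\<^bsub>R\<^esub> A"
  shows "h x = 0"
proof -
  interpret ring_hom_ring R "type_ring :: 'a ring" h by fact
  have "Idl\<^bsub>R\<^esub> A \<subseteq> a_kernel R type_ring h"
  proof (rule R.genideal_minimal[OF kernel_is_ideal], rule subsetI)
    fix a assume "a \<in> A"
    thus "a \<in> a_kernel R type_ring h" using assms(2,3) unfolding a_kernel_def' by simp blast
  qed
  hence "x \<in> a_kernel R type_ring h" using assms(4) ..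
  thus ?thesis unfolding a_kernel_def' by simp
qed

lemma coset_eq_iff:
  fixes I :: "'a::ab_group_add set"
  assumes "0 \<in> I" "\<And>x y. x \<in> I \<Longrightarrow> y \<in> I \<Longrightarrow> x - y \<in> I"
  shows "(\<lambda>i. i + p) ` I = (\<lambda>i. i + q) ` I \<longleftrightarrow> p - q \<in> I"
proof
  assume "(\<lambda>i. i + p) ` I = (\<lambda>i. i + q) ` I"
  hence "0 + p \<in> (\<lambda>i. i + q) ` I" using assms(1) by blast
  thus "p - q \<in> I" by auto
next
  assume d: "p - q \<in> I"
  have "- (p - q) \<in> I" using assms(2)[OF assms(1) d] by simp
  have *: "(\<lambda>i. i + p) ` I \<subseteq> (\<lambda>i. i + q) ` I" if d: "- (p - q) \<in> I" for p q
  proof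
    fix x assume "x \<in> (\<lambda>i. i + p) ` I"
    then obtain i where i: "i \<in> I" "x = i + p" by auto
    have "i - - (p - q) \<in> I" by (rule assms(2)[OF i(1) d])
    moreover have "x = (i - - (p - q)) + q" using i(2) by simp
    ultimately show "x \<in> (\<lambda>i. i + q) ` I" by blast
  qed
  show "(\<lambda>i. i + p) ` I = (\<lambda>i. i + q) ` I" using *[of p q] *[of q p] d \<open>- (p - q) \<in> I\<close> by auto
qed

section \<open>Polynomials in the seven variables: evaluation and reduction\<close>

lemma UNIV_box_var: "UNIV = {Z1, Z2, Z3, W1, W2, W3, C}"
  using box_var.exhaust by blast

definition mon :: "(box_var \<Rightarrow> 'b::comm_ring_1) \<Rightarrow> (box_var \<Rightarrow>\<^sub>0 nat) \<Rightarrow> 'b" where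
  "mon a m = (\<Prod>v\<in>UNIV. a v ^ Poly_Mapping.lookup m v)"

definition peval :: "('k::zero \<Rightarrow> 'b::comm_ring_1) \<Rightarrow> (box_var \<Rightarrow> 'b) \<Rightarrow> 'k box_poly \<Rightarrow> 'b" where
  "peval \<sigma> a p = (\<Sum>m\<in>Poly_Mapping.keys p. \<sigma> (Poly_Mapping.lookup p m) * mon a m)"

lemma mon_add: "mon a (m + m') = mon a m * mon a m'"
  by (simp add: mon_def lookup_add power_add prod.distrib)

lemma mon_zero [simp]: "mon a 0 = 1"
  by (simp add: mon_def)

lemma mon_single: "mon a (Poly_Mapping.single v n) = a v ^ n"
  unfolding mon_def UNIV_box_var by (cases v) (simp_all add: lookup_single)

lemma mon_explicit: "mon a m = a Z1 ^ Poly_Mapping.lookup m Z1 * a Z2 ^ Poly_Mapping.lookup m Z2 * a Z3 ^ Poly_Mapping.lookup m Z3 *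
   a W1 ^ Poly_Mapping.lookup m W1 * a W2 ^ Poly_Mapping.lookup m W2 * a W3 ^ Poly_Mapping.lookup m W3 * a C ^ Poly_Mapping.lookup m C"
  unfolding mon_def UNIV_box_var by simp

lemma monom_degree_explicit: "monom_degree m = Poly_Mapping.lookup m Z1 + Poly_Mapping.lookup m Z2 + Poly_Mapping.lookup m Z3 +
   Poly_Mapping.lookup m W1 + Poly_Mapping.lookup m W2 + Poly_Mapping.lookup m W3 + Poly_Mapping.lookup m C"
proof -
  have "monom_degree m = (\<Sum>v\<in>UNIV. Poly_Mapping.lookup m v)"
    unfolding monom_degree_def
  proof (rule sum.mono_neutral_left)
    show "finite (UNIV :: box_var set)" unfolding UNIV_box_var by simp
  qed (auto simp: in_keys_iff)
  thus ?thesis unfolding UNIV_box_var by simp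
qed

lemma poly_induct [consumes 1, case_names zero add]:
  fixes p :: "'a \<Rightarrow>\<^sub>0 'k::ab_group_add"
  assumes "Poly_Mapping.keys p \<subseteq> S" "P 0" "\<And>m k q. m \<in> S \<Longrightarrow> P q \<Longrightarrow> P (Poly_Mapping.single m k + q)"
  shows "P p"
proof -
  have "P (\<Sum>m\<in>I. Poly_Mapping.single m (Poly_Mapping.lookup p m))" if "finite I" "I \<subseteq> S" for I
    using that by (induction I rule: finite_induct) (use assms(2,3) in auto)
  from this[OF finite_keys assms(1)]
  have "P (\<Sum>m\<in>Poly_Mapping.keys p. Poly_Mapping.single m (Poly_Mapping.lookup p m))" .
  moreover have "(\<Sum>m\<in>Poly_Mapping.keys p. Poly_Mapping.single m (Poly_Mapping.lookup p m)) = p"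
    by (rule poly_mapping_eqI) (simp add: lookup_sum lookup_single when_def in_keys_iff)
  ultimately show ?thesis by simp
qed

lemmas poly_induct_UNIV = poly_induct[OF subset_UNIV, case_names zero add]

text \<open>Used twice: with the rational constants as power series, for evaluating B, and with the
  identity of the complex numbers, for the polynomials of the surjectivity proof.\<close>

locale coeff_hom =
  fixes \<sigma> :: "'k::comm_ring_1 \<Rightarrow> 'b::comm_ring_1"
  assumes add: "\<And>x y. \<sigma> (x + y) = \<sigma> x + \<sigma> y" and mult: "\<And>x y. \<sigma> (x * y) = \<sigma> x * \<sigma> y" and one: "\<sigma> 1 = 1"
begin

lemma zero: "\<sigma> 0 = 0"
  using add[of 0 0] by simp

lemma power: "\<sigma> (x ^ n) = \<sigma> x ^ n"
  by (induction n) (simp_all add: one mult)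

lemma sum: "\<sigma> (\<Sum>i\<in>A. f i) = (\<Sum>i\<in>A. \<sigma> (f i))"
  by (induction A rule: infinite_finite_induct) (simp_all add: zero add)

lemma prod: "\<sigma> (\<Prod>i\<in>A. f i) = (\<Prod>i\<in>A. \<sigma> (f i))"
  by (induction A rule: infinite_finite_induct) (simp_all add: one mult)

lemma peval_superset:
  assumes "finite M" "Poly_Mapping.keys p \<subseteq> M"
  shows "peval \<sigma> a p = (\<Sum>m\<in>M. \<sigma> (Poly_Mapping.lookup p m) * mon a m)"
  unfolding peval_def by (rule sum.mono_neutral_left) (use assms in \<open>auto simp: in_keys_iff zero\<close>)

lemma peval_add: "peval \<sigma> a (p + q) = peval \<sigma> a p + peval \<sigma> a q"
  using keys_add[of p q]
  by (simp add: peval_superset[of "Poly_Mapping.keys p \<union> Poly_Mapping.keys q"] lookup_add add sum.distrib algebra_simps)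

lemma peval_zero [simp]: "peval \<sigma> a 0 = 0"
  by (simp add: peval_def)

lemma peval_single [simp]: "peval \<sigma> a (Poly_Mapping.single m k) = \<sigma> k * mon a m"
  by (subst peval_superset[of "{m}"]) auto

lemma peval_one [simp]: "peval \<sigma> a 1 = 1"
  using peval_single[of a 0 1] by (simp add: one)

lemma peval_mult: "peval \<sigma> a (p * q) = peval \<sigma> a p * peval \<sigma> a q"
proof (induction p rule: poly_induct_UNIV)
  case (add m k p)
  have "peval \<sigma> a (Poly_Mapping.single m k * q) = peval \<sigma> a (Poly_Mapping.single m k) * peval \<sigma> a q"
  proof (induction q rule: poly_induct_UNIV)
    case (add m' k' q)
    thus ?case by (simp add: distrib_left peval_add mult_single mult mon_add mult_ac)
  qed auto
  thus ?case using add by (simp add: distrib_right peval_add)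
qed auto

lemma peval_minus: "peval \<sigma> a (- p) = - peval \<sigma> a p"
  using peval_add[of a p "- p"] by (simp add: eq_neg_iff_add_eq_0 add.commute)

lemma peval_diff: "peval \<sigma> a (p - q) = peval \<sigma> a p - peval \<sigma> a q"
  using peval_add[of a p "- q"] by (simp add: peval_minus)

lemma peval_power: "peval \<sigma> a (p ^ n) = peval \<sigma> a p ^ n"
  by (induction n) (simp_all add: peval_mult)

end

interpretation poly_ring: cring "type_ring :: rat box_poly ring"
  by (rule type_ring_cring)

lemma box_relations_subset: "box_relations \<subseteq> carrier type_ring" by simp

lemma box_ideal_ideal: "ideal box_ideal type_ring"
  unfolding box_ideal_def by (rule poly_ring.genideal_ideal) simp

lemma box_ideal_closed:
  shows "0 \<in> box_ideal" "x \<in> box_ideal \<Longrightarrow> y \<in> box_ideal \<Longrightarrow> x + y \<in> box_ideal"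
    "x \<in> box_ideal \<Longrightarrow> p * x \<in> box_ideal" "x \<in> box_ideal \<Longrightarrow> - x \<in> box_ideal"
    "x \<in> box_ideal \<Longrightarrow> y \<in> box_ideal \<Longrightarrow> x - y \<in> box_ideal"
proof -
  interpret ideal box_ideal type_ring by (rule box_ideal_ideal)
  show "0 \<in> box_ideal" using zero_closed by simp
  show a: "x \<in> box_ideal \<Longrightarrow> y \<in> box_ideal \<Longrightarrow> x + y \<in> box_ideal" for x y using a_closed[of x y] by simp
  show m: "x \<in> box_ideal \<Longrightarrow> p * x \<in> box_ideal" for x p using I_l_closed[of x p] by simp
  show n: "x \<in> box_ideal \<Longrightarrow> - x \<in> box_ideal" for x using m[of x "-1"] by simp
  show "x \<in> box_ideal \<Longrightarrow> y \<in> box_ideal \<Longrightarrow> x - y \<in> box_ideal" using a[of x "- y"] n[of y] by simp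
qed

lemma box_class_def': "box_class p = (\<lambda>i. i + p) ` box_ideal"
  by (auto simp: box_class_def a_r_coset_def')

lemma box_class_eq: "box_class p = box_class q \<longleftrightarrow> p - q \<in> box_ideal"
  unfolding box_class_def' by (rule coset_eq_iff[OF box_ideal_closed(1,5)])

lemma box_algebra_simps [simp]:
  "carrier box_algebra = range box_class"
  "box_class p \<otimes>\<^bsub>box_algebra\<^esub> box_class q = box_class (p * q)"
  "box_class p \<oplus>\<^bsub>box_algebra\<^esub> box_class q = box_class (p + q)"
  "\<one>\<^bsub>box_algebra\<^esub> = box_class 1"
  "k \<odot>\<^bsub>box_algebra\<^esub> box_class p = box_class (poly_const k * p)"
proof -
  interpret ideal box_ideal type_ring by (rule box_ideal_ideal)
  show "carrier box_algebra = range box_class"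
    by (auto simp: box_algebra_def algebra_via_simps FactRing_def A_RCOSETS_def' box_class_def)
  show m: "box_class p \<otimes>\<^bsub>box_algebra\<^esub> box_class q = box_class (p * q)" for p q
    using rcoset_mult_add[of p q] by (simp add: box_algebra_def algebra_via_simps FactRing_def box_class_def)
  show "box_class p \<oplus>\<^bsub>box_algebra\<^esub> box_class q = box_class (p + q)"
    using a_rcos_sum[of p q] by (simp add: box_algebra_def algebra_via_simps FactRing_def box_class_def)
  show "\<one>\<^bsub>box_algebra\<^esub> = box_class 1"
    by (simp add: box_algebra_def algebra_via_simps FactRing_def box_class_def)
  have "k \<odot>\<^bsub>box_algebra\<^esub> box_class p = box_class (poly_const k) \<otimes>\<^bsub>box_algebra\<^esub> box_class p"
    by (simp only: box_algebra_def algebra_via_simps)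
  thus "k \<odot>\<^bsub>box_algebra\<^esub> box_class p = box_class (poly_const k * p)" unfolding m .
qed

lemma box_algebra_cring: "cring box_algebra"
  unfolding box_algebra_def
  by (rule algebra_via_cring[OF ideal.quotient_is_cring[OF box_ideal_ideal type_ring_cring]])

lemma complex_algebra_simps [simp]:
  "carrier complex_algebra = UNIV" "mult complex_algebra = (*)" "one complex_algebra = 1" "add complex_algebra = (+)"
  "zero complex_algebra = 0" "k \<odot>\<^bsub>complex_algebra\<^esub> c = of_rat k * c"
  by (simp_all add: complex_algebra_def algebra_via_simps)

lemma complex_algebra_cring: "cring complex_algebra"
  unfolding complex_algebra_def by (rule algebra_via_cring[OF type_ring_cring])

lemma box_ideal_vanish:
  assumes "coeff_hom \<sigma>" "\<And>p. p \<in> box_relations \<Longrightarrow> peval \<sigma> a p = 0" "p \<in> box_ideal"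
  shows "peval \<sigma> a p = 0"
proof -
  interpret coeff_hom \<sigma> by fact
  have "ring_hom_ring type_ring type_ring (peval \<sigma> a)"
    by (rule type_ring_hom[OF type_ring_cring]) (simp_all add: peval_mult peval_add)
  from genideal_vanish[OF this box_relations_subset assms(2)] assms(3) show ?thesis
    by (simp add: box_ideal_def)
qed

definition reduced_mon :: "(box_var \<Rightarrow>\<^sub>0 nat) \<Rightarrow> bool" where
  "reduced_mon m \<longleftrightarrow> (\<forall>v\<in>{Z1, Z2, Z3, C}. Poly_Mapping.lookup m v \<le> 1)"

text \<open>The four defining relations, up to sign, in one common shape, so that the reduction
  treats Z1, Z2, Z3 and C alike.\<close>

lemma square_relation:
  assumes "v \<in> {Z1, Z2, Z3, C}"
  shows "\<exists>V\<subseteq>{W1, W2, W3}. poly_var v ^ 2 - (\<Sum>w\<in>V. poly_var w ^ 2) \<in> box_ideal"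
proof -
  have r: "- p \<in> box_ideal" if "p \<in> box_relations" for p
    using poly_ring.genideal_self[OF box_relations_subset] that box_ideal_closed(4) by (auto simp: box_ideal_def)
  define Q where "Q v \<longleftrightarrow> (\<exists>V\<subseteq>{W1, W2, W3}. poly_var v ^ 2 - (\<Sum>w\<in>V. poly_var w ^ 2) \<in> box_ideal)" for v
  have Q: "Q v" if "V \<subseteq> {W1, W2, W3}" "poly_var v ^ 2 - (\<Sum>w\<in>V. poly_var w ^ 2) \<in> box_ideal" for v V
    unfolding Q_def using that by (intro exI[of _ V] conjI)
  have "Q Z3"
    by (rule Q[of "{W1, W2}"], simp)
      (use r[of "poly_var W1 ^ 2 + poly_var W2 ^ 2 - poly_var Z3 ^ 2"] in \<open>simp add: box_relations_def algebra_simps\<close>)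
  moreover have "Q Z2"
    by (rule Q[of "{W1, W3}"], simp)
      (use r[of "poly_var W1 ^ 2 + poly_var W3 ^ 2 - poly_var Z2 ^ 2"] in \<open>simp add: box_relations_def algebra_simps\<close>)
  moreover have "Q Z1"
    by (rule Q[of "{W2, W3}"], simp)
      (use r[of "poly_var W2 ^ 2 + poly_var W3 ^ 2 - poly_var Z1 ^ 2"] in \<open>simp add: box_relations_def algebra_simps\<close>)
  moreover have "Q C"
    by (rule Q[of "{W1, W2, W3}"], simp)
      (use r[of "poly_var W1 ^ 2 + poly_var W2 ^ 2 + poly_var W3 ^ 2 - poly_var C ^ 2"] in \<open>simp add: box_relations_def algebra_simps\<close>)
  ultimately have "Q v" using assms by blast
  thus ?thesis unfolding Q_def .
qed

lemma poly_var_square: "poly_var v ^ 2 = Poly_Mapping.single (Poly_Mapping.single v 2) 1"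
  by (simp add: poly_var_def power2_eq_square mult_single single_add[symmetric] del: One_nat_def) 

text \<open>Replacing v^2 by squares of the W's keeps the class and lowers the total exponent in Z1,
  Z2, Z3, C by 2, so the rewriting terminates at reduced monomials.\<close>

lemma reduced_representative:
  "\<exists>q. (\<forall>m\<in>Poly_Mapping.keys q. reduced_mon m) \<and> box_class p = box_class q"
proof -
  define D where "D = {p. \<exists>q. (\<forall>m\<in>Poly_Mapping.keys q. reduced_mon m) \<and> p - q \<in> box_ideal}"
  have D: "p \<in> D" if "\<forall>m\<in>Poly_Mapping.keys q. reduced_mon m" "p - q \<in> box_ideal" for p q
    unfolding D_def using that by (intro CollectI exI[of _ q] conjI)
  have D0: "0 \<in> D" by (rule D[of 0]) (simp_all add: box_ideal_closed(1))
  have Dadd: "p + p' \<in> D" if pp: "p \<in> D" "p' \<in> D" for p p'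
  proof -
    obtain q q' where q: "\<forall>m\<in>Poly_Mapping.keys q. reduced_mon m" "p - q \<in> box_ideal"
      "\<forall>m\<in>Poly_Mapping.keys q'. reduced_mon m" "p' - q' \<in> box_ideal" using pp by (auto simp: D_def)
    have "\<forall>m\<in>Poly_Mapping.keys (q + q'). reduced_mon m" using q(1,3) keys_add[of q q'] by blast
    moreover have "p + p' - (q + q') \<in> box_ideal" using box_ideal_closed(2)[OF q(2,4)] by (simp add: algebra_simps)
    ultimately show ?thesis by (rule D)
  qed
  have Dcong: "p \<in> D" if p: "p' \<in> D" "p - p' \<in> box_ideal" for p p'
  proof -
    obtain q where q: "\<forall>m\<in>Poly_Mapping.keys q. reduced_mon m" "p' - q \<in> box_ideal" using p(1) by (auto simp: D_def)
    have "p - q \<in> box_ideal" using box_ideal_closed(2)[OF p(2) q(2)] by simp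
    thus ?thesis by (rule D[OF q(1)])
  qed
  have Dsum: "(\<Sum>i\<in>A. f i) \<in> D" if "\<And>i. i \<in> A \<Longrightarrow> f i \<in> D" for A :: "box_var set" and f
    using that by (induction A rule: infinite_finite_induct) (simp_all add: D0 Dadd)
  let ?n = "\<lambda>m. Poly_Mapping.lookup m Z1 + Poly_Mapping.lookup m Z2 + Poly_Mapping.lookup m Z3 + Poly_Mapping.lookup m C"
  have single: "Poly_Mapping.single m k \<in> D" for m k
  proof (induction m rule: measure_induct_rule[of ?n])
    case (less m)
    show ?case
    proof (cases "reduced_mon m")
      case True
      have "\<forall>m'\<in>Poly_Mapping.keys (Poly_Mapping.single m k). reduced_mon m'" using True by (simp add: keys_single)
      moreover have "Poly_Mapping.single m k - Poly_Mapping.single m k \<in> box_ideal" using box_ideal_closed(1) by simp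
      ultimately show ?thesis by (rule D)
    next
      case False
      then obtain v where v: "v \<in> {Z1, Z2, Z3, C}" "\<not> Poly_Mapping.lookup m v \<le> 1" unfolding reduced_mon_def by blast
      obtain V where V: "V \<subseteq> {W1, W2, W3}" "poly_var v ^ 2 - (\<Sum>w\<in>V. poly_var w ^ 2) \<in> box_ideal"
        using square_relation[OF v(1)] by (elim exE conjE)
      define m' where "m' = m - Poly_Mapping.single v 2"
      have m: "m = m' + Poly_Mapping.single v 2"
        by (rule poly_mapping_eqI) (use v(2) in \<open>auto simp: m'_def lookup_add lookup_minus lookup_single when_def\<close>)
      have "(\<Sum>w\<in>V. Poly_Mapping.single (m' + Poly_Mapping.single w 2) k) \<in> D"
      proof (rule Dsum, rule less)
        fix w assume "w \<in> V"
        hence "w \<in> {W1, W2, W3}" using V(1) by (rule rev_subsetD)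
        thus "?n (m' + Poly_Mapping.single w 2) < ?n m" using v(1) unfolding m by (auto simp: lookup_add lookup_single)
      qed
      moreover have "Poly_Mapping.single m k - (\<Sum>w\<in>V. Poly_Mapping.single (m' + Poly_Mapping.single w 2) k)
          = Poly_Mapping.single m' k * (poly_var v ^ 2 - (\<Sum>w\<in>V. poly_var w ^ 2))"
        unfolding m poly_var_square by (simp add: right_diff_distrib sum_distrib_left mult_single)
      ultimately show ?thesis using Dcong box_ideal_closed(3)[OF V(2)] by metis
    qed
  qed
  have "p \<in> D"
    by (induction p rule: poly_induct_UNIV) (simp_all add: D0 Dadd single)
  thus ?thesis unfolding D_def box_class_eq by blast
qed

section \<open>The monoid ring behind the tensor product\<close>

locale cring_pair = S: cring S + T: cring T
  for S :: "('k, 's) module" and T :: "('k, 't) module"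
begin

abbreviation PR :: "('s \<times> 't \<Rightarrow>\<^sub>0 int) ring" where "PR \<equiv> pair_monoid_ring S T"

lemma PR_simps:
  "carrier PR = {x. Poly_Mapping.keys x \<subseteq> carrier S \<times> carrier T}"
  "\<one>\<^bsub>PR\<^esub> = frag_of (\<one>\<^bsub>S\<^esub>, \<one>\<^bsub>T\<^esub>)" "\<zero>\<^bsub>PR\<^esub> = 0" "x \<oplus>\<^bsub>PR\<^esub> y = x + y"
  by (simp_all add: pair_monoid_ring_def)

lemma PR_mult: "x \<otimes>\<^bsub>PR\<^esub> y = frag_extend (\<lambda>p. frag_extend (\<lambda>q. frag_of (fst p \<otimes>\<^bsub>S\<^esub> fst q, snd p \<otimes>\<^bsub>T\<^esub> snd q)) y) x"
  by (simp add: pair_monoid_ring_def case_prod_unfold)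

lemma PR_mult_frag: "frag_of (s, t) \<otimes>\<^bsub>PR\<^esub> frag_of (s', t') = frag_of (s \<otimes>\<^bsub>S\<^esub> s', t \<otimes>\<^bsub>T\<^esub> t')"
  by (simp add: PR_mult)

lemma frag_of_closed [simp]: "frag_of (s, t) \<in> carrier PR \<longleftrightarrow> s \<in> carrier S \<and> t \<in> carrier T"
  by (simp add: PR_simps keys_frag_of)

lemma PR_closed: "0 \<in> carrier PR" "x \<in> carrier PR \<Longrightarrow> y \<in> carrier PR \<Longrightarrow> x - y \<in> carrier PR"
    "x \<in> carrier PR \<Longrightarrow> y \<in> carrier PR \<Longrightarrow> x + y \<in> carrier PR" "x \<in> carrier PR \<Longrightarrow> - x \<in> carrier PR"
  using keys_diff[of x y] keys_add[of x y] by (auto simp: PR_simps)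

lemma PR_diff_left: "(x - x') \<otimes>\<^bsub>PR\<^esub> y = x \<otimes>\<^bsub>PR\<^esub> y - x' \<otimes>\<^bsub>PR\<^esub> y"
  by (simp add: PR_mult frag_extend_diff)

lemma PR_diff_right: "y \<otimes>\<^bsub>PR\<^esub> (x - x') = y \<otimes>\<^bsub>PR\<^esub> x - y \<otimes>\<^bsub>PR\<^esub> x'"
  using subset_UNIV[of "Poly_Mapping.keys y"]
  by (induction y rule: frag_induction) (simp_all add: PR_diff_left PR_mult frag_extend_diff)

lemma PR_mult_zero: "0 \<otimes>\<^bsub>PR\<^esub> y = 0" "y \<otimes>\<^bsub>PR\<^esub> 0 = 0"
  using PR_diff_left[of 0 0 y] PR_diff_right[of y 0 0] by simp_all

text \<open>The free abelian group on pairs is generated by them under differences. As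
  multiplication is biadditive, each ring axiom has to be checked on pairs only.\<close>

lemma PR_induct [consumes 1, case_names zero frag diff]:
  assumes "x \<in> carrier PR" and "P 0" and "\<And>s t. s \<in> carrier S \<Longrightarrow> t \<in> carrier T \<Longrightarrow> P (frag_of (s, t))"
    and "\<And>x y. x \<in> carrier PR \<Longrightarrow> y \<in> carrier PR \<Longrightarrow> P x \<Longrightarrow> P y \<Longrightarrow> P (x - y)"
  shows "P x"
proof -
  have "Poly_Mapping.keys x \<subseteq> carrier S \<times> carrier T" using assms(1) by (simp add: PR_simps)
  hence "x \<in> carrier PR \<and> P x"
  proof (induction x rule: frag_induction)
    case (one p)
    thus ?case using assms(3) by (cases p) auto
  qed (use assms(2,4) PR_closed in auto)
  thus ?thesis ..
qed

lemma PR_mult_closed: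
  assumes "x \<in> carrier PR" "y \<in> carrier PR" shows "x \<otimes>\<^bsub>PR\<^esub> y \<in> carrier PR"
  using assms(1)
proof (induction x rule: PR_induct)
  case (frag s t)
  show ?case using assms(2)
    by (induction y rule: PR_induct) (use frag in \<open>simp_all add: PR_mult_zero PR_diff_right PR_mult_frag PR_closed\<close>)
qed (simp_all add: PR_mult_zero PR_diff_left PR_closed)

lemma PR_mult_comm:
  assumes "x \<in> carrier PR" "y \<in> carrier PR" shows "x \<otimes>\<^bsub>PR\<^esub> y = y \<otimes>\<^bsub>PR\<^esub> x"
  using assms(1)
proof (induction x rule: PR_induct)
  case (frag s t)
  show ?case using assms(2)
    by (induction y rule: PR_induct)
      (use frag in \<open>simp_all add: PR_mult_zero PR_diff_right PR_diff_left PR_mult_frag S.m_comm T.m_comm\<close>)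
qed (simp_all add: PR_mult_zero PR_diff_left PR_diff_right)

lemma PR_mult_assoc:
  assumes "x \<in> carrier PR" "y \<in> carrier PR" "z \<in> carrier PR"
  shows "(x \<otimes>\<^bsub>PR\<^esub> y) \<otimes>\<^bsub>PR\<^esub> z = x \<otimes>\<^bsub>PR\<^esub> (y \<otimes>\<^bsub>PR\<^esub> z)"
  using assms(1)
proof (induction x rule: PR_induct)
  case (frag s t)
  show ?case using assms(2)
  proof (induction y rule: PR_induct)
    case (frag s' t')
    show ?case using assms(3)
      by (induction z rule: PR_induct)
        (use frag \<open>s \<in> carrier S\<close> \<open>t \<in> carrier T\<close> in \<open>simp_all add: PR_mult_zero PR_diff_right PR_mult_frag S.m_assoc T.m_assoc\<close>)
  qed (simp_all add: PR_mult_zero PR_diff_left PR_diff_right)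
qed (simp_all add: PR_mult_zero PR_diff_left)

lemma PR_one_left: "x \<in> carrier PR \<Longrightarrow> \<one>\<^bsub>PR\<^esub> \<otimes>\<^bsub>PR\<^esub> x = x"
  by (induction x rule: PR_induct) (simp_all add: PR_simps(2) PR_mult_zero PR_diff_right PR_mult_frag)

lemma PR_add_left: "(x + x') \<otimes>\<^bsub>PR\<^esub> y = x \<otimes>\<^bsub>PR\<^esub> y + x' \<otimes>\<^bsub>PR\<^esub> y"
  by (simp add: PR_mult frag_extend_add)

lemma PR_cring: "cring PR"
proof (rule cringI)
  show "abelian_group PR"
  proof (rule abelian_groupI)
    fix x assume "x \<in> carrier PR"
    thus "\<exists>y\<in>carrier PR. y \<oplus>\<^bsub>PR\<^esub> x = \<zero>\<^bsub>PR\<^esub>"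
      by (intro bexI[of _ "- x"]) (simp_all add: PR_simps(3,4) PR_closed)
  qed (simp_all add: PR_simps(3,4) PR_closed algebra_simps)
  show "comm_monoid PR"
    by (rule comm_monoidI) (simp_all add: PR_mult_closed PR_mult_assoc PR_one_left, simp_all add: PR_simps(2) PR_mult_comm)
qed (simp add: PR_simps(4) PR_add_left)

end

definition lin :: "('a \<Rightarrow> 'b::comm_ring_1) \<Rightarrow> ('a \<Rightarrow>\<^sub>0 int) \<Rightarrow> 'b" where
  "lin h x = (\<Sum>k\<in>Poly_Mapping.keys x. of_int (Poly_Mapping.lookup x k) * h k)"

lemma lin_superset:
  assumes "finite M" "Poly_Mapping.keys x \<subseteq> M" shows "lin h x = (\<Sum>k\<in>M. of_int (Poly_Mapping.lookup x k) * h k)"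
  unfolding lin_def by (rule sum.mono_neutral_left) (use assms in \<open>auto simp: in_keys_iff\<close>)

lemma lin_diff: "lin h (x - y) = lin h x - lin h y"
  using keys_diff[of x y]
  by (simp add: lin_superset[of "Poly_Mapping.keys x \<union> Poly_Mapping.keys y"] lookup_minus sum_subtractf algebra_simps)

lemma lin_zero [simp]: "lin h 0 = 0"
  by (simp add: lin_def)

lemma lin_frag [simp]: "lin h (frag_of k) = h k"
  by (simp add: lin_def)

lemma lin_add: "lin h (x + y) = lin h x + lin h y"
  using lin_diff[of h x "- y"] lin_diff[of h 0 y] by simp

lemma lin_sum: "lin h (\<Sum>i\<in>A. f i) = (\<Sum>i\<in>A. lin h (f i))"
  by (induction A rule: infinite_finite_induct) (simp_all add: lin_add)

locale algebra_pair = cring_pair S T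
  for S :: "('k, 's) module" and T :: "('k, 't) module" +
  assumes smult_S: "\<And>k s. s \<in> carrier S \<Longrightarrow> k \<odot>\<^bsub>S\<^esub> s \<in> carrier S"
    and smult_T: "\<And>k t. t \<in> carrier T \<Longrightarrow> k \<odot>\<^bsub>T\<^esub> t \<in> carrier T"
begin

abbreviation J :: "('s \<times> 't \<Rightarrow>\<^sub>0 int) set" where "J \<equiv> tensor_ideal S T"

lemma relations_subset: "tensor_relations S T \<subseteq> carrier PR"
  by (auto simp: tensor_relations_def smult_S smult_T intro!: PR_closed)

lemma J_ideal: "ideal J PR"
  unfolding tensor_ideal_def by (rule ring.genideal_ideal[OF cring.axioms(1)[OF PR_cring] relations_subset])

lemma J_subset: "J \<subseteq> carrier PR"
  using J_ideal by (simp add: additive_subgroup.a_subset ideal.axioms(1))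

lemma J_zero: "0 \<in> J"
  using additive_subgroup.zero_closed[OF ideal.axioms(1)[OF J_ideal]] by (simp add: PR_simps)

lemma J_add: "x \<in> J \<Longrightarrow> y \<in> J \<Longrightarrow> x + y \<in> J"
  using additive_subgroup.a_closed[OF ideal.axioms(1)[OF J_ideal], of x y] by (simp add: PR_simps)

lemma J_uminus: assumes "x \<in> J" shows "- x \<in> J"
proof -
  interpret R: cring PR by (rule PR_cring)
  have x: "x \<in> carrier PR" using assms J_subset by auto
  have "\<ominus>\<^bsub>PR\<^esub> x = - x"
    by (rule R.minus_equality) (use x in \<open>simp_all add: PR_simps(3,4) PR_closed\<close>)
  thus ?thesis using additive_subgroup.a_inv_closed[OF ideal.axioms(1)[OF J_ideal] assms] by simp
qed

lemma J_diff: "x \<in> J \<Longrightarrow> y \<in> J \<Longrightarrow> x - y \<in> J"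
  using J_add[of x "- y"] J_uminus[of y] by simp

lemma relation_J: "x \<in> tensor_relations S T \<Longrightarrow> x \<in> J"
  unfolding tensor_ideal_def using ring.genideal_self[OF cring.axioms(1)[OF PR_cring] relations_subset] by blast

lemma J_add_left: "s \<in> carrier S \<Longrightarrow> s' \<in> carrier S \<Longrightarrow> t \<in> carrier T \<Longrightarrow>
    frag_of (s \<oplus>\<^bsub>S\<^esub> s', t) - frag_of (s, t) - frag_of (s', t) \<in> J"
  by (rule relation_J) (auto simp: tensor_relations_def)

lemma J_add_right: "s \<in> carrier S \<Longrightarrow> t \<in> carrier T \<Longrightarrow> t' \<in> carrier T \<Longrightarrow>
    frag_of (s, t \<oplus>\<^bsub>T\<^esub> t') - frag_of (s, t) - frag_of (s, t') \<in> J"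
  by (rule relation_J) (auto simp: tensor_relations_def)

lemma J_smult: "s \<in> carrier S \<Longrightarrow> t \<in> carrier T \<Longrightarrow> frag_of (k \<odot>\<^bsub>S\<^esub> s, t) - frag_of (s, k \<odot>\<^bsub>T\<^esub> t) \<in> J"
  by (rule relation_J) (auto simp: tensor_relations_def)

lemma J_zero_right: "s \<in> carrier S \<Longrightarrow> frag_of (s, \<zero>\<^bsub>T\<^esub>) \<in> J"
  using J_uminus[OF J_add_right[of s "\<zero>\<^bsub>T\<^esub>" "\<zero>\<^bsub>T\<^esub>"]] by simp

lemma J_zero_left: "t \<in> carrier T \<Longrightarrow> frag_of (\<zero>\<^bsub>S\<^esub>, t) \<in> J"
  using J_uminus[OF J_add_left[of "\<zero>\<^bsub>S\<^esub>" "\<zero>\<^bsub>S\<^esub>" t]] by simp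

lemma lin_hom:
  assumes one: "h (\<one>\<^bsub>S\<^esub>, \<one>\<^bsub>T\<^esub>) = 1"
    and mult: "\<And>s s' t t'. s \<in> carrier S \<Longrightarrow> s' \<in> carrier S \<Longrightarrow> t \<in> carrier T \<Longrightarrow> t' \<in> carrier T \<Longrightarrow>
      h (s \<otimes>\<^bsub>S\<^esub> s', t \<otimes>\<^bsub>T\<^esub> t') = h (s, t) * h (s', t')"
  shows "ring_hom_ring PR type_ring (lin h)"
proof (rule type_ring_hom[OF PR_cring])
  fix x y assume x: "x \<in> carrier PR" and y: "y \<in> carrier PR"
  show "lin h (x \<otimes>\<^bsub>PR\<^esub> y) = lin h x * lin h y" using x
  proof (induction x rule: PR_induct)
    case (frag s t)
    show ?case using y
      by (induction y rule: PR_induct)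
        (use frag in \<open>simp_all add: PR_mult_zero PR_diff_right PR_mult_frag lin_diff mult algebra_simps\<close>)
  qed (simp_all add: PR_mult_zero PR_diff_left lin_diff algebra_simps)
qed (simp_all add: PR_simps lin_add one)

text \<open>Universal property of the tensor product: \<open>lin h\<close> is a ring homomorphism by
  \<open>lin_hom\<close>, so vanishing on the ideal can be tested on the generating
  relations.\<close>

lemma lin_vanish:
  assumes "h (\<one>\<^bsub>S\<^esub>, \<one>\<^bsub>T\<^esub>) = 1"
    and "\<And>s s' t t'. s \<in> carrier S \<Longrightarrow> s' \<in> carrier S \<Longrightarrow> t \<in> carrier T \<Longrightarrow> t' \<in> carrier T \<Longrightarrow>
      h (s \<otimes>\<^bsub>S\<^esub> s', t \<otimes>\<^bsub>T\<^esub> t') = h (s, t) * h (s', t')"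
    and add: "\<And>s s' t. s \<in> carrier S \<Longrightarrow> s' \<in> carrier S \<Longrightarrow> t \<in> carrier T \<Longrightarrow> h (s \<oplus>\<^bsub>S\<^esub> s', t) = h (s, t) + h (s', t)"
      "\<And>s t t'. s \<in> carrier S \<Longrightarrow> t \<in> carrier T \<Longrightarrow> t' \<in> carrier T \<Longrightarrow> h (s, t \<oplus>\<^bsub>T\<^esub> t') = h (s, t) + h (s, t')"
    and smult: "\<And>k s t. s \<in> carrier S \<Longrightarrow> t \<in> carrier T \<Longrightarrow> h (k \<odot>\<^bsub>S\<^esub> s, t) = h (s, k \<odot>\<^bsub>T\<^esub> t)"
    and x: "x \<in> J"
  shows "lin h x = 0"
proof (rule genideal_vanish[OF lin_hom[OF assms(1,2)] relations_subset _ x[unfolded tensor_ideal_def]])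
  fix x assume "x \<in> tensor_relations S T"
  thus "lin h x = 0" unfolding tensor_relations_def
    by (elim UnE CollectE exE conjE) (simp_all add: lin_diff add smult)
qed

end

interpretation box: algebra_pair box_algebra complex_algebra
proof (intro algebra_pair.intro cring_pair.intro algebra_pair_axioms.intro)
  fix k s assume "s \<in> carrier box_algebra"
  thus "k \<odot>\<^bsub>box_algebra\<^esub> s \<in> carrier box_algebra" by auto
qed (auto simp: box_algebra_cring complex_algebra_cring)

text \<open>A lift to the monoid ring of the evident map from complex polynomials to the tensor
  product. It is additive only modulo the tensor ideal.\<close>

definition tau :: "complex box_poly \<Rightarrow> (rat box_poly set \<times> complex \<Rightarrow>\<^sub>0 int)" where
  "tau P = (\<Sum>m\<in>Poly_Mapping.keys P. frag_of (box_class (Poly_Mapping.single m 1), Poly_Mapping.lookup P m))"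

text \<open>A pair with second entry 0 is not zero in the monoid ring, it merely lies in the tensor
  ideal. Hence enlarging the index set beyond the support is harmless only up to that ideal.\<close>

lemma tau_superset:
  assumes "finite M" "Poly_Mapping.keys P \<subseteq> M"
  shows "(\<Sum>m\<in>M. frag_of (box_class (Poly_Mapping.single m 1), Poly_Mapping.lookup P m)) - tau P \<in> box.J"
proof -
  have sumJ: "(\<Sum>m\<in>A. f m) \<in> box.J" if "\<And>m. m \<in> A \<Longrightarrow> f m \<in> box.J" for A :: "(box_var \<Rightarrow>\<^sub>0 nat) set" and f
    using that by (induction A rule: infinite_finite_induct) (simp_all add: box.J_zero box.J_add)
  let ?f = "\<lambda>m. frag_of (box_class (Poly_Mapping.single m 1), Poly_Mapping.lookup P m)"
  have "sum ?f M = sum ?f (M - Poly_Mapping.keys P) + sum ?f (Poly_Mapping.keys P)"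
    by (rule sum.subset_diff[OF assms(2,1)])
  moreover have "sum ?f (M - Poly_Mapping.keys P) \<in> box.J"
    by (rule sumJ) (use box.J_zero_right in \<open>auto simp: in_keys_iff\<close>)
  ultimately show ?thesis by (simp add: tau_def)
qed

lemma tau_add: "tau (P + Q) - (tau P + tau Q) \<in> box.J"
proof -
  define M where "M = Poly_Mapping.keys P \<union> Poly_Mapping.keys Q"
  let ?f = "\<lambda>P m. frag_of (box_class (Poly_Mapping.single m 1), Poly_Mapping.lookup P m)"
  have M: "finite M" "Poly_Mapping.keys P \<subseteq> M" "Poly_Mapping.keys Q \<subseteq> M" "Poly_Mapping.keys (P + Q) \<subseteq> M"
    using keys_add[of P Q] by (auto simp: M_def)
  have "(\<Sum>m\<in>A. ?f (P + Q) m - ?f P m - ?f Q m) \<in> box.J" for A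
  proof (induction A rule: infinite_finite_induct)
    case (insert m A)
    have "?f (P + Q) m - ?f P m - ?f Q m \<in> box.J"
      using box.J_add_right[of "box_class (Poly_Mapping.single m 1)" "Poly_Mapping.lookup P m" "Poly_Mapping.lookup Q m"]
      by (simp add: lookup_add)
    thus ?case using insert box.J_add by simp
  qed (simp_all add: box.J_zero)
  from this[of M] have s: "sum (?f (P + Q)) M - sum (?f P) M - sum (?f Q) M \<in> box.J" by (simp add: sum_subtractf)
  have "(sum (?f (P + Q)) M - sum (?f P) M - sum (?f Q) M) - (sum (?f (P + Q)) M - tau (P + Q))
      + ((sum (?f P) M - tau P) + (sum (?f Q) M - tau Q)) \<in> box.J"
    by (intro box.J_add box.J_diff s tau_superset M)
  thus ?thesis by (simp add: algebra_simps)
qed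

lemma tau_single: "tau (Poly_Mapping.single m c) - frag_of (box_class (Poly_Mapping.single m 1), c) \<in> box.J"
  using box.J_uminus[OF tau_superset[of "{m}" "Poly_Mapping.single m c"]] by simp

text \<open>The elements congruent to some reduced \<open>tau P\<close> are closed under sums and
  contain every pair: the first entry is replaced by a reduced representative and its rational
  coefficients are moved to the second. Negatives are carried along because the induction on the
  monoid ring runs over differences.\<close>

lemma tensor_normal_form:
  assumes "x \<in> carrier (pair_monoid_ring box_algebra complex_algebra)"
  shows "\<exists>P. (\<forall>m\<in>Poly_Mapping.keys P. reduced_mon m) \<and> x - tau P \<in> box.J"
proof -
  define N where "N = (\<lambda>P::complex box_poly. \<forall>m\<in>Poly_Mapping.keys P. reduced_mon m)"
  define D where "D = {x. \<exists>P. N P \<and> x - tau P \<in> box.J}"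
  have D: "x \<in> D" if "N P" "x - tau P \<in> box.J" for x P using that by (auto simp: D_def)
  have N_add: "N (P + Q)" if "N P" "N Q" for P Q using that keys_add[of P Q] by (auto simp: N_def)
  have D0: "0 \<in> D" by (rule D[of 0]) (simp_all add: N_def tau_def box.J_zero)
  have Dadd: "x + y \<in> D" if xy: "x \<in> D" "y \<in> D" for x y
  proof -
    obtain P Q where PQ: "N P" "x - tau P \<in> box.J" "N Q" "y - tau Q \<in> box.J" using xy unfolding D_def by blast
    have "((x - tau P) + (y - tau Q)) - (tau (P + Q) - (tau P + tau Q)) \<in> box.J"
      by (intro box.J_add box.J_diff PQ tau_add)
    hence "x + y - tau (P + Q) \<in> box.J" by (simp add: algebra_simps)
    thus ?thesis by (rule D[OF N_add[OF PQ(1,3)]])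
  qed
  have Dcong: "x \<in> D" if xy: "y \<in> D" "x - y \<in> box.J" for x y
  proof -
    obtain P where P: "N P" "y - tau P \<in> box.J" using xy unfolding D_def by blast
    have "x - tau P \<in> box.J" using box.J_add[OF xy(2) P(2)] by simp
    thus ?thesis by (rule D[OF P(1)])
  qed
  have frag: "frag_of (box_class q, c) \<in> D" if "Poly_Mapping.keys q \<subseteq> {m. reduced_mon m}" for q c using that
  proof (induction q rule: poly_induct)
    case zero
    have "\<zero>\<^bsub>box_algebra\<^esub> \<oplus>\<^bsub>box_algebra\<^esub> box_class 0 = box_class 0" by (rule box.S.l_zero) simp
    moreover have "\<zero>\<^bsub>box_algebra\<^esub> \<in> carrier box_algebra" by (rule box.S.zero_closed)
    then obtain p where p: "\<zero>\<^bsub>box_algebra\<^esub> = box_class p" by auto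
    have "\<zero>\<^bsub>box_algebra\<^esub> = box_class 0"
      using calculation unfolding p box_algebra_simps by simp
    thus ?case using box.J_zero_left[of c] D0 Dcong[of 0] by simp
  next
    case (add m k q)
    have "tau (Poly_Mapping.single m (of_rat k * c)) \<in> D"
      by (rule D[of "Poly_Mapping.single m (of_rat k * c)"]) (use add(1) box.J_zero in \<open>auto simp: N_def\<close>)
    from Dcong[OF this, of "frag_of (box_class (Poly_Mapping.single m 1), of_rat k * c)"]
    have "frag_of (box_class (Poly_Mapping.single m 1), of_rat k * c) \<in> D"
      using box.J_uminus[OF tau_single[of m "of_rat k * c"]] by simp
    moreover have "frag_of (box_class (Poly_Mapping.single m k), c) - frag_of (box_class (Poly_Mapping.single m 1), of_rat k * c) \<in> box.J"
      using box.J_smult[of "box_class (Poly_Mapping.single m 1)" c k] by (simp add: poly_const_def mult_single)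
    ultimately have "frag_of (box_class (Poly_Mapping.single m k), c) \<in> D" by (rule Dcong)
    from Dadd[OF this add(2)]
    have "frag_of (box_class (Poly_Mapping.single m k), c) + frag_of (box_class q, c) \<in> D" .
    moreover have "frag_of (box_class (Poly_Mapping.single m k + q), c) - (frag_of (box_class (Poly_Mapping.single m k), c) + frag_of (box_class q, c)) \<in> box.J"
      using box.J_add_left[of "box_class (Poly_Mapping.single m k)" "box_class q" c] by (simp add: algebra_simps)
    ultimately show ?case by (rule Dcong)
  qed
  have frag': "frag_of (s, c) \<in> D" if "s \<in> carrier box_algebra" for s c
  proof -
    obtain p where "s = box_class p" using \<open>s \<in> carrier box_algebra\<close> by auto
    then obtain q where "\<forall>m\<in>Poly_Mapping.keys q. reduced_mon m" "s = box_class q"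
      using reduced_representative[of p] by auto
    thus ?thesis using frag[of q c] by auto
  qed
  have neg: "- frag_of (s, c) \<in> D" if s: "s \<in> carrier box_algebra" for s c
  proof (rule Dcong[OF frag'[OF s, of "- c"]])
    have "frag_of (s, c) + frag_of (s, - c) \<in> box.J"
      using box.J_add[OF box.J_uminus[OF box.J_add_right[of s c "- c"]] box.J_zero_right[of s]] s by (simp add: algebra_simps)
    from box.J_uminus[OF this] show "- frag_of (s, c) - frag_of (s, - c) \<in> box.J" by (simp add: algebra_simps)
  qed
  have "x \<in> D \<and> - x \<in> D" using assms
  proof (induction x rule: box.PR_induct)
    case (diff x y)
    thus ?case using Dadd[of x "- y"] Dadd[of "- x" y] by simp
  qed (use D0 frag' neg in auto)
  thus ?thesis by (auto simp: D_def N_def)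
qed

section \<open>The ring of modular forms\<close>

abbreviation HH :: "(complex \<times> complex) set" where "HH \<equiv> upper_half_plane \<times> upper_half_plane"

definition onH :: "(complex \<times> complex \<Rightarrow> complex) \<Rightarrow> complex \<times> complex \<Rightarrow> complex" where
  "onH f = (\<lambda>p. if p \<in> HH then f p else 0)"

lemma open_HH: "open HH"
proof -
  have "open upper_half_plane" unfolding upper_half_plane_def by (rule open_halfspace_Im_gt)
  thus ?thesis by (intro open_Times)
qed

lemma holomorphic2_const: "holomorphic2_on (onH (\<lambda>p. c)) HH"
  unfolding holomorphic2_on_def
proof
  fix p assume p: "p \<in> HH"
  have "((\<lambda>p. c) has_derivative (\<lambda>(h, k). 0 * h + 0 * k)) (at p)" by (simp add: case_prod_unfold)
  hence "(onH (\<lambda>p. c) has_derivative (\<lambda>(h, k). 0 * h + 0 * k)) (at p)"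
    by (rule has_derivative_transform_within_open[OF _ open_HH p]) (simp add: onH_def)
  thus "\<exists>\<alpha> \<beta>. (onH (\<lambda>p. c) has_derivative (\<lambda>(h, k). \<alpha> * h + \<beta> * k)) (at p)" by blast
qed

lemma holomorphic2_add:
  assumes "holomorphic2_on f U" "holomorphic2_on g U"
  shows "holomorphic2_on (\<lambda>p. f p + g p) U"
  unfolding holomorphic2_on_def
proof
  fix p assume "p \<in> U"
  then obtain \<alpha> \<beta> \<alpha>' \<beta>' where "(f has_derivative (\<lambda>(h, k). \<alpha> * h + \<beta> * k)) (at p)" "(g has_derivative (\<lambda>(h, k). \<alpha>' * h + \<beta>' * k)) (at p)"
    using assms unfolding holomorphic2_on_def by metis
  from has_derivative_add[OF this]
  have "((\<lambda>p. f p + g p) has_derivative (\<lambda>(h, k). (\<alpha> + \<alpha>') * h + (\<beta> + \<beta>') * k)) (at p)"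
    by (simp add: case_prod_unfold algebra_simps)
  thus "\<exists>\<alpha> \<beta>. ((\<lambda>p. f p + g p) has_derivative (\<lambda>(h, k). \<alpha> * h + \<beta> * k)) (at p)" by blast
qed

lemma holomorphic2_mult:
  assumes "holomorphic2_on f U" "holomorphic2_on g U"
  shows "holomorphic2_on (\<lambda>p. f p * g p) U"
  unfolding holomorphic2_on_def
proof
  fix p assume "p \<in> U"
  then obtain \<alpha> \<beta> \<alpha>' \<beta>' where "(f has_derivative (\<lambda>(h, k). \<alpha> * h + \<beta> * k)) (at p)" "(g has_derivative (\<lambda>(h, k). \<alpha>' * h + \<beta>' * k)) (at p)"
    using assms unfolding holomorphic2_on_def by metis
  from has_derivative_mult[OF this]
  have "((\<lambda>p. f p * g p) has_derivative (\<lambda>(h, k). (f p * \<alpha>' + \<alpha> * g p) * h + (f p * \<beta>' + \<beta> * g p) * k)) (at p)"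
    by (simp add: case_prod_unfold algebra_simps)
  thus "\<exists>\<alpha> \<beta>. ((\<lambda>p. f p * g p) has_derivative (\<lambda>(h, k). \<alpha> * h + \<beta> * k)) (at p)" by blast
qed

lemma holomorphic2_product:
  assumes "g holomorphic_on upper_half_plane" "h holomorphic_on upper_half_plane"
  shows "holomorphic2_on (onH (\<lambda>(z, w). g z * h w)) HH"
  unfolding holomorphic2_on_def
proof
  fix p assume p: "p \<in> HH"
  have o: "open upper_half_plane" unfolding upper_half_plane_def by (rule open_halfspace_Im_gt)
  have "g field_differentiable at (fst p)" "h field_differentiable at (snd p)"
    using holomorphic_on_imp_differentiable_at[OF assms(1) o, of "fst p"]
      holomorphic_on_imp_differentiable_at[OF assms(2) o, of "snd p"] p by (auto simp: mem_Times_iff)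
  then obtain g' h' where d: "(g has_derivative (*) g') (at (fst p))" "(h has_derivative (*) h') (at (snd p))"
    unfolding field_differentiable_def has_field_derivative_def by blast
  have "((\<lambda>p. g (fst p)) has_derivative (\<lambda>q. g' * fst q)) (at p)"
    using has_derivative_compose[OF has_derivative_fst[OF has_derivative_ident] d(1)] by simp
  moreover have "((\<lambda>p. h (snd p)) has_derivative (\<lambda>q. h' * snd q)) (at p)"
    using has_derivative_compose[OF has_derivative_snd[OF has_derivative_ident] d(2)] by simp
  ultimately have "((\<lambda>p. g (fst p) * h (snd p)) has_derivative (\<lambda>q. g (fst p) * (h' * snd q) + g' * fst q * h (snd p))) (at p)"
    by (rule has_derivative_mult)
  hence "((\<lambda>p. g (fst p) * h (snd p)) has_derivative (\<lambda>(a, b). (g' * h (snd p)) * a + (g (fst p) * h') * b)) (at p)"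
    by (simp add: case_prod_unfold algebra_simps)
  hence "(onH (\<lambda>(z, w). g z * h w) has_derivative (\<lambda>(a, b). (g' * h (snd p)) * a + (g (fst p) * h') * b)) (at p)"
    by (rule has_derivative_transform_within_open[OF _ open_HH p]) (simp add: onH_def case_prod_unfold)
  thus "\<exists>\<alpha> \<beta>. (onH (\<lambda>(z, w). g z * h w) has_derivative (\<lambda>(h, k). \<alpha> * h + \<beta> * k)) (at p)" by blast
qed

lemma modular_formsD:
  assumes "f \<in> modular_forms r"
  shows "p \<notin> HH \<Longrightarrow> f p = 0" "holomorphic2_on f HH" "regular_at_cusps r f"
    "(M, M') \<in> Delta48 \<Longrightarrow> z \<in> upper_half_plane \<Longrightarrow> w \<in> upper_half_plane \<Longrightarrow>
      f (act M z, act M' w) = (theta_mult M * theta_mult M') ^ r * sqrt_factor M z ^ r * sqrt_factor M' w ^ r * f (z, w)"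
  using assms unfolding modular_forms_def by blast+

lemma modular_formsI:
  assumes "\<And>p. p \<notin> HH \<Longrightarrow> f p = 0" "holomorphic2_on f HH" "regular_at_cusps r f"
    "\<And>M M' z w. (M, M') \<in> Delta48 \<Longrightarrow> z \<in> upper_half_plane \<Longrightarrow> w \<in> upper_half_plane \<Longrightarrow>
      f (act M z, act M' w) = (theta_mult M * theta_mult M') ^ r * sqrt_factor M z ^ r * sqrt_factor M' w ^ r * f (z, w)"
  shows "f \<in> modular_forms r"
  using assms unfolding modular_forms_def by blast

lemma modular_forms_zero: "(\<lambda>p. 0) \<in> modular_forms r"
proof (rule modular_formsI)
  have "((\<lambda>p. 0) has_derivative (\<lambda>(h, k). 0 * h + 0 * k)) (at p)" for p :: "complex \<times> complex" by (simp add: case_prod_unfold)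
  thus "holomorphic2_on (\<lambda>p. 0) HH" unfolding holomorphic2_on_def by blast
  show "regular_at_cusps r (\<lambda>p. 0)" unfolding regular_at_cusps_def
    by (intro ballI, rule exI[of _ 1], rule conjI, simp, rule exI[of _ 0]) simp
qed simp_all

lemma modular_forms_const: "onH (\<lambda>p. c) \<in> modular_forms 0"
proof -
  have "regular_at_cusps 0 (onH (\<lambda>p. c))"
    unfolding regular_at_cusps_def
    by (intro ballI exI[of _ 1] conjI exI[of _ "norm c"]) (auto simp: onH_def)
  moreover have "act M z \<in> upper_half_plane" if "M \<in> principal_congruence_subgroup 4" "z \<in> upper_half_plane" for M z
  proof -
    have "mk (M $ 1 $ 1) (M $ 1 $ 2) (M $ 2 $ 1) (M $ 2 $ 2) \<in> principal_congruence_subgroup 4" using that(1) by (simp add: mk_eta)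
    hence "gamma4 (M $ 1 $ 1) (M $ 1 $ 2) (M $ 2 $ 1) (M $ 2 $ 2)" by (simp only: mk_gamma4)
    hence "Im (mob (M $ 1 $ 1) (M $ 1 $ 2) (M $ 2 $ 1) (M $ 2 $ 2) z) > 0" using that(2) by (intro Im_mob_pos) (auto simp: gamma4_def)
    thus ?thesis using act_mob[of "M $ 1 $ 1" "M $ 1 $ 2" "M $ 2 $ 1" "M $ 2 $ 2"] by (simp add: mk_eta)
  qed
  ultimately show ?thesis unfolding modular_forms_def using holomorphic2_const
    by (auto simp: Delta48_def onH_def)
qed

lemma modular_forms_add:
  assumes f: "f \<in> modular_forms r" and g: "g \<in> modular_forms r"
  shows "(\<lambda>p. f p + g p) \<in> modular_forms r"
proof -
  have fg: "regular_at_cusps r f" "regular_at_cusps r g" using f g by (simp_all add: modular_forms_def)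
  have "regular_at_cusps r (\<lambda>p. f p + g p)"
    unfolding regular_at_cusps_def
  proof (intro ballI)
    fix N M assume NM: "N \<in> SL2Z" "M \<in> SL2Z"
    obtain Y K where Y: "Y > 0" "\<And>z w. Im z \<ge> Y \<Longrightarrow> Im w \<ge> Y \<Longrightarrow> cmod (f (act N z, act M w) / (sqrt_factor N z ^ r * sqrt_factor M w ^ r)) \<le> K"
      using fg(1) NM unfolding regular_at_cusps_def by metis
    obtain Y' K' where Y': "Y' > 0" "\<And>z w. Im z \<ge> Y' \<Longrightarrow> Im w \<ge> Y' \<Longrightarrow> cmod (g (act N z, act M w) / (sqrt_factor N z ^ r * sqrt_factor M w ^ r)) \<le> K'"
      using fg(2) NM unfolding regular_at_cusps_def by metis
    have "cmod ((f (act N z, act M w) + g (act N z, act M w)) / (sqrt_factor N z ^ r * sqrt_factor M w ^ r)) \<le> K + K'"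
      if "Im z \<ge> max Y Y'" "Im w \<ge> max Y Y'" for z w
      unfolding add_divide_distrib using that by (intro order_trans[OF norm_triangle_ineq] add_mono Y(2) Y'(2)) auto
    thus "\<exists>Y>0. \<exists>K. \<forall>z w. Y \<le> Im z \<longrightarrow> Y \<le> Im w \<longrightarrow>
        cmod ((f (act N z, act M w) + g (act N z, act M w)) / (sqrt_factor N z ^ r * sqrt_factor M w ^ r)) \<le> K"
      using Y(1) by (intro exI[of _ "max Y Y'"]) auto
  qed
  thus ?thesis
    by (intro modular_formsI holomorphic2_add modular_formsD(2)[OF f] modular_formsD(2)[OF g])
      (simp_all only: modular_formsD(1,4)[OF f] modular_formsD(1,4)[OF g] distrib_left add_0_left not_False_eq_True)
qed

lemma modular_forms_mult:
  assumes f: "f \<in> modular_forms r" and g: "g \<in> modular_forms s"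
  shows "(\<lambda>p. f p * g p) \<in> modular_forms (r + s)"
proof -
  have fg: "regular_at_cusps r f" "regular_at_cusps s g" using f g by (simp_all add: modular_forms_def)
  have "regular_at_cusps (r + s) (\<lambda>p. f p * g p)"
    unfolding regular_at_cusps_def
  proof (intro ballI)
    fix N M assume NM: "N \<in> SL2Z" "M \<in> SL2Z"
    obtain Y K where Y: "Y > 0" "\<And>z w. Im z \<ge> Y \<Longrightarrow> Im w \<ge> Y \<Longrightarrow> cmod (f (act N z, act M w) / (sqrt_factor N z ^ r * sqrt_factor M w ^ r)) \<le> K"
      using fg(1) NM unfolding regular_at_cusps_def by metis
    obtain Y' K' where Y': "Y' > 0" "\<And>z w. Im z \<ge> Y' \<Longrightarrow> Im w \<ge> Y' \<Longrightarrow> cmod (g (act N z, act M w) / (sqrt_factor N z ^ s * sqrt_factor M w ^ s)) \<le> K'"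
      using fg(2) NM unfolding regular_at_cusps_def by metis
    have "cmod (f (act N z, act M w) * g (act N z, act M w) / (sqrt_factor N z ^ (r + s) * sqrt_factor M w ^ (r + s))) \<le> K * K'"
      if zw: "Im z \<ge> max Y Y'" "Im w \<ge> max Y Y'" for z w
    proof -
      have b: "cmod (f (act N z, act M w) / (sqrt_factor N z ^ r * sqrt_factor M w ^ r)) \<le> K"
        "cmod (g (act N z, act M w) / (sqrt_factor N z ^ s * sqrt_factor M w ^ s)) \<le> K'"
        using zw by (auto intro!: Y(2) Y'(2))
      have "f (act N z, act M w) * g (act N z, act M w) / (sqrt_factor N z ^ (r + s) * sqrt_factor M w ^ (r + s)) =
        f (act N z, act M w) / (sqrt_factor N z ^ r * sqrt_factor M w ^ r) * (g (act N z, act M w) / (sqrt_factor N z ^ s * sqrt_factor M w ^ s))"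
        by (simp add: power_add)
      thus ?thesis using mult_mono[OF b] order_trans[OF norm_ge_zero b(1)] by (simp only: norm_mult norm_ge_zero)
    qed
    thus "\<exists>Y>0. \<exists>K. \<forall>z w. Y \<le> Im z \<longrightarrow> Y \<le> Im w \<longrightarrow>
        cmod (f (act N z, act M w) * g (act N z, act M w) / (sqrt_factor N z ^ (r + s) * sqrt_factor M w ^ (r + s))) \<le> K"
      using Y(1) by (intro exI[of _ "max Y Y'"]) auto
  qed
  thus ?thesis
    by (intro modular_formsI holomorphic2_mult modular_formsD(2)[OF f] modular_formsD(2)[OF g])
      (simp_all only: modular_formsD(1,4)[OF f] modular_formsD(1,4)[OF g] power_add power_mult_distrib mult_ac mult_zero_left not_False_eq_True)
qed

lemma modular_forms_scale: "f \<in> modular_forms r \<Longrightarrow> (\<lambda>p. c * f p) \<in> modular_forms r"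
proof -
  assume f: "f \<in> modular_forms r"
  have "(\<lambda>p. onH (\<lambda>p. c) p * f p) = (\<lambda>p. c * f p)"
  proof
    fix p show "onH (\<lambda>p. c) p * f p = c * f p" using modular_formsD(1)[OF f, of p] by (cases "p \<in> HH") (simp_all only: onH_def if_True if_False mult_zero_right not_False_eq_True)
  qed
  with modular_forms_mult[OF modular_forms_const f, of c] show ?thesis by simp
qed

lemma modular_forms_sum: "(\<And>i. i \<in> A \<Longrightarrow> f i \<in> modular_forms r) \<Longrightarrow> (\<lambda>p. \<Sum>i\<in>A. f i p) \<in> modular_forms r"
  by (induction A rule: infinite_finite_induct) (simp_all add: modular_forms_zero modular_forms_add)

lemma form_ring_simps:
  "carrier form_ring = {F. (\<forall>r. F r \<in> modular_forms r) \<and> finite {r. F r \<noteq> (\<lambda>p. 0)}}"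
  "F \<otimes>\<^bsub>form_ring\<^esub> G = (\<lambda>r p. \<Sum>i\<le>r. F i p * G (r - i) p)" "\<one>\<^bsub>form_ring\<^esub> = in_degree 0 (\<lambda>p. 1)"
  "\<zero>\<^bsub>form_ring\<^esub> = (\<lambda>r p. 0)" "F \<oplus>\<^bsub>form_ring\<^esub> G = (\<lambda>r p. F r p + G r p)"
  by (simp_all add: form_ring_def)

text \<open>The generating power series of a family at a point. It turns the graded product into
  multiplication of power series, from which the ring axioms are inherited.\<close>

definition series :: "form_family \<Rightarrow> complex \<times> complex \<Rightarrow> complex fps" where
  "series F p = Abs_fps (\<lambda>r. F r p)"

lemma series_inject: "(\<And>p. series F p = series G p) \<Longrightarrow> F = G"
  unfolding series_def by (intro ext) (metis fps_nth_Abs_fps)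

lemma series_simps:
  "series (F \<otimes>\<^bsub>form_ring\<^esub> G) p = series F p * series G p" "series (F \<oplus>\<^bsub>form_ring\<^esub> G) p = series F p + series G p"
  "series \<zero>\<^bsub>form_ring\<^esub> p = 0"
  by (auto simp: fps_eq_iff series_def form_ring_simps fps_mult_nth atLeast0AtMost)

lemma in_degree_closed:
  assumes "onH f \<in> modular_forms r" shows "in_degree r f \<in> carrier form_ring"
proof -
  have e: "in_degree r f k = (if k = r then onH f else (\<lambda>p. 0))" for k by (auto simp: in_degree_def onH_def)
  have "{k. in_degree r f k \<noteq> (\<lambda>p. 0)} \<subseteq> {r}" by (auto simp: e)
  hence "finite {k. in_degree r f k \<noteq> (\<lambda>p. 0)}" by (rule finite_subset) simp
  thus ?thesis using assms by (simp add: form_ring_simps e modular_forms_zero)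
qed

lemma form_ring_add_closed:
  assumes "F \<in> carrier form_ring" "G \<in> carrier form_ring" shows "F \<oplus>\<^bsub>form_ring\<^esub> G \<in> carrier form_ring"
proof -
  have "{r. (\<lambda>p. F r p + G r p) \<noteq> (\<lambda>p. 0)} \<subseteq> {r. F r \<noteq> (\<lambda>p. 0)} \<union> {r. G r \<noteq> (\<lambda>p. 0)}" by auto
  hence "finite {r. (\<lambda>p. F r p + G r p) \<noteq> (\<lambda>p. 0)}" by (rule finite_subset) (use assms in \<open>simp add: form_ring_simps\<close>)
  thus ?thesis using assms by (simp add: form_ring_simps modular_forms_add)
qed

lemma form_ring_uminus_closed:
  assumes "F \<in> carrier form_ring" shows "(\<lambda>r p. - F r p) \<in> carrier form_ring"
proof -
  have "{r. (\<lambda>p. - F r p) \<noteq> (\<lambda>p. 0)} \<subseteq> {r. F r \<noteq> (\<lambda>p. 0)}" by auto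
  hence "finite {r. (\<lambda>p. - F r p) \<noteq> (\<lambda>p. 0)}" by (rule finite_subset) (use assms in \<open>simp add: form_ring_simps\<close>)
  moreover have "(\<lambda>p. - F r p) \<in> modular_forms r" for r using modular_forms_scale[of "F r" r "-1"] assms by (simp add: form_ring_simps)
  ultimately show ?thesis by (simp add: form_ring_simps)
qed

lemma form_ring_mult_closed:
  assumes F: "F \<in> carrier form_ring" and G: "G \<in> carrier form_ring" shows "F \<otimes>\<^bsub>form_ring\<^esub> G \<in> carrier form_ring"
proof -
  have "{r. (\<lambda>p. \<Sum>i\<le>r. F i p * G (r - i) p) \<noteq> (\<lambda>p. 0)} \<subseteq> (\<lambda>(i, j). i + j) ` ({r. F r \<noteq> (\<lambda>p. 0)} \<times> {r. G r \<noteq> (\<lambda>p. 0)})"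
  proof
    fix r assume "r \<in> {r. (\<lambda>p. \<Sum>i\<le>r. F i p * G (r - i) p) \<noteq> (\<lambda>p. 0)}"
    hence "\<not> (\<forall>p. (\<Sum>i\<le>r. F i p * G (r - i) p) = 0)" unfolding mem_Collect_eq fun_eq_iff .
    then obtain p where "(\<Sum>i\<le>r. F i p * G (r - i) p) \<noteq> 0" by blast
    then obtain i where "i \<le> r" "F i p * G (r - i) p \<noteq> 0" by (meson atMost_iff sum.neutral)
    hence "(i, r - i) \<in> {r. F r \<noteq> (\<lambda>p. 0)} \<times> {r. G r \<noteq> (\<lambda>p. 0)}" "r = i + (r - i)" by auto
    thus "r \<in> (\<lambda>(i, j). i + j) ` ({r. F r \<noteq> (\<lambda>p. 0)} \<times> {r. G r \<noteq> (\<lambda>p. 0)})" by force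
  qed
  hence "finite {r. (\<lambda>p. \<Sum>i\<le>r. F i p * G (r - i) p) \<noteq> (\<lambda>p. 0)}"
    by (rule finite_subset) (use assms in \<open>simp add: form_ring_simps\<close>)
  moreover have "(\<lambda>p. \<Sum>i\<le>r. F i p * G (r - i) p) \<in> modular_forms r" for r
  proof (rule modular_forms_sum)
    fix i assume "i \<in> {..r}"
    thus "(\<lambda>p. F i p * G (r - i) p) \<in> modular_forms r"
      using modular_forms_mult[of "F i" i "G (r - i)" "r - i"] assms by (simp add: form_ring_simps)
  qed
  ultimately show ?thesis by (simp add: form_ring_simps)
qed

lemma form_ring_cring: "cring form_ring"
proof (rule cringI)
  have one: "\<one>\<^bsub>form_ring\<^esub> \<in> carrier form_ring"
    unfolding form_ring_simps(3) by (rule in_degree_closed[OF modular_forms_const])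
  have one_l: "\<one>\<^bsub>form_ring\<^esub> \<otimes>\<^bsub>form_ring\<^esub> F = F" if "F \<in> carrier form_ring" for F
  proof (intro ext)
    fix r p
    have "(\<Sum>i\<le>r. in_degree 0 (\<lambda>p. 1) i p * F (r - i) p) = (\<Sum>i\<in>{0}. in_degree 0 (\<lambda>p. 1) i p * F (r - i) p)"
      by (rule sum.mono_neutral_right) (auto simp: in_degree_def)
    also have "\<dots> = F r p" using modular_formsD(1)[of "F r" r p] that by (auto simp only: in_degree_def form_ring_simps if_True if_False mem_Collect_eq) (simp_all add: in_degree_def)
    finally show "(\<one>\<^bsub>form_ring\<^esub> \<otimes>\<^bsub>form_ring\<^esub> F) r p = F r p" by (simp add: form_ring_simps)
  qed
  show "abelian_group form_ring"
  proof (rule abelian_groupI)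
    fix F assume F: "F \<in> carrier form_ring"
    show "\<exists>G\<in>carrier form_ring. G \<oplus>\<^bsub>form_ring\<^esub> F = \<zero>\<^bsub>form_ring\<^esub>"
      by (rule bexI[OF _ form_ring_uminus_closed[OF F]]) (simp add: form_ring_simps)
  qed (simp_all add: form_ring_add_closed, simp_all add: form_ring_simps modular_forms_zero algebra_simps)
  show "comm_monoid form_ring"
    by (rule comm_monoidI[OF form_ring_mult_closed one _ one_l])
      (auto intro!: series_inject simp: series_simps mult_ac)
  fix F G K
  show "(F \<oplus>\<^bsub>form_ring\<^esub> G) \<otimes>\<^bsub>form_ring\<^esub> K = F \<otimes>\<^bsub>form_ring\<^esub> K \<oplus>\<^bsub>form_ring\<^esub> G \<otimes>\<^bsub>form_ring\<^esub> K"
    by (rule series_inject) (simp add: series_simps distrib_right)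
qed

text \<open>Only the joint factor over pairs in Delta(4,8) is prescribed, so g and h may carry
  characters of their own as long as these cancel for congruent matrices. The two bounds by 3 give
  the bound 9.\<close>

lemma product_form:
  assumes hol: "g holomorphic_on upper_half_plane" "h holomorphic_on upper_half_plane"
    and bound: "\<And>a b c d z. a * d - b * c = 1 \<Longrightarrow> Im z \<ge> 1/2 \<Longrightarrow> wnorm 1 g (mob a b c d z) \<le> 3 * Im z powr (1/4)"
      "\<And>a b c d z. a * d - b * c = 1 \<Longrightarrow> Im z \<ge> 1/2 \<Longrightarrow> wnorm 1 h (mob a b c d z) \<le> 3 * Im z powr (1/4)"
    and trans: "\<And>a b c d a' b' c' d' z w. delta48 (a, b, c, d) (a', b', c', d') \<Longrightarrow> Im z > 0 \<Longrightarrow> Im w > 0 \<Longrightarrow>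
      g (mob a b c d z) * h (mob a' b' c' d' w) = tfac a b c d z * tfac a' b' c' d' w * (g z * h w)"
  shows "onH (\<lambda>(z, w). g z * h w) \<in> modular_forms 1"
  unfolding modular_forms_iff regular_at_cusps_iff
proof (intro conjI allI impI holomorphic2_product hol)
  fix p assume "p \<notin> HH" thus "onH (\<lambda>(z, w). g z * h w) p = 0" by (simp add: onH_def)
next
  fix a b c d a' b' c' d' :: int assume N: "a * d - b * c = 1" "a' * d' - b' * c' = 1"
  have "wnorm2 1 (onH (\<lambda>(z, w). g z * h w)) (mob a b c d z) (mob a' b' c' d' w) \<le> 9 * (Im z powr (real 1 / 4) * Im w powr (real 1 / 4))"
    if zw: "Im z \<ge> 1/2" "Im w \<ge> 1/2" for z w
  proof -
    have "Im (mob a b c d z) > 0" "Im (mob a' b' c' d' w) > 0" using Im_mob_pos[OF N(1), of z] Im_mob_pos[OF N(2), of w] zw by auto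
    hence "wnorm2 1 (onH (\<lambda>(z, w). g z * h w)) (mob a b c d z) (mob a' b' c' d' w) = wnorm 1 g (mob a b c d z) * wnorm 1 h (mob a' b' c' d' w)"
      by (simp add: wnorm2_def onH_def wnorm_def norm_mult)
    also have "\<dots> \<le> (3 * Im z powr (1/4)) * (3 * Im w powr (1/4))"
      by (intro mult_mono bound N zw) simp_all
    finally show ?thesis by simp
  qed
  thus "\<exists>Y>0. \<exists>K. \<forall>z w. Y \<le> Im z \<longrightarrow> Y \<le> Im w \<longrightarrow>
      wnorm2 1 (onH (\<lambda>(z, w). g z * h w)) (mob a b c d z) (mob a' b' c' d' w) \<le> K * (Im z powr (real 1 / 4) * Im w powr (real 1 / 4))"
    by - (rule exI[of _ "1/2"], rule conjI, simp, rule exI[of _ 9], simp)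
next
  fix a b c d a' b' c' d' z w assume d: "delta48 (a, b, c, d) (a', b', c', d')" and zw: "Im z > 0" "Im w > 0"
  have "gamma4 a b c d" "gamma4 a' b' c' d'" using d by (auto simp: delta48_def)
  hence "Im (mob a b c d z) > 0" "Im (mob a' b' c' d' w) > 0" using zw by (auto intro!: Im_mob_pos simp: gamma4_def)
  thus "onH (\<lambda>(z, w). g z * h w) (mob a b c d z, mob a' b' c' d' w) =
       tfac a b c d z ^ 1 * tfac a' b' c' d' w ^ 1 * onH (\<lambda>(z, w). g z * h w) (z, w)"
    using trans[OF d zw] zw by (simp add: onH_def)
qed


text \<open>Congruence modulo 8 becomes congruence modulo 2 after division by 4, so both matrices of
  a pair in Delta(4,8) carry the same theta signs.\<close>

lemma sg_delta48:
  assumes "delta48 (a, b, c, d) (a', b', c', d')"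
  shows "gamma4 a b c d" "gamma4 a' b' c' d'" "sg (b' div 4 + (d' - 1) div 4) = sg (b div 4 + (d - 1) div 4)"
    "sg ((d' - 1) div 4) = sg ((d - 1) div 4)" "sg ((d' - 1) div 4 + c' div 4) = sg ((d - 1) div 4 + c div 4)"
proof -
  have D: "gamma4 a b c d \<and> gamma4 a' b' c' d' \<and> a mod 8 = a' mod 8 \<and> b mod 8 = b' mod 8 \<and> c mod 8 = c' mod 8 \<and> d mod 8 = d' mod 8"
    using assms unfolding delta48_def prod.case .
  show "gamma4 a b c d" "gamma4 a' b' c' d'" using D by (simp_all only: simp_thms)
  have p: "(x div 4 - x' div 4) mod 2 = 0" if "x mod 8 = x' mod 8" for x x' :: int
    using that by presburger
  have m: "b mod 8 = b' mod 8" "c mod 8 = c' mod 8" "d mod 8 = d' mod 8" using D by (simp_all only: simp_thms)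
  have e: "even (b div 4) = even (b' div 4)" "even (c div 4) = even (c' div 4)"
    using p[OF m(1)] p[OF m(2)] by presburger+
  have "(d - 1) mod 8 = (d' - 1) mod 8" using m(3) by (rule mod_diff_cong) simp
  hence "((d - 1) div 4 - (d' - 1) div 4) mod 2 = 0" by (rule p)
  hence "even ((d - 1) div 4) = even ((d' - 1) div 4)" by presburger
  thus "sg (b' div 4 + (d' - 1) div 4) = sg (b div 4 + (d - 1) div 4)"
    "sg ((d' - 1) div 4) = sg ((d - 1) div 4)" "sg ((d' - 1) div 4 + c' div 4) = sg ((d - 1) div 4 + c div 4)"
    using e by (simp_all only: even_add)
qed

lemma sg_square: "sg n * sg n = 1"
  by simp

text \<open>Every sign occurs once per variable and squares away, including the one between
  \<open>jfac\<close> and \<open>tfac\<close>.\<close>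

lemma theta_products:
  shows "onH (\<lambda>(z, w). theta 0 0 z * theta 0 0 w) \<in> modular_forms 1"
    "onH (\<lambda>(z, w). theta 0 1 z * theta 0 1 w) \<in> modular_forms 1"
    "onH (\<lambda>(z, w). theta 1 0 z * theta 1 0 w) \<in> modular_forms 1"
proof -
  have p: "onH (\<lambda>(z, w). g z * g w) \<in> modular_forms 1" if g: "g \<in> thetas"
    and t: "\<And>a b c d z. gamma4 a b c d \<Longrightarrow> Im z > 0 \<Longrightarrow> g (mob a b c d z) = jfac a b c d z * sg (e b c d) * g z"
    and e: "\<And>a b c d a' b' c' d'. delta48 (a, b, c, d) (a', b', c', d') \<Longrightarrow> sg (e b' c' d') = sg (e b c d)" for g e
  proof (rule product_form)
    show "g holomorphic_on upper_half_plane" "g holomorphic_on upper_half_plane"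
      using g theta_holomorphic by (auto simp: thetas_def)
    fix a b c d a' b' c' d' :: int and z w assume d: "delta48 (a, b, c, d) (a', b', c', d')" and zw: "Im z > 0" "Im w > 0"
    note s = sg_delta48[OF d]
    have "g (mob a b c d z) * g (mob a' b' c' d' w) = jfac a b c d z * jfac a' b' c' d' w * (sg (e b c d) * sg (e b c d)) * (g z * g w)"
      unfolding t[OF s(1) zw(1)] t[OF s(2) zw(2)] e[OF d] by (simp only: mult_ac)
    also have "\<dots> = tfac a b c d z * tfac a' b' c' d' w * (g z * g w)"
      unfolding tfac_eq(2)[OF s(1) zw(1)] tfac_eq(2)[OF s(2) zw(2)] s(4)
      using sg_square[of "e b c d"] sg_square[of "(d - 1) div 4"] by (simp add: mult_ac)
    finally show "g (mob a b c d z) * g (mob a' b' c' d' w) = tfac a b c d z * tfac a' b' c' d' w * (g z * g w)" .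
  qed (rule theta_wnorm_bounded[OF _ g]; assumption)+
  show "onH (\<lambda>(z, w). theta 0 0 z * theta 0 0 w) \<in> modular_forms 1"
    by (rule p[of _ "\<lambda>b c d. (d - 1) div 4"]) (simp add: thetas_def, rule theta_gamma4(5), assumption, assumption, rule sg_delta48(4), assumption)
  show "onH (\<lambda>(z, w). theta 0 1 z * theta 0 1 w) \<in> modular_forms 1"
    by (rule p[of _ "\<lambda>b c d. (d - 1) div 4 + c div 4"]) (simp add: thetas_def, rule theta_gamma4(6), assumption, assumption, rule sg_delta48(5), assumption)
  show "onH (\<lambda>(z, w). theta 1 0 z * theta 1 0 w) \<in> modular_forms 1"
    by (rule p[of _ "\<lambda>b c d. b div 4 + (d - 1) div 4"]) (simp add: thetas_def, rule theta_gamma4(4), assumption, assumption, rule sg_delta48(3), assumption)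
qed

text \<open>X and Y have the common factor \<open>jfac\<close>, so mixed products are allowed too;
  the sign that relates it to \<open>tfac\<close> occurs twice and cancels.\<close>

lemma thXY_products:
  assumes "g \<in> {thX, thY}" "h \<in> {thX, thY}"
  shows "onH (\<lambda>(z, w). g z * h w) \<in> modular_forms 1"
proof (rule product_form)
  show "g holomorphic_on upper_half_plane" "h holomorphic_on upper_half_plane"
    using assms thX_holomorphic thY_holomorphic by auto
  have t: "f (mob a b c d z) = jfac a b c d z * f z" if "f \<in> {thX, thY}" "gamma4 a b c d" "Im z > 0" for f a b c d z
    using theta_gamma4(2,3)[OF that(2,3)] that(1) by auto
  fix a b c d a' b' c' d' :: int and z w assume d: "delta48 (a, b, c, d) (a', b', c', d')" and zw: "Im z > 0" "Im w > 0"
  note s = sg_delta48[OF d]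
  show "g (mob a b c d z) * h (mob a' b' c' d' w) = tfac a b c d z * tfac a' b' c' d' w * (g z * h w)"
    unfolding tfac_eq(2)[OF s(1) zw(1)] tfac_eq(2)[OF s(2) zw(2)] s(4) t[OF assms(1) s(1) zw(1)] t[OF assms(2) s(2) zw(2)]
    using sg_square[of "(d - 1) div 4"] by (simp add: mult_ac)
qed (rule thXY_wnorm_bounded[OF _ assms(1)] thXY_wnorm_bounded[OF _ assms(2)]; assumption)+

section \<open>The theta values of the generators and the evaluation map\<close>

definition vals :: "complex \<times> complex \<Rightarrow> box_var \<Rightarrow> complex" where
  "vals p v = (case p of (z, w) \<Rightarrow> case v of
      Z1 \<Rightarrow> theta 0 1 z * theta 0 1 w | Z2 \<Rightarrow> theta 0 0 z * theta 0 0 w | Z3 \<Rightarrow> theta 1 0 z * theta 1 0 w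
    | C \<Rightarrow> thX z * thX w + thY z * thY w | W1 \<Rightarrow> thY z * thX w + thX z * thY w
    | W2 \<Rightarrow> \<i> * (thY z * thX w - thX z * thY w) | W3 \<Rightarrow> thX z * thX w - thY z * thY w)"

lemma vals_modular: "onH (\<lambda>p. vals p v) \<in> modular_forms 1"
proof -
  have xy: "onH (\<lambda>p. c * (case p of (z, w) \<Rightarrow> g z * h w) + c' * (case p of (z, w) \<Rightarrow> g' z * h' w)) \<in> modular_forms 1"
    if "g \<in> {thX, thY}" "h \<in> {thX, thY}" "g' \<in> {thX, thY}" "h' \<in> {thX, thY}" for g h g' h' c c'
  proof -
    have "(\<lambda>p. c * onH (\<lambda>(z, w). g z * h w) p + c' * onH (\<lambda>(z, w). g' z * h' w) p) \<in> modular_forms 1"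
      by (intro modular_forms_add modular_forms_scale thXY_products that)
    moreover have "(\<lambda>p. c * onH (\<lambda>(z, w). g z * h w) p + c' * onH (\<lambda>(z, w). g' z * h' w) p) =
      onH (\<lambda>p. c * (case p of (z, w) \<Rightarrow> g z * h w) + c' * (case p of (z, w) \<Rightarrow> g' z * h' w))"
      by (auto simp: onH_def)
    ultimately show ?thesis by simp
  qed
  show ?thesis
  proof (cases v)
    case Z1 thus ?thesis using theta_products(2) by (simp add: vals_def case_prod_unfold)
  next
    case Z2 thus ?thesis using theta_products(1) by (simp add: vals_def case_prod_unfold)
  next
    case Z3 thus ?thesis using theta_products(3) by (simp add: vals_def case_prod_unfold)
  next
    case C thus ?thesis using xy[of thX thX thY thY 1 1] by (simp add: vals_def case_prod_unfold)
  next
    case W1 thus ?thesis using xy[of thY thX thX thY 1 1] by (simp add: vals_def case_prod_unfold)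
  next
    case W2 thus ?thesis using xy[of thY thX thX thY \<i> "- \<i>"] by (simp add: vals_def case_prod_unfold algebra_simps)
  next
    case W3 thus ?thesis using xy[of thX thX thY thY 1 "-1"] by (simp add: vals_def case_prod_unfold)
  qed
qed

lemma onH_mult: "onH f p * onH g p = onH (\<lambda>p. f p * g p) p"
  by (simp add: onH_def)

lemma mon_modular: "onH (\<lambda>p. mon (vals p) m) \<in> modular_forms (monom_degree m)"
proof -
  have mult: "onH (\<lambda>p. f p * g p) \<in> modular_forms (r + s)" if "onH f \<in> modular_forms r" "onH g \<in> modular_forms s" for f g r s
    using modular_forms_mult[OF that] by (simp only: onH_mult)
  have pow: "onH (\<lambda>p. vals p v ^ n) \<in> modular_forms n" for v n
  proof (induction n)
    case 0
    show ?case using modular_forms_const[of 1] by simp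
  next
    case (Suc n)
    show ?case using mult[OF vals_modular[of v] Suc] by simp
  qed
  show ?thesis unfolding mon_explicit monom_degree_explicit by (intro mult pow)
qed

lemma vals_relations:
  assumes "Im z > 0" "Im w > 0"
  shows "vals (z, w) W1 ^ 2 + vals (z, w) W2 ^ 2 = vals (z, w) Z3 ^ 2"
    "vals (z, w) W1 ^ 2 + vals (z, w) W3 ^ 2 = vals (z, w) Z2 ^ 2"
    "vals (z, w) W2 ^ 2 + vals (z, w) W3 ^ 2 = vals (z, w) Z1 ^ 2"
    "vals (z, w) W1 ^ 2 + vals (z, w) W2 ^ 2 + vals (z, w) W3 ^ 2 = vals (z, w) C ^ 2"
  by (simp_all only: vals_def prod.case box_var.case power_mult_distrib theta_squares[OF assms(1)] theta_squares[OF assms(2)] power2_i)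
    (simp_all add: power2_eq_square algebra_simps)

text \<open>The formal variable records the degree: the coefficient at r is the value at p of the
  part of degree r. One ring homomorphism to power series thus handles all graded
  components.\<close>

definition ev :: "complex \<times> complex \<Rightarrow> rat box_poly \<Rightarrow> complex fps" where
  "ev p = peval (\<lambda>k. fps_const (of_rat k)) (\<lambda>v. fps_X * fps_const (vals p v))"

interpretation rat_fps: coeff_hom "\<lambda>k. fps_const (of_rat k :: complex)"
  by unfold_locales (simp_all add: of_rat_add of_rat_mult)

interpretation cid: coeff_hom "\<lambda>c::complex. c"
  by unfold_locales simp_all

lemma mon_graded: "mon (\<lambda>v. fps_X * fps_const (a v)) m = fps_X ^ monom_degree m * fps_const (mon a m :: complex)"
  unfolding mon_explicit monom_degree_explicit power_mult_distrib power_add fps_const_power fps_const_mult[symmetric]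
  by (simp only: mult_ac)

lemma ev_nth: "fps_nth (ev p q) r = (\<Sum>m\<in>Poly_Mapping.keys q. if monom_degree m = r then of_rat (Poly_Mapping.lookup q m) * mon (vals p) m else 0)"
proof -
  have "fps_nth (fps_const c * (fps_X ^ n * fps_const d)) r = (if n = r then c * d else 0)" for c d :: complex and n
    by (simp add: fps_X_power_mult_nth)
  thus ?thesis unfolding ev_def peval_def mon_graded fps_sum_nth by simp
qed

lemma ev_var: "ev p (poly_var v) = fps_X * fps_const (vals p v)"
  unfolding ev_def poly_var_def rat_fps.peval_single mon_single by simp

lemma ev_box_ideal:
  assumes p: "p \<in> HH" and q: "q \<in> box_ideal" shows "ev p q = 0"
  unfolding ev_def
proof (rule box_ideal_vanish[OF rat_fps.coeff_hom_axioms _ q])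
  obtain z w where zw: "p = (z, w)" "Im z > 0" "Im w > 0" using p by auto
  note rel = vals_relations[OF zw(2,3), folded zw(1)]
  have X: "(fps_X * fps_const a) ^ 2 = fps_X ^ 2 * fps_const (a ^ 2)" for a :: complex
    by (simp add: power_mult_distrib fps_const_power)
  fix q assume "q \<in> box_relations"
  thus "peval (\<lambda>k. fps_const (of_rat k)) (\<lambda>v. fps_X * fps_const (vals p v)) q = 0"
    unfolding box_relations_def ev_def[symmetric]
    by (elim insertE emptyE; simp only: ev_def rat_fps.peval_diff rat_fps.peval_add rat_fps.peval_power)
      (simp_all only: ev_def[symmetric] ev_var X rel[symmetric] fps_const_add[symmetric] distrib_left diff_self)
qed

text \<open>\<open>SOME\<close> picks a polynomial representing the class. By
  \<open>hfun_class\<close> the choice does not matter on \<open>HH\<close>, because the theta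
  relations hold there.\<close>

definition hfun :: "complex \<times> complex \<Rightarrow> rat box_poly set \<times> complex \<Rightarrow> complex fps" where
  "hfun p = (\<lambda>(b, c). fps_const c * ev p (SOME q. b = box_class q))"

lemma hfun_class:
  assumes p: "p \<in> HH" shows "hfun p (box_class q, c) = fps_const c * ev p q"
proof -
  define q' where "q' = (SOME q'. box_class q = box_class q')"
  have "box_class q = box_class q'" unfolding q'_def by (rule someI[of _ q]) simp
  hence "ev p (q - q') = 0" unfolding box_class_eq by (rule ev_box_ideal[OF p])
  hence "ev p q = ev p q'" by (simp add: ev_def rat_fps.peval_diff)
  thus ?thesis by (simp add: hfun_def q'_def)
qed

lemma hfun_one: assumes "p \<in> HH" shows "hfun p (\<one>\<^bsub>box_algebra\<^esub>, \<one>\<^bsub>complex_algebra\<^esub>) = 1"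
  by (simp add: hfun_class[OF assms] ev_def)

lemma hfun_mult:
  assumes p: "p \<in> HH" and "s \<in> carrier box_algebra" "s' \<in> carrier box_algebra"
  shows "hfun p (s \<otimes>\<^bsub>box_algebra\<^esub> s', t \<otimes>\<^bsub>complex_algebra\<^esub> t') = hfun p (s, t) * hfun p (s', t')"
proof -
  obtain q q' where e: "s = box_class q" "s' = box_class q'" using assms(2,3) by auto
  show ?thesis unfolding e box_algebra_simps hfun_class[OF p] ev_def rat_fps.peval_mult complex_algebra_simps fps_const_mult[symmetric]
    by (simp only: mult_ac)
qed

lemma hfun_vanish:
  assumes p: "p \<in> HH" and x: "x \<in> box.J" shows "lin (hfun p) x = 0"
proof (rule box.lin_vanish[OF hfun_one[OF p] hfun_mult[OF p] _ _ _ x])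
  fix s s' t t' k assume "s \<in> carrier box_algebra"
  then obtain q where e: "s = box_class q" by auto
  show "hfun p (s, t \<oplus>\<^bsub>complex_algebra\<^esub> t') = hfun p (s, t) + hfun p (s, t')"
    unfolding e hfun_class[OF p] by (simp add: fps_const_add[symmetric] distrib_right del: fps_const_add)
  have "ev p (poly_const k * q) = fps_const (of_rat k) * ev p q"
    unfolding ev_def rat_fps.peval_mult poly_const_def rat_fps.peval_single by simp
  thus "hfun p (k \<odot>\<^bsub>box_algebra\<^esub> s, t) = hfun p (s, k \<odot>\<^bsub>complex_algebra\<^esub> t)"
    unfolding e box_algebra_simps hfun_class[OF p] complex_algebra_simps fps_const_mult[symmetric] by (simp only: mult_ac)
  assume "s' \<in> carrier box_algebra"
  then obtain q' where e': "s' = box_class q'" by auto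
  show "hfun p (s \<oplus>\<^bsub>box_algebra\<^esub> s', t) = hfun p (s, t) + hfun p (s', t)"
    unfolding e e' box_algebra_simps hfun_class[OF p] ev_def rat_fps.peval_add by (rule distrib_left)
qed

text \<open>The desired isomorphism before passing to the quotient: its image is the whole ring of
  forms (\<open>Psi_surj\<close>) and its kernel is the tensor ideal
  (\<open>Psi_kernel\<close>).\<close>

definition Psi :: "(rat box_poly set \<times> complex \<Rightarrow>\<^sub>0 int) \<Rightarrow> form_family" where
  "Psi x = (\<lambda>r p. if p \<in> HH then fps_nth (lin (hfun p) x) r else 0)"

lemma series_Psi: "series (Psi x) p = (if p \<in> HH then lin (hfun p) x else 0)"
  by (simp add: series_def Psi_def fps_eq_iff)

lemma Psi_diff: "Psi (x - y) = (\<lambda>r p. Psi x r p - Psi y r p)"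
  by (intro ext) (simp add: Psi_def lin_diff)

lemma Psi_zero: "Psi 0 = (\<lambda>r p. 0)"
  by (intro ext) (simp add: Psi_def)

lemma Psi_sum: "Psi (\<Sum>i\<in>A. f i) r p = (\<Sum>i\<in>A. Psi (f i) r p)"
  by (simp add: Psi_def lin_sum fps_sum_nth)

lemma Psi_class: "Psi (frag_of (box_class q, c)) r =
    onH (\<lambda>p. c * (\<Sum>m\<in>Poly_Mapping.keys q. if monom_degree m = r then of_rat (Poly_Mapping.lookup q m) * mon (vals p) m else 0))"
  by (rule ext) (simp add: Psi_def onH_def hfun_class ev_nth)

lemma Psi_tau: "Psi (tau P) r =
    onH (\<lambda>p. \<Sum>m\<in>Poly_Mapping.keys P. if monom_degree m = r then Poly_Mapping.lookup P m * mon (vals p) m else 0)"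
proof (rule ext)
  fix p
  have "Psi (tau P) r p = (\<Sum>m\<in>Poly_Mapping.keys P. Psi (frag_of (box_class (Poly_Mapping.single m 1), Poly_Mapping.lookup P m)) r p)"
    by (simp only: tau_def Psi_sum)
  also have "\<dots> = (\<Sum>m\<in>Poly_Mapping.keys P. onH (\<lambda>p. if monom_degree m = r then Poly_Mapping.lookup P m * mon (vals p) m else 0) p)"
    unfolding Psi_class by (rule sum.cong) (simp_all add: onH_def)
  finally show "Psi (tau P) r p = onH (\<lambda>p. \<Sum>m\<in>Poly_Mapping.keys P. if monom_degree m = r then Poly_Mapping.lookup P m * mon (vals p) m else 0) p"
    by (simp add: onH_def)
qed

lemma combination_modular:
  "onH (\<lambda>p. \<Sum>m\<in>A. if monom_degree m = r then c m * mon (vals p) m else 0) \<in> modular_forms r"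
proof -
  have "(\<lambda>p. \<Sum>m\<in>A. onH (\<lambda>p. if monom_degree m = r then c m * mon (vals p) m else 0) p) \<in> modular_forms r"
  proof (rule modular_forms_sum)
    fix m
    have "(\<lambda>p. c m * onH (\<lambda>p. mon (vals p) m) p) \<in> modular_forms (monom_degree m)"
      by (rule modular_forms_scale[OF mon_modular])
    moreover have "(\<lambda>p. c m * onH (\<lambda>p. mon (vals p) m) p) = onH (\<lambda>p. c m * mon (vals p) m)" by (auto simp: onH_def)
    moreover have "onH (\<lambda>p. 0) = (\<lambda>p. 0)" by (auto simp: onH_def)
    ultimately show "onH (\<lambda>p. if monom_degree m = r then c m * mon (vals p) m else 0) \<in> modular_forms r"
      using modular_forms_zero[of r] by (cases "monom_degree m = r") simp_all
  qed
  moreover have "(\<lambda>p. \<Sum>m\<in>A. onH (\<lambda>p. if monom_degree m = r then c m * mon (vals p) m else 0) p)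
      = onH (\<lambda>p. \<Sum>m\<in>A. if monom_degree m = r then c m * mon (vals p) m else 0)"
  proof
    fix p show "(\<Sum>m\<in>A. onH (\<lambda>p. if monom_degree m = r then c m * mon (vals p) m else 0) p)
      = onH (\<lambda>p. \<Sum>m\<in>A. if monom_degree m = r then c m * mon (vals p) m else 0) p"
      by (cases "p \<in> HH") (simp_all add: onH_def)
  qed
  ultimately show ?thesis by simp
qed

lemma Psi_class_closed: "Psi (frag_of (box_class q, c)) \<in> carrier form_ring"
proof -
  have "{r. Psi (frag_of (box_class q, c)) r \<noteq> (\<lambda>p. 0)} \<subseteq> monom_degree ` Poly_Mapping.keys q"
  proof
    fix r assume "r \<in> {r. Psi (frag_of (box_class q, c)) r \<noteq> (\<lambda>p. 0)}"
    hence n: "Psi (frag_of (box_class q, c)) r \<noteq> (\<lambda>p. 0)" by simp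
    show "r \<in> monom_degree ` Poly_Mapping.keys q"
    proof (rule ccontr)
      assume "r \<notin> monom_degree ` Poly_Mapping.keys q"
      hence "(\<Sum>m\<in>Poly_Mapping.keys q. if monom_degree m = r then of_rat (Poly_Mapping.lookup q m) * mon (vals p) m else 0) = 0" for p
        by (intro sum.neutral) auto
      hence "Psi (frag_of (box_class q, c)) r = (\<lambda>p. 0)" unfolding Psi_class by (simp add: onH_def)
      thus False using n by contradiction
    qed
  qed
  hence "finite {r. Psi (frag_of (box_class q, c)) r \<noteq> (\<lambda>p. 0)}" by (rule finite_subset) simp
  moreover have "Psi (frag_of (box_class q, c)) r \<in> modular_forms r" for r
  proof -
    have "(\<lambda>p. c * onH (\<lambda>p. \<Sum>m\<in>Poly_Mapping.keys q. if monom_degree m = r then of_rat (Poly_Mapping.lookup q m) * mon (vals p) m else 0) p) \<in> modular_forms r"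
      by (intro modular_forms_scale combination_modular)
    moreover have "(\<lambda>p. c * onH f p) = onH (\<lambda>p. c * f p)" for f by (auto simp: onH_def)
    ultimately show ?thesis unfolding Psi_class by simp
  qed
  ultimately show ?thesis unfolding form_ring_simps by simp
qed

lemma Psi_closed: "x \<in> carrier box.PR \<Longrightarrow> Psi x \<in> carrier form_ring"
proof (induction x rule: box.PR_induct)
  case zero
  show ?case unfolding Psi_zero using modular_forms_zero by (simp add: form_ring_simps)
next
  case (frag s t)
  thus ?case using Psi_class_closed by auto
next
  case (diff x y)
  have "Psi x \<oplus>\<^bsub>form_ring\<^esub> (\<lambda>r p. - Psi y r p) \<in> carrier form_ring"
    by (rule form_ring_add_closed[OF diff(3) form_ring_uminus_closed[OF diff(4)]])
  thus ?case unfolding Psi_diff form_ring_simps(5) by simp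
qed

lemma Psi_hom: "ring_hom_ring box.PR form_ring Psi"
proof (rule ring_hom_ringI[OF cring.axioms(1)[OF box.PR_cring] cring.axioms(1)[OF form_ring_cring] Psi_closed])
  fix x y assume xy: "x \<in> carrier box.PR" "y \<in> carrier box.PR"
  have h: "ring_hom_ring box.PR type_ring (lin (hfun p))" if "p \<in> HH" for p
    by (rule box.lin_hom[OF hfun_one[OF that] hfun_mult[OF that]])
  have "lin (hfun p) (x \<otimes>\<^bsub>box.PR\<^esub> y) = lin (hfun p) x * lin (hfun p) y" if "p \<in> HH" for p
    using ring_hom_mult[OF ring_hom_ring.homh[OF h[OF that]] xy] by simp
  thus "Psi (x \<otimes>\<^bsub>box.PR\<^esub> y) = Psi x \<otimes>\<^bsub>form_ring\<^esub> Psi y"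
    by (intro series_inject) (simp add: series_simps series_Psi)
  show "Psi (x \<oplus>\<^bsub>box.PR\<^esub> y) = Psi x \<oplus>\<^bsub>form_ring\<^esub> Psi y"
    by (intro series_inject) (simp add: series_simps series_Psi box.PR_simps(4) lin_add)
next
  show "Psi \<one>\<^bsub>box.PR\<^esub> = \<one>\<^bsub>form_ring\<^esub>"
    unfolding box.PR_simps(2) form_ring_simps(3) Psi_def in_degree_def using hfun_one
    by (intro ext) (simp del: box_algebra_simps complex_algebra_simps)
qed

subsection \<open>Surjectivity\<close>

definition box_form :: "nat \<Rightarrow> (complex \<times> complex \<Rightarrow> complex) \<Rightarrow> bool" where
  "box_form r f \<longleftrightarrow> (\<exists>P. (\<forall>m\<in>Poly_Mapping.keys P. monom_degree m = r) \<and> (\<forall>p\<in>HH. f p = peval (\<lambda>c. c) (vals p) P))"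

lemma box_formI: "\<forall>m\<in>Poly_Mapping.keys P. monom_degree m = r \<Longrightarrow> (\<And>p. p \<in> HH \<Longrightarrow> f p = peval (\<lambda>c. c) (vals p) P) \<Longrightarrow> box_form r f"
  unfolding box_form_def by blast

lemma box_form_add:
  assumes "box_form r f" "box_form r g" shows "box_form r (\<lambda>p. f p + g p)"
proof -
  obtain P Q where PQ: "\<forall>m\<in>Poly_Mapping.keys P. monom_degree m = r" "\<forall>p\<in>HH. f p = peval (\<lambda>c. c) (vals p) P"
    "\<forall>m\<in>Poly_Mapping.keys Q. monom_degree m = r" "\<forall>p\<in>HH. g p = peval (\<lambda>c. c) (vals p) Q"
    using assms unfolding box_form_def by blast
  show ?thesis
    by (rule box_formI[of "P + Q"]) (use PQ keys_add[of P Q] in \<open>auto simp: cid.peval_add\<close>)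
qed

lemma monom_degree_add: "monom_degree (m + m') = monom_degree m + monom_degree m'"
  by (simp add: monom_degree_explicit lookup_add)

lemma box_form_mult:
  assumes "box_form r f" "box_form s g" shows "box_form (r + s) (\<lambda>p. f p * g p)"
proof -
  obtain P Q where PQ: "\<forall>m\<in>Poly_Mapping.keys P. monom_degree m = r" "\<forall>p\<in>HH. f p = peval (\<lambda>c. c) (vals p) P"
    "\<forall>m\<in>Poly_Mapping.keys Q. monom_degree m = s" "\<forall>p\<in>HH. g p = peval (\<lambda>c. c) (vals p) Q"
    using assms unfolding box_form_def by blast
  show ?thesis
  proof (rule box_formI[of "P * Q"])
    show "\<forall>m\<in>Poly_Mapping.keys (P * Q). monom_degree m = r + s"
      using keys_mult[of P Q] PQ(1,3) by (auto simp: monom_degree_add)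
  qed (use PQ in \<open>auto simp: cid.peval_mult\<close>)
qed

lemma box_form_const: "box_form 0 (\<lambda>p. c)"
  by (rule box_formI[of "Poly_Mapping.single 0 c"]) (auto simp: monom_degree_def)

lemma box_form_zero: "box_form r (\<lambda>p. 0)"
  by (rule box_formI[of 0]) auto

lemma box_form_scale: "box_form r f \<Longrightarrow> box_form r (\<lambda>p. c * f p)"
  using box_form_mult[OF box_form_const[of c]] by simp

lemma box_form_sum: "(\<And>i. i \<in> A \<Longrightarrow> box_form r (f i)) \<Longrightarrow> box_form r (\<lambda>p. \<Sum>i\<in>A. f i p)"
  by (induction A rule: infinite_finite_induct) (simp_all add: box_form_zero box_form_add)

lemma box_form_var: "box_form 1 (\<lambda>p. vals p v)"
  by (rule box_formI[of "Poly_Mapping.single (Poly_Mapping.single v 1) 1"]) (auto simp: monom_degree_def mon_single lookup_single)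

lemma box_form_power: "box_form n (\<lambda>p. vals p v ^ n)"
proof (induction n)
  case 0 show ?case using box_form_const[of 1] by simp
next
  case (Suc n) show ?case using box_form_mult[OF box_form_var[of v] Suc] by simp
qed

lemma box_form_cong: "box_form r f \<Longrightarrow> (\<And>z w. g (z, w) = f (z, w)) \<Longrightarrow> box_form r g"
  unfolding box_form_def by (metis surj_pair)

text \<open>Half sums and half differences of the formulas for C, W3 and for W1, W2. As W2 enters
  with an imaginary coefficient, complex scalars are required.\<close>

lemma box_form_bilinear:
  "box_form 1 (\<lambda>(z, w). thX z * thX w)" "box_form 1 (\<lambda>(z, w). thY z * thY w)"
  "box_form 1 (\<lambda>(z, w). thY z * thX w)" "box_form 1 (\<lambda>(z, w). thX z * thY w)"
proof -
  have l: "box_form 1 (\<lambda>p. c * vals p v + c' * vals p v')" for c c' v v'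
    by (intro box_form_add box_form_scale box_form_var)
  show "box_form 1 (\<lambda>(z, w). thX z * thX w)"
    by (rule box_form_cong[OF l[of "1/2" C "1/2" W3]]) (simp add: vals_def field_simps)
  show "box_form 1 (\<lambda>(z, w). thY z * thY w)"
    by (rule box_form_cong[OF l[of "1/2" C "-1/2" W3]]) (simp add: vals_def field_simps)
  show "box_form 1 (\<lambda>(z, w). thY z * thX w)"
    by (rule box_form_cong[OF l[of "1/2" W1 "-\<i>/2" W2]]) (simp add: vals_def field_simps)
  show "box_form 1 (\<lambda>(z, w). thX z * thY w)"
    by (rule box_form_cong[OF l[of "1/2" W1 "\<i>/2" W2]]) (simp add: vals_def field_simps)
qed

text \<open>A monomial of bidegree (k, k) is a product of k bilinear ones. Each step takes one
  factor in z and one in w, choosing Y as long as its exponent is positive.\<close>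

lemma box_form_XY: "i \<le> k \<Longrightarrow> j \<le> k \<Longrightarrow> box_form k (\<lambda>(z, w). XY k i z * XY k j w)"
proof (induction k arbitrary: i j)
  case 0 thus ?case using box_form_const[of 1] by (simp add: XY_def case_prod_unfold)
next
  case (Suc k)
  have m: "box_form (Suc k) (\<lambda>(z, w). XY (Suc k) i z * XY (Suc k) j w)"
    if "box_form 1 (\<lambda>(z, w). g z * h w)" "i' \<le> k" "j' \<le> k"
      "\<And>z. XY (Suc k) i z = g z * XY k i' z" "\<And>w. XY (Suc k) j w = h w * XY k j' w" for g h i' j'
  proof -
    have "box_form (1 + k) (\<lambda>p. (case p of (z, w) \<Rightarrow> g z * h w) * (case p of (z, w) \<Rightarrow> XY k i' z * XY k j' w))"
      by (rule box_form_mult[OF that(1) Suc.IH[OF that(2,3)]])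
    hence "box_form (Suc k) (\<lambda>p. (case p of (z, w) \<Rightarrow> g z * h w) * (case p of (z, w) \<Rightarrow> XY k i' z * XY k j' w))"
      unfolding plus_1_eq_Suc .
    thus ?thesis by (rule box_form_cong) (simp add: that(4,5) mult_ac)
  qed
  have Y: "XY (Suc k) (Suc i) z = thY z * XY k i z" for i z by (simp add: XY_def mult_ac)
  have X: "XY (Suc k) i z = thX z * XY k i z" if "i \<le> k" for i z using that by (simp add: XY_def Suc_diff_le mult_ac)
  show ?case
  proof (cases i; cases j)
    assume e: "i = 0" "j = 0"
    show ?case by (rule m[OF box_form_bilinear(1), of 0 0]) (simp_all add: e X)
  next
    fix j' assume e: "i = 0" "j = Suc j'"
    show ?case by (rule m[OF box_form_bilinear(4), of 0 j']) (use Suc.prems in \<open>simp_all add: e X Y\<close>)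
  next
    fix i' assume e: "i = Suc i'" "j = 0"
    show ?case by (rule m[OF box_form_bilinear(3), of i' 0]) (use Suc.prems in \<open>simp_all add: e X Y\<close>)
  next
    fix i' j' assume e: "i = Suc i'" "j = Suc j'"
    show ?case by (rule m[OF box_form_bilinear(2), of i' j']) (use Suc.prems in \<open>simp_all add: e Y\<close>)
  qed
qed

lemma box_form_thS: "box_form (tsize e) (\<lambda>(z, w). thS e z * thS e w)"
proof -
  obtain i j k where e: "e = (i, j, k)" by (metis prod.exhaust)
  have "box_form (i + j + k) (\<lambda>p. vals p Z2 ^ i * vals p Z1 ^ j * vals p Z3 ^ k)"
    by (intro box_form_mult box_form_power)
  hence "box_form (tsize e) (\<lambda>p. vals p Z2 ^ i * vals p Z1 ^ j * vals p Z3 ^ k)" by (simp add: e tsize_def)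
  thus ?thesis by (rule box_form_cong) (simp add: vals_def e thS_def power_mult_distrib mult_ac)
qed

lemma modular_form_box_form:
  assumes "f \<in> modular_forms r" shows "box_form r f"
proof -
  obtain d where d: "\<And>z w. Im z > 0 \<Longrightarrow> Im w > 0 \<Longrightarrow> f (z, w) =
    (\<Sum>u\<in>UNIV. if tsize (texp r u) \<le> r then thS (texp r u) z * thS (texp r u) w *
        (\<Sum>i\<le>r - tsize (texp r u). \<Sum>j\<le>r - tsize (texp r u). d u i j * (XY (r - tsize (texp r u)) i z * XY (r - tsize (texp r u)) j w)) else 0)"
    using modular_forms_expansion[OF assms] by blast
  let ?F = "\<lambda>u p. if tsize (texp r u) \<le> r then (case p of (z, w) \<Rightarrow> thS (texp r u) z * thS (texp r u) w) *
      (\<Sum>i\<le>r - tsize (texp r u). \<Sum>j\<le>r - tsize (texp r u). d u i j * (case p of (z, w) \<Rightarrow> XY (r - tsize (texp r u)) i z * XY (r - tsize (texp r u)) j w)) else 0"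
  have "box_form r (?F u)" for u
  proof (cases "tsize (texp r u) \<le> r")
    case True
    have "box_form (tsize (texp r u) + (r - tsize (texp r u))) (\<lambda>p. (case p of (z, w) \<Rightarrow> thS (texp r u) z * thS (texp r u) w) *
      (\<Sum>i\<le>r - tsize (texp r u). \<Sum>j\<le>r - tsize (texp r u). d u i j * (case p of (z, w) \<Rightarrow> XY (r - tsize (texp r u)) i z * XY (r - tsize (texp r u)) j w)))"
      by (intro box_form_mult box_form_thS box_form_sum box_form_scale box_form_XY) simp_all
    thus ?thesis using True by simp
  next
    case False
    thus ?thesis using box_form_zero[of r] by simp
  qed
  hence "box_form r (\<lambda>p. \<Sum>u\<in>UNIV. ?F u p)" by (rule box_form_sum)
  then obtain P where P: "\<forall>m\<in>Poly_Mapping.keys P. monom_degree m = r" "\<forall>p\<in>HH. (\<Sum>u\<in>UNIV. ?F u p) = peval (\<lambda>c. c) (vals p) P"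
    unfolding box_form_def by (elim exE conjE)
  show ?thesis
  proof (rule box_formI[OF P(1)])
    fix p assume p: "p \<in> HH"
    obtain z w where "p = (z, w)" "Im z > 0" "Im w > 0" using p by auto
    hence "f p = (\<Sum>u\<in>UNIV. ?F u p)" by (simp only: d prod.case)
    also have "\<dots> = peval (\<lambda>c. c) (vals p) P" using P(2) p by (rule bspec)
    finally show "f p = peval (\<lambda>c. c) (vals p) P" .
  qed
qed

lemma tau_keys: "Poly_Mapping.keys (tau P) \<subseteq> (\<lambda>m. box_class (Poly_Mapping.single m 1)) ` Poly_Mapping.keys P \<times> UNIV"
  unfolding tau_def by (rule order_trans[OF keys_sum]) (auto simp: keys_frag_of)

text \<open>The polynomial supplied by \<open>modular_form_box_form\<close> is homogeneous of degree
  r, so the preimage can be taken in the r-th graded piece. This serves both surjectivity and the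
  compatibility with the gradings.\<close>

lemma homogeneous_preimage:
  assumes f: "f \<in> modular_forms r"
  shows "\<exists>x. Poly_Mapping.keys x \<subseteq> box_grading r \<times> UNIV \<and> Psi x = in_degree r f"
proof -
  obtain P where P: "\<forall>m\<in>Poly_Mapping.keys P. monom_degree m = r" "\<forall>p\<in>HH. f p = peval (\<lambda>c. c) (vals p) P"
    using modular_form_box_form[OF f] unfolding box_form_def by blast
  have "box_class (Poly_Mapping.single m 1) \<in> box_grading r" if "m \<in> Poly_Mapping.keys P" for m
    unfolding box_grading_def using P(1) that by (intro imageI) simp
  hence "Poly_Mapping.keys (tau P) \<subseteq> box_grading r \<times> UNIV" using tau_keys[of P] by blast
  moreover have "Psi (tau P) = in_degree r f"
  proof (intro ext)
    fix k p
    have "(\<Sum>m\<in>Poly_Mapping.keys P. if monom_degree m = k then Poly_Mapping.lookup P m * mon (vals p) m else 0)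
      = (if k = r then peval (\<lambda>c. c) (vals p) P else 0)"
      unfolding peval_def using P(1) by (auto intro!: sum.cong sum.neutral)
    thus "Psi (tau P) k p = in_degree r f k p" using bspec[OF P(2), of p] unfolding Psi_tau
      by (cases "p \<in> HH") (simp_all only: onH_def in_degree_def if_True if_False simp_thms split: if_splits)
  qed
  ultimately show ?thesis by blast
qed

lemma box_grading_subset: "box_grading r \<subseteq> carrier box_algebra"
  by (auto simp: box_grading_def)

lemma Psi_surj: "Psi ` carrier box.PR = carrier form_ring"
proof
  show "Psi ` carrier box.PR \<subseteq> carrier form_ring" using Psi_closed by auto
  show "carrier form_ring \<subseteq> Psi ` carrier box.PR"
  proof
    fix F assume F: "F \<in> carrier form_ring"
    define S where "S = {r. F r \<noteq> (\<lambda>p. 0)}"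
    have S: "finite S" and Fr: "\<And>r. F r \<in> modular_forms r" using F by (simp_all add: S_def form_ring_simps)
    have "\<forall>r. \<exists>x. Poly_Mapping.keys x \<subseteq> box_grading r \<times> UNIV \<and> Psi x = in_degree r (F r)"
      using homogeneous_preimage[OF Fr] by blast
    then obtain x where x: "\<And>r. Poly_Mapping.keys (x r) \<subseteq> box_grading r \<times> UNIV" "\<And>r. Psi (x r) = in_degree r (F r)" by metis
    have xc: "x r \<in> carrier box.PR" for r using x(1)[of r] box_grading_subset[of r] by (auto simp: box.PR_simps)
    have "(\<Sum>r\<in>S. x r) \<in> carrier box.PR" using S
      by (induction S rule: finite_induct) (simp_all add: box.PR_closed xc)
    moreover have "Psi (\<Sum>r\<in>S. x r) = F"
    proof (intro ext)
      fix k p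
      have "Psi (\<Sum>r\<in>S. x r) k p = (\<Sum>r\<in>S. in_degree r (F r) k p)" by (simp only: Psi_sum x(2))
      also have "\<dots> = (\<Sum>r\<in>S. if r = k then F k p else 0)"
        using modular_formsD(1)[OF Fr[of k], of p] by (intro sum.cong) (auto simp: in_degree_def simp del: mem_Sigma_iff)
      also have "\<dots> = (if k \<in> S then F k p else 0)" using S by simp
      also have "\<dots> = F k p" by (simp add: S_def)
      finally show "Psi (\<Sum>r\<in>S. x r) k p = F k p" .
    qed
    ultimately show "F \<in> Psi ` carrier box.PR" by blast
  qed
qed

section \<open>Injectivity\<close>

definition wc :: "(box_var \<Rightarrow> 'b::comm_ring_1) \<Rightarrow> (box_var \<Rightarrow>\<^sub>0 nat) \<Rightarrow> 'b" where
  "wc a m = a W1 ^ Poly_Mapping.lookup m W1 * a W2 ^ Poly_Mapping.lookup m W2 * a W3 ^ Poly_Mapping.lookup m W3 * a C ^ Poly_Mapping.lookup m C"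

definition wdeg :: "(box_var \<Rightarrow>\<^sub>0 nat) \<Rightarrow> nat" where
  "wdeg m = Poly_Mapping.lookup m W1 + Poly_Mapping.lookup m W2 + Poly_Mapping.lookup m W3 + Poly_Mapping.lookup m C"

text \<open>The parametrisation of the cone over the quadric W1^2 + W2^2 + W3^2 = C^2 by two pairs
  of coordinates. At X(z), Y(z), X(w), Y(w) it returns the theta values of the four
  generators.\<close>

definition bil :: "complex \<Rightarrow> complex \<Rightarrow> complex \<Rightarrow> complex \<Rightarrow> box_var \<Rightarrow> complex" where
  "bil x y u v s = (case s of C \<Rightarrow> x * u + y * v | W1 \<Rightarrow> y * u + x * v | W2 \<Rightarrow> \<i> * (y * u - x * v) | W3 \<Rightarrow> x * u - y * v | _ \<Rightarrow> 0)"

lemma wc_infinite_zero: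
  assumes "infinite T" "\<And>t. t \<in> T \<Longrightarrow> (\<Sum>m\<in>A. c m * wc (\<lambda>v. poly (q v) t) m) = (0::complex)"
  shows "(\<Sum>m\<in>A. c m * wc (\<lambda>v. poly (q v) t) m) = 0"
proof -
  define p where "p = (\<Sum>m\<in>A. Polynomial.smult (c m) (wc q m))"
  have p: "poly p t = (\<Sum>m\<in>A. c m * wc (\<lambda>v. poly (q v) t) m)" for t
    by (simp add: p_def poly_sum wc_def poly_mult poly_power)
  have "p = 0"
  proof (rule ccontr)
    assume "p \<noteq> 0"
    hence "finite {t. poly p t = 0}" by (rule poly_roots_finite)
    moreover have "T \<subseteq> {t. poly p t = 0}" using assms(2) p by auto
    ultimately show False using assms(1) finite_subset by blast
  qed
  thus ?thesis using p[of t] by simp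
qed

lemma wc_bil_homogeneous: "wc (bil (l * x) (l * y) (k * u) (k * v)) m = (l * k) ^ wdeg m * wc (bil x y u v) m"
proof -
  have "bil (l * x) (l * y) (k * u) (k * v) s = (l * k) * bil x y u v s" for s
    by (cases s) (simp_all add: bil_def algebra_simps)
  thus ?thesis by (simp add: wc_def wdeg_def power_mult_distrib power_add mult_ac)
qed

lemma chi_orthogonal: "(\<Sum>v\<in>UNIV. chi u v * chi u' v) = (if u = u' then 8 else 0)"
proof -
  have s: "chi u v = chi v u" for u v by (cases u; cases v) (auto simp: chi_def)
  have "(\<Sum>v\<in>UNIV. chi u v * chi u' v) = (\<Sum>v\<in>UNIV. chi v (cls_add u u'))" unfolding chi_cls_add by (simp add: s[of u] s[of u'])
  moreover have "cls_add u u' = (False, False, False) \<longleftrightarrow> u = u'" by (cases u; cases u') (auto simp: cls_add_def)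
  ultimately show ?thesis by (simp add: sum_chi)
qed

text \<open>Encodes the character of a monomial when Gamma[4] acts on z alone: in
  \<open>theta_gamma4\<close> the parity of b/4 concerns theta_10, that of c/4 concerns theta_01,
  and that of (d - 1)/4 all three.\<close>

definition zclass :: "(box_var \<Rightarrow>\<^sub>0 nat) \<Rightarrow> bool \<times> bool \<times> bool" where
  "zclass m = (odd (Poly_Mapping.lookup m Z3), odd (Poly_Mapping.lookup m Z1),
     odd (Poly_Mapping.lookup m Z1 + Poly_Mapping.lookup m Z2 + Poly_Mapping.lookup m Z3))"

lemma mon_twist:
  assumes M: "gamma4 a b c d" and z: "Im z > 0"
  shows "mon (vals (mob a b c d z, w)) m = jfac a b c d z ^ monom_degree m * chi (zclass m) (cls (a, b, c, d)) * mon (vals (z, w)) m"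
proof -
  define J where "J = jfac a b c d z"
  let ?l = "b div 4" and ?m = "c div 4" and ?n = "(d - 1) div 4"
  note th = theta_gamma4[OF M z, folded J_def]
  have v: "vals (mob a b c d z, w) Z1 = J * (sg (?n + ?m) * vals (z, w) Z1)" "vals (mob a b c d z, w) Z2 = J * (sg ?n * vals (z, w) Z2)"
    "vals (mob a b c d z, w) Z3 = J * (sg (?l + ?n) * vals (z, w) Z3)"
    unfolding vals_def prod.case box_var.case th by (simp_all only: mult_ac)
  have v': "vals (mob a b c d z, w) W1 = J * vals (z, w) W1" "vals (mob a b c d z, w) W2 = J * vals (z, w) W2"
    "vals (mob a b c d z, w) W3 = J * vals (z, w) W3" "vals (mob a b c d z, w) C = J * vals (z, w) C"
    unfolding vals_def prod.case box_var.case th(2,3) by (simp_all add: algebra_simps)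
  have pw: "sg n ^ k = (if odd k \<and> odd n then -1 else 1)" for n k by (cases "even n"; cases "even k") auto
  define e1 e2 e3 where "e1 = Poly_Mapping.lookup m Z1" and "e2 = Poly_Mapping.lookup m Z2" and "e3 = Poly_Mapping.lookup m Z3"
  have s: "sg (?n + ?m) ^ e1 * sg ?n ^ e2 * sg (?l + ?n) ^ e3 = chi (zclass m) (cls (a, b, c, d))"
    unfolding pw zclass_def cls_def chi_def prod.case e1_def[symmetric] e2_def[symmetric] e3_def[symmetric] even_add
    by (cases "even e1"; cases "even e2"; cases "even e3"; cases "even ?l"; cases "even ?m"; cases "even ?n") simp_all
  have "mon (vals (mob a b c d z, w)) m = J ^ monom_degree m * (sg (?n + ?m) ^ e1 * sg ?n ^ e2 * sg (?l + ?n) ^ e3) * mon (vals (z, w)) m"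
    unfolding mon_explicit monom_degree_explicit v v' power_mult_distrib power_add e1_def e2_def e3_def by (simp only: mult_ac)
  thus ?thesis unfolding s J_def .
qed

text \<open>(M, 1) need not belong to Delta(4,8), but an identity that holds at all points may be
  evaluated at (M z, w). Homogeneity makes the power of \<open>jfac\<close> a common factor, and
  orthogonality of the characters isolates each class.\<close>

lemma vanish_zclass:
  assumes deg: "\<And>m. m \<in> M \<Longrightarrow> monom_degree m = r" and fin: "finite M"
    and zero: "\<And>p. p \<in> HH \<Longrightarrow> (\<Sum>m\<in>M. c m * mon (vals p) m) = 0" and zw: "Im z > 0" "Im w > 0"
  shows "(\<Sum>m\<in>{m\<in>M. zclass m = u}. c m * mon (vals (z, w)) m) = 0"
proof -
  have tw: "(\<Sum>m\<in>M. chi (zclass m) v * (c m * mon (vals (z, w)) m)) = 0" for v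
  proof -
    obtain a b c' d where e: "rep v = (a, b, c', d)" by (metis prod.exhaust)
    have g: "gamma4 a b c' d" "cls (a, b, c', d) = v" using rep_gamma4[of v] by (simp_all add: e gamma4t_def)
    have "Im (mob a b c' d z) > 0" using g(1) zw(1) by (intro Im_mob_pos) (simp_all add: gamma4_def)
    hence "(mob a b c' d z, w) \<in> HH" using zw by simp
    from zero[OF this] have "0 = (\<Sum>m\<in>M. c m * mon (vals (mob a b c' d z, w)) m)" by simp
    also have "\<dots> = (\<Sum>m\<in>M. jfac a b c' d z ^ r * (chi (zclass m) v * (c m * mon (vals (z, w)) m)))"
      unfolding mon_twist[OF g(1) zw(1)] g(2) using deg by (intro sum.cong) simp_all
    also have "\<dots> = jfac a b c' d z ^ r * (\<Sum>m\<in>M. chi (zclass m) v * (c m * mon (vals (z, w)) m))" by (rule sum_distrib_left[symmetric])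
    finally show ?thesis using jfac_nonzero[OF g(1) zw(1)] by simp
  qed
  have "0 = (\<Sum>v\<in>UNIV. chi u v * (\<Sum>m\<in>M. chi (zclass m) v * (c m * mon (vals (z, w)) m)))" unfolding tw by simp
  also have "\<dots> = (\<Sum>v\<in>UNIV. \<Sum>m\<in>M. (chi u v * chi (zclass m) v) * (c m * mon (vals (z, w)) m))"
    by (simp only: sum_distrib_left mult.assoc)
  also have "\<dots> = (\<Sum>m\<in>M. \<Sum>v\<in>UNIV. (chi u v * chi (zclass m) v) * (c m * mon (vals (z, w)) m))" by (rule sum.swap)
  also have "\<dots> = (\<Sum>m\<in>M. (if u = zclass m then 8 else 0) * (c m * mon (vals (z, w)) m))"
    unfolding sum_distrib_right[symmetric] chi_orthogonal ..
  also have "\<dots> = (\<Sum>m\<in>M. if zclass m = u then 8 * (c m * mon (vals (z, w)) m) else 0)"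
    by (rule sum.cong) auto
  also have "\<dots> = (\<Sum>m\<in>{m\<in>M. zclass m = u}. 8 * (c m * mon (vals (z, w)) m))"
    by (rule sum.inter_filter[symmetric, OF fin])
  also have "\<dots> = 8 * (\<Sum>m\<in>{m\<in>M. zclass m = u}. c m * mon (vals (z, w)) m)" by (rule sum_distrib_left[symmetric])
  finally show ?thesis by simp
qed

text \<open>By homogeneity in (x, y) and in (u, v) only the slopes y/x and v/u matter. The slopes
  Y/X of theta values form an infinite set, so the polynomial identity extends to all values of the
  first slope and then of the second.\<close>

lemma bil_vanish:
  assumes deg: "\<And>m. m \<in> A \<Longrightarrow> wdeg m = e"
    and zero: "\<And>z w. Im z > 0 \<Longrightarrow> Im w > 0 \<Longrightarrow> (\<Sum>m\<in>A. c m * wc (bil (thX z) (thY z) (thX w) (thY w)) m) = 0"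
    and xu: "x \<noteq> 0" "u \<noteq> 0"
  shows "(\<Sum>m\<in>A. c m * wc (bil x y u v) m) = 0"
proof -
  define F where "F x y u v = (\<Sum>m\<in>A. c m * wc (bil x y u v) m)" for x y u v
  have hom: "F (l * x) (l * y) (k * u) (k * v) = (l * k) ^ e * F x y u v" for l k x y u v
    unfolding F_def wc_bil_homogeneous sum_distrib_left using deg by (intro sum.cong) simp_all
  define T where "T = (\<lambda>z. thY z / thX z) ` {z. Im z \<ge> 1}"
  have T: "infinite T" unfolding T_def by (rule thY_thX_infinite)
  have 0: "F 1 t 1 t' = 0" if tt: "t \<in> T" "t' \<in> T" for t t'
  proof -
    obtain z where z: "Im z \<ge> 1" "t = thY z / thX z" using tt(1) unfolding T_def by blast
    obtain w where w: "Im w \<ge> 1" "t' = thY w / thX w" using tt(2) unfolding T_def by blast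
    have zw: "Im z > 0" "Im w > 0" "t = thY z / thX z" "t' = thY w / thX w" using z w by auto
    note nz = thX_nonzero[OF zw(1)] thX_nonzero[OF zw(2)]
    have "F (thX z * 1) (thX z * t) (thX w * 1) (thX w * t') = 0"
      using zero[OF zw(1,2)] nz by (simp add: F_def zw(3,4))
    thus ?thesis unfolding hom using nz by simp
  qed
  have 1: "F 1 t 1 t' = 0" if "t' \<in> T" for t t'
  proof -
    let ?q = "\<lambda>s. case s of C \<Rightarrow> [:1, t':] | W1 \<Rightarrow> [:t', 1:] | W2 \<Rightarrow> [:- \<i> * t', \<i>:] | W3 \<Rightarrow> [:1, - t':] | _ \<Rightarrow> 0"
    have b: "bil 1 t 1 t' = (\<lambda>s. poly (?q s) t)" for t
      by (rule ext) (simp add: bil_def algebra_simps split: box_var.split)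
    show ?thesis unfolding F_def b
      by (rule wc_infinite_zero[OF T]) (use 0[OF _ that] in \<open>simp only: F_def b\<close>)
  qed
  have 2: "F 1 t 1 t' = 0" for t t'
  proof -
    let ?q = "\<lambda>s. case s of C \<Rightarrow> [:1, t:] | W1 \<Rightarrow> [:t, 1:] | W2 \<Rightarrow> [:\<i> * t, - \<i>:] | W3 \<Rightarrow> [:1, - t:] | _ \<Rightarrow> 0"
    have b: "bil 1 t 1 t' = (\<lambda>s. poly (?q s) t')" for t'
      by (rule ext) (simp add: bil_def algebra_simps split: box_var.split)
    show ?thesis unfolding F_def b
      by (rule wc_infinite_zero[OF T]) (use 1[of _ t] in \<open>simp only: F_def b\<close>)
  qed
  have "F x y u v = F (x * 1) (x * (y / x)) (u * 1) (u * (v / u))" using xu by simp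
  also have "\<dots> = 0" unfolding hom 2 by simp
  finally show ?thesis by (simp add: F_def)
qed

text \<open>Within one class the exponents of Z1, Z2, Z3 are determined, being at most 1, and their
  theta factor is nonzero; a relation between W1, W2, W3 and C on the quadric remains. Over real W's
  both signs of C = sqrt(W1^2 + W2^2 + W3^2) are available, which separates C^0 from C^1. The
  remaining polynomial in W1, W2, W3 is disposed of by a Kronecker substitution.\<close>

lemma reduced_monomials_independent:
  assumes red: "\<And>m. m \<in> M \<Longrightarrow> reduced_mon m" and deg: "\<And>m. m \<in> M \<Longrightarrow> monom_degree m = r" and fin: "finite M"
    and zero: "\<And>p. p \<in> HH \<Longrightarrow> (\<Sum>m\<in>M. c m * mon (vals p) m) = 0" and m0: "m0 \<in> M"
  shows "c m0 = 0"
proof -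
  define A where "A = {m\<in>M. zclass m = zclass m0}"
  have finA: "finite A" using fin by (simp add: A_def)
  have Z: "Poly_Mapping.lookup m v = Poly_Mapping.lookup m0 v" if m: "m \<in> A" and v: "v \<in> {Z1, Z2, Z3}" for m v
  proof -
    have b: "Poly_Mapping.lookup n s \<le> 1" if "n \<in> M" "s \<in> {Z1, Z2, Z3}" for n s using red[OF that(1)] that(2) by (auto simp: reduced_mon_def)
    have eq: "x = y" if "x \<le> 1" "y \<le> 1" "odd x = odd y" for x y :: nat using that by (cases x; cases y) auto
    have z: "odd (Poly_Mapping.lookup m Z3) = odd (Poly_Mapping.lookup m0 Z3)" "odd (Poly_Mapping.lookup m Z1) = odd (Poly_Mapping.lookup m0 Z1)"
      "odd (Poly_Mapping.lookup m Z2) = odd (Poly_Mapping.lookup m0 Z2)" using m by (auto simp: A_def zclass_def)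
    have "odd (Poly_Mapping.lookup m v) = odd (Poly_Mapping.lookup m0 v)" using v z by auto
    thus ?thesis using b[OF _ v] m m0 by (intro eq) (simp_all add: A_def)
  qed
  define e where "e = wdeg m0"
  have dg: "monom_degree m = Poly_Mapping.lookup m Z1 + Poly_Mapping.lookup m Z2 + Poly_Mapping.lookup m Z3 + wdeg m" for m
    by (simp add: monom_degree_explicit wdeg_def)
  have e: "wdeg m = e" if "m \<in> A" for m
    using deg[of m] deg[OF m0] Z[OF that] that by (simp add: dg e_def A_def)
  have W0: "(\<Sum>m\<in>A. c m * wc (bil (thX z) (thY z) (thX w) (thY w)) m) = 0" if zw: "Im z > 0" "Im w > 0" for z w
  proof -
    define K where "K = vals (z, w) Z1 ^ Poly_Mapping.lookup m0 Z1 * vals (z, w) Z2 ^ Poly_Mapping.lookup m0 Z2 * vals (z, w) Z3 ^ Poly_Mapping.lookup m0 Z3"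
    have "K \<noteq> 0" using theta_nonzero[OF zw(1)] theta_nonzero[OF zw(2)] by (simp add: K_def vals_def)
    have "mon (vals (z, w)) m = K * wc (bil (thX z) (thY z) (thX w) (thY w)) m" if "m \<in> A" for m
      unfolding mon_explicit wc_def K_def using Z[OF that] by (simp add: vals_def bil_def mult_ac)
    hence "(\<Sum>m\<in>A. c m * mon (vals (z, w)) m) = K * (\<Sum>m\<in>A. c m * wc (bil (thX z) (thY z) (thX w) (thY w)) m)"
      unfolding sum_distrib_left by (intro sum.cong) (simp_all add: mult_ac)
    moreover have "(\<Sum>m\<in>A. c m * mon (vals (z, w)) m) = 0"
      unfolding A_def by (rule vanish_zclass[OF deg fin zero zw])
    ultimately show ?thesis using \<open>K \<noteq> 0\<close> by simp
  qed
  define B where "B i = {m\<in>A. Poly_Mapping.lookup m C = i}" for i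
  let ?w = "\<lambda>a b g m. complex_of_real (a ^ Poly_Mapping.lookup m W1 * b ^ Poly_Mapping.lookup m W2 * g ^ Poly_Mapping.lookup m W3)"
  have AB: "A = B 0 \<union> B 1" "B 0 \<inter> B 1 = {}" "finite (B 0)" "finite (B 1)"
  proof -
    show "A = B 0 \<union> B 1" "B 0 \<inter> B 1 = {}" using red by (auto simp: B_def A_def reduced_mon_def le_Suc_eq)
    show "finite (B 0)" "finite (B 1)" unfolding B_def using finA by simp_all
  qed
  have real_zero: "(\<Sum>m\<in>B i. c m * ?w a b g m) = 0" if pos: "a > 0" "b > 0" "g > 0" and i: "i \<in> {0, 1}" for a b g :: real and i
  proof -
    define R where "R = sqrt (a ^ 2 + b ^ 2 + g ^ 2)"
    have R2: "R ^ 2 = a ^ 2 + b ^ 2 + g ^ 2" using pos by (simp add: R_def)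
    have "g ^ 2 < R ^ 2" using pos by (simp add: R2 add_pos_pos)
    hence R: "g < R" by (rule power2_less_imp_less) (simp add: R_def)
    have s: "(\<Sum>m\<in>B 0. c m * ?w a b g m) + complex_of_real E * (\<Sum>m\<in>B 1. c m * ?w a b g m) = 0" if E: "E = R \<or> E = - R" for E
    proof -
      \<comment> \<open>Solves \<open>bil\<close> for the point (a, b, g, E) of the quadric: the
        four products of coordinates must be (E + g)/2, (E - g)/2, (a - i b)/2 and (a + i b)/2.
        Setting the first coordinate to 1 gives 1, x/p, p, y; p is nonzero because g < R.\<close>
      define p where "p = complex_of_real ((E + g) / 2)"
      define x where "x = (of_real a - \<i> * of_real b) / (2::complex)"
      define y where "y = (of_real a + \<i> * of_real b) / (2::complex)"
      have p0: "p \<noteq> 0" using E R pos by (auto simp: p_def simp del: of_real_add of_real_divide)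
      have E2: "E ^ 2 = a ^ 2 + b ^ 2 + g ^ 2" using E R2 by auto
      have "x * y = of_real ((a ^ 2 + b ^ 2) / 4)" by (simp add: x_def y_def field_simps power2_eq_square)
      also have "(a ^ 2 + b ^ 2) / 4 = ((E + g) / 2) * ((E - g) / 2)" using E2 by (simp add: field_simps power2_eq_square)
      finally have xy: "x / p * y = of_real ((E - g) / 2)" using p0 by (simp add: p_def field_simps)
      have "(\<Sum>m\<in>A. c m * wc (bil 1 (x / p) p y) m) = 0"
        by (rule bil_vanish[OF e W0]) (use p0 in auto)
      moreover have "wc (bil 1 (x / p) p y) m = ?w a b g m * of_real E ^ Poly_Mapping.lookup m C" for m
      proof -
        have "bil 1 (x / p) p y W1 = of_real a" "bil 1 (x / p) p y W2 = of_real b" using p0 by (simp_all add: bil_def x_def y_def field_simps)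
        moreover have "bil 1 (x / p) p y W3 = of_real g" "bil 1 (x / p) p y C = of_real E"
          unfolding bil_def box_var.case xy by (simp_all add: p_def field_simps)
        ultimately show ?thesis by (simp add: wc_def)
      qed
      ultimately have "(\<Sum>m\<in>A. c m * (?w a b g m * of_real E ^ Poly_Mapping.lookup m C)) = 0" by simp
      hence "(\<Sum>m\<in>B 0. c m * (?w a b g m * of_real E ^ Poly_Mapping.lookup m C)) + (\<Sum>m\<in>B 1. c m * (?w a b g m * of_real E ^ Poly_Mapping.lookup m C)) = 0"
        unfolding AB(1) by (simp only: sum.union_disjoint[OF AB(3,4,2)])
      moreover have "(\<Sum>m\<in>B 0. c m * (?w a b g m * of_real E ^ Poly_Mapping.lookup m C)) = (\<Sum>m\<in>B 0. c m * ?w a b g m)"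
        by (rule sum.cong) (simp_all add: B_def)
      moreover have "(\<Sum>m\<in>B 1. c m * (?w a b g m * of_real E ^ Poly_Mapping.lookup m C)) = of_real E * (\<Sum>m\<in>B 1. c m * ?w a b g m)"
        unfolding sum_distrib_left by (rule sum.cong) (simp_all add: B_def mult_ac)
      ultimately show ?thesis by simp
    qed
    have r0: "complex_of_real R \<noteq> 0" using R pos by simp
    define S0 where "S0 = (\<Sum>m\<in>B 0. c m * ?w a b g m)"
    define S1 where "S1 = (\<Sum>m\<in>B 1. c m * ?w a b g m)"
    have "S0 + of_real R * S1 = 0" "S0 - of_real R * S1 = 0" using s[of R] s[of "- R"] by (simp_all add: S0_def S1_def)
    hence "S0 + S0 = 0" "of_real R * S1 = - S0" by (simp_all add: algebra_simps add_eq_0_iff)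
    hence "S0 = 0" "S1 = 0" using r0 by simp_all
    thus ?thesis using i unfolding S0_def S1_def by blast
  qed
  \<comment> \<open>No exponent exceeds r, so the exponents are digits in base r + 1: the
    substitution W1 = t, W2 = t^N, W3 = t^(N N) keeps different monomials apart.\<close>
  define N where "N = Suc r"
  define \<kappa> where "\<kappa> m = Poly_Mapping.lookup m W1 + N * (Poly_Mapping.lookup m W2 + N * Poly_Mapping.lookup m W3)" for m :: "box_var \<Rightarrow>\<^sub>0 nat"
  define i where "i = Poly_Mapping.lookup m0 C"
  have i: "i \<in> {0, 1}" using red[OF m0] by (auto simp: i_def reduced_mon_def)
  have m0B: "m0 \<in> B i" using m0 by (simp add: B_def A_def i_def)
  have finB: "finite (B i)" using finA by (simp add: B_def)
  have inj: "m = m0" if m: "m \<in> B i" and k: "\<kappa> m = \<kappa> m0" for m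
  proof -
    have mA: "m \<in> A" "Poly_Mapping.lookup m C = Poly_Mapping.lookup m0 C" using m by (simp_all add: B_def i_def)
    have lt: "Poly_Mapping.lookup n W1 < N" "Poly_Mapping.lookup n W2 < N" if "n \<in> M" for n
      using deg[OF that] by (simp_all add: N_def monom_degree_explicit)
    have dec: "\<kappa> n mod N = Poly_Mapping.lookup n W1" "\<kappa> n div N mod N = Poly_Mapping.lookup n W2" "\<kappa> n div N div N = Poly_Mapping.lookup n W3"
      if "n \<in> M" for n using lt[OF that] by (simp_all add: \<kappa>_def)
    have "m \<in> M" using mA by (simp add: A_def)
    hence "Poly_Mapping.lookup m W1 = Poly_Mapping.lookup m0 W1" "Poly_Mapping.lookup m W2 = Poly_Mapping.lookup m0 W2"
      "Poly_Mapping.lookup m W3 = Poly_Mapping.lookup m0 W3" using dec[OF \<open>m \<in> M\<close>] dec[OF m0] k by metis+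
    moreover have "Poly_Mapping.lookup m Z1 = Poly_Mapping.lookup m0 Z1" "Poly_Mapping.lookup m Z2 = Poly_Mapping.lookup m0 Z2"
      "Poly_Mapping.lookup m Z3 = Poly_Mapping.lookup m0 Z3" using Z[OF mA(1)] by simp_all
    ultimately have "Poly_Mapping.lookup m v = Poly_Mapping.lookup m0 v" for v using mA(2) by (cases v) simp_all
    thus ?thesis by (rule poly_mapping_eqI)
  qed
  define p where "p = (\<Sum>m\<in>B i. Polynomial.monom (c m) (\<kappa> m))"
  have "poly p (of_real t) = 0" if t: "t > 0" for t :: real
  proof -
    have "t ^ Poly_Mapping.lookup m W1 * (t ^ N) ^ Poly_Mapping.lookup m W2 * (t ^ (N * N)) ^ Poly_Mapping.lookup m W3 = t ^ \<kappa> m" for m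
      by (simp add: \<kappa>_def power_add power_mult[symmetric] algebra_simps)
    thus ?thesis using real_zero[of t "t ^ N" "t ^ (N * N)" i] t i by (simp add: p_def poly_sum poly_monom)
  qed
  hence "of_real ` {0<..} \<subseteq> {t. poly p t = 0}" by auto
  moreover have "infinite ((of_real :: real \<Rightarrow> complex) ` {0<..})"
    by (subst finite_image_iff) (auto simp: inj_on_def infinite_Ioi)
  ultimately have "infinite {t. poly p t = 0}" using finite_subset by blast
  hence "p = 0" using poly_roots_finite by blast
  hence "0 = coeff p (\<kappa> m0)" by simp
  also have "\<dots> = (\<Sum>m\<in>B i. if m = m0 then c m else 0)"
    unfolding p_def coeff_sum coeff_monom using inj by (intro sum.cong) auto
  also have "\<dots> = c m0" using m0B finB by simp
  finally show ?thesis by simp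
qed

lemma reduced_vanish:
  fixes P :: "complex box_poly"
  assumes "\<forall>m\<in>Poly_Mapping.keys P. reduced_mon m"
    and zero: "\<And>r p. p \<in> HH \<Longrightarrow> (\<Sum>m\<in>Poly_Mapping.keys P. if monom_degree m = r then Poly_Mapping.lookup P m * mon (vals p) m else 0) = 0"
  shows "P = 0"
proof (rule ccontr)
  assume "P \<noteq> 0"
  then obtain m0 where m0: "m0 \<in> Poly_Mapping.keys P" by fastforce
  define M where "M = {m\<in>Poly_Mapping.keys P. monom_degree m = monom_degree m0}"
  have "Poly_Mapping.lookup P m0 = 0"
  proof (rule reduced_monomials_independent[of M "monom_degree m0" "Poly_Mapping.lookup P" m0])
    fix p assume "p \<in> HH"
    from zero[OF this, of "monom_degree m0"] show "(\<Sum>m\<in>M. Poly_Mapping.lookup P m * mon (vals p) m) = 0"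
      unfolding M_def by (simp add: sum.inter_filter)
  qed (use assms(1) m0 in \<open>auto simp: M_def\<close>)
  thus False using m0 by (simp add: in_keys_iff)
qed

section \<open>The isomorphism\<close>

text \<open>An element of the kernel is congruent to some reduced \<open>tau P\<close>, which is
  then mapped to 0 as well; independence of the reduced monomials forces P = 0.\<close>

lemma Psi_kernel: "a_kernel box.PR form_ring Psi = box.J"
proof
  show "box.J \<subseteq> a_kernel box.PR form_ring Psi"
  proof
    fix x assume x: "x \<in> box.J"
    hence "Psi x = \<zero>\<^bsub>form_ring\<^esub>" unfolding form_ring_simps(4) Psi_def using hfun_vanish by (intro ext) simp
    thus "x \<in> a_kernel box.PR form_ring Psi" using x box.J_subset unfolding a_kernel_def' by blast
  qed
  show "a_kernel box.PR form_ring Psi \<subseteq> box.J"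
  proof
    fix x assume "x \<in> a_kernel box.PR form_ring Psi"
    hence x: "x \<in> carrier box.PR" "Psi x = (\<lambda>r p. 0)" unfolding a_kernel_def' form_ring_simps(4) by simp_all
    obtain P where P: "\<forall>m\<in>Poly_Mapping.keys P. reduced_mon m" "x - tau P \<in> box.J" using tensor_normal_form[OF x(1)] by blast
    have "P = 0"
    proof (rule reduced_vanish[OF P(1)])
      fix r p assume p: "p \<in> HH"
      have "Psi (x - tau P) r p = 0" unfolding Psi_def using hfun_vanish[OF p P(2)] by simp
      hence "Psi (tau P) r p = 0" unfolding Psi_diff x(2) by simp
      thus "(\<Sum>m\<in>Poly_Mapping.keys P. if monom_degree m = r then Poly_Mapping.lookup P m * mon (vals p) m else 0) = 0"
        using p unfolding Psi_tau onH_def by (simp only: if_True)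
    qed
    thus "x \<in> box.J" using P(2) by (simp add: tau_def)
  qed
qed

text \<open>\<open>Psi\<close> is constant on cosets of its kernel, so the image of a coset is a
  singleton.\<close>

definition Phi :: "box_complex \<Rightarrow> form_family" where
  "Phi X = the_elem (Psi ` X)"

lemma Phi_coset: "x \<in> carrier box.PR \<Longrightarrow> Phi (box.J +>\<^bsub>box.PR\<^esub> x) = Psi x"
  unfolding Phi_def Psi_kernel[symmetric] by (rule ring_hom_ring.the_elem_simp[OF Psi_hom])

lemma Phi_iso_quot: "Phi \<in> ring_iso (box.PR Quot box.J) form_ring"
  using ring_hom_ring.FactRing_iso_set[OF Psi_hom Psi_surj] unfolding Psi_kernel Phi_def[abs_def] .

lemma box_algebra_C_simps:
  "carrier box_algebra_C = carrier (box.PR Quot box.J)" "mult box_algebra_C = mult (box.PR Quot box.J)"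
  "one box_algebra_C = one (box.PR Quot box.J)" "add box_algebra_C = add (box.PR Quot box.J)"
  "k \<odot>\<^bsub>box_algebra_C\<^esub> X = (box.J +>\<^bsub>box.PR\<^esub> frag_of (box_class 1, k)) \<otimes>\<^bsub>box.PR Quot box.J\<^esub> X"
  by (simp_all add: box_algebra_C_def tensor_algebra_def algebra_via_simps pure_tensor_def)

lemma form_algebra_simps:
  "carrier form_algebra = carrier form_ring" "mult form_algebra = mult form_ring"
  "one form_algebra = one form_ring" "add form_algebra = add form_ring"
  "k \<odot>\<^bsub>form_algebra\<^esub> F = in_degree 0 (\<lambda>p. k) \<otimes>\<^bsub>form_ring\<^esub> F"
  by (simp_all add: form_algebra_def algebra_via_simps)

lemma coset_closed: "x \<in> carrier box.PR \<Longrightarrow> box.J +>\<^bsub>box.PR\<^esub> x \<in> carrier (box.PR Quot box.J)"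
  unfolding FactRing_def A_RCOSETS_def' by auto

lemma Psi_scalar: "Psi (frag_of (box_class 1, k)) = in_degree 0 (\<lambda>p. k)"
  by (intro ext) (simp add: Psi_def in_degree_def hfun_class ev_def)

lemma Psi_gen: "Psi (frag_of (box_class (poly_var v), 1)) = in_degree 1 (\<lambda>p. vals p v)"
  by (intro ext) (auto simp: Psi_def in_degree_def hfun_class ev_var simp del: mem_Sigma_iff)

lemma Phi_gen: "Phi (box_gen v) = in_degree 1 (\<lambda>p. vals p v)"
proof -
  have "frag_of (box_class (poly_var v), 1) \<in> carrier box.PR" by simp
  from Phi_coset[OF this] show ?thesis unfolding box_gen_def pure_tensor_def Psi_gen .
qed

lemma Psi_homogeneous:
  assumes "Poly_Mapping.keys x \<subseteq> box_grading r \<times> UNIV"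
  shows "x \<in> carrier box.PR" "Psi x \<in> form_grading r"
proof -
  show x: "x \<in> carrier box.PR" using assms box_grading_subset[of r] by (auto simp: box.PR_simps)
  have other: "Psi x k p = 0" if k: "k \<noteq> r" for k p using assms
  proof (induction x rule: frag_induction)
    case (one s)
    then obtain q c where q: "s = (box_class q, c)" "\<forall>m\<in>Poly_Mapping.keys q. monom_degree m = r"
      unfolding box_grading_def by blast
    have "(\<Sum>m\<in>Poly_Mapping.keys q. if monom_degree m = k then of_rat (Poly_Mapping.lookup q m) * mon (vals p) m else 0) = 0"
      using q(2) k by (intro sum.neutral) auto
    thus ?case unfolding q(1) Psi_class onH_def by simp
  next
    case zero show ?case by (simp add: Psi_zero)
  next
    case (diff x y) thus ?case by (simp add: Psi_diff)
  qed
  have m: "Psi x r \<in> modular_forms r" using Psi_closed[OF x] by (simp add: form_ring_simps)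
  have "Psi x = in_degree r (Psi x r)"
  proof (intro ext)
    fix k p show "Psi x k p = in_degree r (Psi x r) k p"
      using other[of k p] by (cases "k = r") (simp_all add: in_degree_def Psi_def)
  qed
  thus "Psi x \<in> form_grading r" using m unfolding form_grading_def by blast
qed

lemma Phi_grading: "Phi ` box_grading_C r = form_grading r"
proof -
  have "Phi ` box_grading_C r = Psi ` {x. Poly_Mapping.keys x \<subseteq> box_grading r \<times> UNIV}"
    unfolding box_grading_C_def tensor_grading_def image_image complex_algebra_simps
    by (rule image_cong) (simp_all add: Phi_coset Psi_homogeneous(1))
  also have "\<dots> = form_grading r"
  proof
    show "Psi ` {x. Poly_Mapping.keys x \<subseteq> box_grading r \<times> UNIV} \<subseteq> form_grading r" using Psi_homogeneous(2) by blast
    show "form_grading r \<subseteq> Psi ` {x. Poly_Mapping.keys x \<subseteq> box_grading r \<times> UNIV}"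
    proof
      fix F assume "F \<in> form_grading r"
      then obtain f where f: "f \<in> modular_forms r" "F = in_degree r f" by (auto simp: form_grading_def)
      obtain x where "Poly_Mapping.keys x \<subseteq> box_grading r \<times> UNIV" "Psi x = in_degree r f"
        using homogeneous_preimage[OF f(1)] by blast
      thus "F \<in> Psi ` {x. Poly_Mapping.keys x \<subseteq> box_grading r \<times> UNIV}" unfolding f(2) by (intro image_eqI) simp_all
    qed
  qed
  finally show ?thesis .
qed

lemma Phi_iso: "graded_algebra_iso box_algebra_C box_grading_C form_algebra form_grading Phi"
  unfolding graded_algebra_iso_def
proof (intro conjI allI ballI Phi_grading)
  show "Phi \<in> ring_iso box_algebra_C form_algebra"
    using Phi_iso_quot unfolding ring_iso_def ring_hom_def box_algebra_C_simps(1-4) form_algebra_simps(1-4) .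
  fix k X assume X: "X \<in> carrier box_algebra_C"
  have c: "frag_of (box_class 1, k) \<in> carrier box.PR" by simp
  have "Phi \<in> ring_hom (box.PR Quot box.J) form_ring" using Phi_iso_quot by (simp add: ring_iso_def)
  from ring_hom_mult[OF this coset_closed[OF c] X[unfolded box_algebra_C_simps]]
  show "Phi (k \<odot>\<^bsub>box_algebra_C\<^esub> X) = k \<odot>\<^bsub>form_algebra\<^esub> Phi X"
    unfolding box_algebra_C_simps(5) form_algebra_simps(5) Phi_coset[OF c] Psi_scalar .
qed

lemma box_algebra_C_cring: "cring box_algebra_C"
  unfolding box_algebra_C_def tensor_algebra_def
  by (rule algebra_via_cring[OF ideal.quotient_is_cring[OF box.J_ideal box.PR_cring]])

lemma form_algebra_cring: "cring form_algebra"
  unfolding form_algebra_def by (rule algebra_via_cring[OF form_ring_cring])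

theorem mainTheorem2:
  shows "(\<exists>\<phi>. graded_algebra_iso box_algebra_C box_grading_C form_algebra form_grading \<phi> \<and>
      \<phi> (box_gen Z1) = in_degree 1 (\<lambda>(z, w). theta 0 1 z * theta 0 1 w) \<and>
      \<phi> (box_gen Z2) = in_degree 1 (\<lambda>(z, w). theta 0 0 z * theta 0 0 w) \<and>
      \<phi> (box_gen Z3) = in_degree 1 (\<lambda>(z, w). theta 1 0 z * theta 1 0 w) \<and>
      \<phi> (box_gen C) = in_degree 1 (\<lambda>(z, w).
        theta 0 0 (2 * z) * theta 0 0 (2 * w) + theta 1 0 (2 * z) * theta 1 0 (2 * w)) \<and>
      \<phi> (box_gen W1) = in_degree 1 (\<lambda>(z, w).
        theta 1 0 (2 * z) * theta 0 0 (2 * w) + theta 0 0 (2 * z) * theta 1 0 (2 * w)) \<and>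
      \<phi> (box_gen W2) = in_degree 1 (\<lambda>(z, w).
        \<i> * (theta 1 0 (2 * z) * theta 0 0 (2 * w) - theta 0 0 (2 * z) * theta 1 0 (2 * w))) \<and>
      \<phi> (box_gen W3) = in_degree 1 (\<lambda>(z, w).
        theta 0 0 (2 * z) * theta 0 0 (2 * w) - theta 1 0 (2 * z) * theta 1 0 (2 * w)))
    \<and> proj_isomorphic box_algebra_C box_grading_C form_algebra form_grading"
proof
  have "box_grading_C r \<subseteq> carrier box_algebra_C" for r
  proof
    fix X assume "X \<in> box_grading_C r"
    then obtain x where "Poly_Mapping.keys x \<subseteq> box_grading r \<times> UNIV" "X = box.J +>\<^bsub>box.PR\<^esub> x"
      unfolding box_grading_C_def tensor_grading_def by auto
    thus "X \<in> carrier box_algebra_C" unfolding box_algebra_C_simps using coset_closed[OF Psi_homogeneous(1)] by blast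
  qed
  moreover have "k \<odot>\<^bsub>box_algebra_C\<^esub> \<one>\<^bsub>box_algebra_C\<^esub> \<in> carrier box_algebra_C" for k
  proof -
    interpret Q: cring "box.PR Quot box.J" by (rule ideal.quotient_is_cring[OF box.J_ideal box.PR_cring])
    show ?thesis unfolding box_algebra_C_simps by (intro Q.m_closed Q.one_closed coset_closed) simp
  qed
  ultimately show "proj_isomorphic box_algebra_C box_grading_C form_algebra form_grading"
    by (intro graded_iso_proj_isomorphic[OF box_algebra_C_cring form_algebra_cring Phi_iso])
qed (rule exI[of _ Phi], simp only: Phi_iso Phi_gen vals_def box_var.case thX_def thY_def case_prod_unfold simp_thms)

end
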